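(* Let $n\geq 3$ and let $(R,\Lambda)$ be a form ring (with respect to an involution $r\mapsto\bar r$ and a central element $\lambda$ with $\lambda\bar\lambda=1$) such that $R$ is quasi-finite. Let $H$ be a subgroup of $U_{2n}(R,\Lambda)$. Then $H$ is normalized by $EU_{2n}(R,\Lambda)$ if and only if there exists a unique form ideal $(I,\Gamma)$ of $(R,\Lambda)$ such that \[EU_{2n}((R,\Lambda),(I,\Gamma))\subseteq H\subseteq CU_{2n}((R,\Lambda),(I,\Gamma)).\]
   Context: Rings are associative with $1\neq 0$. An involution on $R$ is a map $r\mapsto \bar r$ with $\overline{r+s}=\bar r+\bar s$, $\overline{rs}=\bar s\bar r$, $\bar{\bar r}=r$. Fix $\lambda\in\mathrm{center}(R)$ with $\lambda\bar\lambda=1$. A form parameter is an additive subgroup $\Lambda\subseteq R$ with $\{r-\lambda\bar r: r\in R\}\subseteq\Lambda\subseteq\{r\in R: r=-\lambda\bar r\}$ and $r\Lambda\bar r\subseteq\Lambda$ for all $r\in R$; then $(R,\Lambda)$ is a form ring. A form ideal $(I,\Gamma)$ of $(R,\Lambda)$ is a two-sided ideal $I$ with $\bar I=I$ together with an additive subgroup $\Gamma\subseteq I$ such that $\Gamma^I_{min}\subseteq\Gamma\subseteq I\cap\Lambda$ and $\alpha\Gamma\bar\alpha\subseteq\Gamma$ for all $\alpha\in R$, where $\Gamma^I_{min}=\{\xi-\lambda\bar\xi:\xi\in I\}+\langle\{\zeta\alpha\bar\zeta:\zeta\in I,\alpha\in\Lambda\}\rangle$. Rows and columns of $2n\times 2n$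 matrices are indexed by $\Omega=\{1,\dots,n,-n,\dots,-1\}$ in this order; $\epsilon(i)=1$ if $i>0$ and $\epsilon(i)=-1$ if $i<0$; $e$ is the identity matrix and $e^{ij}$ the matrix unit. For columns $u,v\in R^{2n}$ put $\mathbbm{f}(u,v)=\sum_{i=1}^n\bar u_iv_{-i}$ and $\mathbbm{h}(u,v)=\sum_{i=1}^n(\bar u_iv_{-i}+\lambda\bar u_{-i}v_i)$. The hyperbolic unitary group $U_{2n}(R,\Lambda)$ is the group of all $\sigma\in GL_{2n}(R)$ with $\mathbbm{h}(\sigma u,\sigma v)=\mathbbm{h}(u,v)$ and $\mathbbm{f}(\sigma u,\sigma u)-\mathbbm{f}(u,u)\in\Lambda$ for all $u,v$. For $i\neq\pm j$ and $\xi\in R$ let $T_{ij}(\xi)=e+\xi e^{ij}-\lambda^{(\epsilon(j)-\epsilon(i))/2}\bar\xi e^{-j,-i}$; for $i\in\Omega$ and $\alpha\in\lambda^{-(\epsilon(i)+1)/2}\Lambda$ let $T_{i,-i}(\alpha)=e+\alpha e^{i,-i}$. $EU_{2n}(R,\Lambda)$ is the subgroup generated by all these. For a form ideal $(I,\Gamma)$, $EU_{2n}((R,\Lambda),(I,\Gamma))$ is the normal closure in $EU_{2n}(R,\Lambda)$ of the subgroup generated by all $T_{ij}(\xi)$ ($i\neq\pm j$, $\xi\in I$) and all $T_{i,-i}(\alpha)$ ($\alpha\in\lambda^{-(\epsilon(i)+1)/2}\Gamma$). $U_{2n}((R,\Lambda),(I,\Gamma))$ is the (normal) subgroup of all $\sigma\in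 U_{2n}(R,\Lambda)$ with $\sigma\equiv e \pmod I$ and $\mathbbm{f}(\sigma u,\sigma u)-\mathbbm{f}(u,u)\in\Gamma$ for all $u$; $CU_{2n}((R,\Lambda),(I,\Gamma))$ is the preimage of the center of $U_{2n}(R,\Lambda)/U_{2n}((R,\Lambda),(I,\Gamma))$ under the canonical map. $R$ (with its involution and $\lambda$) is quasi-finite if it is a direct limit (directed union) of subrings $R_i$ which are almost commutative (module finite over their center), involution invariant and contain $\lambda$. *)

theory Defs
  imports Main "HOL-Algebra.Generated_Groups"
begin

definition add_subgroup :: "'a::ring_1 set \<Rightarrow> bool" where
  "add_subgroup G \<longleftrightarrow> 0 \<in> G \<and> (\<forall>x\<in>G. \<forall>y\<in>G. x + y \<in> G) \<and> (\<forall>x\<in>G. - x \<in> G)"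

definition add_span :: "'a::ring_1 set \<Rightarrow> 'a set" where
  "add_span S = \<Inter>{G. add_subgroup G \<and> S \<subseteq> G}"

definition is_involution :: "('a::ring_1 \<Rightarrow> 'a) \<Rightarrow> bool" where
  "is_involution cj \<longleftrightarrow> (\<forall>r s. cj (r + s) = cj r + cj s) \<and> (\<forall>r s. cj (r * s) = cj s * cj r)
     \<and> (\<forall>r. cj (cj r) = r)"

definition admissible_lambda :: "('a::ring_1 \<Rightarrow> 'a) \<Rightarrow> 'a \<Rightarrow> bool" where
  "admissible_lambda cj lam \<longleftrightarrow> (\<forall>r. lam * r = r * lam) \<and> lam * cj lam = 1"

definition form_parameter :: "('a::ring_1 \<Rightarrow> 'a) \<Rightarrow> 'a \<Rightarrow> 'a set \<Rightarrow> bool" where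
  "form_parameter cj lam Lam \<longleftrightarrow> add_subgroup Lam
     \<and> {r - lam * cj r | r. True} \<subseteq> Lam \<and> Lam \<subseteq> {r. r = - (lam * cj r)}
     \<and> (\<forall>r. \<forall>a\<in>Lam. r * a * cj r \<in> Lam)"

definition form_ring :: "('a::ring_1 \<Rightarrow> 'a) \<Rightarrow> 'a \<Rightarrow> 'a set \<Rightarrow> bool" where
  "form_ring cj lam Lam \<longleftrightarrow> is_involution cj \<and> admissible_lambda cj lam \<and> form_parameter cj lam Lam"

definition two_sided_ideal :: "'a::ring_1 set \<Rightarrow> bool" where
  "two_sided_ideal I \<longleftrightarrow> add_subgroup I \<and> (\<forall>r. \<forall>x\<in>I. r * x \<in> I \<and> x * r \<in> I)"

definition Gamma_min :: "('a::ring_1 \<Rightarrow> 'a) \<Rightarrow> 'a \<Rightarrow> 'a set \<Rightarrow> 'a set \<Rightarrow> 'a set" where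
  "Gamma_min cj lam Lam I =
     {a + b | a b. a \<in> {x - lam * cj x | x. x \<in> I}
                 \<and> b \<in> add_span {z * al * cj z | z al. z \<in> I \<and> al \<in> Lam}}"

definition form_ideal :: "('a::ring_1 \<Rightarrow> 'a) \<Rightarrow> 'a \<Rightarrow> 'a set \<Rightarrow> 'a set \<times> 'a set \<Rightarrow> bool" where
  "form_ideal cj lam Lam IG \<longleftrightarrow> (case IG of (I, Gam) \<Rightarrow>
     two_sided_ideal I \<and> cj ` I = I \<and> add_subgroup Gam \<and> Gam \<subseteq> I
     \<and> Gamma_min cj lam Lam I \<subseteq> Gam \<and> Gam \<subseteq> I \<inter> Lam
     \<and> (\<forall>al. \<forall>g\<in>Gam. al * g * cj al \<in> Gam))"

definition is_subring :: "'a::ring_1 set \<Rightarrow> bool" where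
  "is_subring S \<longleftrightarrow> 1 \<in> S \<and> (\<forall>x\<in>S. \<forall>y\<in>S. x + y \<in> S \<and> x * y \<in> S) \<and> (\<forall>x\<in>S. - x \<in> S)"

definition ring_center :: "'a::ring_1 set \<Rightarrow> 'a set" where
  "ring_center S = {z\<in>S. \<forall>s\<in>S. z * s = s * z}"

definition almost_commutative :: "'a::ring_1 set \<Rightarrow> bool" where
  "almost_commutative S \<longleftrightarrow> (\<exists>F. finite F \<and> F \<subseteq> S \<and>
     (\<forall>s\<in>S. \<exists>c. (\<forall>f\<in>F. c f \<in> ring_center S) \<and> s = (\<Sum>f\<in>F. c f * f)))"

definition quasi_finite :: "('a::ring_1 \<Rightarrow> 'a) \<Rightarrow> 'a \<Rightarrow> bool" where
  "quasi_finite cj lam \<longleftrightarrow> (\<exists>\<S> :: 'a set set. \<S> \<noteq> {}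
     \<and> (\<forall>A\<in>\<S>. \<forall>B\<in>\<S>. \<exists>C\<in>\<S>. A \<union> B \<subseteq> C)
     \<and> \<Union>\<S> = UNIV
     \<and> (\<forall>S\<in>\<S>. is_subring S \<and> almost_commutative S \<and> cj ` S \<subseteq> S \<and> lam \<in> S))"

type_synonym 'a mat = "int \<Rightarrow> int \<Rightarrow> 'a"
type_synonym 'a vec = "int \<Rightarrow> 'a"

definition Omega :: "nat \<Rightarrow> int set" where
  "Omega n = {i. i \<noteq> 0 \<and> - int n \<le> i \<and> i \<le> int n}"

definition eps :: "int \<Rightarrow> int" where
  "eps i = (if i > 0 then 1 else -1)"

definition is_mat :: "nat \<Rightarrow> 'a::ring_1 mat \<Rightarrow> bool" where
  "is_mat n A \<longleftrightarrow> (\<forall>i j. (i \<notin> Omega n \<or> j \<notin> Omega n) \<longrightarrow> A i j = 0)"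

definition emat :: "nat \<Rightarrow> 'a::ring_1 mat" where
  "emat n = (\<lambda>i j. if i = j \<and> i \<in> Omega n then 1 else 0)"

definition unit_mat :: "int \<Rightarrow> int \<Rightarrow> 'a::ring_1 mat" where
  "unit_mat k l = (\<lambda>i j. if i = k \<and> j = l then 1 else 0)"

definition madd :: "'a::ring_1 mat \<Rightarrow> 'a mat \<Rightarrow> 'a mat" where
  "madd A B = (\<lambda>i j. A i j + B i j)"

definition smul :: "'a::ring_1 \<Rightarrow> 'a mat \<Rightarrow> 'a mat" where
  "smul c A = (\<lambda>i j. c * A i j)"

definition mmul :: "nat \<Rightarrow> 'a::ring_1 mat \<Rightarrow> 'a mat \<Rightarrow> 'a mat" where
  "mmul n A B = (\<lambda>i j. \<Sum>k\<in>Omega n. A i k * B k j)"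

definition mvec :: "nat \<Rightarrow> 'a::ring_1 mat \<Rightarrow> 'a vec \<Rightarrow> 'a vec" where
  "mvec n A u = (\<lambda>i. \<Sum>j\<in>Omega n. A i j * u j)"

definition GL :: "nat \<Rightarrow> 'a::ring_1 mat set" where
  "GL n = {A. is_mat n A \<and> (\<exists>B. is_mat n B \<and> mmul n A B = emat n \<and> mmul n B A = emat n)}"

definition GLgrp :: "nat \<Rightarrow> 'a::ring_1 mat monoid" where
  "GLgrp n = \<lparr>carrier = GL n, mult = mmul n, one = emat n\<rparr>"

definition form_f :: "('a::ring_1 \<Rightarrow> 'a) \<Rightarrow> nat \<Rightarrow> 'a vec \<Rightarrow> 'a vec \<Rightarrow> 'a" where
  "form_f cj n u v = (\<Sum>i\<in>{1..int n}. cj (u i) * v (- i))"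

definition form_h :: "('a::ring_1 \<Rightarrow> 'a) \<Rightarrow> 'a \<Rightarrow> nat \<Rightarrow> 'a vec \<Rightarrow> 'a vec \<Rightarrow> 'a" where
  "form_h cj lam n u v = (\<Sum>i\<in>{1..int n}. cj (u i) * v (- i) + lam * cj (u (- i)) * v i)"

definition U :: "('a::ring_1 \<Rightarrow> 'a) \<Rightarrow> 'a \<Rightarrow> 'a set \<Rightarrow> nat \<Rightarrow> 'a mat set" where
  "U cj lam Lam n = {s \<in> GL n.
     (\<forall>u v. form_h cj lam n (mvec n s u) (mvec n s v) = form_h cj lam n u v)
     \<and> (\<forall>u. form_f cj n (mvec n s u) (mvec n s u) - form_f cj n u u \<in> Lam)}"

text \<open>lam_pow k = lam^k for k in Z (using lam^(-1) = cj lam).\<close>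
definition lam_pow :: "('a::ring_1 \<Rightarrow> 'a) \<Rightarrow> 'a \<Rightarrow> int \<Rightarrow> 'a" where
  "lam_pow cj lam k = (if k \<ge> 0 then lam ^ nat k else (cj lam) ^ nat (- k))"

definition Tij :: "('a::ring_1 \<Rightarrow> 'a) \<Rightarrow> 'a \<Rightarrow> nat \<Rightarrow> int \<Rightarrow> int \<Rightarrow> 'a \<Rightarrow> 'a mat" where
  "Tij cj lam n i j x = madd (madd (emat n) (smul x (unit_mat i j)))
      (smul (- (lam_pow cj lam ((eps j - eps i) div 2) * cj x)) (unit_mat (- j) (- i)))"

definition Tii :: "nat \<Rightarrow> int \<Rightarrow> 'a::ring_1 \<Rightarrow> 'a mat" where
  "Tii n i a = madd (emat n) (smul a (unit_mat i (- i)))"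

definition elem_gens :: "('a::ring_1 \<Rightarrow> 'a) \<Rightarrow> 'a \<Rightarrow> nat \<Rightarrow> 'a set \<Rightarrow> 'a set \<Rightarrow> 'a mat set" where
  "elem_gens cj lam n X Gam =
     {Tij cj lam n i j x | i j x. i \<in> Omega n \<and> j \<in> Omega n \<and> i \<noteq> j \<and> i \<noteq> - j \<and> x \<in> X}
   \<union> {Tii n i a | i a. i \<in> Omega n \<and> a \<in> {lam_pow cj lam (- ((eps i + 1) div 2)) * g | g. g \<in> Gam}}"

definition EU :: "('a::ring_1 \<Rightarrow> 'a) \<Rightarrow> 'a \<Rightarrow> 'a set \<Rightarrow> nat \<Rightarrow> 'a mat set" where
  "EU cj lam Lam n = generate (GLgrp n) (elem_gens cj lam n UNIV Lam)"

definition EU_rel :: "('a::ring_1 \<Rightarrow> 'a) \<Rightarrow> 'a \<Rightarrow> 'a set \<Rightarrow> nat \<Rightarrow> 'a set \<times> 'a set \<Rightarrow> 'a mat set" where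
  "EU_rel cj lam Lam n IG = (case IG of (I, Gam) \<Rightarrow>
     generate (GLgrp n)
       {g \<otimes>\<^bsub>GLgrp n\<^esub> k \<otimes>\<^bsub>GLgrp n\<^esub> inv\<^bsub>GLgrp n\<^esub> g | g k.
          g \<in> EU cj lam Lam n \<and> k \<in> generate (GLgrp n) (elem_gens cj lam n I Gam)})"

definition U_rel :: "('a::ring_1 \<Rightarrow> 'a) \<Rightarrow> 'a \<Rightarrow> 'a set \<Rightarrow> nat \<Rightarrow> 'a set \<times> 'a set \<Rightarrow> 'a mat set" where
  "U_rel cj lam Lam n IG = (case IG of (I, Gam) \<Rightarrow>
     {s \<in> U cj lam Lam n. (\<forall>i\<in>Omega n. \<forall>j\<in>Omega n. s i j - emat n i j \<in> I)
        \<and> (\<forall>u. form_f cj n (mvec n s u) (mvec n s u) - form_f cj n u u \<in> Gam)})"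

text \<open>Preimage of the center of U / U(I,Gam): elements whose commutators with all of U lie in U(I,Gam).\<close>
definition CU_rel :: "('a::ring_1 \<Rightarrow> 'a) \<Rightarrow> 'a \<Rightarrow> 'a set \<Rightarrow> nat \<Rightarrow> 'a set \<times> 'a set \<Rightarrow> 'a mat set" where
  "CU_rel cj lam Lam n IG =
     {s \<in> U cj lam Lam n. \<forall>t \<in> U cj lam Lam n.
        s \<otimes>\<^bsub>GLgrp n\<^esub> t \<otimes>\<^bsub>GLgrp n\<^esub> inv\<^bsub>GLgrp n\<^esub> s \<otimes>\<^bsub>GLgrp n\<^esub> inv\<^bsub>GLgrp n\<^esub> t
          \<in> U_rel cj lam Lam n IG}"

definition normalized_by :: "nat \<Rightarrow> 'a::ring_1 mat set \<Rightarrow> 'a mat set \<Rightarrow> bool" where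
  "normalized_by n H E \<longleftrightarrow>
     (\<forall>g\<in>E. \<forall>h\<in>H. g \<otimes>\<^bsub>GLgrp n\<^esub> h \<otimes>\<^bsub>GLgrp n\<^esub> inv\<^bsub>GLgrp n\<^esub> g \<in> H)"

end

theory Submission
  imports Defs "HOL-Library.Function_Algebras"
begin

text \<open>
  Everything is phrased with Eichler transvections \<open>Eich u v q\<close> along isotropic vectors \<open>u\<close>, which conjugation by a
  unitary matrix \<open>g\<close> turns into \<open>Eich (g u) (g v) q\<close>. By quasi-finiteness all ring elements of interest lie in an
  involution-invariant subring \<open>S\<close> that is finitely generated as a module over a central subring \<open>K\<close> of symmetric
  elements. For a maximal ideal \<open>M\<close> of \<open>K\<close>, the ring \<open>S\<close> has stable rank one modulo a suitable ideal; hence an elementary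
  change of basis makes the diagonal entry in a column \<open>u\<close> of a unitary matrix invertible up to a
  denominator in \<open>K - M\<close>, and then the transvections along \<open>u\<close>, scaled by a power of this denominator, are elementary. The
  denominators obtained for all \<open>M\<close> generate the unit ideal of \<open>K\<close>. Applied to the ring of pairs congruent modulo \<open>I\<close>, this
  yields the relative commutator formula: commutators of \<open>CU_rel\<close> with \<open>EU\<close> lie in \<open>EU_rel\<close>, so that every subgroup in the
  sandwich is normal. Conversely, the root elements contained in a normalized subgroup \<open>H\<close> define a form ideal
  \<open>(I, Gam)\<close>. The same localization, applied to a transvection fixing a column of \<open>s \<in> H\<close>, shows that \<open>s\<close> is scalar modulo
  \<open>I\<close>, and taking commutators with root elements transfers the defect of the quadratic form under \<open>s\<close> to a single root element,
  which forces it into \<open>Gam\<close>.\<close>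

section \<open>Matrices and column vectors\<close>

text \<open>The localization of \<open>S\<close> at \<open>M\<close> is never formed. An equation
  over the local ring is replaced by the same equation multiplied by a denominator from
  \<open>K - M\<close>, and \<open>kunit\<close> means invertible up to such a factor. Denominators
  are central and symmetric because scaling turns the quadratic part \<open>q\<close> of a
  transvection into \<open>cj s * q * s\<close>, and scaled transvections for different denominators
  must combine, so that the admissible denominators form an ideal of \<open>K\<close>. An ideal
  contained in no maximal ideal contains 1, which returns the unscaled statement. No stable range
  condition is available globally; finite dimension over the residue field of \<open>M\<close>
  supplies it locally, with leading indices in place of bases. The part that escapes linear
  arguments is \<open>Gam\<close>: the defect \<open>Q s\<close> of the quadratic form is not
  additive in the vector. Its failure to be additive lies in \<open>Gam\<close> as soon as
  \<open>s\<close> respects \<open>f\<close> modulo \<open>I\<close>, so that values on basis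
  vectors decide; hence \<open>I\<close> is settled before \<open>Gam\<close>.\<close>

lemma finite_Omega [simp]: "finite (Omega n)"
proof -
  have "Omega n \<subseteq> {- int n..int n}" by (auto simp: Omega_def)
  then show ?thesis by (rule finite_subset) simp
qed

lemma uminus_Omega [simp]: "- i \<in> Omega n \<longleftrightarrow> i \<in> Omega n"
  by (auto simp: Omega_def)

lemma zero_notin_Omega [simp]: "0 \<notin> Omega n"
  by (simp add: Omega_def)

lemma Omega_neq_uminus: "i \<in> Omega n \<Longrightarrow> i \<noteq> - i"
  by (auto simp: Omega_def)

lemma is_mat_mmul: "is_mat n A \<Longrightarrow> is_mat n B \<Longrightarrow> is_mat n (mmul n A B)"
  by (auto simp: is_mat_def mmul_def intro!: sum.neutral)

lemma is_mat_emat: "is_mat n (emat n)"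
  by (auto simp: is_mat_def emat_def)

lemma mmul_assoc: "mmul n (mmul n A B) C = mmul n A (mmul n B C)"
proof (intro ext)
  fix i j
  have "mmul n (mmul n A B) C i j = (\<Sum>k\<in>Omega n. \<Sum>l\<in>Omega n. A i l * B l k * C k j)"
    by (simp add: mmul_def sum_distrib_right)
  also have "\<dots> = (\<Sum>l\<in>Omega n. \<Sum>k\<in>Omega n. A i l * B l k * C k j)"
    by (rule sum.swap)
  finally show "mmul n (mmul n A B) C i j = mmul n A (mmul n B C) i j"
    by (simp add: mmul_def sum_distrib_left mult.assoc)
qed

lemma mmul_emat_left: "is_mat n A \<Longrightarrow> mmul n (emat n) A = A"
proof (intro ext)
  fix i j assume A: "is_mat n A"
  have "mmul n (emat n) A i j = (\<Sum>k\<in>Omega n. if k = i then A i j else 0)"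
    unfolding mmul_def emat_def by (rule sum.cong) auto
  then show "mmul n (emat n) A i j = A i j"
    using A by (auto simp: is_mat_def)
qed

lemma mmul_emat_right: "is_mat n A \<Longrightarrow> mmul n A (emat n) = A"
proof (intro ext)
  fix i j assume A: "is_mat n A"
  have "mmul n A (emat n) i j = (\<Sum>k\<in>Omega n. if k = j then A i j else 0)"
    unfolding mmul_def emat_def by (rule sum.cong) auto
  then show "mmul n A (emat n) i j = A i j"
    using A by (auto simp: is_mat_def)
qed

lemma GLgrp_simps [simp]:
  "carrier (GLgrp n) = GL n" "mult (GLgrp n) = mmul n" "one (GLgrp n) = emat n"
  by (simp_all add: GLgrp_def)

lemma GL_is_mat: "A \<in> GL n \<Longrightarrow> is_mat n A"
  by (simp add: GL_def)

lemma GL_mmul: assumes "A \<in> GL n" "B \<in> GL n" shows "mmul n A B \<in> GL n"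
proof -
  obtain A' where A': "is_mat n A'" "mmul n A A' = emat n" "mmul n A' A = emat n"
    using assms by (auto simp: GL_def)
  obtain B' where B': "is_mat n B'" "mmul n B B' = emat n" "mmul n B' B = emat n"
    using assms by (auto simp: GL_def)
  have "mmul n (mmul n A B) (mmul n B' A') = mmul n A (mmul n (mmul n B B') A')"
    by (simp add: mmul_assoc)
  moreover have "mmul n (mmul n B' A') (mmul n A B) = mmul n B' (mmul n (mmul n A' A) B)"
    by (simp add: mmul_assoc)
  ultimately show ?thesis
    using assms A' B' by (auto simp: GL_def is_mat_mmul mmul_emat_left intro!: exI[of _ "mmul n B' A'"])
qed

lemma group_GLgrp: "group (GLgrp n)"
proof (rule groupI)
  fix x assume "x \<in> carrier (GLgrp n)"
  then obtain B where B: "is_mat n x" "is_mat n B" "mmul n x B = emat n" "mmul n B x = emat n"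
    by (auto simp: GL_def)
  then have "B \<in> GL n" by (auto simp: GL_def)
  with B show "\<exists>y\<in>carrier (GLgrp n). y \<otimes>\<^bsub>GLgrp n\<^esub> x = \<one>\<^bsub>GLgrp n\<^esub>" by auto
qed (auto simp: GL_mmul mmul_assoc mmul_emat_left GL_is_mat,
     auto simp: GL_def is_mat_emat mmul_emat_left intro!: exI[of _ "emat n"])

abbreviation ginv :: "nat \<Rightarrow> 'a::ring_1 mat \<Rightarrow> 'a mat" where
  "ginv n g \<equiv> inv\<^bsub>GLgrp n\<^esub> g"

lemma ginv_GL: "g \<in> GL n \<Longrightarrow> ginv n g \<in> GL n"
  using group.inv_closed[OF group_GLgrp, of g n] by simp

lemma mmul_ginv: "g \<in> GL n \<Longrightarrow> mmul n g (ginv n g) = emat n"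
  using group.r_inv[OF group_GLgrp, of g n] by simp

lemma ginv_mmul: "g \<in> GL n \<Longrightarrow> mmul n (ginv n g) g = emat n"
  using group.l_inv[OF group_GLgrp, of g n] by simp

lemma mmul_ginv_assoc: "g \<in> GL n \<Longrightarrow> is_mat n A \<Longrightarrow> mmul n g (mmul n (ginv n g) A) = A"
  by (metis mmul_assoc mmul_ginv mmul_emat_left)

lemma ginv_mmul_assoc: "g \<in> GL n \<Longrightarrow> is_mat n A \<Longrightarrow> mmul n (ginv n g) (mmul n g A) = A"
  by (metis mmul_assoc ginv_mmul mmul_emat_left)

lemma ginv_mmul_distrib: "g \<in> GL n \<Longrightarrow> k \<in> GL n \<Longrightarrow> ginv n (mmul n g k) = mmul n (ginv n k) (ginv n g)"
  using group.inv_mult_group[OF group_GLgrp, of g n k] by simp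

lemma ginv_ginv: "g \<in> GL n \<Longrightarrow> ginv n (ginv n g) = g"
  using group.inv_inv[OF group_GLgrp, of g n] by simp

lemma ginv_unique: "g \<in> GL n \<Longrightarrow> k \<in> GL n \<Longrightarrow> mmul n k g = emat n \<Longrightarrow> ginv n g = k"
  using group.inv_equality[OF group_GLgrp, of n k g] by simp

lemma ginv_emat: "ginv n (emat n) = emat n"
  using monoid.inv_one[OF group.is_monoid[OF group_GLgrp], of n] by simp

lemma mvec_mmul: "mvec n (mmul n A B) u = mvec n A (mvec n B u)"
proof
  fix i
  have "mvec n (mmul n A B) u i = (\<Sum>j\<in>Omega n. \<Sum>k\<in>Omega n. A i k * B k j * u j)"
    by (simp add: mvec_def mmul_def sum_distrib_right)
  also have "\<dots> = (\<Sum>k\<in>Omega n. \<Sum>j\<in>Omega n. A i k * B k j * u j)"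
    by (rule sum.swap)
  finally show "mvec n (mmul n A B) u i = mvec n A (mvec n B u) i"
    by (simp add: mvec_def sum_distrib_left mult.assoc)
qed

lemma mvec_cong: "(\<And>i. i \<in> Omega n \<Longrightarrow> u i = v i) \<Longrightarrow> mvec n A u = mvec n A v"
  by (auto simp: mvec_def intro!: sum.cong)

lemma mvec_emat: "mvec n (emat n) u i = (if i \<in> Omega n then u i else 0)"
proof -
  have "mvec n (emat n) u i = (\<Sum>k\<in>Omega n. if k = i then u i else 0)"
    unfolding mvec_def emat_def by (rule sum.cong) auto
  then show ?thesis by auto
qed

lemma mvec_ginv: "g \<in> GL n \<Longrightarrow> i \<in> Omega n \<Longrightarrow> mvec n g (mvec n (ginv n g) u) i = u i"
  by (metis mvec_mmul mmul_ginv mvec_emat)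

lemma ginv_mvec: "g \<in> GL n \<Longrightarrow> i \<in> Omega n \<Longrightarrow> mvec n (ginv n g) (mvec n g u) i = u i"
  by (metis mvec_mmul ginv_mmul mvec_emat)

lemma mvec_add: "mvec n A (u + v) = mvec n A u + mvec n A v"
  by (rule ext) (simp add: mvec_def distrib_left sum.distrib)

definition bvec :: "int \<Rightarrow> 'a::zero \<Rightarrow> 'a vec" where
  "bvec i r = (\<lambda>k. if k = i then r else 0)"

text \<open>Columns form a right module, so that matrices, acting from the left, commute with
  scalars.\<close>

definition vscale :: "'a::times vec \<Rightarrow> 'a \<Rightarrow> 'a vec" where
  "vscale u r = (\<lambda>k. u k * r)"

lemma bvec_apply: "bvec i r k = (if k = i then r else 0)"
  by (simp add: bvec_def)

lemma vscale_apply [simp]: "vscale u r k = u k * r"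
  by (simp add: vscale_def)

lemma vscale_bvec: "vscale (bvec i r) s = bvec i (r * s :: 'a::mult_zero)"
  by (auto simp: vscale_def bvec_def)

lemma vscale_vscale: "vscale (vscale u r) s = vscale u (r * s :: 'a::semigroup_mult)"
  by (auto simp: vscale_def mult.assoc)

lemma vscale_add: "vscale (u + v) s = vscale u s + vscale v (s :: 'a::semiring)"
  by (auto simp: vscale_def distrib_right)

lemma vscale_one [simp]: "vscale u 1 = (u :: 'a::monoid_mult vec)"
  by (auto simp: vscale_def)

lemma vscale_zero [simp]: "vscale 0 r = (0 :: 'a::mult_zero vec)" "vscale u 0 = (0 :: 'a::mult_zero vec)"
  by (auto simp: vscale_def)

lemma bvec_zero [simp]: "bvec i 0 = (0 :: 'a::zero vec)"
  by (auto simp: bvec_def)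

lemma mvec_vscale: "mvec n A (vscale u r) = vscale (mvec n A u) r"
  by (rule ext) (simp add: mvec_def sum_distrib_right mult.assoc)

lemma mvec_bvec: "j \<in> Omega n \<Longrightarrow> mvec n A (bvec j r) i = A i j * r"
proof -
  assume j: "j \<in> Omega n"
  have "mvec n A (bvec j r) i = (\<Sum>k\<in>Omega n. if k = j then A i j * r else 0)"
    unfolding mvec_def bvec_def by (rule sum.cong) auto
  then show ?thesis using j by auto
qed

lemma mat_eqI:
  assumes "is_mat n A" "is_mat n B"
    and "\<And>u i. i \<in> Omega n \<Longrightarrow> mvec n A u i = mvec n B u i"
  shows "A = B"
proof (intro ext)
  fix i j
  show "A i j = B i j"
  proof (cases "i \<in> Omega n \<and> j \<in> Omega n")
    case True
    then show ?thesis using assms(3)[of i "bvec j 1"] by (simp add: mvec_bvec)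
  qed (use assms(1,2) in \<open>auto simp: is_mat_def\<close>)
qed

lemma vec_decomp: "i \<in> Omega n \<Longrightarrow> (\<Sum>k\<in>Omega n. bvec k (u k)) i = (u i :: 'a::comm_monoid_add)"
proof -
  assume i: "i \<in> Omega n"
  have "(\<Sum>k\<in>A. bvec k (u k)) i = (\<Sum>k\<in>A. bvec k (u k) i)" if "finite A" for A
    using that by (induction A) auto
  then show ?thesis using i by (simp add: bvec_apply)
qed

section \<open>The hermitian form and Eichler transformations\<close>

locale unitary_space =
  fixes cj :: "'a::ring_1 \<Rightarrow> 'a" and lam :: 'a and n :: nat
  assumes inv: "is_involution cj" and adm: "admissible_lambda cj lam" and n3: "n \<ge> 3"
begin

abbreviation h :: "'a vec \<Rightarrow> 'a vec \<Rightarrow> 'a" where "h \<equiv> form_h cj lam n"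
abbreviation f :: "'a vec \<Rightarrow> 'a vec \<Rightarrow> 'a" where "f \<equiv> form_f cj n"

lemma cj_add: "cj (r + s) = cj r + cj s"
  and cj_mult: "cj (r * s) = cj s * cj r"
  and cj_cj [simp]: "cj (cj r) = r"
  using inv by (auto simp: is_involution_def)

lemma cj_0 [simp]: "cj 0 = 0"
  using cj_add[of 0 0] by simp

lemma cj_1 [simp]: "cj 1 = 1"
  using cj_mult[of "cj 1" 1] by simp

lemma cj_minus: "cj (- r) = - cj r"
  using cj_add[of r "- r"] by (simp add: eq_neg_iff_add_eq_0 add.commute)

lemma cj_diff: "cj (r - s) = cj r - cj s"
  using cj_add[of r "- s"] by (simp add: cj_minus)

lemma cj_sum: "cj (sum g A) = (\<Sum>x\<in>A. cj (g x))"
  by (induction A rule: infinite_finite_induct) (auto simp: cj_add)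

lemmas cjs = cj_add cj_mult cj_minus cj_diff

lemma lam_commute: "lam * r = r * lam"
  using adm by (auto simp: admissible_lambda_def)

lemma lam_cj_lam [simp]: "lam * cj lam = 1" and cj_lam_lam [simp]: "cj lam * lam = 1"
  using adm lam_commute[of "cj lam"] by (auto simp: admissible_lambda_def)

lemma lam_cj_lam_assoc [simp]: "lam * (cj lam * r) = r" "cj lam * (lam * r) = r"
  by (simp_all add: mult.assoc[symmetric])

lemma cj_lam_commute: "cj lam * r = r * cj lam"
  using arg_cong[OF lam_commute[of "cj r"], of cj] by (simp add: cj_mult)

lemma lam_left_commute: "r * (lam * s) = lam * (r * s)"
  by (metis lam_commute mult.assoc)

lemma cj_lam_left_commute: "r * (cj lam * s) = cj lam * (r * s)"
  by (metis cj_lam_commute mult.assoc)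

text \<open>The coefficient of the coordinate pair \<open>i\<close>, \<open>- i\<close> in
  \<open>h\<close>, arranged so that \<open>h\<close> becomes one sum over \<open>Omega n\<close>
  (see \<open>h_eta\<close>). The powers of \<open>lam\<close> in the root elements are expressed
  through it.\<close>

definition eta :: "int \<Rightarrow> 'a" where "eta i = (if i > 0 then 1 else lam)"

lemma eta_commute: "eta i * r = r * eta i"
  by (simp add: eta_def lam_commute[of r])

lemma eta_left_commute: "r * (eta i * s) = eta i * (r * s)"
  by (simp add: eta_def lam_left_commute[of r s])

lemma eta_cj [simp]: "eta i * cj (eta i) = 1" "cj (eta i) * eta i = 1"
  by (simp_all add: eta_def)

lemma eta_cj_assoc [simp]: "eta i * (cj (eta i) * r) = r" "cj (eta i) * (eta i * r) = r"
  by (simp_all add: eta_def)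

lemma Omega_split: "Omega n = {1..int n} \<union> uminus ` {1..int n}"
proof -
  have "i \<in> Omega n \<longleftrightarrow> i \<in> {1..int n} \<or> - i \<in> {1..int n}" for i
    by (auto simp: Omega_def)
  moreover have "i \<in> uminus ` {1..int n} \<longleftrightarrow> - i \<in> {1..int n}" for i :: int
    by (metis image_iff minus_minus)
  ultimately show ?thesis by blast
qed

lemma sum_Omega: "(\<Sum>i\<in>Omega n. g i) = (\<Sum>i\<in>{1..int n}. g i + g (- i))"
  for g :: "int \<Rightarrow> 'b::comm_monoid_add"
proof -
  have "(\<Sum>i\<in>Omega n. g i) = (\<Sum>i\<in>{1..int n}. g i) + (\<Sum>i\<in>uminus ` {1..int n}. g i)"
    unfolding Omega_split by (rule sum.union_disjoint) auto
  also have "(\<Sum>i\<in>uminus ` {1..int n}. g i) = (\<Sum>i\<in>{1..int n}. g (- i))"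
    by (subst sum.reindex) (auto simp: inj_on_def)
  finally show ?thesis by (simp add: sum.distrib)
qed

lemma h_eta: "h u v = (\<Sum>i\<in>Omega n. cj (u i) * eta i * v (- i))"
  unfolding form_h_def sum_Omega
  by (rule sum.cong) (auto simp: eta_def simp flip: lam_commute)

lemma h_cong: "(\<And>i. i \<in> Omega n \<Longrightarrow> u i = u' i) \<Longrightarrow> (\<And>i. i \<in> Omega n \<Longrightarrow> v i = v' i) \<Longrightarrow> h u v = h u' v'"
  unfolding h_eta by (rule sum.cong) auto

lemma h_conj: "h u v = lam * cj (h v u)"
proof -
  have "h u v = (\<Sum>i\<in>{1..int n}. lam * cj (cj (v i) * u (- i) + lam * cj (v (- i)) * u i))"
    unfolding form_h_def
    by (rule sum.cong) (auto simp: cjs distrib_left mult.assoc simp flip: cj_lam_commute)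
  then show ?thesis
    unfolding form_h_def by (simp add: sum_distrib_left cj_sum)
qed

lemma h_f: "h u v = f u v + lam * cj (f v u)"
proof -
  have "lam * cj (f v u) = (\<Sum>i\<in>{1..int n}. lam * cj (u (- i)) * v i)"
    by (simp add: form_f_def cj_sum cj_mult sum_distrib_left mult.assoc)
  then show ?thesis by (simp add: form_h_def form_f_def sum.distrib)
qed

lemma f_cong: "(\<And>i. i \<in> Omega n \<Longrightarrow> u i = u' i) \<Longrightarrow> (\<And>i. i \<in> Omega n \<Longrightarrow> v i = v' i) \<Longrightarrow> f u v = f u' v'"
  unfolding form_f_def by (rule sum.cong) (auto simp: Omega_def)

lemma f_add: "f (u + v) w = f u w + f v w" "f w (u + v) = f w u + f w v"
  by (simp_all add: form_f_def cj_add algebra_simps sum.distrib)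

lemma f_diff: "f (u - v) w = f u w - f v w" "f w (u - v) = f w u - f w v"
  by (simp_all add: form_f_def cj_diff algebra_simps sum_subtractf)

lemma f_minus: "f (- u) w = - f u w" "f w (- u) = - f w u"
  by (simp_all add: form_f_def cj_minus sum_negf)

lemma f_vscale: "f (vscale u r) w = cj r * f u w" "f w (vscale u r) = f w u * r"
  by (simp_all add: form_f_def cj_mult sum_distrib_left sum_distrib_right mult.assoc)

lemma f_zero [simp]: "f 0 w = 0" "f w 0 = 0"
  by (simp_all add: form_f_def)

lemmas fs = f_add f_diff f_minus f_vscale

lemma h_add: "h (u + v) w = h u w + h v w" "h w (u + v) = h w u + h w v"
  by (simp_all add: h_f fs cjs algebra_simps)

lemma h_diff: "h (u - v) w = h u w - h v w" "h w (u - v) = h w u - h w v"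
  by (simp_all add: h_f fs cjs algebra_simps)

lemma h_minus: "h (- u) w = - h u w" "h w (- u) = - h w u"
  by (simp_all add: h_f fs cjs algebra_simps)

lemma h_vscale: "h (vscale u r) w = cj r * h u w" "h w (vscale u r) = h w u * r"
  by (simp_all add: h_f fs cjs algebra_simps lam_left_commute)

lemma h_zero [simp]: "h 0 w = 0" "h w 0 = 0"
  by (simp_all add: h_f)

lemmas hs = h_add h_diff h_minus h_vscale

lemma h_sum_right: "h w (sum g A) = (\<Sum>x\<in>A. h w (g x))"
proof (induction A rule: infinite_finite_induct)
  case (infinite A)
  show ?case unfolding sum.infinite[OF infinite.hyps] by (rule h_zero)
next
  case empty
  show ?case unfolding sum.empty by (rule h_zero)
next
  case (insert x F)
  show ?case unfolding sum.insert[OF insert.hyps] h_add insert.IH ..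
qed

lemma h_bvec_left: "i \<in> Omega n \<Longrightarrow> h (bvec i r) v = cj r * eta i * v (- i)"
proof -
  assume i: "i \<in> Omega n"
  have "h (bvec i r) v = (\<Sum>k\<in>Omega n. if k = i then cj r * eta i * v (- i) else 0)"
    unfolding h_eta by (rule sum.cong) (auto simp: bvec_apply)
  then show ?thesis using i by simp
qed

lemma h_bvec_right: "i \<in> Omega n \<Longrightarrow> h v (bvec i r) = eta (- i) * cj (v (- i)) * r"
proof -
  assume i: "i \<in> Omega n"
  have "h v (bvec i r) = (\<Sum>k\<in>Omega n. if k = - i then cj (v (- i)) * eta (- i) * r else 0)"
    unfolding h_eta by (rule sum.cong) (auto simp: bvec_apply)
  then show ?thesis using i by (simp add: eta_commute)
qed

lemma f_bvec: "f (bvec i r) (bvec j s) = (if j = - i \<and> 0 < i \<and> i \<le> int n then cj r * s else 0)"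
proof -
  have "f (bvec i r) (bvec j s) = (\<Sum>k\<in>{1..int n}. if k = i then (if j = - i then cj r * s else 0) else 0)"
    unfolding form_f_def by (rule sum.cong) (auto simp: bvec_apply)
  then show ?thesis by (auto simp: sum.delta)
qed

lemma h_bvec_bvec: "i \<in> Omega n \<Longrightarrow> h (bvec i r) (bvec j s) = (if j = - i then eta i * cj r * s else 0)"
  by (auto simp: h_bvec_left bvec_apply eta_commute)

lemma h_eq_0_sym: "h u v = 0 \<Longrightarrow> h v u = 0"
  using h_conj[of v u] by simp

subsection \<open>Eichler transformations\<close>

text \<open>Since \<open>cj (h w u) = cj lam * h u w\<close>, \<open>Ev u v q w\<close> is
  \<open>w + u h(v,w) - cj lam (v h(u,w) + u q h(u,w))\<close>: an Eichler-Siegel-Dickson transvection along \<open>u\<close>.\<close>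

definition Ev :: "'a vec \<Rightarrow> 'a vec \<Rightarrow> 'a \<Rightarrow> 'a vec \<Rightarrow> 'a vec" where
  "Ev u v q w = w + vscale u (h v w) - vscale v (cj (h w u)) - vscale u (q * cj (h w u))"

text \<open>The truncation makes this an admissible matrix for \<open>GL\<close>; accordingly only
  the coordinates of \<open>u\<close> and \<open>v\<close> in \<open>Omega n\<close> matter, which
  \<open>Eich_cong\<close> exploits.\<close>

definition Eich :: "'a vec \<Rightarrow> 'a vec \<Rightarrow> 'a \<Rightarrow> 'a mat" where
  "Eich u v q = (\<lambda>i j. if i \<in> Omega n \<and> j \<in> Omega n then Ev u v q (bvec j 1) i else 0)"

lemma Ev_add: "Ev u v q (w + w') = Ev u v q w + Ev u v q w'"
  by (simp add: Ev_def hs cjs distrib_left fun_eq_iff algebra_simps)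

lemma Ev_vscale: "Ev u v q (vscale w r) = vscale (Ev u v q w) r"
  by (simp add: Ev_def hs cjs fun_eq_iff algebra_simps)

lemma Ev_zero: "Ev u v q 0 = 0"
  by (simp add: Ev_def)

lemma Ev_cong: "(\<And>j. j \<in> Omega n \<Longrightarrow> w j = w' j) \<Longrightarrow> i \<in> Omega n \<Longrightarrow> Ev u v q w i = Ev u v q w' i"
  using h_cong[of v v w w'] h_cong[of w w' u u] by (simp add: Ev_def)

lemma is_mat_Eich: "is_mat n (Eich u v q)"
  by (auto simp: is_mat_def Eich_def)

lemma mvec_Eich: assumes "i \<in> Omega n" shows "mvec n (Eich u v q) w i = Ev u v q w i"
proof -
  have lin: "(\<Sum>j\<in>A. Ev u v q (bvec j (w j)) i) = Ev u v q (\<Sum>j\<in>A. bvec j (w j)) i" if "finite A" for A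
    using that
  proof induction
    case empty
    show ?case unfolding sum.empty Ev_zero by simp
  next
    case (insert x F)
    show ?case unfolding sum.insert[OF insert.hyps] Ev_add insert.IH by simp
  qed
  have "mvec n (Eich u v q) w i = (\<Sum>j\<in>Omega n. vscale (Ev u v q (bvec j 1)) (w j) i)"
    unfolding mvec_def Eich_def using assms by (intro sum.cong) auto
  also have "\<dots> = (\<Sum>j\<in>Omega n. Ev u v q (bvec j (w j)) i)"
    by (simp add: Ev_vscale[symmetric] vscale_bvec)
  also have "\<dots> = Ev u v q (\<Sum>j\<in>Omega n. bvec j (w j)) i"
    by (simp add: lin)
  also have "\<dots> = Ev u v q w i"
    by (rule Ev_cong) (auto simp: vec_decomp assms)
  finally show ?thesis .
qed

lemma Eich_eqI: "(\<And>w. Ev u v q w = Ev u' v' q' w) \<Longrightarrow> Eich u v q = Eich u' v' q'"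
  by (simp add: Eich_def fun_eq_iff)

lemma Eich_mult_eqI:
  assumes "\<And>w. Ev u v q (Ev u' v' q' w) = Ev u'' v'' q'' w"
  shows "mmul n (Eich u v q) (Eich u' v' q') = Eich u'' v'' q''"
proof (rule mat_eqI)
  fix w i assume i: "i \<in> Omega n"
  have "mvec n (mmul n (Eich u v q) (Eich u' v' q')) w i = Ev u v q (Ev u' v' q' w) i"
    unfolding mvec_mmul mvec_Eich[OF i] by (rule Ev_cong) (auto simp: mvec_Eich i)
  then show "mvec n (mmul n (Eich u v q) (Eich u' v' q')) w i = mvec n (Eich u'' v'' q'') w i"
    by (simp add: assms mvec_Eich i)
qed (auto simp: is_mat_mmul is_mat_Eich)

text \<open>For fixed isotropic \<open>u\<close> the transvections form a group of Heisenberg type: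
  vector parts add, and \<open>h v v'\<close> is the cocycle in the central quadratic part.\<close>

lemma Eich_mult:
  assumes "h u u = 0" "h u v = 0" "h u v' = 0"
  shows "mmul n (Eich u v q) (Eich u v' q') = Eich u (v + v') (q + q' + h v v')"
proof (rule Eich_mult_eqI)
  fix w
  have "h v u = 0" "h v' u = 0" using assms by (auto intro: h_eq_0_sym)
  then show "Ev u v q (Ev u v' q' w) = Ev u (v + v') (q + q' + h v v') w"
    using assms by (simp add: Ev_def hs cjs fun_eq_iff algebra_simps)
qed

lemma Eich_0: "Eich u 0 0 = emat n"
proof (rule mat_eqI)
  fix w i assume "i \<in> Omega n"
  then show "mvec n (Eich u 0 0) w i = mvec n (emat n) w i"
    by (simp add: mvec_Eich mvec_emat Ev_def)
qed (auto simp: is_mat_Eich is_mat_emat)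

lemma Eich_cong:
  assumes "\<And>i. i \<in> Omega n \<Longrightarrow> u i = u' i" "\<And>i. i \<in> Omega n \<Longrightarrow> v i = v' i"
  shows "Eich u v q = Eich u' v' q"
proof -
  have "h v w = h v' w" "h w u = h w u'" for w using assms by (auto intro: h_cong)
  then show ?thesis using assms by (simp add: Eich_def Ev_def fun_eq_iff)
qed

lemma Eich_mult_inverse:
  assumes "h u u = 0" "h u v = 0"
  shows "mmul n (Eich u v q) (Eich u (- v) (h v v - q)) = emat n"
    and "mmul n (Eich u (- v) (h v v - q)) (Eich u v q) = emat n"
  using assms by (simp_all add: Eich_mult hs Eich_0)

lemma Eich_GL: "h u u = 0 \<Longrightarrow> h u v = 0 \<Longrightarrow> Eich u v q \<in> GL n"
  unfolding GL_def using Eich_mult_inverse is_mat_Eich by blast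

lemma ginv_Eich: "h u u = 0 \<Longrightarrow> h u v = 0 \<Longrightarrow> ginv n (Eich u v q) = Eich u (- v) (h v v - q)"
  by (rule ginv_unique) (auto simp: Eich_GL Eich_mult_inverse hs)

lemma mvec_Eich_conj:
  assumes g: "is_mat n g" and hg: "\<And>u v. h (mvec n g u) (mvec n g v) = h u v"
  shows "mmul n g (Eich u v q) = mmul n (Eich (mvec n g u) (mvec n g v) q) g"
proof (rule mat_eqI)
  fix w i assume i: "i \<in> Omega n"
  have "mvec n g (Ev u v q w) = Ev (mvec n g u) (mvec n g v) q (mvec n g w)"
  proof -
    have "mvec n g (w - w') = mvec n g w - mvec n g w'" for w w'
      using mvec_add[of n g "w - w'" w'] by simp
    then show ?thesis by (simp add: Ev_def mvec_add mvec_vscale hg)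
  qed
  moreover have "mvec n g (mvec n (Eich u v q) w) = mvec n g (Ev u v q w)"
    by (rule mvec_cong) (simp add: mvec_Eich)
  ultimately show "mvec n (mmul n g (Eich u v q)) w i
      = mvec n (mmul n (Eich (mvec n g u) (mvec n g v) q) g) w i"
    using i by (simp add: mvec_mmul mvec_Eich)
qed (auto simp: is_mat_mmul is_mat_Eich g)

lemma Eich_conj:
  assumes g: "g \<in> GL n" and hg: "\<And>u v. h (mvec n g u) (mvec n g v) = h u v"
  shows "mmul n (mmul n g (Eich u v q)) (ginv n g) = Eich (mvec n g u) (mvec n g v) q"
  using g by (simp add: mvec_Eich_conj[OF GL_is_mat hg] mmul_assoc mmul_ginv mmul_emat_right is_mat_Eich)

text \<open>Without quadratic part the two vectors play the same role up to the factor
  \<open>- lam\<close> and the involution on \<open>r\<close>. A transvection along a little known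
  vector thus becomes one along a better known vector.\<close>

lemma Eich_swap: "Eich u (vscale w r) 0 = Eich w (vscale u (- (lam * cj r))) 0"
proof (rule Eich_eqI)
  fix x
  have 1: "cj lam * h w x = cj (h x w)"
    using h_conj[of w x] by simp
  have 2: "h (vscale u (- (lam * cj r))) x = - (r * cj (h x u))"
    using h_conj[of u x] by (simp add: hs cjs mult.assoc)
  have 3: "lam * cj r * cj (h x w) = cj r * h w x"
    by (simp add: 1[symmetric] mult.assoc cj_lam_left_commute)
  show "Ev u (vscale w r) 0 x = Ev w (vscale u (- (lam * cj r))) 0 x"
    unfolding Ev_def 2 by (simp add: hs cjs fun_eq_iff mult.assoc 3[unfolded mult.assoc])
qed

text \<open>Expanding the quadratic term at \<open>u + u'\<close> produces mixed terms containing
  \<open>q\<close>. The correction \<open>vscale u q\<close> of the vector part accounts for them;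
  the relation between \<open>q\<close> and \<open>h v v\<close> disposes of the \<open>cj q\<close>
  that it introduces.\<close>

lemma Eich_add_left:
  assumes "h u u = 0" "h u u' = 0" "h u' u' = 0" "h u v = 0" "h u' v = 0" and q: "q + lam * cj q = h v v"
  shows "Eich (u + u') v q = mmul n (Eich u' (v + vscale u q) q) (Eich u v q)"
proof (rule Eich_mult_eqI[symmetric])
  fix w
  have 0: "h u' u = 0" "h v u = 0" "h v u' = 0" using assms by (auto intro: h_eq_0_sym)
  have *: "cj q * h u w = h v v * cj (h w u) - q * cj (h w u)"
    using h_conj[of u w] by (simp add: q[symmetric] distrib_right mult.assoc lam_left_commute[of "cj q"])
  show "Ev u' (v + vscale u q) q (Ev u v q w) = Ev (u + u') v q w"
    using assms(1-5) 0 by (simp add: Ev_def hs cjs fun_eq_iff algebra_simps *)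
qed

lemma Eich_vscale_left: "Eich (vscale u z) v q = Eich u (vscale v (cj z)) (z * q * cj z)"
  by (rule Eich_eqI) (simp add: Ev_def hs cjs fun_eq_iff algebra_simps)

text \<open>A vector part parallel to \<open>u\<close> collapses into a quadratic part. This is how
  the minimal form parameter enters.\<close>

lemma Eich_self: "Eich u (vscale u z) 0 = Eich u 0 (z - lam * cj z)"
proof (rule Eich_eqI)
  fix w
  have "cj z * h u w = lam * (cj z * cj (h w u))"
    using h_conj[of u w] by (simp add: lam_left_commute[of "cj z"])
  then show "Ev u (vscale u z) 0 w = Ev u 0 (z - lam * cj z) w"
    by (simp add: Ev_def hs cjs fun_eq_iff algebra_simps)
qed

lemma Ev_bvec_eq:
  assumes "i \<in> Omega n" "k \<in> Omega n" "a \<in> Omega n" "b \<in> Omega n"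
  shows "Ev (bvec i 1) (bvec k r) q (bvec b 1) a =
    (if a = b then 1 else 0) + (if a = i \<and> b = - k then cj r * eta k else 0)
      - (if a = k \<and> b = - i then r * cj (eta (- i)) else 0)
      - (if a = i \<and> b = - i then q * cj (eta (- i)) else 0)"
proof -
  have 1: "h (bvec k r) (bvec b 1) = (if b = - k then cj r * eta k else 0)"
    using assms by (simp add: h_bvec_bvec eta_commute)
  have 2: "cj (h (bvec b 1) (bvec i 1)) = (if b = - i then cj (eta (- i)) else 0)"
    using assms by (auto simp: h_bvec_bvec)
  show ?thesis
    unfolding Ev_def by (simp add: 1 2 bvec_apply)
qed

lemma lam_conjugate: "lam * x * cj lam = x"
  by (simp add: mult.assoc flip: cj_lam_commute)

lemma Tij_eq_Eich:
  assumes "i \<in> Omega n" "j \<in> Omega n"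
  shows "Tij cj lam n i j x = Eich (bvec i 1) (bvec (- j) (eta (- j) * cj x)) 0"
proof -
  have "lam_pow cj lam ((eps j - eps i) div 2) * cj x = eta (- j) * cj x * cj (eta (- i))"
    using assms by (cases "i > 0"; cases "j > 0")
      (simp_all add: Omega_def lam_pow_def eps_def eta_def lam_conjugate cj_lam_commute[of "cj x"])
  moreover have "x = cj (eta (- j) * cj x) * eta (- j)"
    by (simp add: cjs mult.assoc)
  ultimately show ?thesis
    using assms
    by (auto simp: fun_eq_iff Eich_def Ev_bvec_eq Tij_def madd_def smul_def unit_mat_def emat_def)
qed

lemma Tii_eq_Eich:
  assumes "i \<in> Omega n"
  shows "Tii n i (lam_pow cj lam (- ((eps i + 1) div 2)) * g) = Eich (bvec i 1) 0 (- g)"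
proof -
  have *: "lam_pow cj lam (- ((eps i + 1) div 2)) * g = g * cj (eta (- i))"
    using assms by (auto simp: Omega_def lam_pow_def eps_def eta_def cj_lam_commute)
  show ?thesis
    using assms unfolding * bvec_zero[of 0, symmetric]
    by (auto simp: fun_eq_iff Eich_def Tii_def madd_def smul_def unit_mat_def emat_def
        Ev_def h_bvec_right cjs bvec_apply)
qed

text \<open>Both kinds of root elements are transvections along basis vectors. Passing between the
  parametrizations costs conjugations, signs and powers of \<open>lam\<close>, whence the closure
  assumptions on \<open>X\<close> and \<open>L\<close>. Absolute and relative generators are both
  covered.\<close>

lemma elem_gens_Eich:
  assumes "\<And>x. x \<in> X \<Longrightarrow> cj x \<in> X" "\<And>x. x \<in> X \<Longrightarrow> lam * x \<in> X" "\<And>x. x \<in> X \<Longrightarrow> cj lam * x \<in> X"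
    and "\<And>x. x \<in> L \<Longrightarrow> - x \<in> L"
  shows "elem_gens cj lam n X L =
    {Eich (bvec i 1) (bvec k r) 0 | i k r. i \<in> Omega n \<and> k \<in> Omega n \<and> k \<noteq> i \<and> k \<noteq> - i \<and> r \<in> X}
    \<union> {Eich (bvec i 1) 0 a | i a. i \<in> Omega n \<and> a \<in> L}" (is "_ = ?A \<union> ?B")
proof -
  let ?A' = "{Tij cj lam n i j x | i j x. i \<in> Omega n \<and> j \<in> Omega n \<and> i \<noteq> j \<and> i \<noteq> - j \<and> x \<in> X}"
  let ?B' = "{Tii n i a | i a. i \<in> Omega n \<and> a \<in> {lam_pow cj lam (- ((eps i + 1) div 2)) * g | g. g \<in> L}}"
  have eX: "eta i * x \<in> X" "cj (eta i) * x \<in> X" if "x \<in> X" for i x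
    using that assms by (auto simp: eta_def)
  have "?A' = ?A"
  proof safe
    fix i j x assume "i \<in> Omega n" "j \<in> Omega n" "i \<noteq> j" "i \<noteq> - j" "x \<in> X"
    then show "\<exists>i' k r. Tij cj lam n i j x = Eich (bvec i' 1) (bvec k r) 0 \<and>
        i' \<in> Omega n \<and> k \<in> Omega n \<and> k \<noteq> i' \<and> k \<noteq> - i' \<and> r \<in> X"
      by (intro exI[of _ i] exI[of _ "- j"] exI[of _ "eta (- j) * cj x"])
        (auto simp: Tij_eq_Eich eX assms)
  next
    fix i k r assume *: "i \<in> Omega n" "k \<in> Omega n" "k \<noteq> i" "k \<noteq> - i" "r \<in> X"
    have "eta k * cj (cj r * eta k) = r"
      by (simp add: cjs)
    then have "Eich (bvec i 1) (bvec k r) 0 = Tij cj lam n i (- k) (cj r * eta k)"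
      using * by (simp add: Tij_eq_Eich)
    moreover have "cj r * eta k \<in> X" using * assms eX by (simp flip: eta_commute)
    ultimately show "\<exists>i' j x. Eich (bvec i 1) (bvec k r) 0 = Tij cj lam n i' j x \<and>
        i' \<in> Omega n \<and> j \<in> Omega n \<and> i' \<noteq> j \<and> i' \<noteq> - j \<and> x \<in> X"
      using * by (intro exI[of _ i] exI[of _ "- k"] exI[of _ "cj r * eta k"]) auto
  qed
  moreover have "?B' = ?B"
  proof safe
    fix i g assume "i \<in> Omega n" "g \<in> L"
    then show "\<exists>i' a. Tii n i (lam_pow cj lam (- ((eps i + 1) div 2)) * g) = Eich (bvec i' 1) 0 a \<and>
        i' \<in> Omega n \<and> a \<in> L"
      using assms(4) Tii_eq_Eich by blast
  next
    fix i a assume "i \<in> Omega n" "a \<in> L"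
    then show "\<exists>i' a'. Eich (bvec i 1) 0 a = Tii n i' a' \<and>
        i' \<in> Omega n \<and> a' \<in> {lam_pow cj lam (- ((eps i' + 1) div 2)) * g | g. g \<in> L}"
      using assms(4) Tii_eq_Eich[of i "- a"] by force
  qed
  ultimately show ?thesis by (simp add: elem_gens_def)
qed

text \<open>Two hyperbolic planes cannot exhaust three, so a spare plane is always at hand. This is
  the main use of \<open>n \<ge> 3\<close>.\<close>

lemma exists_index:
  assumes "i \<in> Omega n" "j \<in> Omega n"
  obtains p where "p \<in> Omega n" "p > 0" "p \<noteq> i" "p \<noteq> - i" "p \<noteq> j" "p \<noteq> - j"
proof -
  have "\<exists>p\<in>{1, 2, 3}. p \<noteq> i \<and> p \<noteq> - i \<and> p \<noteq> j \<and> p \<noteq> - j"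
    by auto
  then obtain p where "p \<in> {1, 2, 3}" "p \<noteq> i \<and> p \<noteq> - i \<and> p \<noteq> j \<and> p \<noteq> - j" by blast
  then show ?thesis using n3 by (intro that[of p]) (auto simp: Omega_def)
qed

lemma Eich_conj_Eich:
  assumes "h u u = 0" "h u v = 0" "Eich u v q \<in> GL n"
    and "\<And>x y. h (mvec n (Eich u v q) x) (mvec n (Eich u v q) y) = h x y"
  shows "mmul n (mmul n (Eich u v q) (Eich x y r)) (ginv n (Eich u v q))
    = Eich (Ev u v q x) (Ev u v q y) r"
  using Eich_conj[OF assms(3,4), of x y r] Eich_cong[of "mvec n (Eich u v q) x" "Ev u v q x"
      "mvec n (Eich u v q) y" "Ev u v q y" r] by (simp add: mvec_Eich)

lemma Ev_preserves_h:
  assumes "h u u = 0" "h u v = 0" "q + lam * cj q = h v v"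
  shows "h (Ev u v q x) (Ev u v q y) = h x y"
proof -
  have 0: "h v u = 0" using assms by (auto intro: h_eq_0_sym)
  have 1: "h u y = lam * cj (h y u)" "h x v = lam * cj (h v x)"
    by (rule h_conj)+
  have 2: "h x u * (h v v * z) = h x u * (q * z) + lam * (h x u * (cj q * z))" for z
    by (simp add: assms(3)[symmetric] algebra_simps lam_left_commute[of "h x u"])
  have 3: "cj (h v x) * (lam * z) = lam * (cj (h v x) * z)"
      "h x u * (cj q * (lam * z)) = lam * (h x u * (cj q * z))" for z
    by (simp_all add: lam_left_commute[of "cj q"] lam_left_commute[of "h x u"] lam_left_commute[of "cj (h v x)"])
  show ?thesis
    using assms(1,2) 0 unfolding Ev_def
    by (simp add: hs cjs algebra_simps 2 1 3)
qed

lemma mvec_Eich_preserves_h: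
  assumes "h u u = 0" "h u v = 0" "q + lam * cj q = h v v"
  shows "h (mvec n (Eich u v q) x) (mvec n (Eich u v q) y) = h x y"
proof -
  have "h (mvec n (Eich u v q) x) (mvec n (Eich u v q) y) = h (Ev u v q x) (Ev u v q y)"
    by (rule h_cong) (auto simp: mvec_Eich)
  then show ?thesis by (simp add: Ev_preserves_h[OF assms])
qed

end

section \<open>Eichler transformations inside the elementary group\<close>

text \<open>A form ring carried by a subset of the ambient ring. It is used for the whole ring with
  \<open>Lam\<close> and, later, for the pairs congruent modulo an ideal, so that every membership
  in \<open>G\<close> proved here also has a relative reading.\<close>

locale form_subring = unitary_space cj lam n for cj :: "'a::ring_1 \<Rightarrow> 'a" and lam n +
  fixes X L :: "'a set"
  assumes X1: "1 \<in> X" and X_add: "x \<in> X \<Longrightarrow> y \<in> X \<Longrightarrow> x + y \<in> X"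
    and X_mult: "x \<in> X \<Longrightarrow> y \<in> X \<Longrightarrow> x * y \<in> X" and X_uminus: "x \<in> X \<Longrightarrow> - x \<in> X"
    and X_cj: "x \<in> X \<Longrightarrow> cj x \<in> X" and X_lam: "lam \<in> X"
    and LX: "L \<subseteq> X" and L0: "0 \<in> L"
    and L_add: "x \<in> L \<Longrightarrow> y \<in> L \<Longrightarrow> x + y \<in> L" and L_uminus: "x \<in> L \<Longrightarrow> - x \<in> L"
    and L_conj: "r \<in> X \<Longrightarrow> x \<in> L \<Longrightarrow> r * x * cj r \<in> L"
    and L_min: "r \<in> X \<Longrightarrow> r - lam * cj r \<in> L"
    and L_max: "x \<in> L \<Longrightarrow> lam * cj x = - x"
begin

definition G :: "'a mat set" where "G = generate (GLgrp n) (elem_gens cj lam n X L)"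

definition XV :: "'a vec \<Rightarrow> bool" where "XV v \<longleftrightarrow> (\<forall>k\<in>Omega n. v k \<in> X)"

lemma X0: "0 \<in> X"
  using X_add[OF X1 X_uminus[OF X1]] by simp

lemma X_diff: "x \<in> X \<Longrightarrow> y \<in> X \<Longrightarrow> x - y \<in> X"
  using X_add[OF _ X_uminus, of x y] by simp

lemma X_power: "x \<in> X \<Longrightarrow> x ^ k \<in> X"
  by (induction k) (auto simp: X1 X_mult)

lemma X_sum: "(\<And>i. i \<in> A \<Longrightarrow> g i \<in> X) \<Longrightarrow> sum g A \<in> X"
  by (induction A rule: infinite_finite_induct) (auto simp: X0 X_add)

lemma X_eta: "eta i \<in> X"
  by (simp add: eta_def X1 X_lam)

lemmas X_intros = X0 X1 X_add X_mult X_uminus X_cj X_lam X_diff X_power X_eta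

lemma L_diff: "x \<in> L \<Longrightarrow> y \<in> L \<Longrightarrow> x - y \<in> L"
  using L_add[OF _ L_uminus, of x y] by simp

lemma L_conj': "r \<in> X \<Longrightarrow> x \<in> L \<Longrightarrow> cj r * x * r \<in> L"
  using L_conj[of "cj r" x] by (simp add: X_cj)

lemma XV_intros: "XV u \<Longrightarrow> XV v \<Longrightarrow> XV (u + v)" "XV u \<Longrightarrow> XV v \<Longrightarrow> XV (u - v)" "XV u \<Longrightarrow> XV (- u)"
  "XV u \<Longrightarrow> r \<in> X \<Longrightarrow> XV (vscale u r)" "XV 0" "r \<in> X \<Longrightarrow> XV (bvec k r)"
  by (auto simp: XV_def bvec_apply intro: X_intros)

lemma XV_sum: "(\<And>i. i \<in> A \<Longrightarrow> XV (g i)) \<Longrightarrow> XV (sum g A)"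
proof (induction A rule: infinite_finite_induct)
  case (infinite A)
  show ?case unfolding sum.infinite[OF infinite.hyps] by (rule XV_intros)
next
  case empty
  show ?case unfolding sum.empty by (rule XV_intros)
next
  case (insert x F)
  then show ?case unfolding sum.insert[OF insert.hyps] by (intro XV_intros) auto
qed

lemma X_f: "XV u \<Longrightarrow> XV v \<Longrightarrow> f u v \<in> X"
  unfolding form_f_def XV_def Omega_def by (intro X_sum X_mult X_cj) auto

lemma X_h: "XV u \<Longrightarrow> XV v \<Longrightarrow> h u v \<in> X"
  unfolding h_f by (intro X_add X_mult X_cj X_f X_lam)

lemma h_self_of_L:
  assumes "q - f v v \<in> L" shows "q + lam * cj q = h v v"
proof -
  have "lam * cj (q - f v v) = - (q - f v v)" using L_max[OF assms] .
  then show ?thesis unfolding h_f by (simp add: cjs algebra_simps)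
qed

lemma G_gens:
  "elem_gens cj lam n X L =
    {Eich (bvec i 1) (bvec k r) 0 | i k r. i \<in> Omega n \<and> k \<in> Omega n \<and> k \<noteq> i \<and> k \<noteq> - i \<and> r \<in> X}
    \<union> {Eich (bvec i 1) 0 a | i a. i \<in> Omega n \<and> a \<in> L}"
  by (rule elem_gens_Eich) (auto intro: X_intros L_uminus)

lemma h_bvec_self: "i \<in> Omega n \<Longrightarrow> h (bvec i r) (bvec i s) = 0"
  using Omega_neq_uminus by (fastforce simp: h_bvec_bvec)

lemma f_bvec_self: "i \<in> Omega n \<Longrightarrow> f (bvec i r) (bvec i s) = 0"
  by (auto simp: f_bvec Omega_def)

lemma gens_GL: "elem_gens cj lam n X L \<subseteq> GL n"
  unfolding G_gens by (auto intro!: Eich_GL simp: h_bvec_self h_bvec_bvec)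

lemma G_GL: "G \<subseteq> GL n"
  using group.generate_incl[OF group_GLgrp, of "elem_gens cj lam n X L" n] gens_GL by (simp add: G_def)

lemma G_subgroup: "subgroup G (GLgrp n)"
  unfolding G_def by (rule group.generate_is_subgroup[OF group_GLgrp]) (simp add: gens_GL)

lemma G_mult: "a \<in> G \<Longrightarrow> b \<in> G \<Longrightarrow> mmul n a b \<in> G"
  using subgroup.m_closed[OF G_subgroup] by simp

lemma G_inv: "a \<in> G \<Longrightarrow> ginv n a \<in> G"
  using subgroup.m_inv_closed[OF G_subgroup] by simp

lemma G_one: "emat n \<in> G"
  using subgroup.one_closed[OF G_subgroup] by simp

lemma G_cancel_right: "mmul n a b \<in> G \<Longrightarrow> b \<in> G \<Longrightarrow> is_mat n a \<Longrightarrow> a \<in> G"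
  using G_mult[OF _ G_inv, of "mmul n a b" b] G_GL
  by (auto simp: mmul_assoc mmul_ginv mmul_emat_right)

lemma G_cancel_left: "mmul n b a \<in> G \<Longrightarrow> b \<in> G \<Longrightarrow> is_mat n a \<Longrightarrow> a \<in> G"
  using G_mult[OF G_inv, of b "mmul n b a"] G_GL
  by (auto simp: mmul_assoc[symmetric] ginv_mmul mmul_emat_left)

lemma G_short: "i \<in> Omega n \<Longrightarrow> k \<in> Omega n \<Longrightarrow> k \<noteq> i \<Longrightarrow> k \<noteq> - i \<Longrightarrow> r \<in> X \<Longrightarrow> Eich (bvec i 1) (bvec k r) 0 \<in> G"
  unfolding G_def G_gens by (rule generate.incl) blast

lemma G_long: "i \<in> Omega n \<Longrightarrow> a \<in> L \<Longrightarrow> Eich (bvec i 1) 0 a \<in> G"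
  unfolding G_def G_gens by (rule generate.incl) blast

lemma G_conj_Eich:
  assumes "h u u = 0" "h u v = 0" "q - f v v \<in> L" "Eich u v q \<in> G" "Eich x y r \<in> G"
  shows "Eich (Ev u v q x) (Ev u v q y) r \<in> G"
  using Eich_conj_Eich[OF assms(1,2) _ mvec_Eich_preserves_h[OF assms(1,2) h_self_of_L[OF assms(3)]], of x y r]
    assms(4,5) G_mult G_inv G_GL by (metis subsetD)

text \<open>The scaling parameter \<open>z\<close> accounts for denominators: after inverting \<open>z\<close> the predicate \<open>wk u z v\<close>
  says that some Eichler transformation along \<open>u\<close> with vector part \<open>v\<close> is elementary.\<close>

definition wk :: "'a vec \<Rightarrow> 'a \<Rightarrow> 'a vec \<Rightarrow> bool" where
  "wk u z v \<longleftrightarrow> (\<exists>q. q - f v v \<in> L \<and> Eich u (vscale v z) (cj z * q * z) \<in> G)"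

definition long :: "'a vec \<Rightarrow> 'a \<Rightarrow> bool" where
  "long u z \<longleftrightarrow> (\<forall>a\<in>L. Eich u 0 (cj z * a * z) \<in> G)"

text \<open>The cocycle of \<open>Eich_mult\<close> differs from the mixed terms of
  \<open>f (v + v') (v + v')\<close>, up to sign, by \<open>f v' v - lam * cj (f v' v)\<close>, an
  element of \<open>L\<close>. Hence a suitable quadratic part for the sum exists again.\<close>

lemma wk_add:
  assumes u: "h u u = 0" "h u v = 0" "h u v' = 0" and X: "XV v" "XV v'"
    and "wk u z v" "wk u z v'"
  shows "wk u z (v + v')"
proof -
  obtain q q' where q: "q - f v v \<in> L" "Eich u (vscale v z) (cj z * q * z) \<in> G"
    and q': "q' - f v' v' \<in> L" "Eich u (vscale v' z) (cj z * q' * z) \<in> G"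
    using assms by (auto simp: wk_def)
  have "(q - f v v) + (q' - f v' v') - (f v' v - lam * cj (f v' v)) \<in> L"
    by (rule L_diff[OF L_add[OF q(1) q'(1)] L_min[OF X_f[OF X(2,1)]]])
  then have 1: "q + q' + h v v' - f (v + v') (v + v') \<in> L"
    by (simp add: h_f fs algebra_simps)
  have "mmul n (Eich u (vscale v z) (cj z * q * z)) (Eich u (vscale v' z) (cj z * q' * z))
    = Eich u (vscale (v + v') z) (cj z * (q + q' + h v v') * z)"
    using u by (subst Eich_mult) (auto simp: hs vscale_add algebra_simps)
  then show ?thesis
    using 1 q q' G_mult unfolding wk_def by metis
qed

lemma wk_zero: "wk u z 0"
  unfolding wk_def by (intro exI[of _ 0]) (simp add: L0 Eich_0 G_one)

lemma wk_sum:
  assumes "h u u = 0" "finite A" "\<And>k. k \<in> A \<Longrightarrow> h u (g k) = 0" "\<And>k. k \<in> A \<Longrightarrow> XV (g k)" "\<And>k. k \<in> A \<Longrightarrow> wk u z (g k)"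
  shows "wk u z (sum g A)"
  using assms(2-5)
proof (induction A)
  case empty
  show ?case unfolding sum.empty by (rule wk_zero)
next
  case (insert x F)
  have "h u (sum g F) = 0" using insert.prems by (auto simp: h_sum_right intro: sum.neutral)
  then show ?case unfolding sum.insert[OF insert.hyps(1,2)]
    using insert.prems insert.IH assms(1) by (intro wk_add XV_sum) auto
qed

lemma wk_cong:
  assumes "wk u z v" "\<And>i. i \<in> Omega n \<Longrightarrow> v i = v' i" shows "wk u z v'"
proof -
  have "f v v = f v' v'" using assms(2) by (intro f_cong)
  moreover have "Eich u (vscale v z) q = Eich u (vscale v' z) q" for q
    using assms(2) by (intro Eich_cong) auto
  ultimately show ?thesis using assms(1) by (simp add: wk_def)
qed

text \<open>Two admissible quadratic parts for the same \<open>v\<close> differ by an element of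
  \<open>L\<close>, and \<open>long\<close> supplies the corresponding factor; so the existential in
  \<open>wk\<close> becomes universal.\<close>

lemma wk_long:
  assumes u: "h u u = 0" "h u v = 0" and "wk u z v" "long u z" "q - f v v \<in> L"
  shows "Eich u (vscale v z) (cj z * q * z) \<in> G"
proof -
  obtain q' where q': "q' - f v v \<in> L" "Eich u (vscale v z) (cj z * q' * z) \<in> G"
    using assms by (auto simp: wk_def)
  have "q - q' \<in> L" using L_diff[OF assms(5) q'(1)] by simp
  then have "Eich u 0 (cj z * (q - q') * z) \<in> G" using assms by (simp add: long_def)
  from G_mult[OF q'(2) this] show ?thesis
    using u by (simp add: Eich_mult hs algebra_simps)
qed

lemma wk_long': "h u u = 0 \<Longrightarrow> h u v = 0 \<Longrightarrow> wk u 1 v \<Longrightarrow> long u 1 \<Longrightarrow> q - f v v \<in> L \<Longrightarrow> Eich u v q \<in> G"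
  using wk_long[of u v 1 q] by simp

text \<open>Split \<open>v\<close> into coordinates. Each one gives a generator: the coordinate at
  \<open>p\<close> is parallel to the axis and turns into a long root element, and the one at
  \<open>- p\<close> is absent.\<close>

lemma Eich_bvec_G:
  assumes p: "p \<in> Omega n" and v: "XV v" "v (- p) = 0" and q: "q - f v v \<in> L"
  shows "Eich (bvec p 1) v q \<in> G"
proof -
  let ?e = "bvec p 1"
  have long: "long ?e 1" using p by (auto simp: long_def G_long)
  have u: "h ?e ?e = 0" using p by (simp add: h_bvec_self)
  have wk: "wk ?e 1 (bvec k (v k))" if k: "k \<in> Omega n" for k
  proof (cases "k = - p")
    case True
    then show ?thesis using v wk_zero by simp
  next
    case False
    have vk: "v k \<in> X" using v k by (simp add: XV_def)
    show ?thesis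
    proof (cases "k = p")
      case True
      have "Eich ?e (bvec p (v p)) 0 = Eich ?e 0 (v p - lam * cj (v p))"
        using Eich_self[of ?e "v p"] by (simp add: vscale_bvec)
      then show ?thesis using True p vk by (auto simp: wk_def f_bvec_self L0 L_min G_long intro!: exI[of _ 0])
    next
      case False
      then show ?thesis using k p vk \<open>k \<noteq> - p\<close> by (auto simp: wk_def f_bvec_self L0 G_short intro!: exI[of _ 0])
    qed
  qed
  have "h ?e (bvec k (v k)) = 0" if "k \<in> Omega n" for k
    using that p v by (auto simp: h_bvec_bvec)
  moreover have "XV (bvec k (v k))" if "k \<in> Omega n" for k
    using that v by (intro XV_intros) (simp add: XV_def)
  ultimately have "wk ?e 1 (\<Sum>k\<in>Omega n. bvec k (v k))"
    by (intro wk_sum[OF u] wk) auto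
  then have "wk ?e 1 v" by (rule wk_cong) (simp add: vec_decomp)
  moreover have "h ?e v = 0" using p v by (simp add: h_bvec_left)
  ultimately show ?thesis using u long q by (intro wk_long')
qed

lemma Eich_swap1: "Eich u w 0 = Eich w (vscale u (- lam)) 0"
  using Eich_swap[of u w 1] by simp

lemma f_vscale_self_L: "f u u \<in> L \<Longrightarrow> r \<in> X \<Longrightarrow> 0 - f (vscale u r) (vscale u r) \<in> L"
  using L_uminus[OF L_conj'[of r "f u u"]] by (simp add: f_vscale mult.assoc)

text \<open>If \<open>w\<close> is isotropic and misses the hyperbolic plane \<open>{p, - p}\<close>, then Eichler transformations along \<open>w\<close>
  are commutators of those along \<open>bvec p 1\<close> and \<open>bvec (- p) 1\<close>.\<close>

context
  fixes w p
  assumes p: "p \<in> Omega n" "p > 0" and w: "XV w" "f w w = 0" "h w w = 0" "w p = 0" "w (- p) = 0"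
begin

lemma Eich_hyp_plane_short:
  assumes "r \<in> X" "j = p \<or> j = - p" shows "Eich w (bvec j r) 0 \<in> G"
proof -
  have j: "j \<in> Omega n" using assms p by auto
  have "Eich w (vscale (bvec j 1) r) 0 = Eich (bvec j 1) (vscale w (- (lam * cj r))) 0"
    by (rule Eich_swap)
  also have "\<dots> \<in> G"
    using w assms j by (intro Eich_bvec_G) (auto simp: XV_intros X_intros f_vscale L0)
  finally show ?thesis by (simp add: vscale_bvec)
qed

lemma eta_p: "eta p = 1" "eta (- p) = lam"
  using p by (auto simp: eta_def)

lemma Ev_p: 
  assumes "v p = 0" "v (- p) = 0" 
  shows "Ev (bvec p 1) v q (bvec (- p) 1) = bvec (- p) 1 - vscale v (cj lam) - vscale (bvec p 1) (q * cj lam)"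
proof -
  have "h v (bvec (- p) 1) = 0" "h (bvec (- p) 1) (bvec p 1) = lam"
    using assms p by (simp_all add: h_bvec_right h_bvec_left bvec_apply eta_p)
  then show ?thesis by (simp add: Ev_def)
qed

text \<open>A long root element along \<open>?e'\<close> is conjugated into one along
  \<open>?e' + w\<close>. Splitting the direction by \<open>Eich_add_left\<close> leaves the long
  element along \<open>w\<close> next to factors already known to be elementary.\<close>

lemma long_isotropic: "long w 1"
  unfolding long_def
proof
  fix a assume a: "a \<in> L"
  let ?e = "bvec p 1" and ?e' = "bvec (- p) 1"
  \<comment> \<open>The pairing of \<open>?e'\<close> with \<open>?e\<close> is \<open>lam\<close>,
    so \<open>Ev\<close> contributes a factor \<open>cj lam\<close>; with \<open>- lam\<close> here
    \<open>?e'\<close> goes exactly to \<open>?e' + w\<close>.\<close>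
  let ?v = "vscale w (- lam)"
  have ee: "h ?e ?e = 0" "h ?e' ?e' = 0" using p by (auto simp: h_bvec_self)
  have ev: "h ?e ?v = 0" using p w by (simp add: h_bvec_left)
  have q: "0 - f ?v ?v \<in> L" using w by (simp add: f_vscale L0)
  have g: "Eich ?e ?v 0 \<in> G"
    using p w q by (intro Eich_bvec_G) (auto intro: XV_intros X_intros)
  have "Eich (Ev ?e ?v 0 ?e') (Ev ?e ?v 0 0) a \<in> G"
    by (rule G_conj_Eich[OF ee(1) ev q g]) (use p a in \<open>simp add: G_long\<close>)
  moreover have "Ev ?e ?v 0 ?e' = ?e' + w"
    using w by (subst Ev_p) (auto simp: fun_eq_iff mult.assoc)
  ultimately have 1: "Eich (?e' + w) 0 a \<in> G" by (simp add: Ev_zero)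
  have ew: "h ?e' w = 0" using p w by (simp add: h_bvec_left)
  have "Eich (?e' + w) 0 a = mmul n (Eich w (0 + vscale ?e' a) a) (Eich ?e' 0 a)"
    using w ee ew L_max[OF a] by (intro Eich_add_left) auto
  with 1 have 2: "Eich w (bvec (- p) a) a \<in> G"
    using G_cancel_right[of _ "Eich ?e' 0 a"] p a by (simp add: G_long is_mat_Eich vscale_bvec)
  have 3: "Eich w (bvec (- p) a) 0 \<in> G"
    using a LX by (intro Eich_hyp_plane_short) auto
  have "h w (bvec (- p) a) = 0" using p w by (simp add: h_bvec_right)
  then have "mmul n (Eich w (bvec (- p) a) 0) (Eich w 0 a) = Eich w (bvec (- p) a) a"
    using w by (simp add: Eich_mult)
  then show "Eich w 0 (cj 1 * a * 1) \<in> G"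
    using 2 3 G_cancel_left[of "Eich w (bvec (- p) a) 0" "Eich w 0 a"] by (simp add: is_mat_Eich)
qed

text \<open>The part \<open>v'\<close> of \<open>v\<close> outside the hyperbolic plane gives a
  transvection along \<open>?e\<close> that fixes \<open>w\<close>. Conjugating
  \<open>Eich ?e' w 0\<close> by it and swapping yields a transvection along \<open>w\<close> whose
  vector part is \<open>v'\<close> plus a term in the plane, and such terms are handled by
  \<open>Eich_hyp_plane_short\<close>.\<close>

lemma wk_isotropic:
  assumes v: "XV v" "h w v = 0" shows "wk w 1 v"
proof -
  let ?e = "bvec p 1" and ?e' = "bvec (- p) 1"
  define v' where "v' = (\<lambda>i. if i = p \<or> i = - p then 0 else v i)"
  have v': "XV v'" "v' p = 0" "v' (- p) = 0" using v by (auto simp: v'_def XV_def X0)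
  have short: "wk w 1 (bvec j r)" if "r \<in> X" "j = p \<or> j = - p" for j r
    using that p Eich_hyp_plane_short[OF that] f_bvec_self[of j r r]
    unfolding wk_def by (intro exI[of _ 0]) (auto simp: L0)
  have hw: "h w (bvec p r) = 0" "h w (bvec (- p) r) = 0" for r
    using p w by (simp_all add: h_bvec_right)
  define q where "q = f v' v'"
  have qX: "q \<in> X" using v' by (simp add: q_def X_f)
  \<comment> \<open>The component in the hyperbolic plane of the image of \<open>?e'\<close> under
    \<open>Eich ?e v' q\<close>, rescaled by the factor \<open>- lam\<close> that the swap
    introduces.\<close>
  let ?t = "bvec p q + bvec (- p) (- lam)"
  have "wk w 1 ?t"
    using w hw qX by (intro wk_add short) (auto intro: XV_intros X_intros)
  then obtain q2 where q2: "q2 - f ?t ?t \<in> L" "Eich w ?t q2 \<in> G"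
    by (auto simp: wk_def)
  have fe: "f (bvec (- p) r) (bvec j s) = 0" for r j s
    using p by (auto simp: f_bvec)
  have ft: "f ?t ?t = - (lam * cj q)"
    using p f_bvec_self[of p q q] by (simp add: fs fe f_bvec Omega_def flip: lam_commute)
  have ee: "h ?e ?e = 0" using p by (auto simp: h_bvec_self)
  have ev: "h ?e v' = 0" using p v' by (simp add: h_bvec_left)
  have vv: "v = v' + (bvec p (v p) + bvec (- p) (v (- p)))"
    using p by (auto simp: v'_def fun_eq_iff bvec_apply)
  have vX: "v p \<in> X" "v (- p) \<in> X" using v p by (auto simp: XV_def)
  have wv': "h w v' = 0"
    using arg_cong[OF vv, of "h w"] v(2) by (simp add: hs hw)
  have g: "Eich ?e v' q \<in> G"
    using p v' by (intro Eich_bvec_G) (auto simp: q_def L0)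
  have "Eich ?e' w 0 \<in> G"
    using p w by (intro Eich_bvec_G) (auto simp: L0)
  then have "Eich (Ev ?e v' q ?e') (Ev ?e v' q w) 0 \<in> G"
    using ee ev g by (intro G_conj_Eich) (auto simp: q_def L0)
  moreover have "Ev ?e v' q w = w"
    using h_eq_0_sym[OF wv'] hw[of 1] by (simp add: Ev_def)
  ultimately have "Eich w (vscale (Ev ?e v' q ?e') (- lam)) 0 \<in> G"
    by (simp add: Eich_swap1[of _ w])
  moreover have "vscale (Ev ?e v' q ?e') (- lam) = v' + ?t"
    using v' by (subst Ev_p) (auto simp: fun_eq_iff algebra_simps bvec_apply mult.assoc)
  ultimately have 1: "Eich w (v' + ?t) 0 \<in> G" by simp
  have "h v' ?t = 0"
    using p v' by (simp add: hs h_bvec_right)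
  then have "mmul n (Eich w v' (- q2)) (Eich w ?t q2) = Eich w (v' + ?t) 0"
    using w wv' hw by (simp add: Eich_mult hs)
  with 1 q2 have 2: "Eich w v' (- q2) \<in> G"
    using G_cancel_right[of "Eich w v' (- q2)" "Eich w ?t q2"] by (simp add: is_mat_Eich)
  have "- (q2 - f ?t ?t) - (q - lam * cj q) \<in> L"
    by (rule L_diff[OF L_uminus[OF q2(1)] L_min[OF qX]])
  then have "- q2 - f v' v' \<in> L" unfolding ft by (simp add: q_def algebra_simps)
  with 2 have "wk w 1 v'" unfolding wk_def by (intro exI[of _ "- q2"]) simp
  then have "wk w 1 (v' + (bvec p (v p) + bvec (- p) (v (- p))))"
    using w hw wv' v' vX by (intro wk_add short) (auto simp: hs intro: XV_intros X_intros)
  then show ?thesis using vv by simp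
qed

lemma Eich_isotropic_G:
  "XV v \<Longrightarrow> h w v = 0 \<Longrightarrow> q - f v v \<in> L \<Longrightarrow> Eich w v q \<in> G"
  using w by (intro wk_long' wk_isotropic long_isotropic) auto

end

text \<open>The decomposition of a vector \<open>v\<close> orthogonal to \<open>u\<close> along the vectors \<open>dv k\<close>, which are supported on \<open>{k, - o'}\<close>
  and orthogonal to \<open>u\<close>, replaces the division by the unit \<open>u o'\<close> available over a local ring.\<close>

context
  fixes u o' B s
  assumes o': "o' \<in> Omega n" and u: "XV u" "h u u = 0" "f u u \<in> L"
    and B: "B \<in> X" "u o' * B = s" "B * u o' = s" and s: "cj s = s"
    and su: "\<And>k. k \<in> Omega n \<Longrightarrow> s * u k = u k * s" and sB: "s * B = B * s"
begin

definition dv :: "int \<Rightarrow> 'a vec" where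
  "dv k = bvec k s - bvec (- o') (cj (eta o') * cj B * h u (bvec k 1))"

lemma sX: "s \<in> X"
  using B o' u(1) by (auto simp: XV_def intro: X_mult)

lemma s_cj: "s * x = x * s \<Longrightarrow> s * cj x = cj x * s"
  by (metis cj_mult s)

lemma s_mult: "s * x = x * s \<Longrightarrow> s * y = y * s \<Longrightarrow> s * (x * y) = (x * y) * s"
  by (metis mult.assoc)

lemma B_cj: "cj B * cj (u o') = s" "cj (u o') * cj B = s"
  using arg_cong[OF B(2), of cj] arg_cong[OF B(3), of cj] by (simp_all add: cj_mult s)

lemma h_u_bvec: "k \<in> Omega n \<Longrightarrow> h u (bvec k r) = eta (- k) * cj (u (- k)) * r"
  by (simp add: h_bvec_right)

lemma XV_dv: "k \<in> Omega n \<Longrightarrow> XV (dv k)"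
  unfolding dv_def using u B sX by (intro XV_intros X_intros X_h) auto

lemma h_u_dv: assumes "k \<in> Omega n" shows "h u (dv k) = 0"
proof -
  have k': "- k \<in> Omega n" using assms by simp
  have "s * (eta (- k) * cj (u (- k))) = (eta (- k) * cj (u (- k))) * s"
    by (intro s_mult s_cj su[OF k']) (simp add: eta_commute)
  moreover have "eta o' * (cj (u o') * (cj (eta o') * x)) = cj (u o') * x" for x
    by (metis eta_cj_assoc(1) eta_left_commute)
  moreover have "cj (u o') * (cj B * x) = s * x" for x
    by (simp add: B_cj flip: mult.assoc)
  ultimately show ?thesis
    using assms o' by (simp add: dv_def hs h_u_bvec mult.assoc)
qed

lemma f_dv: "k \<in> Omega n \<Longrightarrow> k \<noteq> o' \<Longrightarrow> k \<noteq> - o' \<Longrightarrow> f (dv k) (dv k) = 0"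
  using o' by (auto simp: dv_def fs f_bvec Omega_def)

lemma h_dv: "k \<in> Omega n \<Longrightarrow> k \<noteq> o' \<Longrightarrow> k \<noteq> - o' \<Longrightarrow> h (dv k) (dv k) = 0"
  unfolding h_f by (simp add: f_dv)

text \<open>As \<open>dv k\<close> is supported on two indices, it misses some hyperbolic plane, and
  the results on isotropic vectors apply.\<close>

lemma Eich_dv_G:
  assumes k: "k \<in> Omega n" "k \<noteq> o'" "k \<noteq> - o'" and v: "XV v" "h (dv k) v = 0" "q - f v v \<in> L"
  shows "Eich (dv k) v q \<in> G"
proof -
  obtain p where p: "p \<in> Omega n" "p > 0" "p \<noteq> k" "p \<noteq> - k" "p \<noteq> o'" "p \<noteq> - o'"
    using exists_index[OF k(1) o'] by blast
  then have "dv k p = 0" "dv k (- p) = 0" by (auto simp: dv_def bvec_apply)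
  then show ?thesis using p k v by (intro Eich_isotropic_G[of p]) (auto simp: XV_dv f_dv h_dv)
qed

lemma Eich_u_dv_G:
  assumes k: "k \<in> Omega n" "k \<noteq> o'" "k \<noteq> - o'" and r: "r \<in> X"
  shows "Eich u (vscale (dv k) r) 0 \<in> G"
  unfolding Eich_swap[of u "dv k" r]
  using k r u h_eq_0_sym[OF h_u_dv[OF k(1)]]
  by (intro Eich_dv_G f_vscale_self_L XV_intros X_intros) (auto simp: hs)

text \<open>The isotropic vectors \<open>dv k\<close> and \<open>dv (- k)\<close> pair to
  \<open>lam * s * s\<close>. Conjugation by a long element along \<open>dv k\<close> and
  multiplication of transvections along \<open>u\<close> produce the same vector part, but the
  cocycle of the product leaves the quadratic part \<open>- (s * s * a * s * s)\<close>. The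
  quotient is a long element along \<open>u\<close>, scaled by \<open>s ^ 2\<close>.\<close>

lemma long_u: "long u (s ^ 2)"
  unfolding long_def
proof
  fix a assume a: "a \<in> L"
  obtain k where k: "k \<in> Omega n" "k > 0" "k \<noteq> o'" "k \<noteq> - o'"
    using exists_index[OF o' o'] by blast
  then have k': "- k \<in> Omega n" "- k \<noteq> o'" "- k \<noteq> - o'" by auto
  have "Eich u (vscale (dv (- k)) 1) 0 \<in> G"
    using k' by (intro Eich_u_dv_G X1)
  then have 1: "Eich u (dv (- k)) 0 \<in> G" by simp
  have g: "Eich (dv k) 0 a \<in> G"
    using k a by (intro Eich_dv_G) (auto intro: XV_intros)
  have h1: "h (dv (- k)) (dv k) = lam * s * s"
    using k k' o' by (auto simp: dv_def hs h_bvec_bvec eta_def s)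
  have h2: "h u (dv k) = 0" "h u (dv (- k)) = 0" using k k' by (auto intro: h_u_dv)
  let ?z = "- (a * cj lam * s * s)"
  have "Eich (Ev (dv k) 0 a u) (Ev (dv k) 0 a (dv (- k))) 0 \<in> G"
    using k a g 1 by (intro G_conj_Eich) (auto simp: h_dv)
  moreover have "Ev (dv k) 0 a u = u" by (simp add: Ev_def h2)
  moreover have "Ev (dv k) 0 a (dv (- k)) = dv (- k) + vscale (dv k) ?z"
    by (simp add: Ev_def h1 cjs s fun_eq_iff cj_lam_commute mult.assoc)
  ultimately have 2: "Eich u (dv (- k) + vscale (dv k) ?z) 0 \<in> G" by simp
  have "?z \<in> X" using a LX sX by (intro X_intros) auto
  then have "Eich u (vscale (dv k) ?z) 0 \<in> G" using k by (intro Eich_u_dv_G)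
  from G_mult[OF 1 this]
  have 3: "Eich u (dv (- k) + vscale (dv k) ?z) (- (s * s * a * s * s)) \<in> G"
    using u h2 by (simp add: Eich_mult hs h1 mult.assoc cj_lam_left_commute[of a] cj_lam_left_commute[of s])
  have "mmul n (Eich u (dv (- k) + vscale (dv k) ?z) (- (s * s * a * s * s))) (Eich u 0 (s * s * a * s * s))
     = Eich u (dv (- k) + vscale (dv k) ?z) 0"
    using u h2 by (simp add: Eich_mult hs)
  with 2 have "Eich u 0 (s * s * a * s * s) \<in> G"
    by (simp add: G_cancel_left[OF _ 3] is_mat_Eich)
  then show "Eich u 0 (cj (s ^ 2) * a * s ^ 2) \<in> G"
    by (simp add: power2_eq_square cj_mult s mult.assoc)
qed

lemma wk_u_dv:
  assumes k: "k \<in> Omega n" "k \<noteq> o'" "k \<noteq> - o'" and r: "r \<in> X"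
  shows "wk u (s ^ 2) (vscale (dv k) r)"
  unfolding wk_def using k r sX
  by (intro exI[of _ 0]) (auto simp: fs f_dv L0 vscale_vscale intro!: Eich_u_dv_G X_intros)

text \<open>The extra factor \<open>s ^ 2\<close> in the vector gives the quadratic part produced by
  \<open>Eich_self\<close> the two-sided shape that \<open>long_u\<close> can handle.\<close>

lemma wk_u_u: assumes r: "r \<in> X" shows "wk u (s ^ 2) (vscale u (s ^ 2 * r))"
proof -
  have cs: "cj (s ^ 2) = s ^ 2" by (simp add: power2_eq_square cj_mult s)
  have "Eich u (vscale (vscale u (s ^ 2 * r)) (s ^ 2)) 0 = Eich u 0 (cj (s ^ 2) * (r - lam * cj r) * s ^ 2)"
    by (simp add: vscale_vscale Eich_self cjs cs mult.assoc right_diff_distrib left_diff_distrib lam_left_commute[of "s ^ 2"])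
  moreover have "0 - f (vscale u (s ^ 2 * r)) (vscale u (s ^ 2 * r)) \<in> L"
    using r sX u by (intro f_vscale_self_L X_intros)
  ultimately show ?thesis
    using long_u r unfolding wk_def long_def
    by (intro exI[of _ 0]) (auto intro!: L_min)
qed

theorem Eich_scaled_G:
  assumes v: "XV v" "h u v = 0" "q - f v v \<in> L" and sv: "\<And>k. k \<in> Omega n \<Longrightarrow> s * v k = v k * s"
  shows "Eich u (vscale v (s ^ 6)) (s ^ 6 * q * s ^ 6) \<in> G"
proof -
  \<comment> \<open>Subtracting a multiple of \<open>u\<close> clears the coordinate at
    \<open>o'\<close> and, \<open>u\<close> being isotropic, keeps the vector orthogonal to
    \<open>u\<close>.\<close>
  define v1 where "v1 = vscale v s - vscale u (B * v o')"
  let ?I = "Omega n - {o', - o'}"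
  have no: "- o' \<in> Omega n" "o' \<noteq> - o'" using o' Omega_neq_uminus by auto
  have vX: "v o' \<in> X" using v o' by (auto simp: XV_def)
  have v1X: "XV v1" using v u vX B sX by (auto simp: v1_def intro!: XV_intros X_intros)
  have v1s: "s * v1 k = v1 k * s" if "k \<in> Omega n" for k
  proof -
    have "s * (u k * (B * v o')) = (u k * (B * v o')) * s"
      using that o' by (intro s_mult su sv sB)
    moreover have "s * (v k * s) = (v k * s) * s" using that by (simp add: sv flip: mult.assoc)
    ultimately show ?thesis by (simp add: v1_def algebra_simps)
  qed
  have v1o: "v1 o' = 0"
    using sv[OF o'] B by (simp add: v1_def flip: mult.assoc)
  have hv1: "h u v1 = 0" using v u by (simp add: v1_def hs)
  have "h u v1 = (\<Sum>k\<in>Omega n. h u (bvec k (v1 k)))"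
    unfolding h_sum_right[symmetric] by (rule h_cong) (auto simp: vec_decomp)
  also have "\<dots> = (\<Sum>k\<in>?I. h u (bvec k (v1 k))) + h u (bvec (- o') (v1 (- o')))"
  proof -
    have "Omega n = insert o' (insert (- o') ?I)" using o' no by auto
    then have "(\<Sum>k\<in>Omega n. h u (bvec k (v1 k))) = (\<Sum>k\<in>insert o' (insert (- o') ?I). h u (bvec k (v1 k)))"
      by simp
    then show ?thesis using no v1o by simp
  qed
  finally have sum0: "(\<Sum>k\<in>?I. h u (bvec k (v1 k))) = - (eta o' * cj (u o') * v1 (- o'))"
    using hv1 no by (simp add: h_u_bvec eq_neg_iff_add_eq_0)
  \<comment> \<open>At \<open>- o'\<close> the sum takes the right value because \<open>v1\<close>
    is orthogonal to \<open>u\<close>; this is the content of \<open>sum0\<close>.\<close>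
  have dec: "(\<Sum>k\<in>?I. vscale (dv k) (v1 k)) i = v1 i * s" if i: "i \<in> Omega n" for i
  proof -
    have pt: "(\<Sum>k\<in>A. vscale (dv k) (v1 k)) i = (\<Sum>k\<in>A. dv k i * v1 k)" if "finite A" for A
      using that by (induction A) auto
    have "(\<Sum>k\<in>?I. vscale (dv k) (v1 k)) i = (\<Sum>k\<in>?I. (if i = k then s * v1 i else 0))
        - (\<Sum>k\<in>?I. if i = - o' then cj (eta o') * cj B * h u (bvec k (v1 k)) else 0)"
      unfolding pt[OF finite_Diff[OF finite_Omega]] sum_subtractf[symmetric]
      by (intro sum.cong) (auto simp: dv_def bvec_apply algebra_simps h_u_bvec mult.assoc)
    also have "\<dots> = v1 i * s"
    proof (cases "i = - o'")
      case True
      have "cj (eta o') * cj B * (eta o' * cj (u o') * v1 (- o')) = s * v1 (- o')"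
        by (metis B_cj(1) eta_cj_assoc(2) eta_left_commute mult.assoc)
      then have "(\<Sum>k\<in>?I. cj (eta o') * cj B * h u (bvec k (v1 k))) = - (s * v1 (- o'))"
        unfolding sum_distrib_left[symmetric] sum0 by simp
      then show ?thesis using True no v1s by (simp add: sum.delta)
    next
      case False
      then show ?thesis using i v1o v1s by (cases "i = o'") auto
    qed
    finally show ?thesis .
  qed
  \<comment> \<open>The vector \<open>v1\<close> carries one factor \<open>s\<close>, the
    decomposition along \<open>dv\<close> a second, and \<open>s ^ 2\<close> is added so that the
    multiple of \<open>u\<close> to be restored fits \<open>wk_u_u\<close>. This makes
    \<open>s ^ 4\<close>; the scaling in \<open>wk\<close> adds \<open>s ^ 2\<close>, whence the
    exponent 6.\<close>
  define w where "w = (\<Sum>k\<in>?I. vscale (dv k) (v1 k * s ^ 2)) + vscale u (s ^ 2 * (B * v o' * s))"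
  have "wk u (s ^ 2) w"
    unfolding w_def using u v1X vX B sX
    by (intro wk_add wk_sum wk_u_dv wk_u_u XV_intros XV_sum X_intros XV_dv)
      (auto simp: hs h_u_dv h_sum_right XV_def)
  moreover have wv: "w i = vscale v (s ^ 4) i" if i: "i \<in> Omega n" for i
  proof -
    have "(\<Sum>k\<in>?I. vscale (dv k) (v1 k * s ^ 2)) i = (\<Sum>k\<in>?I. vscale (dv k) (v1 k)) i * s ^ 2"
    proof -
      have "(\<Sum>k\<in>A. vscale (dv k) (v1 k * s ^ 2)) i = (\<Sum>k\<in>A. vscale (dv k) (v1 k)) i * s ^ 2"
        if "finite A" for A
        using that by (induction A) (auto simp: algebra_simps)
      then show ?thesis by simp
    qed
    also have "\<dots> = v i * s ^ 4 - u i * (B * v o') * s ^ 3"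
      unfolding dec[OF i] by (simp add: v1_def algebra_simps eval_nat_numeral)
    finally have 1: "(\<Sum>k\<in>?I. vscale (dv k) (v1 k * s ^ 2)) i = v i * s ^ 4 - u i * (B * v o') * s ^ 3" .
    have c: "s * (B * v o' * s) = (B * v o' * s) * s"
      by (intro s_mult sB sv o') simp
    have "s ^ 2 * (B * v o' * s) = B * v o' * s ^ 3"
      using c by (simp add: eval_nat_numeral mult.assoc) (simp add: c[unfolded mult.assoc] flip: mult.assoc)
    then show ?thesis unfolding w_def by (simp add: 1 mult.assoc)
  qed
  ultimately have wk: "wk u (s ^ 2) (vscale v (s ^ 4))" by (rule wk_cong)
  have cs: "cj (s ^ k) = s ^ k" for k
    by (induction k) (auto simp: cj_mult s power_commutes)
  have "cj (s ^ 4) * (q - f v v) * s ^ 4 \<in> L" using v sX by (intro L_conj' X_intros)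
  then have "s ^ 4 * q * s ^ 4 - f (vscale v (s ^ 4)) (vscale v (s ^ 4)) \<in> L"
    by (simp add: fs cs algebra_simps)
  from wk_long[OF u(2) _ wk long_u this] v(2)
  have "Eich u (vscale (vscale v (s ^ 4)) (s ^ 2)) (s ^ 2 * (s ^ 4 * q * s ^ 4) * s ^ 2) \<in> G"
    by (simp add: hs cs)
  moreover have "s ^ 2 * (s ^ 4 * q * s ^ 4) * s ^ 2 = s ^ 6 * q * s ^ 6" "s ^ 4 * s ^ 2 = s ^ 6"
    by (simp_all add: eval_nat_numeral mult.assoc)
  ultimately show ?thesis by (simp add: vscale_vscale)
qed

end

end

section \<open>Rings that are module-finite over a central subring\<close>

locale finite_extension =
  fixes S K :: "'a::ring_1 set" and g :: "nat \<Rightarrow> 'a" and d :: nat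
  assumes S1: "1 \<in> S" and S_add: "x \<in> S \<Longrightarrow> y \<in> S \<Longrightarrow> x + y \<in> S"
    and S_mult: "x \<in> S \<Longrightarrow> y \<in> S \<Longrightarrow> x * y \<in> S" and S_uminus: "x \<in> S \<Longrightarrow> - x \<in> S"
    and KS: "K \<subseteq> S" and K1: "1 \<in> K" and K_add: "x \<in> K \<Longrightarrow> y \<in> K \<Longrightarrow> x + y \<in> K"
    and K_mult: "x \<in> K \<Longrightarrow> y \<in> K \<Longrightarrow> x * y \<in> K" and K_uminus: "x \<in> K \<Longrightarrow> - x \<in> K"
    and central: "k \<in> K \<Longrightarrow> x \<in> S \<Longrightarrow> k * x = x * k"
    and g_S: "i < d \<Longrightarrow> g i \<in> S"
    and span: "x \<in> S \<Longrightarrow> \<exists>c. (\<forall>i<d. c i \<in> K) \<and> x = (\<Sum>i<d. c i * g i)"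

locale central_extension = finite_extension S K g d
  for S K :: "'a::ring_1 set" and g :: "nat \<Rightarrow> 'a" and d :: nat +
  fixes M :: "'a set"
  assumes MK: "M \<subseteq> K" and M0: "0 \<in> M" and M_add: "x \<in> M \<Longrightarrow> y \<in> M \<Longrightarrow> x + y \<in> M"
    and M_mult: "k \<in> K \<Longrightarrow> x \<in> M \<Longrightarrow> k * x \<in> M"
    and M_max: "k \<in> K \<Longrightarrow> k \<notin> M \<Longrightarrow> \<exists>k'\<in>K. 1 - k * k' \<in> M"
    and M1: "1 \<notin> M"
begin

lemma S0: "0 \<in> S" using S_add[OF S1 S_uminus[OF S1]] by simp
lemma S_diff: "x \<in> S \<Longrightarrow> y \<in> S \<Longrightarrow> x - y \<in> S" using S_add[OF _ S_uminus, of x y] by simp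
lemma K0: "0 \<in> K" using K_add[OF K1 K_uminus[OF K1]] by simp
lemma K_diff: "x \<in> K \<Longrightarrow> y \<in> K \<Longrightarrow> x - y \<in> K" using K_add[OF _ K_uminus, of x y] by simp
lemma M_uminus: "x \<in> M \<Longrightarrow> - x \<in> M" using M_mult[OF K_uminus[OF K1], of x] by simp
lemma M_mult': "k \<in> K \<Longrightarrow> x \<in> M \<Longrightarrow> x * k \<in> M"
  using M_mult[of k x] central[of k x] KS MK by auto
lemma S_sum: "(\<And>i. i \<in> A \<Longrightarrow> f i \<in> S) \<Longrightarrow> sum f A \<in> S"
  by (induction A rule: infinite_finite_induct) (auto simp: S0 S_add)

lemmas S_intros = S0 S1 S_add S_mult S_uminus S_diff
lemmas K_intros = K0 K1 K_add K_mult K_uminus K_diff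

lemma M_prime: assumes "a \<in> K" "b \<in> K" "a * b \<in> M" "a \<notin> M" shows "b \<in> M"
proof -
  obtain a' where a': "a' \<in> K" "1 - a * a' \<in> M" using M_max assms by blast
  have "(1 - a * a') * b + a' * (a * b) \<in> M"
    by (rule M_add[OF M_mult'[OF assms(2) a'(2)] M_mult[OF a'(1) assms(3)]])
  moreover have "a * a' = a' * a" using assms a' central KS by blast
  ultimately show ?thesis by (simp add: algebra_simps)
qed

section \<open>Dimension counting modulo \<open>M\<close> and Nakayama's lemma\<close>

definition Kmod :: "'a set \<Rightarrow> bool" where
  "Kmod N \<longleftrightarrow> N \<subseteq> S \<and> 0 \<in> N \<and> (\<forall>x\<in>N. \<forall>y\<in>N. x + y \<in> N) \<and> (\<forall>k\<in>K. \<forall>x\<in>N. k * x \<in> N)"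

definition lideal :: "'a set \<Rightarrow> bool" where
  "lideal N \<longleftrightarrow> N \<subseteq> S \<and> 0 \<in> N \<and> (\<forall>x\<in>N. \<forall>y\<in>N. x + y \<in> N) \<and> (\<forall>r\<in>S. \<forall>x\<in>N. r * x \<in> N)"

definition tideal :: "'a set \<Rightarrow> bool" where
  "tideal N \<longleftrightarrow> lideal N \<and> (\<forall>r\<in>S. \<forall>x\<in>N. x * r \<in> N)"

lemma lideal_Kmod: "lideal N \<Longrightarrow> Kmod N"
  using KS by (auto simp: lideal_def Kmod_def)

lemma Kmod_uminus: "Kmod N \<Longrightarrow> x \<in> N \<Longrightarrow> - x \<in> N"
  using K_uminus[OF K1] unfolding Kmod_def by (metis mult_minus1)

lemma Kmod_diff: "Kmod N \<Longrightarrow> x \<in> N \<Longrightarrow> y \<in> N \<Longrightarrow> x - y \<in> N"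
  using Kmod_uminus[of N y] unfolding Kmod_def by (metis add_uminus_conv_diff)

lemma Kmod_sum: "Kmod N \<Longrightarrow> (\<And>i. i \<in> A \<Longrightarrow> f i \<in> N) \<Longrightarrow> sum f A \<in> N"
  by (induction A rule: infinite_finite_induct) (auto simp: Kmod_def)

definition MS :: "'a set" where "MS = {\<Sum>i<d. c i * g i | c. \<forall>i<d. c i \<in> M}"

lemma MS_I: assumes "m \<in> M" "x \<in> S" shows "m * x \<in> MS"
proof -
  obtain c where c: "\<forall>i<d. c i \<in> K" "x = (\<Sum>i<d. c i * g i)" using span assms by blast
  have "m * x = (\<Sum>i<d. (m * c i) * g i)"
    by (subst c(2)) (simp add: sum_distrib_left mult.assoc)
  moreover have "\<forall>i<d. m * c i \<in> M" using c assms by (auto intro: M_mult')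
  ultimately show ?thesis unfolding MS_def by (intro CollectI exI[of _ "\<lambda>i. m * c i"]) simp
qed

lemma MS_add: assumes "x \<in> MS" "y \<in> MS" shows "x + y \<in> MS"
proof -
  obtain c c' where "\<forall>i<d. c i \<in> M" "x = (\<Sum>i<d. c i * g i)" "\<forall>i<d. c' i \<in> M" "y = (\<Sum>i<d. c' i * g i)"
    using assms unfolding MS_def by blast
  then show ?thesis
    unfolding MS_def by (intro CollectI exI[of _ "\<lambda>i. c i + c' i"])
      (auto simp: M_add distrib_right sum.distrib)
qed

lemma MS_0: "0 \<in> MS"
  unfolding MS_def by (intro CollectI exI[of _ "\<lambda>i. 0"]) (auto simp: M0)

lemma MS_sum: "(\<And>i. i \<in> A \<Longrightarrow> f i \<in> MS) \<Longrightarrow> sum f A \<in> MS"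
  by (induction A rule: infinite_finite_induct) (auto simp: MS_0 MS_add)

lemma MS_tideal: "tideal MS"
proof -
  have S: "MS \<subseteq> S" using MK KS g_S by (auto simp: MS_def intro!: S_sum S_mult)
  have "r * x \<in> MS" "x * r \<in> MS" if r: "r \<in> S" and x: "x \<in> MS" for r x
  proof -
    obtain c where c: "\<forall>i<d. c i \<in> M" "x = (\<Sum>i<d. c i * g i)" using x unfolding MS_def by blast
    have "r * c i = c i * r" if "i < d" for i using c(1) that r central[of "c i" r] MK by auto
    then have "r * x = (\<Sum>i<d. c i * (r * g i))"
      unfolding c(2) by (auto simp: sum_distrib_left simp flip: mult.assoc)
    then show "r * x \<in> MS" using c(1) r g_S by (auto intro!: MS_sum MS_I S_mult)
    have "x * r = (\<Sum>i<d. c i * (g i * r))"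
      unfolding c(2) by (auto simp: sum_distrib_right mult.assoc)
    then show "x * r \<in> MS" using c(1) r g_S by (auto intro!: MS_sum MS_I S_mult)
  qed
  then show ?thesis using S MS_0 MS_add by (auto simp: tideal_def lideal_def)
qed

text \<open>The set of leading indices measures the dimension of \<open>N / MS\<close> over the residue field of \<open>M\<close>.\<close>

definition lead :: "'a set \<Rightarrow> nat set" where
  "lead N = {k. k < d \<and> (\<exists>c. (\<forall>j<k. c j \<in> K) \<and> g k + (\<Sum>j<k. c j * g j) \<in> N)}"

lemma finite_lead: "finite (lead N)"
  by (rule finite_subset[of _ "{..<d}"]) (auto simp: lead_def)

lemma card_lead_le: "card (lead N) \<le> d"
  using card_mono[of "{..<d}" "lead N"] by (auto simp: lead_def)

lemma lead_mono: "N \<subseteq> N' \<Longrightarrow> lead N \<subseteq> lead N'"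
  by (auto simp: lead_def)

text \<open>Gaussian elimination from the top coefficient: if it is in \<open>M\<close>, its term is
  absorbed by \<open>MS\<close>; otherwise it is invertible modulo \<open>M\<close>, its index is
  leading for \<open>N'\<close>, hence for \<open>N\<close>, and an element of \<open>N\<close>
  cancels it.\<close>

lemma lead_eq_imp_subset:
  assumes N: "Kmod N" "Kmod N'" "MS \<subseteq> N" "N \<subseteq> N'" and eq: "lead N = lead N'"
  shows "N' \<subseteq> N"
proof -
  have *: "k \<le> d \<Longrightarrow> \<forall>j<k. c j \<in> K \<Longrightarrow> (\<Sum>j<k. c j * g j) \<in> N' \<Longrightarrow> (\<Sum>j<k. c j * g j) \<in> N" for k c
  proof (induction k arbitrary: c)
    case 0
    then show ?case using N by (simp add: Kmod_def)
  next
    case (Suc k)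
    let ?x = "(\<Sum>j<k. c j * g j) + c k * g k"
    have k: "k < d" and ck: "c k \<in> K" and x: "?x \<in> N'" using Suc.prems by (auto simp: add.commute)
    have "?x \<in> N"
    proof (cases "c k \<in> M")
      case True
      then have 1: "c k * g k \<in> N" using N k g_S MS_I by auto
      then have "?x - c k * g k \<in> N'" using N x Kmod_diff[of N'] by blast
      then have "(\<Sum>j<k. c j * g j) \<in> N" using Suc by simp
      then show ?thesis using 1 N by (auto simp: Kmod_def)
    next
      case False
      then obtain k' where k': "k' \<in> K" "1 - c k * k' \<in> M" using M_max ck by blast
      have com: "c k * k' = k' * c k" using ck k' central KS by blast
      have "(1 - c k * k') * g k \<in> N'" using k' k g_S MS_I N by blast
      then have "k' * ?x + (1 - c k * k') * g k \<in> N'" using N x k' by (auto simp: Kmod_def)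
      also have "k' * ?x + (1 - c k * k') * g k = g k + (\<Sum>j<k. (k' * c j) * g j)"
        by (simp add: com algebra_simps sum_distrib_left)
      finally have "k \<in> lead N'"
        using k k' Suc.prems by (auto simp: lead_def intro!: exI[of _ "\<lambda>j. k' * c j"] K_mult)
      then obtain e where e: "\<forall>j<k. e j \<in> K" "g k + (\<Sum>j<k. e j * g j) \<in> N"
        unfolding eq[symmetric] by (auto simp: lead_def)
      let ?y = "c k * (g k + (\<Sum>j<k. e j * g j))"
      have y: "?y \<in> N" using e ck N by (auto simp: Kmod_def)
      have 1: "?x - ?y = (\<Sum>j<k. (c j - c k * e j) * g j)"
        by (simp add: algebra_simps sum_distrib_left sum_subtractf sum.distrib)
      have "?x - ?y \<in> N'" using x y N Kmod_diff by blast
      then have "?x - ?y \<in> N"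
        unfolding 1 using Suc.prems e ck by (intro Suc.IH) (auto intro!: K_intros)
      then show ?thesis using y N Kmod_def[of N] by (metis diff_add_cancel)
    qed
    then show ?case by (simp add: add.commute)
  qed
  show ?thesis
  proof
    fix x assume x: "x \<in> N'"
    then obtain c where "\<forall>i<d. c i \<in> K" "x = (\<Sum>i<d. c i * g i)" using span N by (force simp: Kmod_def)
    then show "x \<in> N" using *[of d c] x by simp
  qed
qed

lemma card_lead_eq_imp:
  assumes "Kmod N" "Kmod N'" "MS \<subseteq> N" "N \<subseteq> N'" "card (lead N') \<le> card (lead N)" shows "N = N'"
  using lead_eq_imp_subset[OF assms(1-4)] card_seteq[OF finite_lead lead_mono[OF assms(4)] assms(5)] assms(4)
  by auto

definition kunit :: "'a \<Rightarrow> bool" where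
  "kunit x \<longleftrightarrow> (\<exists>B\<in>S. \<exists>s\<in>K. s \<notin> M \<and> x * B = s \<and> B * x = s)"

text \<open>A left and a right inverse coincide: \<open>P * t\<close> and \<open>s * Q\<close> both
  equal \<open>P * a * Q\<close>, which inverts \<open>a\<close> on both sides with denominator
  \<open>s * t\<close>.\<close>

lemma kunit_I:
  assumes "a \<in> S" "P \<in> S" "Q \<in> S" "s \<in> K" "s \<notin> M" "t \<in> K" "t \<notin> M" "P * a = s" "a * Q = t"
  shows "kunit a"
proof -
  have "P * t = s * Q" using assms by (metis mult.assoc)
  then have "a * (P * t) = s * t" "(P * t) * a = s * t"
    using assms central by (metis mult.assoc)+
  moreover have "s * t \<notin> M" using assms(4-7) M_prime by blast
  moreover have "P * t \<in> S" "s * t \<in> K" using assms(2,4,6) KS by (auto intro: S_mult K_mult)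
  ultimately show ?thesis
    unfolding kunit_def by blast
qed

text \<open>Elimination in place of a determinant: the coefficient \<open>s - c a\<close> of
  \<open>g a\<close> lies outside \<open>M\<close>, so \<open>g a\<close> can be solved for and
  substituted into the other relations at the price of a denominator.\<close>

lemma nakayama_elim:
  assumes N: "Kmod N" and "finite A" "A \<subseteq> {..<d}"
    and "\<And>i. i \<in> A \<Longrightarrow> \<exists>s c. s \<in> K \<and> s \<notin> M \<and> (\<forall>j\<in>A. c j \<in> M) \<and> s * g i - (\<Sum>j\<in>A. c j * g j) \<in> N"
  shows "\<exists>s\<in>K. s \<notin> M \<and> (\<forall>i\<in>A. s * g i \<in> N)"
  using assms(2-4)
proof (induction A)
  case empty
  then show ?case using K1 M1 by auto
next
  case (insert a A)
  have aS: "g a \<in> S" using insert.prems g_S by auto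
  obtain s c where s: "s \<in> K" "s \<notin> M" "\<forall>j\<in>insert a A. c j \<in> M" "s * g a - (\<Sum>j\<in>insert a A. c j * g j) \<in> N"
    using insert.prems(2)[of a] by blast
  define t where "t = s - c a"
  have t: "t \<in> K" "t \<notin> M"
    using s MK K_diff M_add[of t "c a"] by (auto simp: t_def)
  have ta: "t * g a - (\<Sum>j\<in>A. c j * g j) \<in> N"
    using s insert.hyps by (simp add: t_def algebra_simps)
  have "\<exists>s c. s \<in> K \<and> s \<notin> M \<and> (\<forall>j\<in>A. c j \<in> M) \<and> s * g i - (\<Sum>j\<in>A. c j * g j) \<in> N" if i: "i \<in> A" for i
  proof -
    obtain s' c' where s': "s' \<in> K" "s' \<notin> M" "\<forall>j\<in>insert a A. c' j \<in> M"
        "s' * g i - (\<Sum>j\<in>insert a A. c' j * g j) \<in> N"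
      using insert.prems(2)[of i] i by blast
    have "t * (s' * g i - (\<Sum>j\<in>insert a A. c' j * g j)) + c' a * (t * g a - (\<Sum>j\<in>A. c j * g j)) \<in> N"
      using N s' t ta MK by (auto simp: Kmod_def)
    moreover have "t * c' a = c' a * t" using t s' MK KS central by blast
    then have "t * (c' a * x) = c' a * (t * x)" for x by (metis mult.assoc)
    then have "t * (s' * g i - (\<Sum>j\<in>insert a A. c' j * g j)) + c' a * (t * g a - (\<Sum>j\<in>A. c j * g j))
        = (t * s') * g i - (\<Sum>j\<in>A. (t * c' j + c' a * c j) * g j)"
      using insert.hyps by (simp add: algebra_simps sum_distrib_left sum.distrib)
    moreover have "t * s' \<notin> M" using t s' M_prime by blast
    moreover have "\<forall>j\<in>A. t * c' j + c' a * c j \<in> M"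
    proof
      fix j assume "j \<in> A"
      then have "c' j \<in> M" "c j \<in> M" "c' a \<in> K" using s s' MK by auto
      then show "t * c' j + c' a * c j \<in> M" using t by (intro M_add M_mult)
    qed
    ultimately show ?thesis using t s'
      by (intro exI[of _ "t * s'"] exI[of _ "\<lambda>j. t * c' j + c' a * c j"]) (auto intro: K_mult)
  qed
  then obtain s' where s': "s' \<in> K" "s' \<notin> M" "\<forall>i\<in>A. s' * g i \<in> N"
    using insert.IH insert.prems by blast
  have "(\<Sum>j\<in>A. c j * (s' * g j)) + s' * (t * g a - (\<Sum>j\<in>A. c j * g j)) \<in> N"
  proof -
    have "c j * (s' * g j) \<in> N" if "j \<in> A" for j
      using that N s s' MK unfolding Kmod_def by blast
    then have "(\<Sum>j\<in>A. c j * (s' * g j)) \<in> N" by (rule Kmod_sum[OF N])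
    moreover have "s' * (t * g a - (\<Sum>j\<in>A. c j * g j)) \<in> N"
      using N s' ta unfolding Kmod_def by blast
    ultimately show ?thesis using N unfolding Kmod_def by blast
  qed
  moreover have "s' * (c j * x) = c j * (s' * x)" if "j \<in> A" for j x
  proof -
    have "c j \<in> S" using that s MK KS by auto
    then show ?thesis using s' central[of s' "c j"] by (metis mult.assoc)
  qed
  then have "(\<Sum>j\<in>A. c j * (s' * g j)) + s' * (t * g a - (\<Sum>j\<in>A. c j * g j)) = (s' * t) * g a"
    by (simp add: algebra_simps sum_distrib_left)
  ultimately have 1: "(s' * t) * g a \<in> N" by simp
  have 2: "(s' * t) * g i \<in> N" if "i \<in> A" for i
  proof -
    have "s' * t = t * s'" using s' t central KS by blast
    then show ?thesis using s' t N that by (auto simp: Kmod_def mult.assoc)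
  qed
  have "s' * t \<notin> M" using t s' M_prime by blast
  then show ?case using 1 2 s' t K_mult by blast
qed

text \<open>Nakayama's lemma for \<open>S / N\<close> after localization at \<open>M\<close>: a
  denominator annihilates the quotient, and applied to 1 it lies in \<open>N\<close> itself.\<close>

lemma nakayama: assumes N: "Kmod N" and "\<And>i. i < d \<Longrightarrow> \<exists>x\<in>MS. g i + x \<in> N"
  shows "\<exists>s\<in>K. s \<notin> M \<and> s \<in> N"
proof -
  have "\<exists>s c. s \<in> K \<and> s \<notin> M \<and> (\<forall>j\<in>{..<d}. c j \<in> M) \<and> s * g i - (\<Sum>j<d. c j * g j) \<in> N" if i: "i \<in> {..<d}" for i
  proof -
    obtain c where "\<forall>i<d. c i \<in> M" "g i + (\<Sum>j<d. c j * g j) \<in> N" using assms(2) i unfolding MS_def by blast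
    then show ?thesis by (intro exI[of _ 1] exI[of _ "\<lambda>j. - c j"]) (auto simp: K1 M1 M_uminus sum_negf)
  qed
  from nakayama_elim[OF N _ _ this] obtain s where s: "s \<in> K" "s \<notin> M" "\<forall>i<d. s * g i \<in> N" by auto
  obtain c where c: "\<forall>i<d. c i \<in> K" "1 = (\<Sum>i<d. c i * g i)" using span S1 by blast
  have "s * 1 = (\<Sum>i<d. c i * (s * g i))"
  proof -
    have "s * (c i * g i) = c i * (s * g i)" if "i < d" for i
    proof -
      have "s * c i = c i * s" using c(1) s(1) that central KS by blast
      then show ?thesis by (metis mult.assoc)
    qed
    then show ?thesis by (subst c(2)) (simp add: sum_distrib_left)
  qed
  moreover have "(\<Sum>i<d. c i * (s * g i)) \<in> N"
    using N s c Kmod_sum[OF N, of "{..<d}" "\<lambda>i. c i * (s * g i)"] by (auto simp: Kmod_def)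
  ultimately show ?thesis using s by auto
qed

text \<open>The left and the right ideal generated by \<open>1 + x\<close> both fill
  \<open>S\<close> modulo \<open>MS\<close>, so Nakayama's lemma yields an inverse up to a
  denominator on each side.\<close>

lemma kunit_MS: assumes x: "x \<in> MS" shows "kunit (1 + x)"
proof -
  have xS: "x \<in> S" using x MS_tideal by (auto simp: tideal_def lideal_def)
  have l: "Kmod {y * (1 + x) | y. y \<in> S}" (is "Kmod ?N")
    unfolding Kmod_def
  proof (intro conjI ballI)
    show "?N \<subseteq> S" using xS by (auto intro!: S_intros)
    show "0 \<in> ?N" using S0 by force
    fix a b assume "a \<in> ?N" "b \<in> ?N"
    then show "a + b \<in> ?N" by (force simp flip: distrib_right intro: S_add)
  next
    fix k a assume "k \<in> K" "a \<in> ?N"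
    then show "k * a \<in> ?N" using KS by (force simp flip: mult.assoc intro: S_mult)
  qed
  have r: "Kmod {(1 + x) * y | y. y \<in> S}" (is "Kmod ?N'")
    unfolding Kmod_def
  proof (intro conjI ballI)
    show "?N' \<subseteq> S" using xS by (auto intro!: S_intros)
    show "0 \<in> ?N'" using S0 by force
    fix a b assume "a \<in> ?N'" "b \<in> ?N'"
    then show "a + b \<in> ?N'" by (force simp flip: distrib_left intro: S_add)
  next
    fix k a assume k: "k \<in> K" and "a \<in> ?N'"
    then obtain y where y: "y \<in> S" "a = (1 + x) * y" by blast
    have "k * a = (1 + x) * (k * y)"
      using y central[OF k S_add[OF S1 xS]] by (metis mult.assoc)
    then show "k * a \<in> ?N'" using y k KS S_mult by blast
  qed
  have "\<exists>z\<in>MS. g i + z \<in> ?N" if "i < d" for i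
    using that x g_S MS_tideal
    by (intro bexI[of _ "g i * x"]) (auto simp: distrib_left tideal_def lideal_def)
  from nakayama[OF l this] obtain s y where s: "s \<in> K" "s \<notin> M" "y \<in> S" "y * (1 + x) = s" by auto
  have "\<exists>z\<in>MS. g i + z \<in> ?N'" if "i < d" for i
    using that x g_S MS_tideal
    by (intro bexI[of _ "x * g i"]) (auto simp: distrib_right tideal_def lideal_def)
  from nakayama[OF r this] obtain t y' where t: "t \<in> K" "t \<notin> M" "y' \<in> S" "(1 + x) * y' = t" by auto
  show ?thesis using s t xS by (intro kunit_I[of "1 + x" y y' s t]) (auto intro: S_intros)
qed

end

lemma add_span_induct: "z \<in> add_span A \<Longrightarrow> add_subgroup P \<Longrightarrow> A \<subseteq> P \<Longrightarrow> z \<in> P"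
  by (auto simp: add_span_def)

lemma add_span_incl: "A \<subseteq> add_span A"
  by (auto simp: add_span_def)

lemma add_subgroup_add_span: "add_subgroup (add_span A)"
  by (auto simp: add_span_def add_subgroup_def)

section \<open>An ideal in the role of the Jacobson radical\<close>

context central_extension
begin

definition good :: "'a set \<Rightarrow> bool" where
  "good N \<longleftrightarrow> tideal N \<and> MS \<subseteq> N \<and> (\<forall>x\<in>N. kunit (1 + x))"

text \<open>It replaces the Jacobson radical of the localized ring. Taking the largest dimension
  modulo \<open>MS\<close> among the good ideals gives exactly the maximality that
  \<open>semiprime\<close> needs.\<close>

definition J :: "'a set" where
  "J = (SOME N. good N \<and> (\<forall>N'. good N' \<longrightarrow> card (lead N') \<le> card (lead N)))"

lemma J_max: "good J" "good N' \<Longrightarrow> card (lead N') \<le> card (lead J)"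
proof -
  have "good MS" using MS_tideal kunit_MS by (auto simp: good_def)
  then have "\<exists>N. good N \<and> (\<forall>N'. good N' \<longrightarrow> card (lead N') \<le> card (lead N))"
    by (rule ex_has_greatest_nat[of good _ _ "Suc d"]) (simp add: less_Suc_eq_le card_lead_le)
  from someI_ex[OF this] show "good J" "good N' \<Longrightarrow> card (lead N') \<le> card (lead J)"
    unfolding J_def by blast+
qed

lemma J_tideal: "tideal J" and MS_J: "MS \<subseteq> J" and kunit_J: "x \<in> J \<Longrightarrow> kunit (1 + x)"
  using J_max(1) by (auto simp: good_def)

lemma J_S: "x \<in> J \<Longrightarrow> x \<in> S" and J0: "0 \<in> J" and J_add: "x \<in> J \<Longrightarrow> y \<in> J \<Longrightarrow> x + y \<in> J"
  and J_left: "r \<in> S \<Longrightarrow> x \<in> J \<Longrightarrow> r * x \<in> J" and J_right: "r \<in> S \<Longrightarrow> x \<in> J \<Longrightarrow> x * r \<in> J"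
  using J_tideal by (auto simp: tideal_def lideal_def)

lemma J_uminus: "x \<in> J \<Longrightarrow> - x \<in> J"
  using J_left[OF S_uminus[OF S1], of x] by simp

lemma J_diff: "x \<in> J \<Longrightarrow> y \<in> J \<Longrightarrow> x - y \<in> J"
  using J_add[OF _ J_uminus, of x y] by simp

lemma tideal_span_add:
  assumes x: "x \<in> S"
  defines "T \<equiv> add_span {a * x * b | a b. a \<in> S \<and> b \<in> S}"
  shows "tideal {j + t | j t. j \<in> J \<and> t \<in> T}"
    and "T \<subseteq> S" "x \<in> T"
proof -
  have T: "0 \<in> T" "\<And>y z. y \<in> T \<Longrightarrow> z \<in> T \<Longrightarrow> y + z \<in> T" "\<And>y. y \<in> T \<Longrightarrow> - y \<in> T"
    using add_subgroup_add_span[of "{a * x * b | a b. a \<in> S \<and> b \<in> S}"] unfolding T_def add_subgroup_def by blast+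
  have gen: "a * x * b \<in> T" if "a \<in> S" "b \<in> S" for a b
    unfolding T_def by (rule subsetD[OF add_span_incl]) (use that in blast)
  have "add_subgroup S" by (auto simp: add_subgroup_def intro: S_intros)
  moreover have "{a * x * b | a b. a \<in> S \<and> b \<in> S} \<subseteq> S" using x by (auto intro: S_intros)
  ultimately show TS: "T \<subseteq> S" unfolding T_def by (blast intro: add_span_induct)
  show "x \<in> T" using gen[OF S1 S1] by simp
  have l: "r * t \<in> T" if r: "r \<in> S" and t: "t \<in> T" for r t
  proof -
    have "t \<in> {t. r * t \<in> T}"
    proof (rule add_span_induct[OF t[unfolded T_def]])
      show "add_subgroup {t. r * t \<in> T}" using T by (auto simp: add_subgroup_def distrib_left)
      show "{a * x * b | a b. a \<in> S \<and> b \<in> S} \<subseteq> {t. r * t \<in> T}"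
        using gen[OF S_mult[OF r]] by (auto simp: mult.assoc)
    qed
    then show ?thesis by simp
  qed
  have rt: "t * r \<in> T" if r: "r \<in> S" and t: "t \<in> T" for r t
  proof -
    have "t \<in> {t. t * r \<in> T}"
    proof (rule add_span_induct[OF t[unfolded T_def]])
      show "add_subgroup {t. t * r \<in> T}" using T by (auto simp: add_subgroup_def distrib_right)
      show "{a * x * b | a b. a \<in> S \<and> b \<in> S} \<subseteq> {t. t * r \<in> T}"
        using gen[OF _ S_mult[OF _ r]] by (auto simp: mult.assoc)
    qed
    then show ?thesis by simp
  qed
  show "tideal {j + t | j t. j \<in> J \<and> t \<in> T}" (is "tideal ?N")
    unfolding tideal_def lideal_def
  proof (intro conjI ballI)
    show "?N \<subseteq> S" using J_S TS by (auto intro!: S_add)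
    show "0 \<in> ?N" using J0 T by force
  next
    fix y z assume "y \<in> ?N" "z \<in> ?N"
    then obtain j t j' t' where "j \<in> J" "t \<in> T" "j' \<in> J" "t' \<in> T" "y = j + t" "z = j' + t'" by blast
    then show "y + z \<in> ?N"
      by (intro CollectI exI[of _ "j + j'"] exI[of _ "t + t'"]) (auto simp: T J_add add_ac)
  next
    fix r y assume r: "r \<in> S" "y \<in> ?N"
    then obtain j t where "j \<in> J" "t \<in> T" "y = j + t" by blast
    then show "r * y \<in> ?N"
      using r by (intro CollectI exI[of _ "r * j"] exI[of _ "r * t"]) (auto simp: l J_left distrib_left)
  next
    fix r y assume r: "r \<in> S" "y \<in> ?N"
    then obtain j t where "j \<in> J" "t \<in> T" "y = j + t" by blast
    then show "y * r \<in> ?N"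
      using r by (intro CollectI exI[of _ "j * r"] exI[of _ "t * r"]) (auto simp: rt J_right distrib_right)
  qed
qed

text \<open>\<open>S\<close> is semiprime modulo \<open>J\<close>: if \<open>k\<close> lies in an ideal with square inside \<open>J\<close> then \<open>(1 + j + k) (1 - k) \<in> 1 + J\<close>,
  so that ideal could be added to \<open>J\<close>.\<close>

lemma semiprime:
  assumes x: "x \<in> S" and xx: "\<And>y. y \<in> S \<Longrightarrow> x * y * x \<in> J" shows "x \<in> J"
proof -
  define T where "T = add_span {a * x * b | a b. a \<in> S \<and> b \<in> S}"
  define N where "N = {j + t | j t. j \<in> J \<and> t \<in> T}"
  have N: "tideal N" and TS: "T \<subseteq> S" and xT: "x \<in> T"
    using tideal_span_add[OF x] by (auto simp: N_def T_def)
  have TT: "t * t' \<in> J" if t: "t \<in> T" "t' \<in> T" for t t'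
  proof -
    have 1: "(a * x * b) * t' \<in> J" if ab: "a \<in> S" "b \<in> S" for a b
    proof -
      have "t' \<in> {t'. (a * x * b) * t' \<in> J}"
      proof (rule add_span_induct[OF t(2)[unfolded T_def]])
        show "add_subgroup {t'. (a * x * b) * t' \<in> J}"
          by (auto simp: add_subgroup_def distrib_left J0 J_add J_uminus)
        have "a * (x * (b * a') * x) * b' \<in> J" if "a' \<in> S" "b' \<in> S" for a' b'
          by (rule J_right[OF that(2) J_left[OF ab(1) xx[OF S_mult[OF ab(2) that(1)]]]])
        then show "{a * x * b | a b. a \<in> S \<and> b \<in> S} \<subseteq> {t'. (a * x * b) * t' \<in> J}"
          by (auto simp: mult.assoc)
      qed
      then show ?thesis by simp
    qed
    have "t \<in> {t. t * t' \<in> J}"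
    proof (rule add_span_induct[OF t(1)[unfolded T_def]])
      show "add_subgroup {t. t * t' \<in> J}"
        by (auto simp: add_subgroup_def distrib_right J0 J_add J_uminus)
    qed (use 1 in auto)
    then show ?thesis by simp
  qed
  have "kunit (1 + (j + k))" if j: "j \<in> J" and k: "k \<in> T" for j k
  proof -
    have kS: "k \<in> S" using k TS by auto
    have "j * k \<in> J" "k * j \<in> J" "k * k \<in> J"
      using J_right[OF kS j] J_left[OF kS j] TT[OF k k] .
    then have "j - j * k - k * k \<in> J" "j - k * j - k * k \<in> J"
      using j by (simp_all add: J_diff)
    then have "kunit (1 + (j - j * k - k * k))" "kunit (1 + (j - k * j - k * k))"
      by (auto intro: kunit_J)
    then have "kunit ((1 + (j + k)) * (1 - k))" "kunit ((1 - k) * (1 + (j + k)))"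
      by (simp_all add: algebra_simps)
    then obtain B s B' s' where
        B: "B \<in> S" "s \<in> K" "s \<notin> M" "(1 + (j + k)) * (1 - k) * B = s"
           "B' \<in> S" "s' \<in> K" "s' \<notin> M" "B' * ((1 - k) * (1 + (j + k))) = s'"
      unfolding kunit_def by blast
    show ?thesis
      using B j kS J_S by (intro kunit_I[of _ "B' * (1 - k)" "(1 - k) * B" s' s])
        (auto simp: mult.assoc intro!: S_intros)
  qed
  moreover have JN: "J \<subseteq> N"
  proof -
    have "0 \<in> T" using add_subgroup_add_span unfolding T_def add_subgroup_def by blast
    then show ?thesis unfolding N_def by force
  qed
  ultimately have "good N" using N MS_J by (auto simp: good_def N_def)
  then have "J = N"
    using J_max(2) N J_tideal MS_J JN by (intro card_lead_eq_imp lideal_Kmod) (auto simp: tideal_def)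
  moreover have "x \<in> N" using xT J0 unfolding N_def by force
  ultimately show ?thesis by simp
qed

section \<open>Left ideals, idempotents and stable rank modulo \<open>J\<close>\<close>

definition lJ :: "'a \<Rightarrow> 'a set" where "lJ a = {x * a + j | x j. x \<in> S \<and> j \<in> J}"

lemma lJ_lideal: assumes "a \<in> S" shows "lideal (lJ a)"
  unfolding lideal_def
proof (intro conjI ballI)
  show "lJ a \<subseteq> S" using assms J_S by (auto simp: lJ_def intro!: S_intros)
  show "0 \<in> lJ a" using S0 J0 unfolding lJ_def by force
next
  fix y z assume "y \<in> lJ a" "z \<in> lJ a"
  then obtain x j x' j' where "x \<in> S" "j \<in> J" "x' \<in> S" "j' \<in> J" "y = x * a + j" "z = x' * a + j'"
    unfolding lJ_def by blast
  then show "y + z \<in> lJ a" unfolding lJ_def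
    by (intro CollectI exI[of _ "x + x'"] exI[of _ "j + j'"]) (auto simp: S_add J_add algebra_simps)
next
  fix r y assume r: "r \<in> S" "y \<in> lJ a"
  then obtain x j where "x \<in> S" "j \<in> J" "y = x * a + j"
    unfolding lJ_def by blast
  then show "r * y \<in> lJ a" unfolding lJ_def using r
    by (intro CollectI exI[of _ "r * x"] exI[of _ "r * j"]) (auto simp: S_mult J_left algebra_simps)
qed

lemma J_lJ: "J \<subseteq> lJ a"
  using S0 unfolding lJ_def by force

lemma lJ_self: "a \<in> lJ a"
  using S1 J0 unfolding lJ_def by force

lemma lJ_add: "a \<in> S \<Longrightarrow> x \<in> lJ a \<Longrightarrow> y \<in> lJ a \<Longrightarrow> x + y \<in> lJ a"
  and lJ_left: "a \<in> S \<Longrightarrow> r \<in> S \<Longrightarrow> x \<in> lJ a \<Longrightarrow> r * x \<in> lJ a"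
  and lJ_S: "a \<in> S \<Longrightarrow> x \<in> lJ a \<Longrightarrow> x \<in> S"
  using lJ_lideal[of a] by (auto simp: lideal_def)

lemma lJ_uminus: "a \<in> S \<Longrightarrow> x \<in> lJ a \<Longrightarrow> - x \<in> lJ a"
  using lJ_left[OF _ S_uminus[OF S1], of a x] by simp

lemma lJ_diff: "a \<in> S \<Longrightarrow> x \<in> lJ a \<Longrightarrow> y \<in> lJ a \<Longrightarrow> x - y \<in> lJ a"
  using lJ_add[OF _ _ lJ_uminus, of a x y] by simp

lemma lJ_subset: "a \<in> S \<Longrightarrow> b \<in> S \<Longrightarrow> b \<in> lJ a \<Longrightarrow> lJ b \<subseteq> lJ a"
  using J_lJ[of a] by (auto simp: lJ_def[of b] intro!: lJ_add lJ_left)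

lemma card_lJ_eq: "a \<in> S \<Longrightarrow> b \<in> S \<Longrightarrow> b \<in> lJ a \<Longrightarrow> card (lead (lJ a)) \<le> card (lead (lJ b)) \<Longrightarrow> lJ b = lJ a"
  by (rule card_lead_eq_imp) (auto intro!: lideal_Kmod lJ_lideal dest: lJ_subset subsetD[OF MS_J] subsetD[OF J_lJ])

definition cg :: "'a \<Rightarrow> 'a \<Rightarrow> bool" where "cg x y \<longleftrightarrow> x - y \<in> J"

lemma cg_refl: "cg x x" by (simp add: cg_def J0)
lemma cg_sym: "cg x y \<Longrightarrow> cg y x" using J_uminus[of "x - y"] by (simp add: cg_def)
lemma cg_trans [trans]: "cg x y \<Longrightarrow> cg y z \<Longrightarrow> cg x z" using J_add[of "x - y" "y - z"] by (simp add: cg_def)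
lemma cg_left: "r \<in> S \<Longrightarrow> cg x y \<Longrightarrow> cg (r * x) (r * y)" using J_left[of r "x - y"] by (simp add: cg_def algebra_simps)
lemma cg_right: "r \<in> S \<Longrightarrow> cg x y \<Longrightarrow> cg (x * r) (y * r)" using J_right[of r "x - y"] by (simp add: cg_def algebra_simps)
lemma cg_add: "cg x y \<Longrightarrow> cg x' y' \<Longrightarrow> cg (x + x') (y + y')"
  using J_add[of "x - y" "x' - y'"] by (simp add: cg_def algebra_simps)
lemma cg_diff: "cg x y \<Longrightarrow> cg x' y' \<Longrightarrow> cg (x - x') (y - y')"
  using J_diff[of "x - y" "x' - y'"] by (simp add: cg_def algebra_simps)
lemma cg_0: "cg x 0 \<longleftrightarrow> x \<in> J" by (simp add: cg_def)
lemma cg_J: "cg x y \<Longrightarrow> x \<in> J \<longleftrightarrow> y \<in> J"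
  using J_add[of "x - y" y] J_diff[of x "x - y"] by (auto simp: cg_def)
lemma cg_eq_left [trans]: "x = y \<Longrightarrow> cg y z \<Longrightarrow> cg x z" by simp
lemma lJ_iff: "x \<in> lJ a \<longleftrightarrow> (\<exists>y\<in>S. cg x (y * a))"
proof
  assume "x \<in> lJ a"
  then show "\<exists>y\<in>S. cg x (y * a)" unfolding lJ_def cg_def by force
next
  assume "\<exists>y\<in>S. cg x (y * a)"
  then obtain y where "y \<in> S" "x - y * a \<in> J" by (auto simp: cg_def)
  then show "x \<in> lJ a" unfolding lJ_def by (intro CollectI exI[of _ y] exI[of _ "x - y * a"]) auto
qed

text \<open>Brauer's argument. Among the left ideals between \<open>J\<close> and \<open>L\<close>
  that do not annihilate \<open>Z\<close> modulo \<open>J\<close>, take \<open>N\<close> of least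
  dimension. Semiprimeness gives \<open>x\<close> in \<open>N\<close> and \<open>Z\<close> with
  \<open>N * x + J = N\<close>, so \<open>x\<close> is congruent to \<open>e * x\<close> for some
  \<open>e\<close> in \<open>N\<close>. The elements of \<open>N\<close> that kill \<open>x\<close>
  form a smaller left ideal, which annihilates \<open>Z\<close> by minimality. It contains
  \<open>e * e - e\<close>, and since \<open>N\<close> lies in \<open>Z\<close>, semiprimeness puts
  this element into \<open>J\<close>.\<close>

lemma idempotent_in_lideal:
  assumes L: "lideal L" "J \<subseteq> L" and Z: "tideal Z" "J \<subseteq> Z" and LZ: "\<exists>x\<in>L. \<exists>z\<in>Z. x * z \<notin> J"
  shows "\<exists>e\<in>L. cg (e * e) e \<and> (\<exists>z\<in>Z. e * z \<notin> J)"
proof -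
  let ?P = "\<lambda>N. lideal N \<and> J \<subseteq> N \<and> N \<subseteq> L \<and> (\<exists>x\<in>N. \<exists>z\<in>Z. x * z \<notin> J)"
  have "?P L" using L LZ by auto
  then obtain N where N: "?P N" and min: "\<And>N'. ?P N' \<Longrightarrow> card (lead N) \<le> card (lead N')"
    using ex_has_least_nat[of ?P L "\<lambda>N. card (lead N)"] by blast
  have min': "N' = N" if "?P N'" "N' \<subseteq> N" for N'
    using that N min[OF that(1)] MS_J by (intro card_lead_eq_imp lideal_Kmod) auto
  have NS: "N \<subseteq> S" "Z \<subseteq> S" using N Z by (auto simp: lideal_def tideal_def)
  obtain x0 z0 where x0: "x0 \<in> N" "z0 \<in> Z" "x0 * z0 \<notin> J" using N by blast
  have x0S: "x0 \<in> S" "z0 \<in> S" using x0 NS by auto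
  then obtain y where y: "y \<in> S" "(x0 * z0) * y * (x0 * z0) \<notin> J"
    using semiprime[of "x0 * z0"] x0 S_mult by blast
  \<comment> \<open>The right factor \<open>x0\<close> places \<open>x\<close> in \<open>N\<close>,
    the left factor \<open>z0\<close> places it in \<open>Z\<close>.\<close>
  define x where "x = z0 * y * x0"
  have xN: "x \<in> N" using N x0 x0S y unfolding x_def lideal_def by (auto intro: S_mult)
  have xS: "x \<in> S" using xN NS by auto
  have xZ: "x \<in> Z" using Z x0 x0S y unfolding x_def tideal_def by auto
  have xx: "x0 * (x * z0) \<notin> J" using y by (simp add: x_def mult.assoc)
  define N' where "N' = {l * x + j | l j. l \<in> N \<and> j \<in> J}"
  have N'l: "lideal N'" unfolding lideal_def
  proof (intro conjI ballI)
    show "N' \<subseteq> S" using NS J_S xS by (auto simp: N'_def intro!: S_intros)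
    show "0 \<in> N'" using N J0 unfolding N'_def lideal_def by force
  next
    fix u v assume "u \<in> N'" "v \<in> N'"
    then obtain l j l' j' where "l \<in> N" "j \<in> J" "l' \<in> N" "j' \<in> J" "u = l * x + j" "v = l' * x + j'"
      unfolding N'_def by blast
    then show "u + v \<in> N'" unfolding N'_def using N
      by (intro CollectI exI[of _ "l + l'"] exI[of _ "j + j'"]) (auto simp: lideal_def J_add algebra_simps)
  next
    fix r u assume r: "r \<in> S" "u \<in> N'"
    then obtain l j where "l \<in> N" "j \<in> J" "u = l * x + j" unfolding N'_def by blast
    then show "r * u \<in> N'" unfolding N'_def using N r
      by (intro CollectI exI[of _ "r * l"] exI[of _ "r * j"]) (auto simp: lideal_def J_left algebra_simps)
  qed
  have lx: "l * x \<in> N" if "l \<in> N" for l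
    using N xN NS that by (auto simp: lideal_def)
  have "l * x + j \<in> N" if "l \<in> N" "j \<in> J" for l j
    using N lx[OF that(1)] that(2) by (auto simp: lideal_def)
  then have N'1: "N' \<subseteq> N" unfolding N'_def by blast
  have "0 * x + j \<in> N'" if "j \<in> J" for j
    using N that unfolding N'_def lideal_def by blast
  then have N'2: "J \<subseteq> N'" by auto
  have "x0 * x + 0 \<in> N'" using x0 J0 unfolding N'_def by blast
  moreover have "(x0 * x + 0) * z0 \<notin> J" using xx by (simp add: mult.assoc)
  ultimately have N'3: "\<exists>a\<in>N'. \<exists>z\<in>Z. a * z \<notin> J" using x0(2) by blast
  have N'N: "N' = N"
    by (rule min'[OF _ N'1]) (use N N'l N'1 N'2 N'3 in blast)
  then obtain e j where e: "e \<in> N" "j \<in> J" "x = e * x + j" using xN unfolding N'_def by blast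
  then have "x - e * x = j" by (metis add_diff_cancel_left')
  with e have eS: "e \<in> N" "cg x (e * x)" by (simp_all add: cg_def)
  have eS': "e \<in> S" using eS NS by auto
  have xz: "x * z0 \<notin> J" using xx x0S J_left by blast
  have exz: "e * (x * z0) \<notin> J"
    using cg_J[OF cg_right[OF x0S(2) eS(2)]] xz by (simp add: mult.assoc)
  have xzZ: "x * z0 \<in> Z" using Z xZ x0S unfolding tideal_def by auto
  define A where "A = {y \<in> N. y * x \<in> J}"
  have "e * x \<notin> J" using exz J_right[OF x0S(2), of "e * x"] by (auto simp: mult.assoc)
  then have eA: "e \<notin> A" by (simp add: A_def)
  have Al: "lideal A"
    using N NS J0 J_add J_left unfolding A_def lideal_def by (auto simp: distrib_right mult.assoc)
  have "J \<subseteq> A" using N xS J_right unfolding A_def by auto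
  then have AZ: "\<forall>y\<in>A. \<forall>z\<in>Z. y * z \<in> J"
    using min'[of A] eA eS Al N unfolding A_def by blast
  have "l * x + j \<in> Z" if "l \<in> N" "j \<in> J" for l j
    using that Z xZ NS unfolding tideal_def lideal_def by blast
  then have "N' \<subseteq> Z" unfolding N'_def by blast
  then have NZ: "N \<subseteq> Z" by (simp only: N'N)
  define w where "w = e * e - e"
  have "cg (e * e * x) (e * x)" using cg_left[OF eS' cg_sym[OF eS(2)]] by (simp add: mult.assoc)
  then have "w * x \<in> J" by (simp add: w_def cg_def algebra_simps)
  moreover have "e * e \<in> N" using N eS eS' by (auto simp: lideal_def)
  then have wN: "w \<in> N" unfolding w_def using N eS by (blast intro: Kmod_diff[OF lideal_Kmod])
  ultimately have wA: "w \<in> A" by (simp add: A_def)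
  have wS: "w \<in> S" using wN NS by auto
  have "w \<in> J"
  proof (rule semiprime[OF wS])
    fix t assume t: "t \<in> S"
    then have "t * w \<in> Z" using wN NZ Z unfolding tideal_def lideal_def by auto
    then show "w * t * w \<in> J" using AZ wA by (auto simp: mult.assoc)
  qed
  then have "cg (e * e) e" by (simp add: w_def cg_def)
  then show ?thesis using eS N exz xzZ by blast
qed

text \<open>Von Neumann regularity modulo \<open>J\<close>. Take an idempotent \<open>e\<close> in
  \<open>lJ a\<close> whose left ideal has the largest dimension. If \<open>a - a * e\<close> were
  not in \<open>J\<close>, an idempotent from its left ideal, made orthogonal to \<open>e\<close>,
  could be added to \<open>e\<close> and would enlarge that left ideal.\<close>

lemma regular:
  assumes a: "a \<in> S"
  shows "\<exists>e\<in>lJ a. cg (e * e) e \<and> cg (a * e) a"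
proof -
  let ?P = "\<lambda>e. e \<in> lJ a \<and> cg (e * e) e"
  have "?P 0" using J_lJ J0 cg_refl by auto
  then obtain e where e: "?P e" and max: "\<And>e'. ?P e' \<Longrightarrow> card (lead (lJ e')) \<le> card (lead (lJ e))"
    using ex_has_greatest_nat[of ?P 0 "\<lambda>e. card (lead (lJ e))" "Suc d"] card_lead_le
    by (metis le_imp_less_Suc)
  have eS: "e \<in> S" using e a lJ_S by blast
  have "cg (a * e) a"
  proof (rule ccontr)
    assume "\<not> cg (a * e) a"
    define b where "b = a - a * e"
    have bS: "b \<in> S" using a eS by (auto simp: b_def intro: S_intros)
    have bJ: "b \<notin> J" using \<open>\<not> cg (a * e) a\<close> cg_sym by (auto simp: b_def cg_def)
    have "tideal S" using S_intros by (auto simp: tideal_def lideal_def)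
    then obtain h where h: "h \<in> lJ b" "cg (h * h) h" "\<exists>z\<in>S. h * z \<notin> J"
      using idempotent_in_lideal[of "lJ b" S] lJ_lideal[OF bS] J_lJ[of b] J_S bJ lJ_self[of b] S1
      by (metis mult.right_neutral subsetI)
    have hS: "h \<in> S" using h bS lJ_S by blast
    have hJ: "h \<notin> J" using h J_right by blast
    have be: "cg (b * e) 0"
      using cg_left[OF a e[THEN conjunct2]] by (auto simp: b_def cg_def algebra_simps intro: J_uminus dest: J_uminus)
    obtain y where y: "y \<in> S" "cg h (y * b)" using h lJ_iff by blast
    have he: "h * e \<in> J"
    proof -
      have "cg (h * e) (y * b * e)" by (rule cg_right[OF eS y(2)])
      also have "cg (y * b * e) (y * 0)" using cg_left[OF y(1) be] by (simp add: mult.assoc)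
      finally show ?thesis by (simp add: cg_0)
    qed
    \<comment> \<open>The product \<open>h * e\<close> is already in \<open>J\<close>; subtracting
      \<open>e * h\<close> makes the idempotents orthogonal on the other side too.\<close>
    define h' where "h' = h - e * h"
    have h'S: "h' \<in> S" using hS eS by (auto simp: h'_def intro: S_intros)
    have hh': "cg (h * h') h"
    proof -
      have "h * e * h \<in> J" using he hS J_right by blast
      then have "cg (h * h - h * e * h) (h - 0)" using h(2) by (intro cg_diff) (auto simp: cg_0)
      then show ?thesis by (simp add: h'_def algebra_simps)
    qed
    have h'J: "h' \<notin> J" using cg_J[OF hh'] hJ hS J_left by blast
    have eh': "e * h' \<in> J"
    proof -
      have "cg (e * h - e * e * h) (e * h - e * h)" using e hS by (intro cg_diff cg_refl cg_right) auto
      then show ?thesis by (simp add: h'_def cg_def algebra_simps)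
    qed
    have h'e: "h' * e \<in> J"
      using he eS unfolding h'_def by (auto simp: left_diff_distrib mult.assoc intro!: J_diff J_left)
    have h'h': "cg (h' * h') h'"
    proof -
      have "cg (h * h' - e * (h * h')) (h - e * h)" using hh' eS by (intro cg_diff cg_left)
      then show ?thesis by (simp add: h'_def algebra_simps)
    qed
    let ?e' = "e + h'"
    have "h \<in> lJ a"
    proof -
      have "b \<in> lJ a" using a eS e unfolding b_def by (intro lJ_diff lJ_self lJ_left) auto
      then show ?thesis using lJ_subset[OF a bS] h by auto
    qed
    then have "?e' \<in> lJ a" using a eS e unfolding h'_def by (intro lJ_add lJ_diff lJ_left) auto
    moreover have "cg (?e' * ?e') ?e'"
    proof -
      have "cg (e * e + h' * e + (e * h' + h' * h')) (e + 0 + (0 + h'))"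
        using e h'e eh' h'h' by (intro cg_add) (auto simp: cg_0)
      then show ?thesis by (simp add: algebra_simps)
    qed
    ultimately have c: "card (lead (lJ ?e')) \<le> card (lead (lJ e))" using max by blast
    have e'S: "?e' \<in> S" using eS h'S S_add by auto
    have "cg e (e * ?e')"
    proof -
      have "cg (e + 0) (e * e + e * h')" using e eh' by (intro cg_add) (auto intro: cg_sym simp: cg_0)
      then show ?thesis by (simp add: distrib_left)
    qed
    then have "e \<in> lJ ?e'" using eS lJ_iff by blast
    then have "lJ e = lJ ?e'" using c eS e'S by (intro card_lJ_eq)
    then have "?e' \<in> lJ e" using lJ_self by blast
    then obtain z where z: "z \<in> S" "cg ?e' (z * e)" using lJ_iff by blast
    have "cg h' (?e' - ?e' * e)"
    proof -
      have "cg (e - e + (h' - 0)) (e - e * e + (h' - h' * e))"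
        using e h'e by (intro cg_add cg_diff cg_refl) (auto intro: cg_sym simp: cg_0)
      then show ?thesis by (simp add: algebra_simps)
    qed
    also have "cg (?e' - ?e' * e) (z * e - z * e * e)" using z eS by (intro cg_diff cg_right)
    also have "cg (z * e - z * e * e) (z * e - z * e)"
      using cg_left[OF z(1)] e by (intro cg_diff cg_refl) (simp add: mult.assoc)
    finally show False using h'J by (simp add: cg_0)
  qed
  then show ?thesis using e by blast
qed

text \<open>Stable rank one modulo \<open>J\<close>. If \<open>b\<close> is not in the left ideal of \<open>a + t * b\<close>, an idempotent annihilating
  \<open>a + t * b\<close> from the left allows \<open>t\<close> to be changed so that this left ideal strictly grows.\<close>

theorem stable_rank:
  assumes a: "a \<in> S" and b: "b \<in> S"
  shows "\<exists>t\<in>S. a \<in> lJ (a + t * b) \<and> b \<in> lJ (a + t * b)"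
proof -
  let ?l = "\<lambda>t. card (lead (lJ (a + t * b)))"
  obtain t where t: "t \<in> S" and max: "\<And>t'. t' \<in> S \<Longrightarrow> ?l t' \<le> ?l t"
    using ex_has_greatest_nat[of "\<lambda>t. t \<in> S" 0 ?l "Suc d"] S0 card_lead_le by (metis le_imp_less_Suc)
  define a' where "a' = a + t * b"
  have a'S: "a' \<in> S" using a b t by (auto simp: a'_def intro: S_intros)
  have "b \<in> lJ a'"
  proof (rule ccontr)
    assume bn: "b \<notin> lJ a'"
    obtain e0 where e0: "e0 \<in> lJ a'" "cg (e0 * e0) e0" "cg (a' * e0) a'"
      using regular[OF a'S] by blast
    have e0S: "e0 \<in> S" using e0 a'S lJ_S by blast
    \<comment> \<open>Modulo \<open>J\<close>, \<open>e0\<close> is a right identity on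
      \<open>lJ a'\<close>, so \<open>c\<close> is the part of \<open>b\<close> that escapes this
      left ideal.\<close>
    define c where "c = b - b * e0"
    have cS: "c \<in> S" using b e0S by (auto simp: c_def intro: S_intros)
    have cJ: "c \<notin> J"
    proof
      assume "c \<in> J"
      then have "c + b * e0 \<in> lJ a'"
        using J_lJ a'S b e0 by (intro lJ_add lJ_left) auto
      then show False using bn by (simp add: c_def)
    qed
    have xa0: "x * a' - x * a' * e0 \<in> J" if "x \<in> S" for x
      using cg_left[OF that cg_sym[OF e0(3)]] by (simp add: cg_def mult.assoc)
    have ce0: "c * e0 \<in> J"
      using cg_left[OF b cg_sym[OF e0(2)]] by (simp add: c_def cg_def algebra_simps)
    define T where "T = add_span {x * c * y | x y. x \<in> S \<and> y \<in> S}"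
    define Z where "Z = {j + t | j t. j \<in> J \<and> t \<in> T}"
    have Z: "tideal Z" and TS: "T \<subseteq> S" and cT: "c \<in> T"
      using tideal_span_add[OF cS] by (auto simp: Z_def T_def)
    have "0 \<in> T" using add_subgroup_add_span unfolding T_def add_subgroup_def by blast
    then have "j + 0 \<in> Z" if "j \<in> J" for j unfolding Z_def using that by blast
    then have JZ: "J \<subseteq> Z" by auto
    have "0 + c \<in> Z" unfolding Z_def using cT J0 by blast
    then have cZ: "c \<in> Z" by simp
    have ZS: "Z \<subseteq> S" using Z by (auto simp: tideal_def lideal_def)
    define L where "L = {x \<in> S. x * a' \<in> J}"
    have L: "lideal L"
      by (auto simp: lideal_def L_def distrib_right mult.assoc J0 intro: S_intros J_add J_left)
    have JL: "J \<subseteq> L" using J_S J_right[OF a'S] by (auto simp: L_def)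
    \<comment> \<open>Otherwise right multiplication by \<open>a'\<close> is injective on
      \<open>Z\<close> modulo \<open>J\<close>, by semiprimeness. The left ideals
      \<open>Z * a' ^ k + J\<close> descend and stabilize by dimension, so cancellation makes
      \<open>c\<close> congruent to an element of \<open>Z * a'\<close>. Right multiplication by
      \<open>e0\<close> fixes such an element modulo \<open>J\<close> but sends \<open>c\<close>
      into \<open>J\<close>.\<close>
    have "\<exists>x\<in>L. \<exists>z\<in>Z. x * z \<notin> J"
    proof (rule ccontr)
      assume "\<not> ?thesis"
      then have LZ: "x * z \<in> J" if "x \<in> L" "z \<in> Z" for x z using that by blast
      have inj: "w \<in> J" if w: "w \<in> Z" "w * a' \<in> J" for w
      proof (rule semiprime)
        show wS: "w \<in> S" using w ZS by auto
        fix y assume "y \<in> S"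
        then have "y * w \<in> Z" using Z w by (auto simp: tideal_def lideal_def)
        then show "w * y * w \<in> J" using LZ[of w "y * w"] w wS by (simp add: L_def mult.assoc)
      qed
      have Za: "w * a' \<in> Z" if "w \<in> Z" for w using Z a'S that by (auto simp: tideal_def)
      have injk: "w * a' ^ k \<in> J \<Longrightarrow> w \<in> Z \<Longrightarrow> w \<in> J" for w k
        by (induction k arbitrary: w) (auto simp: mult.assoc[symmetric] intro: inj Za)
      have pS: "a' ^ k \<in> S" for k by (induction k) (auto intro: S_intros a'S)
      define Zk where "Zk k = {z * a' ^ k + j | z j. z \<in> Z \<and> j \<in> J}" for k
      have Zk: "lideal (Zk k)" for k
        unfolding lideal_def
      proof (intro conjI ballI)
        show "Zk k \<subseteq> S" using ZS J_S pS by (auto simp: Zk_def intro!: S_intros)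
        have "0 * a' ^ k + 0 \<in> Zk k" unfolding Zk_def using Z J0 unfolding tideal_def lideal_def by blast
        then show "0 \<in> Zk k" by simp
      next
        fix u v assume "u \<in> Zk k" "v \<in> Zk k"
        then obtain l j l' j' where "l \<in> Z" "j \<in> J" "l' \<in> Z" "j' \<in> J" "u = l * a' ^ k + j" "v = l' * a' ^ k + j'"
          unfolding Zk_def by blast
        then show "u + v \<in> Zk k" unfolding Zk_def using Z
          by (intro CollectI exI[of _ "l + l'"] exI[of _ "j + j'"])
            (auto simp: tideal_def lideal_def J_add algebra_simps)
      next
        fix r u assume r: "r \<in> S" "u \<in> Zk k"
        then obtain l j where "l \<in> Z" "j \<in> J" "u = l * a' ^ k + j" unfolding Zk_def by blast
        then show "r * u \<in> Zk k" unfolding Zk_def using Z r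
          by (intro CollectI exI[of _ "r * l"] exI[of _ "r * j"])
            (auto simp: tideal_def lideal_def J_left algebra_simps)
      qed
      have JZk: "J \<subseteq> Zk k" for k
      proof
        fix j assume "j \<in> J"
        then have "0 * a' ^ k + j \<in> Zk k" unfolding Zk_def using Z unfolding tideal_def lideal_def by blast
        then show "j \<in> Zk k" by simp
      qed
      have sub: "Zk (Suc k) \<subseteq> Zk k" for k
      proof
        fix u assume "u \<in> Zk (Suc k)"
        then obtain z j where "z \<in> Z" "j \<in> J" "u = (z * a') * a' ^ k + j" by (auto simp: Zk_def mult.assoc)
        then show "u \<in> Zk k" unfolding Zk_def using Za by blast
      qed
      obtain k where k: "\<And>k'. card (lead (Zk k)) \<le> card (lead (Zk k'))"
        using ex_has_least_nat[of "\<lambda>_. True" 0 "\<lambda>k. card (lead (Zk k))"] by blast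
      have "Zk (Suc k) = Zk k"
        using k[of "Suc k"] Zk sub JZk MS_J by (intro card_lead_eq_imp lideal_Kmod) blast+
      moreover have "c * a' ^ k + 0 \<in> Zk k" unfolding Zk_def using cZ J0 by blast
      ultimately have "c * a' ^ k + 0 \<in> Zk (Suc k)" by simp
      then obtain z j where z: "z \<in> Z" "j \<in> J" "c * a' ^ k + 0 = z * a' ^ Suc k + j"
        unfolding Zk_def by blast
      then have "(c - z * a') * a' ^ k = j" by (simp add: algebra_simps)
      moreover have "c - z * a' \<in> Z"
        using Kmod_diff[OF lideal_Kmod] Z cZ Za[OF z(1)] unfolding tideal_def by blast
      ultimately have 1: "cg c (z * a')" using injk[of "c - z * a'" k] z by (simp add: cg_def)
      have "cg (c - c * e0) (z * a' - z * a' * e0)" by (intro cg_diff 1 cg_right e0S)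
      moreover have "z * a' - z * a' * e0 \<in> J" using z ZS by (intro xa0) auto
      ultimately have "c - c * e0 \<in> J" using cg_J by blast
      then have "c - c * e0 + c * e0 \<in> J" using ce0 J_add by blast
      then show False using cJ by simp
    qed
    then obtain e z where e: "e \<in> L" "cg (e * e) e" "z \<in> Z" "e * z \<notin> J"
      using idempotent_in_lideal[OF L JL Z JZ] by blast
    have eS: "e \<in> S" and ea': "e * a' \<in> J" using e by (auto simp: L_def)
    have "\<exists>y\<in>S. e * (y * c) \<notin> J"
    proof (rule ccontr)
      assume "\<not> ?thesis"
      then have n: "e * (y * c) \<in> J" if "y \<in> S" for y using that by blast
      have "t \<in> {t. e * t \<in> J}" if t: "t \<in> T" for t
      proof (rule add_span_induct[OF t[unfolded T_def]])
        show "add_subgroup {t. e * t \<in> J}" by (auto simp: add_subgroup_def distrib_left J0 J_add J_uminus)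
        show "{x * c * y | x y. x \<in> S \<and> y \<in> S} \<subseteq> {t. e * t \<in> J}"
          using J_right n by (force simp: mult.assoc)
      qed
      then show False using e eS J_left J_add unfolding Z_def by (auto simp: distrib_left)
    qed
    then obtain y where y: "y \<in> S" "e * (y * c) \<notin> J" by blast
    \<comment> \<open>As \<open>e\<close> annihilates \<open>a'\<close> modulo \<open>J\<close>, the
      factor \<open>1 - e\<close> recovers \<open>a'\<close> from \<open>a''\<close>. Maximality
      then makes both left ideals equal, so \<open>e * y * b\<close> falls into
      \<open>lJ a'\<close>, contrary to the choice of \<open>y\<close>.\<close>
    define t' where "t' = t + e * y"
    define a'' where "a'' = a + t' * b"
    have t'S: "t' \<in> S" using t eS y by (auto simp: t'_def intro: S_intros)
    have a''S: "a'' \<in> S" using a b t'S by (auto simp: a''_def intro: S_intros)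
    have a''e: "a'' = a' + e * y * b" by (simp add: a''_def a'_def t'_def algebra_simps)
    have ea'': "cg (e * a'') (e * y * b)"
    proof -
      have "cg (e * a' + e * e * (y * b)) (0 + e * (y * b))"
        using ea' e y b by (intro cg_add cg_right S_mult) (auto simp: cg_0)
      then show ?thesis by (simp add: a''e algebra_simps)
    qed
    have "cg (a'' - e * a'') (a'' - e * y * b)" by (intro cg_diff cg_refl ea'')
    then have "cg a' ((1 - e) * a'')" by (subst cg_sym) (simp_all add: a''e algebra_simps)
    then have "a' \<in> lJ a''" unfolding lJ_iff using eS S1 S_diff by blast
    then have "lJ a' = lJ a''"
      using max[OF t'S] a'S a''S by (intro card_lJ_eq) (auto simp: a'_def a''_def)
    then have "e * a'' \<in> lJ a'" using a''S eS by (auto intro: lJ_left lJ_self)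
    then obtain x where x: "x \<in> S" "cg (e * a'') (x * a')" unfolding lJ_iff by blast
    then have "cg (e * y * b) (x * a')" using ea'' cg_sym cg_trans by blast
    then have "cg (e * y * b - e * y * b * e0) (x * a' - x * a' * e0)" by (intro cg_diff cg_right e0S)
    then have "e * y * b - e * y * b * e0 \<in> J" using xa0[OF x(1)] cg_J by blast
    then show False using y(2) by (simp add: c_def algebra_simps)
  qed
  moreover have "a' - t * b \<in> lJ a'" using a'S t calculation by (intro lJ_diff lJ_self lJ_left)
  then have "a \<in> lJ a'" by (simp add: a'_def)
  ultimately show ?thesis using t by (auto simp: a'_def)
qed

text \<open>Dedekind finiteness by a chain argument. The left annihilators of \<open>a ^ k\<close>
  modulo \<open>J\<close> ascend and stabilize. For \<open>y = a * x - 1\<close> the element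
  \<open>y * x ^ k\<close> annihilates \<open>a ^ Suc k\<close>, hence \<open>a ^ k\<close>; as
  \<open>x ^ k * a ^ k\<close> is congruent to 1, \<open>y\<close> lies in \<open>J\<close>.\<close>

theorem kunit_of_left_inverse:
  assumes a: "a \<in> S" and x: "x \<in> S" and xa: "cg (x * a) 1"
  shows "kunit a"
proof -
  have pS: "y \<in> S \<Longrightarrow> y ^ k \<in> S" for y k by (induction k) (auto intro: S_intros)
  have xk: "cg (x ^ k * a ^ k) 1" for k
  proof (induction k)
    case (Suc k)
    have "x ^ Suc k * a ^ Suc k = x ^ k * (x * a) * a ^ k"
      by (simp only: power_Suc2[of x] power_Suc[of a] mult.assoc)
    also have "cg \<dots> (x ^ k * 1 * a ^ k)" by (intro cg_right cg_left pS a x xa)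
    finally show ?case using Suc cg_trans by simp
  qed (simp add: cg_refl)
  define Lk where "Lk k = {y \<in> S. y * a ^ k \<in> J}" for k
  have L: "lideal (Lk k)" for k
    by (auto simp: lideal_def Lk_def distrib_right mult.assoc J0 intro: S_intros J_add J_left)
  have sub: "Lk k \<subseteq> Lk (Suc k)" for k
    using J_right[OF a] by (auto simp: Lk_def power_Suc2 simp flip: mult.assoc simp del: power_Suc)
  have JL: "J \<subseteq> Lk k" for k using J_S J_right pS[OF a] by (auto simp: Lk_def)
  obtain k where k: "\<And>k'. card (lead (Lk k')) \<le> card (lead (Lk k))"
    using ex_has_greatest_nat[of "\<lambda>_. True" 0 "\<lambda>k. card (lead (Lk k))" "Suc d"] card_lead_le
    by (metis le_imp_less_Suc)
  have eq: "Lk k = Lk (Suc k)"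
    using k[of "Suc k"] L sub JL MS_J by (intro card_lead_eq_imp lideal_Kmod) blast+
  define y where "y = a * x - 1"
  have yS: "y \<in> S" using a x by (auto simp: y_def intro: S_intros)
  have "cg (a * (x * a)) (a * 1)" by (intro cg_left a xa)
  then have ya: "y * a \<in> J" by (simp add: y_def cg_def algebra_simps)
  have "cg (y * (x ^ k * a ^ k) * a) (y * 1 * a)" by (intro cg_right cg_left yS a xk)
  then have "y * x ^ k * a ^ Suc k \<in> J"
    using ya cg_J by (simp add: power_Suc2 mult.assoc del: power_Suc)
  then have "y * x ^ k \<in> Lk k" unfolding eq using yS pS[OF x] by (simp add: Lk_def S_mult)
  then have "y * (x ^ k * a ^ k) \<in> J" by (simp add: Lk_def mult.assoc)
  then have "y \<in> J" using cg_J[OF cg_left[OF yS xk[of k]]] by simp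
  then have "kunit (a * x)" "kunit (x * a)"
    using kunit_J[of y] kunit_J[of "x * a - 1"] xa by (simp_all add: y_def cg_def)
  then obtain B s B' s' where B: "B \<in> S" "s \<in> K" "s \<notin> M" "a * x * B = s"
      "B' \<in> S" "s' \<in> K" "s' \<notin> M" "B' * (x * a) = s'"
    unfolding kunit_def by blast
  show ?thesis
    by (rule kunit_I[of a "B' * x" "x * B" s' s]) (use B a x in \<open>auto simp: mult.assoc intro!: S_mult\<close>)
qed

end

section \<open>From the maximal ideals of \<open>K\<close> back to \<open>K\<close>\<close>

context finite_extension
begin

text \<open>If 1 were missing, Zorn's lemma would enlarge \<open>A\<close> to a maximal ideal of
  \<open>K\<close>, outside of which \<open>A\<close> has no element.\<close>

lemma local_global:
  assumes A: "A \<subseteq> K" "0 \<in> A" "\<And>x y. x \<in> A \<Longrightarrow> y \<in> A \<Longrightarrow> x + y \<in> A" "\<And>k x. k \<in> K \<Longrightarrow> x \<in> A \<Longrightarrow> k * x \<in> A"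
    and local: "\<And>M. central_extension S K g d M \<Longrightarrow> \<exists>s\<in>A. s \<notin> M"
  shows "1 \<in> A"
proof (rule ccontr)
  assume A1: "1 \<notin> A"
  define \<I> where "\<I> = {N. A \<subseteq> N \<and> N \<subseteq> K \<and> (\<forall>x\<in>N. \<forall>y\<in>N. x + y \<in> N) \<and> (\<forall>k\<in>K. \<forall>x\<in>N. k * x \<in> N) \<and> 1 \<notin> N}"
  have "A \<in> \<I>" using A A1 by (auto simp: \<I>_def)
  moreover have "\<Union>C \<in> \<I>" if C: "C \<noteq> {}" "subset.chain \<I> C" for C
  proof -
    have CI: "C \<subseteq> \<I>" using C by (auto simp: subset.chain_def)
    have "x + y \<in> \<Union>C" if "x \<in> N" "N \<in> C" "y \<in> N'" "N' \<in> C" for x y N N'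
    proof -
      have "N \<subseteq> N' \<or> N' \<subseteq> N" using C that by (auto simp: subset_chain_def)
      then show ?thesis using that CI unfolding \<I>_def by blast
    qed
    moreover have "k * x \<in> \<Union>C" if "k \<in> K" "x \<in> N" "N \<in> C" for k x N
      using that CI unfolding \<I>_def by blast
    moreover have "A \<subseteq> \<Union>C" "\<Union>C \<subseteq> K" "1 \<notin> \<Union>C" using C(1) CI unfolding \<I>_def by blast+
    ultimately show ?thesis unfolding \<I>_def by blast
  qed
  ultimately obtain M where M: "M \<in> \<I>" and max: "\<And>N. N \<in> \<I> \<Longrightarrow> M \<subseteq> N \<Longrightarrow> N = M"
    using subset_Zorn_nonempty[of \<I>] by blast
  have MK: "M \<subseteq> K" and AM: "A \<subseteq> M" and M1: "1 \<notin> M" and Madd: "\<And>x y. x \<in> M \<Longrightarrow> y \<in> M \<Longrightarrow> x + y \<in> M"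
    and Mmult: "\<And>k x. k \<in> K \<Longrightarrow> x \<in> M \<Longrightarrow> k * x \<in> M"
    using M by (auto simp: \<I>_def)
  have "\<exists>k'\<in>K. 1 - k * k' \<in> M" if k: "k \<in> K" "k \<notin> M" for k
  proof -
    define N where "N = {x + k * k' | x k'. x \<in> M \<and> k' \<in> K}"
    have K0: "0 \<in> K" using A by auto
    have "x + k * 0 \<in> N" if "x \<in> M" for x unfolding N_def using that K0 by blast
    then have MN: "M \<subseteq> N" by auto
    have "0 + k * 1 \<in> N" unfolding N_def using A(2) AM K1 by blast
    then have kN: "k \<in> N" by simp
    have NK: "N \<subseteq> K" using MK k by (auto simp: N_def intro!: K_add K_mult)
    have "u + v \<in> N" if "u \<in> N" "v \<in> N" for u v
    proof -
      obtain x k1 y k2 where "x \<in> M" "k1 \<in> K" "y \<in> M" "k2 \<in> K" "u = x + k * k1" "v = y + k * k2"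
        using \<open>u \<in> N\<close> \<open>v \<in> N\<close> unfolding N_def by blast
      then show ?thesis unfolding N_def
        by (intro CollectI exI[of _ "x + y"] exI[of _ "k1 + k2"]) (auto simp: Madd K_add algebra_simps)
    qed
    moreover have "r * u \<in> N" if r: "r \<in> K" "u \<in> N" for r u
    proof -
      obtain x k1 where x: "x \<in> M" "k1 \<in> K" "u = x + k * k1" using r unfolding N_def by blast
      have "r * (k * k1) = k * (r * k1)" using r k central KS by (metis mult.assoc subsetD)
      then show ?thesis unfolding N_def using x r
        by (intro CollectI exI[of _ "r * x"] exI[of _ "r * k1"]) (auto simp: Mmult K_mult algebra_simps)
    qed
    ultimately have "1 \<in> N \<or> N \<in> \<I>" using NK MN AM unfolding \<I>_def by blast
    moreover have "N \<notin> \<I>" using max[of N] MN kN k by blast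
    ultimately obtain x k' where "x \<in> M" "k' \<in> K" "1 = x + k * k'" unfolding N_def by blast
    then show ?thesis by (metis add_diff_cancel_right')
  qed
  then have "central_extension S K g d M"
    by unfold_locales (use MK AM A(2) Madd Mmult M1 in auto)
  from local[OF this] show False using AM by blast
qed

end

subsection \<open>Involution-invariant finite extensions inside quasi-finite rings\<close>

definition lin_span :: "'a::ring_1 set \<Rightarrow> 'a set \<Rightarrow> 'a set" where
  "lin_span R F = {\<Sum>f\<in>F. c f * f | c. \<forall>f\<in>F. c f \<in> R}"

locale subring_set =
  fixes R :: "'a::ring_1 set"
  assumes one: "1 \<in> R" and add: "x \<in> R \<Longrightarrow> y \<in> R \<Longrightarrow> x + y \<in> R"
    and mult: "x \<in> R \<Longrightarrow> y \<in> R \<Longrightarrow> x * y \<in> R" and minus: "x \<in> R \<Longrightarrow> - x \<in> R"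
begin

lemma zero: "0 \<in> R" using add[OF one minus[OF one]] by simp

lemma lin_span_I: "\<forall>f\<in>F. c f \<in> R \<Longrightarrow> (\<Sum>f\<in>F. c f * f) \<in> lin_span R F"
  unfolding lin_span_def by blast

lemma lin_span_add: assumes "x \<in> lin_span R F" "y \<in> lin_span R F" shows "x + y \<in> lin_span R F"
proof -
  obtain c c' where c: "\<forall>f\<in>F. c f \<in> R" "\<forall>f\<in>F. c' f \<in> R" "x = (\<Sum>f\<in>F. c f * f)" "y = (\<Sum>f\<in>F. c' f * f)"
    using assms unfolding lin_span_def by blast
  have "x + y = (\<Sum>f\<in>F. (c f + c' f) * f)" by (simp add: c distrib_right sum.distrib)
  then show ?thesis using lin_span_I[of F "\<lambda>f. c f + c' f"] c add by simp
qed

lemma lin_span_0: "0 \<in> lin_span R F"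
  using lin_span_I[of F "\<lambda>_. 0"] zero by simp

lemma lin_span_sum: "(\<And>i. i \<in> A \<Longrightarrow> u i \<in> lin_span R F) \<Longrightarrow> sum u A \<in> lin_span R F"
  by (induction A rule: infinite_finite_induct) (auto simp: lin_span_0 lin_span_add)

lemma lin_span_left: assumes "r \<in> R" "x \<in> lin_span R F" shows "r * x \<in> lin_span R F"
proof -
  obtain c where c: "\<forall>f\<in>F. c f \<in> R" "x = (\<Sum>f\<in>F. c f * f)" using assms unfolding lin_span_def by blast
  have "r * x = (\<Sum>f\<in>F. (r * c f) * f)" by (simp add: c sum_distrib_left mult.assoc)
  then show ?thesis using lin_span_I[of F "\<lambda>f. r * c f"] c assms mult by simp
qed

lemma lin_span_uminus: "x \<in> lin_span R F \<Longrightarrow> - x \<in> lin_span R F"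
  using lin_span_left[OF minus[OF one]] by fastforce

lemma lin_span_gen: assumes "finite F" "f \<in> F" "r \<in> R" shows "r * f \<in> lin_span R F"
proof -
  have "(\<Sum>f'\<in>F. (if f' = f then r else 0) * f') = (\<Sum>f'\<in>F. if f' = f then r * f else 0)"
    by (rule sum.cong) auto
  then have "(\<Sum>f'\<in>F. (if f' = f then r else 0) * f') = r * f"
    using assms by simp
  then show ?thesis using lin_span_I[of F "\<lambda>f'. if f' = f then r else 0"] assms zero by simp
qed

lemma lin_span_induct:
  assumes "x \<in> lin_span R F" "0 \<in> P" "\<And>x y. x \<in> P \<Longrightarrow> y \<in> P \<Longrightarrow> x + y \<in> P"
    and "\<And>r f. r \<in> R \<Longrightarrow> f \<in> F \<Longrightarrow> r * f \<in> P"
  shows "x \<in> P"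
proof -
  obtain c where c: "\<forall>f\<in>F. c f \<in> R" "x = (\<Sum>f\<in>F. c f * f)" using assms(1) unfolding lin_span_def by blast
  have "(\<And>i. i \<in> A \<Longrightarrow> u i \<in> P) \<Longrightarrow> sum u A \<in> P" for A :: "'a set" and u
    by (induction A rule: infinite_finite_induct) (auto simp: assms)
  then show ?thesis using c assms(4) by simp
qed

end

text \<open>An element \<open>y\<close> of the commutative ring \<open>C\<close> satisfies a
  quadratic equation whose coefficients, up to sign its trace \<open>y + cj y\<close> and its norm
  \<open>cj y * y\<close>, are in \<open>K\<close>. So adjoining \<open>y\<close> to
  \<open>P\<close> gives \<open>P + P * y\<close>, and finitely many adjunctions stay finite over
  \<open>K\<close>.\<close>

lemma quadratic_extension:
  fixes cj :: "'a::ring_1 \<Rightarrow> 'a"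
  assumes inv: "is_involution cj" and K: "subring_set K" "\<forall>k\<in>K. cj k = k"
    and C: "subring_set C" "K \<subseteq> C" "\<forall>x\<in>C. \<forall>y\<in>C. x * y = y * x"
    and norm: "\<And>y. y \<in> C \<Longrightarrow> y + cj y \<in> K" "\<And>y. y \<in> C \<Longrightarrow> cj y * y \<in> K"
    and "finite Y" "Y \<subseteq> C"
  shows "\<exists>P F. subring_set P \<and> K \<subseteq> P \<and> Y \<subseteq> P \<and> P \<subseteq> C \<and> cj ` P \<subseteq> P \<and> finite F \<and> F \<subseteq> P \<and> P = lin_span K F"
  using assms(9,10)
proof (induction Y)
  case empty
  interpret K: subring_set K by fact
  have "lin_span K {1} = K" by (auto simp: lin_span_def)
  then show ?case using K C K.one by (intro exI[of _ K] exI[of _ "{1}"]) auto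
next
  case (insert y Y)
  interpret K: subring_set K by fact
  interpret C: subring_set C by fact
  have cj: "cj (r + s) = cj r + cj s" "cj (r * s) = cj s * cj r" for r s
    using inv by (auto simp: is_involution_def)
  obtain P F where P: "subring_set P" "K \<subseteq> P" "Y \<subseteq> P" "P \<subseteq> C" "cj ` P \<subseteq> P"
    and F: "finite F" "F \<subseteq> P" "P = lin_span K F" using insert by auto
  interpret P: subring_set P by fact
  have y: "y \<in> C" using insert by auto
  have com: "a * b = b * a" if "a \<in> C" "b \<in> C" for a b using C(3) that by blast
  have com': "a * (b * c) = b * (a * c)" if "a \<in> C" "b \<in> C" for a b c using com[OF that] by (metis mult.assoc)
  have "cj y * y = y * cj y" using com norm(1)[OF y] C(2) y C.add[OF _ C.minus[OF y]] by fastforce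
  then have y2: "y * y = (y + cj y) * y + (- (cj y * y))" by (simp add: algebra_simps)
  define P' where "P' = {p + q * y | p q. p \<in> P \<and> q \<in> P}"
  have P'I: "p + q * y \<in> P'" if "p \<in> P" "q \<in> P" for p q using that unfolding P'_def by blast
  have "subring_set P'"
  proof
    show "1 \<in> P'" using P'I[OF P.one P.zero] by simp
  next
    fix u v assume "u \<in> P'" "v \<in> P'"
    then obtain p q p' q' where pq: "p \<in> P" "q \<in> P" "p' \<in> P" "q' \<in> P" "u = p + q * y" "v = p' + q' * y"
      unfolding P'_def by blast
    have "(p + p') + (q + q') * y \<in> P'" using pq by (intro P'I P.add)
    then show "u + v \<in> P'" using pq by (simp add: algebra_simps)
    have 1: "y + cj y \<in> P" "- (cj y * y) \<in> P" using norm[OF y] P(2) K.minus by blast+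
    have qC: "q' \<in> C" "p' \<in> C" "q \<in> C" using pq P(4) by auto
    have "u * v = (p * p' + q * q' * (- (cj y * y))) + (p * q' + q * p' + q * q' * (y + cj y)) * y"
    proof -
      have "u * v = p * p' + q * p' * y + p * q' * y + q * q' * (y * y)"
        using pq com[OF y qC(2)] com'[OF y qC(1)] by (simp add: algebra_simps)
      then show ?thesis unfolding y2 by (simp add: algebra_simps)
    qed
    moreover have "(p * p' + q * q' * (- (cj y * y))) + (p * q' + q * p' + q * q' * (y + cj y)) * y \<in> P'"
      using pq by (intro P'I P.add[OF P.mult P.mult[OF _ 1(2)]] P.add[OF _ P.mult[OF _ 1(1)]] P.add P.mult)
    ultimately show "u * v \<in> P'" by (simp only:)
    have "(- p) + (- q) * y \<in> P'" using pq by (intro P'I P.minus)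
    then show "- u \<in> P'" using pq by simp
  qed
  moreover have PP': "P \<subseteq> P'" using P'I[OF _ P.zero] by auto
  moreover have yP': "y \<in> P'" using P'I[OF P.zero P.one] by simp
  moreover have "P' \<subseteq> C" using P(4) y by (auto simp: P'_def intro!: C.add C.mult)
  moreover have "cj ` P' \<subseteq> P'"
  proof
    fix u assume "u \<in> cj ` P'"
    then obtain p q where pq: "p \<in> P" "q \<in> P" "u = cj (p + q * y)" unfolding P'_def by blast
    have q': "cj q \<in> P" "cj p \<in> P" using pq P by auto
    have cy: "cj y = (y + cj y) + (- 1) * y" by simp
    have "cj q \<in> C" "cj y \<in> C" using q' P(4) norm(1)[OF y] C(2) C.add[OF _ C.minus[OF y], of "y + cj y"] by auto
    then have "u = cj p + cj q * cj y" using pq com by (simp add: cj)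
    also have "\<dots> = (cj p + cj q * (y + cj y)) + (- cj q) * y" by (subst cy) (simp add: algebra_simps)
    also have "\<dots> \<in> P'"
      using q' subsetD[OF P(2) norm(1)[OF y]] by (intro P'I P.add[OF _ P.mult] P.minus)
    finally show "u \<in> P'" .
  qed
  moreover define F' where "F' = F \<union> (\<lambda>f. f * y) ` F"
  have F': "finite F'" "F' \<subseteq> P'"
  proof -
    show "finite F'" using F by (simp add: F'_def)
    have "0 + f * y \<in> P'" if "f \<in> F" for f using that F(2) by (intro P'I P.zero) auto
    then show "F' \<subseteq> P'" using F(2) PP' by (auto simp: F'_def)
  qed
  moreover have "P' = lin_span K F'"
  proof
    interpret P': subring_set P' by fact
    show "lin_span K F' \<subseteq> P'"
    proof
      fix x assume "x \<in> lin_span K F'"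
      then show "x \<in> P'"
      proof (rule K.lin_span_induct)
        fix r f assume "r \<in> K" "f \<in> F'"
        then show "r * f \<in> P'" using P'.mult[of r f] F'(2) P(2) PP' by blast
      qed (simp_all add: P'.zero P'.add)
    qed
    have 1: "p \<in> lin_span K F'" if "p \<in> P" for p
      using that unfolding F(3)
      by (rule K.lin_span_induct) (auto simp: F'_def F(1) K.lin_span_0 K.lin_span_add intro!: K.lin_span_gen)
    have 2: "q * y \<in> lin_span K F'" if "q \<in> P" for q
    proof -
      have "q \<in> {q. q * y \<in> lin_span K F'}"
        using that unfolding F(3)
        by (rule K.lin_span_induct)
          (auto simp: F'_def F(1) K.lin_span_0 distrib_right K.lin_span_add mult.assoc intro!: K.lin_span_gen)
      then show ?thesis by simp
    qed
    show "P' \<subseteq> lin_span K F'" using 1 2 K.lin_span_add by (auto simp: P'_def)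
  qed
  ultimately show ?case using P(2,3) by (intro exI[of _ P'] exI[of _ F']) auto
qed

lemma finite_extension_of_lin_span:
  assumes S: "subring_set S" and K: "subring_set K" "K \<subseteq> S" "\<And>k x. k \<in> K \<Longrightarrow> x \<in> S \<Longrightarrow> k * x = x * k"
    and F: "finite F" "F \<subseteq> S" "S = lin_span K F"
  shows "\<exists>g d. finite_extension S K g d"
proof -
  interpret S: subring_set S by fact
  interpret K: subring_set K by fact
  obtain g where g: "bij_betw g {0..<card F} F" using ex_bij_betw_nat_finite[OF F(1)] by blast
  have "finite_extension S K g (card F)"
  proof
    fix x assume "x \<in> S"
    then obtain c where c: "\<forall>f\<in>F. c f \<in> K" "x = (\<Sum>f\<in>F. c f * f)"
      using F(3) unfolding lin_span_def by blast
    have "x = (\<Sum>i<card F. c (g i) * g i)"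
      unfolding c(2) using sum.reindex_bij_betw[OF g, of "\<lambda>f. c f * f"] by (simp add: atLeast0LessThan)
    moreover have "\<forall>i<card F. c (g i) \<in> K" using c(1) g by (auto simp: bij_betw_def)
    ultimately show "\<exists>c. (\<forall>i<card F. c i \<in> K) \<and> x = (\<Sum>i<card F. c i * g i)"
      by (intro exI[of _ "\<lambda>i. c (g i)"] conjI)
  next
    fix i assume "i < card F"
    then show "g i \<in> S" using g F(2) by (auto simp: bij_betw_def)
  qed (use S.one S.add S.mult S.minus K.one K.add K.mult K.minus K in auto)
  then show ?thesis by blast
qed

text \<open>The ring \<open>S0\<close> supplied by quasi-finiteness is finite over its center, but
  the center need not be finite over its symmetric elements \<open>K\<close>. Therefore only the
  finitely many central coefficients that occur are adjoined to \<open>K\<close>, which gives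
  \<open>P\<close>, and \<open>S\<close> is the \<open>P\<close>-span of finitely many
  generators.\<close>

theorem quasi_finite_finite_extension:
  fixes cj :: "'a::ring_1 \<Rightarrow> 'a"
  assumes inv: "is_involution cj" and qf: "quasi_finite cj lam" and Y: "finite Y"
  obtains S K g d where "finite_extension S K g d" "Y \<subseteq> S" "lam \<in> S" "cj ` S \<subseteq> S" "\<And>k. k \<in> K \<Longrightarrow> cj k = k"
proof -
  have cj: "cj (r + s) = cj r + cj s" "cj (r * s) = cj s * cj r" "cj (cj r) = r" for r s
    using inv by (auto simp: is_involution_def)
  have cj0: "cj 0 = 0" using cj(1)[of 0 0] by simp
  have cj1: "cj 1 = 1" using cj(2)[of "cj 1" 1] by (simp add: cj)
  have cjm: "cj (- x) = - cj x" for x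
    using cj(1)[of x "- x"] by (simp add: cj0 eq_neg_iff_add_eq_0 add.commute)
  obtain \<S> :: "'a set set" where SS: "\<S> \<noteq> {}" "\<forall>A\<in>\<S>. \<forall>B\<in>\<S>. \<exists>C\<in>\<S>. A \<union> B \<subseteq> C" "\<Union>\<S> = UNIV"
    "\<forall>S\<in>\<S>. is_subring S \<and> almost_commutative S \<and> cj ` S \<subseteq> S \<and> lam \<in> S"
    using qf unfolding quasi_finite_def by (elim exE conjE) (rule that; assumption)
  have "\<exists>S\<in>\<S>. Y \<subseteq> S"
    using Y
  proof (induction Y)
    case empty
    then show ?case using SS by auto
  next
    case (insert y Y)
    then obtain A where A: "A \<in> \<S>" "Y \<subseteq> A" by auto
    obtain B where B: "B \<in> \<S>" "y \<in> B" using SS(3) by blast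
    obtain C where "C \<in> \<S>" "A \<union> B \<subseteq> C" using SS(2) A B by blast
    then show ?case using A B by blast
  qed
  then obtain S0 where S0: "S0 \<in> \<S>" "Y \<subseteq> S0" by blast
  have sub: "subring_set S0" using SS(4) S0 unfolding is_subring_def subring_set_def by blast
  then interpret S0: subring_set S0 .
  have S0cj: "cj ` S0 \<subseteq> S0" and S0lam: "lam \<in> S0" using SS(4) S0 by auto
  obtain F where F: "finite F" "F \<subseteq> S0"
    "\<forall>s\<in>S0. \<exists>c. (\<forall>f\<in>F. c f \<in> ring_center S0) \<and> s = (\<Sum>f\<in>F. c f * f)"
  proof -
    have "almost_commutative S0" using SS(4) S0 by blast
    then show ?thesis unfolding almost_commutative_def by (elim exE conjE) (rule that; assumption)
  qed
  define C where "C = ring_center S0"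
  have CS: "C \<subseteq> S0" and Cc: "\<And>z s. z \<in> C \<Longrightarrow> s \<in> S0 \<Longrightarrow> z * s = s * z" by (auto simp: C_def ring_center_def)
  have CI: "z \<in> C" if "z \<in> S0" "\<And>s. s \<in> S0 \<Longrightarrow> z * s = s * z" for z
    using that by (auto simp: C_def ring_center_def)
  have C: "subring_set C"
  proof
    show "1 \<in> C" by (intro CI) (auto simp: S0.one)
  next
    fix x y assume xy: "x \<in> C" "y \<in> C"
    have S: "x \<in> S0" "y \<in> S0" using xy CS by auto
    have "x * y * s = s * (x * y)" if s: "s \<in> S0" for s
      using Cc[OF xy(1) s] Cc[OF xy(2) s] by (metis mult.assoc)
    then show "x * y \<in> C" using S S0.mult by (intro CI)
    show "x + y \<in> C" using S S0.add Cc[OF xy(1)] Cc[OF xy(2)]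
      by (intro CI) (auto simp only: distrib_left distrib_right)
    show "- x \<in> C" using S S0.minus Cc[OF xy(1)] by (intro CI) auto
  qed
  interpret C: subring_set C by fact
  have Ccj: "cj z \<in> C" if z: "z \<in> C" for z
  proof -
    have "cj z * s = s * cj z" if s: "s \<in> S0" for s
    proof -
      have "cj s * z = z * cj s" using Cc[OF z, of "cj s"] s S0cj by auto
      then have "cj (cj s * z) = cj (z * cj s)" by simp
      then show ?thesis by (simp add: cj)
    qed
    moreover have "cj z \<in> S0" using z S0cj CS by auto
    ultimately show ?thesis by (intro CI)
  qed
  define K where "K = {c \<in> C. cj c = c}"
  have KC: "K \<subseteq> C" by (auto simp: K_def)
  have K: "subring_set K"
  proof
    fix x y assume "x \<in> K" "y \<in> K"
    then show "x * y \<in> K" using C.mult Cc[of x y] CS by (auto simp: K_def cj)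
  qed (auto simp: K_def cj cj1 cjm C.one C.add C.minus)
  interpret K: subring_set K by fact
  obtain coef where coef: "\<And>s. s \<in> S0 \<Longrightarrow> (\<forall>f\<in>F. coef s f \<in> C) \<and> s = (\<Sum>f\<in>F. coef s f * f)"
    using F(3) unfolding C_def by metis
  define F1 where "F1 = insert 1 (F \<union> cj ` F)"
  have F1: "finite F1" "F1 \<subseteq> S0" "F \<subseteq> F1" "cj ` F1 \<subseteq> F1" "1 \<in> F1"
  proof -
    have "cj ` F \<subseteq> S0" using F(2) S0cj by blast
    then show "finite F1" "F1 \<subseteq> S0" "F \<subseteq> F1" "cj ` F1 \<subseteq> F1" "1 \<in> F1"
      using F(1,2) S0.one by (auto simp: F1_def cj cj1)
  qed
  \<comment> \<open>The coefficients of products of generators are structure constants: once they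
    lie in \<open>P\<close>, the span of \<open>F1\<close> is closed under multiplication.\<close>
  define X where "X = (\<lambda>(a, b). a * b) ` (F1 \<times> F1) \<union> insert lam Y"
  have "a * b \<in> S0" if "a \<in> F1" "b \<in> F1" for a b using that F1(2) S0.mult by blast
  then have X: "finite X" "X \<subseteq> S0" using F1(1) Y S0(2) S0lam by (auto simp: X_def)
  define Z where "Z = (\<Union>x\<in>X. coef x ` F)"
  have Z: "finite Z" "Z \<subseteq> C" using X F(1) coef by (auto simp: Z_def)
  have "\<exists>P G. subring_set P \<and> K \<subseteq> P \<and> Z \<subseteq> P \<and> P \<subseteq> C \<and> cj ` P \<subseteq> P \<and> finite G \<and> G \<subseteq> P \<and> P = lin_span K G"
  proof (rule quadratic_extension[OF inv K _ C KC _ _ _ Z])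
    show "\<forall>x\<in>C. \<forall>y\<in>C. x * y = y * x" using Cc CS by blast
    fix y assume y: "y \<in> C"
    then show "y + cj y \<in> K" using Ccj C.add by (auto simp: K_def cj add.commute)
    show "cj y * y \<in> K" using y Ccj C.mult Cc[OF y, of "cj y"] CS by (auto simp: K_def cj)
  qed (simp add: K_def)
  then obtain P G where P: "subring_set P" "K \<subseteq> P" "Z \<subseteq> P" "P \<subseteq> C" "cj ` P \<subseteq> P"
    and G: "finite G" "G \<subseteq> P" "P = lin_span K G" by blast
  interpret P: subring_set P by fact
  have Pc: "p * s = s * p" if "p \<in> P" "s \<in> S0" for p s using that P(4) Cc by blast
  define S where "S = lin_span P F1"
  have SS0: "S \<subseteq> S0"
  proof
    fix x assume "x \<in> S"
    then show "x \<in> S0" unfolding S_def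
    proof (rule P.lin_span_induct)
      fix r f assume "r \<in> P" "f \<in> F1"
      then show "r * f \<in> S0" using S0.mult[of r f] F1(2) P(4) CS by blast
    qed (simp_all add: S0.zero S0.add)
  qed
  have XS: "x \<in> S" if x: "x \<in> X" for x
  proof -
    have "x = (\<Sum>f\<in>F. coef x f * f)" using coef x X by blast
    moreover have "coef x f * f \<in> S" if "f \<in> F" for f
      unfolding S_def using that x P(3) F1 by (intro P.lin_span_gen) (auto simp: Z_def)
    ultimately show ?thesis using P.lin_span_sum[of F "\<lambda>f. coef x f * f" F1] by (simp add: S_def)
  qed
  have PS: "p \<in> S" if "p \<in> P" for p
    using P.lin_span_gen[OF F1(1) F1(5) that] by (simp add: S_def)
  have S: "subring_set S"
  proof
    show "1 \<in> S" using PS P.one by blast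
  next
    fix x y assume x: "x \<in> S" and y: "y \<in> S"
    show "x + y \<in> S" using x y by (simp add: S_def P.lin_span_add)
    show "- x \<in> S" using x by (simp add: S_def P.lin_span_uminus)
    have 1: "f * y \<in> S" if f: "f \<in> F1" for f
    proof -
      have "y \<in> {y. f * y \<in> S}"
        using y unfolding S_def
      proof (rule P.lin_span_induct)
        fix r f' assume rf: "r \<in> P" "f' \<in> F1"
        have "f * f' \<in> S" using f rf by (intro XS) (auto simp: X_def)
        moreover have "f * (r * f') = r * (f * f')" using Pc[OF rf(1), of f] f F1(2) by (metis mult.assoc subsetD)
        ultimately show "r * f' \<in> {y. f * y \<in> lin_span P F1}" using rf by (simp add: S_def P.lin_span_left)
      qed (auto simp: distrib_left P.lin_span_0 P.lin_span_add)
      then show ?thesis by simp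
    qed
    have "x \<in> {x. x * y \<in> S}"
      using x unfolding S_def
    proof (rule P.lin_span_induct)
      fix r f assume rf: "r \<in> P" "f \<in> F1"
      show "r * f \<in> {x. x * y \<in> lin_span P F1}"
        using 1[OF rf(2)] rf by (simp add: S_def P.lin_span_left mult.assoc)
    qed (auto simp: distrib_right P.lin_span_0 P.lin_span_add)
    then show "x * y \<in> S" by simp
  qed
  interpret S: subring_set S by fact
  have Scj: "cj ` S \<subseteq> S"
  proof
    fix u assume "u \<in> cj ` S"
    then obtain x where x: "x \<in> S" "u = cj x" by blast
    have "x \<in> {x. cj x \<in> S}"
      using x(1) unfolding S_def
    proof (rule P.lin_span_induct)
      fix r f assume rf: "r \<in> P" "f \<in> F1"
      then have "cj r * cj f \<in> S" unfolding S_def using P(5) F1 by (intro P.lin_span_gen) auto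
      moreover have "cj r * cj f = cj f * cj r" using rf P(5) F1 by (intro Pc) auto
      ultimately show "r * f \<in> {x. cj x \<in> lin_span P F1}" by (simp add: cj S_def)
    qed (auto simp: cj cj0 P.lin_span_0 P.lin_span_add)
    then show "u \<in> S" using x by simp
  qed
  define F2 where "F2 = (\<lambda>(a, b). a * b) ` (G \<times> F1)"
  have F2: "finite F2" using G F1 by (simp add: F2_def)
  have F2S: "F2 \<subseteq> S" using G P.lin_span_gen[OF F1(1)] by (auto simp: F2_def S_def)
  have "S = lin_span K F2"
  proof
    show "lin_span K F2 \<subseteq> S"
    proof
      fix x assume "x \<in> lin_span K F2"
      then show "x \<in> S"
      proof (rule K.lin_span_induct)
        fix r f assume "r \<in> K" "f \<in> F2"
        then show "r * f \<in> S" using S.mult[of r f] F2S P(2) PS by blast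
      qed (simp_all add: S.zero S.add)
    qed
    show "S \<subseteq> lin_span K F2"
    proof
      fix x assume "x \<in> S"
      then show "x \<in> lin_span K F2" unfolding S_def
      proof (rule P.lin_span_induct)
        fix r f assume r: "r \<in> P" and f: "f \<in> F1"
        have "r \<in> {r. r * f \<in> lin_span K F2}"
          using r unfolding G(3)
        proof (rule K.lin_span_induct)
          fix k a assume "k \<in> K" "a \<in> G"
          then have "k * (a * f) \<in> lin_span K F2" using f F2 by (intro K.lin_span_gen) (auto simp: F2_def)
          then show "k * a \<in> {r. r * f \<in> lin_span K F2}" by (simp add: mult.assoc)
        qed (auto simp: distrib_right K.lin_span_0 K.lin_span_add)
        then show "r * f \<in> lin_span K F2" by simp
      qed (auto simp: K.lin_span_0 K.lin_span_add)
    qed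
  qed
  moreover have "k * x = x * k" if "k \<in> K" "x \<in> S" for k x using that KC SS0 Cc by blast
  moreover have "K \<subseteq> S" using P(2) PS by blast
  ultimately have "\<exists>g d. finite_extension S K g d"
    by (intro finite_extension_of_lin_span[OF S K _ _ F2 F2S])
  then obtain g d where "finite_extension S K g d" by blast
  moreover have "Y \<subseteq> S" "lam \<in> S" using XS by (auto simp: X_def)
  moreover have "cj k = k" if "k \<in> K" for k using that by (simp add: K_def)
  ultimately show thesis using that Scj by blast
qed

section \<open>The unitary group and its elementary subgroup\<close>

locale hyperbolic = unitary_space cj lam n for cj :: "'a::ring_1 \<Rightarrow> 'a" and lam n +
  fixes Lam :: "'a set"
  assumes fp: "form_parameter cj lam Lam"
begin

lemma Lam0: "0 \<in> Lam" and Lam_add: "x \<in> Lam \<Longrightarrow> y \<in> Lam \<Longrightarrow> x + y \<in> Lam"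
  and Lam_uminus: "x \<in> Lam \<Longrightarrow> - x \<in> Lam" and Lam_min: "r - lam * cj r \<in> Lam"
  and Lam_max: "x \<in> Lam \<Longrightarrow> lam * cj x = - x" and Lam_conj: "x \<in> Lam \<Longrightarrow> r * x * cj r \<in> Lam"
proof -
  have *: "add_subgroup Lam" "{r - lam * cj r | r. True} \<subseteq> Lam" "Lam \<subseteq> {r. r = - (lam * cj r)}"
    "\<forall>r. \<forall>a\<in>Lam. r * a * cj r \<in> Lam"
    using fp by (auto simp: form_parameter_def)
  show "0 \<in> Lam" "x \<in> Lam \<Longrightarrow> y \<in> Lam \<Longrightarrow> x + y \<in> Lam" "x \<in> Lam \<Longrightarrow> - x \<in> Lam"
    using *(1) by (auto simp: add_subgroup_def)
  show "r - lam * cj r \<in> Lam" using *(2) by blast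
  show "x \<in> Lam \<Longrightarrow> r * x * cj r \<in> Lam" using *(4) by blast
  assume "x \<in> Lam"
  then have "x = - (lam * cj x)" using *(3) by blast
  then show "lam * cj x = - x" by (metis minus_minus)
qed

sublocale E: form_subring cj lam n UNIV Lam
  by unfold_locales (auto intro: Lam0 Lam_add Lam_uminus Lam_min Lam_max Lam_conj)

lemma EU_eq: "EU cj lam Lam n = E.G"
  by (simp add: EU_def E.G_def)

abbreviation UU where "UU \<equiv> U cj lam Lam n"
abbreviation EE where "EE \<equiv> EU cj lam Lam n"

lemmas Lam_diff = E.L_diff
lemmas Lam_conj' = E.L_conj'[OF UNIV_I]

text \<open>The failure of \<open>s\<close> to preserve the quadratic form; by \<open>Q_mult\<close>
  it is a crossed homomorphism in \<open>s\<close>.\<close>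

definition Q :: "'a mat \<Rightarrow> 'a vec \<Rightarrow> 'a" where
  "Q s v = f (mvec n s v) (mvec n s v) - f v v"

lemma U_iff: "s \<in> UU \<longleftrightarrow> s \<in> GL n \<and> (\<forall>u v. h (mvec n s u) (mvec n s v) = h u v) \<and> (\<forall>u. Q s u \<in> Lam)"
  by (simp add: U_def Q_def)

lemma U_GL: "s \<in> UU \<Longrightarrow> s \<in> GL n" and U_h: "s \<in> UU \<Longrightarrow> h (mvec n s u) (mvec n s v) = h u v"
  and U_Q: "s \<in> UU \<Longrightarrow> Q s u \<in> Lam"
  by (auto simp: U_iff)

lemma Q_mult: "Q (mmul n s t) v = Q s (mvec n t v) + Q t v"
  by (simp add: Q_def mvec_mmul)

lemma Q_cong: "(\<And>i. i \<in> Omega n \<Longrightarrow> u i = v i) \<Longrightarrow> Q s u = Q s v"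
  unfolding Q_def using mvec_cong[of n u v s] f_cong[of u v u v] by simp

lemma Q_emat: "Q (emat n) v = 0"
  using f_cong[of "mvec n (emat n) v" v "mvec n (emat n) v" v] by (simp add: Q_def mvec_emat)

lemma Q_vscale: "Q s (vscale v r) = cj r * Q s v * r"
  by (simp add: Q_def mvec_vscale fs algebra_simps)

lemma U_mult: "s \<in> UU \<Longrightarrow> t \<in> UU \<Longrightarrow> mmul n s t \<in> UU"
  by (auto simp: U_iff GL_mmul mvec_mmul Q_mult Lam_add)

lemma Q_ginv: assumes "s \<in> GL n" shows "Q (ginv n s) v = - Q s (mvec n (ginv n s) v)"
proof -
  have "Q (mmul n s (ginv n s)) v = 0" using assms by (simp add: mmul_ginv Q_emat)
  then show ?thesis by (simp add: Q_mult eq_neg_iff_add_eq_0 add.commute)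
qed

lemma U_inv: assumes "s \<in> UU" shows "ginv n s \<in> UU"
proof -
  have s: "s \<in> GL n" using assms U_GL by blast
  have "h (mvec n (ginv n s) u) (mvec n (ginv n s) v) = h u v" for u v
  proof -
    have "h (mvec n (ginv n s) u) (mvec n (ginv n s) v)
       = h (mvec n s (mvec n (ginv n s) u)) (mvec n s (mvec n (ginv n s) v))"
      using U_h[OF assms] by simp
    also have "\<dots> = h u v" by (rule h_cong) (simp_all add: mvec_ginv s)
    finally show ?thesis .
  qed
  then show ?thesis using s U_Q[OF assms] by (auto simp: U_iff ginv_GL Q_ginv Lam_uminus)
qed

lemma U_one: "emat n \<in> UU"
proof -
  have "h (mvec n (emat n) u) (mvec n (emat n) v) = h u v" for u v
    by (rule h_cong) (simp_all add: mvec_emat)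
  then show ?thesis using group.is_monoid[OF group_GLgrp, of n]
    by (auto simp: U_iff Q_emat Lam0 monoid_def)
qed

lemma f_sym: "f x y + f y x - h x y \<in> Lam"
  using Lam_min[of "f y x"] by (simp add: h_f)

lemma Eich_U:
  assumes u: "h u u = 0" "f u u \<in> Lam" and v: "h u v = 0" and q: "q - f v v \<in> Lam"
  shows "Eich u v q \<in> UU"
proof -
  have "Q (Eich u v q) w \<in> Lam" for w
  proof -
    define K where "K = cj (h w u)"
    define A where "A = h v w - q * K"
    let ?d = "\<lambda>x y. f x y + f y x - h x y"
    have huw: "h u w = lam * K" unfolding K_def by (rule h_conj)
    have Ev: "Ev u v q w = w + (vscale u A - vscale v K)"
      by (simp add: Ev_def K_def A_def fun_eq_iff algebra_simps)
    have "Q (Eich u v q) w = f (Ev u v q w) (Ev u v q w) - f w w"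
      unfolding Q_def using f_cong[of "mvec n (Eich u v q) w" "Ev u v q w" "mvec n (Eich u v q) w" "Ev u v q w"]
      by (simp add: mvec_Eich)
    \<comment> \<open>The grouping puts every summand into \<open>Lam\<close> separately: the
      differences \<open>?d\<close>, minimal elements and their conjugates, and conjugates of
      \<open>f u u\<close> and \<open>q - f v v\<close>.\<close>
    also have "\<dots> = ?d (vscale u A) w - ?d (vscale v K) w + cj A * f u u * A - ?d (vscale u A) (vscale v K)
       - (cj K * h v w - lam * cj (cj K * h v w)) - cj K * (q - f v v) * K + cj K * (q - lam * cj q) * K"
      unfolding Ev by (simp add: fs hs v huw A_def cjs algebra_simps lam_left_commute[of "cj K"]
          lam_left_commute[of "cj (h v w)"] lam_left_commute[of "cj q"])
    also have "\<dots> \<in> Lam"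
      by (intro Lam_diff Lam_add f_sym Lam_min Lam_conj'[of "q - f v v"] Lam_conj'[of "f u u"]
          Lam_conj'[of "q - lam * cj q"] q u)
    finally show ?thesis .
  qed
  then show ?thesis
    using Eich_GL[OF u(1) v] mvec_Eich_preserves_h[OF u(1) v E.h_self_of_L[OF q]] by (auto simp: U_iff)
qed

lemma subgroup_U: "subgroup UU (GLgrp n)"
  by (rule subgroup.intro) (auto simp: U_mult U_one U_inv dest: U_GL)

lemma EE_U: "EE \<subseteq> UU"
proof -
  have "elem_gens cj lam n UNIV Lam \<subseteq> UU"
    unfolding E.G_gens by (auto intro!: Eich_U simp: h_bvec_bvec E.h_bvec_self E.f_bvec_self Lam0)
  then show ?thesis
    unfolding EU_def by (rule group.generate_subgroup_incl[OF group_GLgrp _ subgroup_U])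
qed

lemma EE_GL: "g \<in> EE \<Longrightarrow> g \<in> GL n" using EE_U U_GL by blast
lemma EE_mult: "a \<in> EE \<Longrightarrow> b \<in> EE \<Longrightarrow> mmul n a b \<in> EE" unfolding EU_eq by (rule E.G_mult)
lemma EE_inv: "a \<in> EE \<Longrightarrow> ginv n a \<in> EE" unfolding EU_eq by (rule E.G_inv)
lemma EE_one: "emat n \<in> EE" unfolding EU_eq by (rule E.G_one)
lemma EE_short: "i \<in> Omega n \<Longrightarrow> k \<in> Omega n \<Longrightarrow> k \<noteq> i \<Longrightarrow> k \<noteq> - i \<Longrightarrow> Eich (bvec i 1) (bvec k r) 0 \<in> EE"
  unfolding EU_eq by (rule E.G_short) auto
lemma EE_long: "i \<in> Omega n \<Longrightarrow> a \<in> Lam \<Longrightarrow> Eich (bvec i 1) 0 a \<in> EE"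
  unfolding EU_eq by (rule E.G_long)
lemma EE_bvec: "p \<in> Omega n \<Longrightarrow> v (- p) = 0 \<Longrightarrow> q - f v v \<in> Lam \<Longrightarrow> Eich (bvec p 1) v q \<in> EE"
  unfolding EU_eq by (rule E.Eich_bvec_G) (auto simp: E.XV_def)

lemma U_conj_Eich: "g \<in> UU \<Longrightarrow> mmul n (mmul n g (Eich u v q)) (ginv n g) = Eich (mvec n g u) (mvec n g v) q"
  by (intro Eich_conj) (auto simp: U_GL U_h)

lemma Eich_conj_Ev:
  assumes "Eich u v q \<in> UU"
  shows "mmul n (mmul n (Eich u v q) (Eich x y r)) (ginv n (Eich u v q)) = Eich (Ev u v q x) (Ev u v q y) r"
  unfolding U_conj_Eich[OF assms] by (rule Eich_cong) (simp_all add: mvec_Eich)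

lemma ginv_fixes:
  assumes "g \<in> GL n" "\<And>i. i \<in> Omega n \<Longrightarrow> mvec n g w i = w i" "k \<in> Omega n"
  shows "mvec n (ginv n g) w k = w k"
proof -
  have "mvec n (ginv n g) w k = mvec n (ginv n g) (mvec n g w) k"
    using assms(2) by (intro fun_cong[OF mvec_cong]) simp
  then show ?thesis using assms by (simp add: ginv_mvec)
qed

lemma conj_column:
  assumes g: "g \<in> GL n" "\<And>i. i \<in> Omega n \<Longrightarrow> mvec n g (bvec o' 1) i = bvec o' 1 i" and o': "o' \<in> Omega n"
  shows "mmul n (mmul n g s) (ginv n g) k o' = mvec n g (mvec n s (bvec o' 1)) k"
proof -
  have "mmul n (mmul n g s) (ginv n g) k o' = mvec n g (mvec n s (mvec n (ginv n g) (bvec o' 1))) k"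
    using o' by (simp add: mvec_bvec mmul_assoc flip: mvec_mmul)
  also have "mvec n s (mvec n (ginv n g) (bvec o' 1)) = mvec n s (bvec o' 1)"
    using ginv_fixes[OF g] by (intro mvec_cong)
  finally show ?thesis .
qed

subsection \<open>Making an entry of a column invertible\<close>

text \<open>Conjugation by such an \<open>e\<close> changes the column with index \<open>o'\<close> by left multiplication only.\<close>

definition SG :: "'a set \<Rightarrow> int \<Rightarrow> 'a mat \<Rightarrow> bool" where
  "SG S o' e \<longleftrightarrow> e \<in> EE \<and> (\<forall>i j. e i j \<in> S) \<and> (\<forall>i j. ginv n e i j \<in> S) \<and>
    (\<forall>i\<in>Omega n. mvec n e (bvec o' 1) i = bvec o' 1 i)"

lemma SG_mult:
  assumes S: "finite_extension S K g d" and e: "SG S o' e" "SG S o' e'"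
  shows "SG S o' (mmul n e e')"
proof -
  interpret S: finite_extension S K g d by fact
  have "0 \<in> S" using S.S_add[OF S.S1 S.S_uminus[OF S.S1]] by simp
  then have sum: "(\<And>i. i \<in> A \<Longrightarrow> u i \<in> S) \<Longrightarrow> sum u A \<in> S" for A :: "int set" and u
    by (induction A rule: infinite_finite_induct) (auto intro: S.S_add)
  have ent: "mmul n A B i j \<in> S" if "\<forall>i j. A i j \<in> S" "\<forall>i j. B i j \<in> S" for A B i j
    unfolding mmul_def using that by (intro sum S.S_mult) auto
  have "mvec n (mmul n e e') (bvec o' 1) i = bvec o' 1 i" if "i \<in> Omega n" for i
  proof -
    have "mvec n e (mvec n e' (bvec o' 1)) = mvec n e (bvec o' 1)"
      using e by (intro mvec_cong) (auto simp: SG_def)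
    then show ?thesis using e that by (simp add: mvec_mmul SG_def)
  qed
  then show ?thesis using e
    by (auto simp: SG_def EE_mult ginv_mmul_distrib EE_GL intro!: ent)
qed

lemma SG_Eich:
  assumes S: "finite_extension S K g d" "cj ` S \<subseteq> S" "lam \<in> S" and r: "r \<in> S"
    and ik: "i \<in> Omega n" "k \<in> Omega n" "k \<noteq> i" "k \<noteq> - i" "i \<noteq> - o'" "k \<noteq> - o'" and o': "o' \<in> Omega n"
  shows "SG S o' (Eich (bvec i 1) (bvec k r) 0)"
proof -
  interpret S: finite_extension S K g d by fact
  have S0: "0 \<in> S" using S.S_add[OF S.S1 S.S_uminus[OF S.S1]] by simp
  have Sd: "x - y \<in> S" if "x \<in> S" "y \<in> S" for x y using S.S_add[OF that(1) S.S_uminus[OF that(2)]] by simp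
  have cjS: "cj x \<in> S" if "x \<in> S" for x using that S by auto
  have eta: "eta j \<in> S" for j by (simp add: eta_def S.S1 S)
  have ent: "Eich (bvec i 1) (bvec k r) 0 a b \<in> S" if "r \<in> S" for r a b
    using that ik by (simp add: Eich_def Ev_bvec_eq S0 S.S1 S.S_add S.S_mult Sd cjS eta)
  have h: "h (bvec i 1) (bvec i 1) = 0" "h (bvec i 1) (bvec k r) = 0" "h (bvec k r) (bvec k r) = 0"
    using ik E.h_bvec_self[of i 1 1] E.h_bvec_self[of k r r] h_bvec_bvec[of i 1 k r] by simp_all
  have "ginv n (Eich (bvec i 1) (bvec k r) 0) = Eich (bvec i 1) (bvec k (- r)) 0"
  proof -
    have "- bvec k r = bvec k (- r)" by (auto simp: bvec_apply)
    then show ?thesis using h by (simp add: ginv_Eich)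
  qed
  moreover have "Ev (bvec i 1) (bvec k r) 0 (bvec o' 1) = bvec o' 1"
  proof -
    have "h (bvec k r) (bvec o' 1) = 0" "h (bvec o' 1) (bvec i 1) = 0"
      using ik o' by (auto simp: h_bvec_bvec)
    then show ?thesis by (simp add: Ev_def)
  qed
  ultimately show ?thesis
    using ik ent[OF r] ent[OF S.S_uminus[OF r]] by (auto simp: SG_def EE_short mvec_Eich)
qed

lemma mvec_Eich_short:
  assumes "i \<in> Omega n" "k \<in> Omega n" "j \<in> Omega n" "k \<noteq> i"
  shows "mvec n (Eich (bvec i 1) (bvec k r) 0) u j =
    (if j = i then u i + cj r * eta k * u (- k) else if j = k then u k - r * (cj (eta (- i)) * u (- i)) else u j)"
proof -
  have "h (bvec k r) u = cj r * eta k * u (- k)" "cj (h u (bvec i 1)) = cj (eta (- i)) * u (- i)"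
    using assms by (simp_all add: h_bvec_left h_bvec_right cjs) (simp add: eta_def lam_commute flip: cj_lam_commute)
  then show ?thesis using assms by (auto simp: mvec_Eich Ev_def bvec_apply)
qed

text \<open>Take \<open>e\<close> for which the entry at \<open>o'\<close> generates a left ideal of
  largest dimension. Stable rank one forces the other entries into it, except the one at
  \<open>- o'\<close>, which no short root element can add to the entry at \<open>o'\<close>. That
  one is reached through the auxiliary position \<open>- i\<close>. The column being unimodular, 1
  lies in the left ideal. The second unit is the entry at \<open>o'\<close> after this detour, which
  \<open>level_column\<close> repeats.\<close>

theorem exists_kunit_entry:
  assumes S: "cj ` S \<subseteq> S" "lam \<in> S" and M: "central_extension S K g d M"
    and o': "o' \<in> Omega n" and i: "i \<in> Omega n" "i \<noteq> o'" "i \<noteq> - o'"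
    and u: "\<And>k. k \<in> Omega n \<Longrightarrow> u k \<in> S" and w: "\<And>k. k \<in> Omega n \<Longrightarrow> w k \<in> S" "(\<Sum>k\<in>Omega n. w k * u k) = 1"
  obtains e where "SG S o' e" "central_extension.kunit S K M (mvec n e u o')"
    "central_extension.kunit S K M (mvec n e u o' - cj (eta i) * mvec n e u i)"
proof -
  interpret M: central_extension S K g d M by fact
  have FE: "finite_extension S K g d" by (rule M.finite_extension_axioms)
  have eta: "eta j \<in> S" for j by (simp add: eta_def M.S1 S)
  have cjS: "cj x \<in> S" if "x \<in> S" for x using that S by auto
  have no: "o' \<noteq> - o'" "i \<noteq> - i" using o' i Omega_neq_uminus by auto
  have SGm: "SG S o' e \<Longrightarrow> SG S o' e' \<Longrightarrow> SG S o' (mmul n e e')" for e e' by (rule SG_mult[OF FE])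
  have SGe: "SG S o' (Eich (bvec i 1) (bvec k r) 0)"
    if "i \<in> Omega n" "k \<in> Omega n" "k \<noteq> i" "k \<noteq> - i" "i \<noteq> - o'" "k \<noteq> - o'" "r \<in> S" for i k r
    using that by (intro SG_Eich[OF FE S] o')
  have SG1: "SG S o' (emat n)"
    using M.S0 M.S1 by (auto simp: SG_def EE_one ginv_emat mvec_emat) (auto simp: emat_def)
  have orbS: "mvec n e u k \<in> S" if "SG S o' e" "k \<in> Omega n" for e k
    unfolding mvec_def using that u by (intro M.S_sum M.S_mult) (auto simp: SG_def)
  let ?c = "\<lambda>e. card (M.lead (M.lJ (mvec n e u o')))"
  obtain e where e: "SG S o' e" and max: "\<And>e'. SG S o' e' \<Longrightarrow> ?c e' \<le> ?c e"
    using ex_has_greatest_nat[of "SG S o'" "emat n" ?c "Suc d"] SG1 M.card_lead_le by (metis le_imp_less_Suc)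
  have absorb: "mvec n e' u k \<in> M.lJ (mvec n e' u o')"
    if e': "SG S o' e'" "?c e' = ?c e" and k: "k \<in> Omega n" "k \<noteq> o'" "k \<noteq> - o'" for e' k
  proof -
    let ?x = "mvec n e' u"
    have xS: "?x o' \<in> S" "?x k \<in> S" using orbS e' o' k by auto
    obtain t where t: "t \<in> S" "?x o' \<in> M.lJ (?x o' + t * ?x k)" "?x k \<in> M.lJ (?x o' + t * ?x k)"
      using M.stable_rank[OF xS] by blast
    define E where "E = Eich (bvec o' 1) (bvec (- k) (cj (t * cj (eta (- k))))) 0"
    have E: "SG S o' E" unfolding E_def using o' k no t eta
      by (intro SGe cjS M.S_mult) auto
    have new: "mvec n (mmul n E e') u o' = ?x o' + t * ?x k"
      unfolding mvec_mmul E_def using o' k by (subst mvec_Eich_short) (auto simp: mult.assoc)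
    have nS: "?x o' + t * ?x k \<in> S" using xS t M.S_add M.S_mult by auto
    have "M.lJ (?x o') = M.lJ (?x o' + t * ?x k)"
      using max[OF SGm[OF E e'(1)]] e' t xS nS by (intro M.card_lJ_eq) (auto simp: new)
    then show ?thesis using t by simp
  qed
  \<comment> \<open>A third index makes room: after a multiple of the entry at \<open>i\<close> is
    added to that at \<open>p\<close>, the entry at \<open>i\<close> is a left multiple of the
    latter modulo \<open>M.J\<close> and can be cleared.\<close>
  obtain p where p: "p \<in> Omega n" "p \<noteq> i" "p \<noteq> - i" "p \<noteq> o'" "p \<noteq> - o'"
    using exists_index[OF i(1) o'] by blast
  let ?x = "mvec n e u"
  obtain t where t: "t \<in> S" "?x p \<in> M.lJ (?x p + t * ?x i)" "?x i \<in> M.lJ (?x p + t * ?x i)"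
    using M.stable_rank[of "?x p" "?x i"] orbS e p i by blast
  define E1 where "E1 = Eich (bvec p 1) (bvec (- i) (cj (t * cj (eta (- i))))) 0"
  have E1: "SG S o' E1" unfolding E1_def using o' p i no t eta
    by (intro SGe cjS M.S_mult) auto
  let ?y = "mvec n (mmul n E1 e) u"
  have y: "?y p = ?x p + t * ?x i" "?y i = ?x i" "?y o' = ?x o'"
    unfolding mvec_mmul E1_def using o' p i no by (auto simp: mvec_Eich_short mult.assoc)
  obtain b where b: "b \<in> S" "M.cg (?y i) (b * ?y p)"
    using t(3) unfolding M.lJ_iff y by blast
  define E2 where "E2 = Eich (bvec i 1) (bvec (- p) (cj ((- b) * cj (eta (- p))))) 0"
  have E2: "SG S o' E2" unfolding E2_def using o' p i no b eta
    by (intro SGe cjS M.S_mult M.S_uminus) auto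
  define e2 where "e2 = mmul n E2 (mmul n E1 e)"
  have e2: "SG S o' e2" unfolding e2_def by (intro SGm E1 E2 e)
  let ?z = "mvec n e2 u"
  have zy: "?z = mvec n E2 ?y" by (simp only: e2_def mvec_mmul)
  have "?z i = ?y i + (- b) * ?y p" "?z o' = ?y o'"
    unfolding zy E2_def using o' p i no
    by (auto simp add: mvec_Eich_short mult.assoc)
  then have z: "?z i \<in> M.J" "?z o' = ?x o'" using b y by (auto simp: M.cg_def)
  \<comment> \<open>Up to a weight, this adds the entry at \<open>- o'\<close> to position
    \<open>- i\<close>, and it changes the entry at \<open>o'\<close> only by a multiple of the
    cleared entry at \<open>i\<close>.\<close>
  define E3 where "E3 = Eich (bvec (- i) 1) (bvec o' 1) 0"
  have E3: "SG S o' E3" unfolding E3_def using o' i no M.S1 by (intro SGe) auto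
  let ?v = "mvec n (mmul n E3 e2) u"
  have v: "?v o' = ?z o' - cj (eta i) * ?z i" "?v (- i) = ?z (- i) + eta o' * ?z (- o')"
    unfolding mvec_mmul E3_def using o' i no by (auto simp: mvec_Eich_short)
  have zS: "?z k \<in> S" "?v k \<in> S" if "k \<in> Omega n" for k
    using that orbS e2 SGm[OF E3 e2] by auto
  have cgv: "M.cg (?v o') (?z o')"
    unfolding v M.cg_def using M.J_left[OF cjS[OF eta] z(1), of i] M.J_uminus by simp
  have lJ: "M.lJ (?v o') = M.lJ (?z o')"
  proof
    have "?v o' \<in> M.lJ (?z o')" unfolding M.lJ_iff using cgv M.S1 by force
    then show "M.lJ (?v o') \<subseteq> M.lJ (?z o')" using zS o' by (intro M.lJ_subset)
    have "?z o' \<in> M.lJ (?v o')" unfolding M.lJ_iff using M.cg_sym[OF cgv] M.S1 by force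
    then show "M.lJ (?z o') \<subseteq> M.lJ (?v o')" using zS o' by (intro M.lJ_subset)
  qed
  have zo: "?z o' \<in> S" using zS o' by auto
  have all: "?z k \<in> M.lJ (?z o')" if k: "k \<in> Omega n" for k
  proof -
    consider "k = o'" | "k = - o'" | "k \<noteq> o'" "k \<noteq> - o'" by blast
    then show ?thesis
    proof cases
      case 1 then show ?thesis using M.lJ_self by blast
    next
      case 2
      have "?v (- i) \<in> M.lJ (?z o')"
        unfolding lJ[symmetric] using e2 E3 SGm i z by (intro absorb) (auto simp: lJ)
      moreover have "?z (- i) \<in> M.lJ (?z o')"
        using e2 i z by (intro absorb) auto
      ultimately have "cj (eta o') * (?v (- i) - ?z (- i)) \<in> M.lJ (?z o')"
        by (intro M.lJ_left[OF zo cjS[OF eta]] M.lJ_diff[OF zo])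
      then show ?thesis using 2 v by simp
    next
      case 3
      then show ?thesis using absorb[OF e2 _ k] z by simp
    qed
  qed
  have lsum: "(\<And>k. k \<in> A \<Longrightarrow> x k \<in> M.lJ (?z o')) \<Longrightarrow> sum x A \<in> M.lJ (?z o')" for A :: "int set" and x
    using M.J_lJ M.J0 by (induction A rule: infinite_finite_induct) (auto intro: M.lJ_add zo)
  have ul: "u k \<in> M.lJ (?z o')" if k: "k \<in> Omega n" for k
  proof -
    have "u k = mvec n (ginv n e2) ?z k"
      using ginv_mvec[of e2 n k u] k e2 EE_GL by (simp add: SG_def)
    also have "\<dots> \<in> M.lJ (?z o')"
      unfolding mvec_def[of n "ginv n e2"] using e2 all zo by (intro lsum M.lJ_left) (auto simp: SG_def)
    finally show ?thesis .
  qed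
  have "1 \<in> M.lJ (?z o')" unfolding w(2)[symmetric] using w zo ul by (intro lsum M.lJ_left)
  then obtain b1 where b1: "b1 \<in> S" "M.cg 1 (b1 * ?z o')" unfolding M.lJ_iff by blast
  have "1 \<in> M.lJ (?v o')" unfolding lJ by fact
  then obtain b2 where b2: "b2 \<in> S" "M.cg 1 (b2 * ?v o')" unfolding M.lJ_iff by blast
  show thesis
  proof (rule that[OF e2])
    show "M.kunit (?z o')" using b1 zo by (intro M.kunit_of_left_inverse) (auto intro: M.cg_sym)
    show "M.kunit (?z o' - cj (eta i) * ?z i)"
      unfolding v(1)[symmetric] using b2 zS o' by (intro M.kunit_of_left_inverse) (auto intro: M.cg_sym)
  qed
qed

end

section \<open>The relative commutator formula\<close>

lemma sum_fun_apply: "(\<Sum>x\<in>A. g x) b = (\<Sum>x\<in>A. (g x b :: 'a::comm_monoid_add))"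
proof (induction A rule: infinite_finite_induct)
  case (insert x F)
  show ?case unfolding sum.insert[OF insert.hyps] plus_fun_apply insert.IH ..
qed simp_all

definition gcomm :: "nat \<Rightarrow> 'a::ring_1 mat \<Rightarrow> 'a mat \<Rightarrow> 'a mat" where
  "gcomm n s t = mmul n (mmul n (mmul n s t) (ginv n s)) (ginv n t)"

lemmas gsimps = mmul_assoc ginv_mmul_distrib ginv_mmul_assoc mmul_ginv_assoc ginv_ginv
  GL_mmul ginv_GL GL_is_mat is_mat_mmul mmul_ginv ginv_mmul mmul_emat_left mmul_emat_right

locale relative = hyperbolic cj lam n Lam for cj :: "'a::ring_1 \<Rightarrow> 'a" and lam n Lam +
  fixes I Gam :: "'a set"
  assumes fi: "form_ideal cj lam Lam (I, Gam)"
begin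

lemma I0: "0 \<in> I" and I_add: "x \<in> I \<Longrightarrow> y \<in> I \<Longrightarrow> x + y \<in> I" and I_uminus: "x \<in> I \<Longrightarrow> - x \<in> I"
  and I_left: "x \<in> I \<Longrightarrow> r * x \<in> I" and I_right: "x \<in> I \<Longrightarrow> x * r \<in> I" and I_cj: "x \<in> I \<Longrightarrow> cj x \<in> I"
  and Gam0: "0 \<in> Gam" and Gam_add: "x \<in> Gam \<Longrightarrow> y \<in> Gam \<Longrightarrow> x + y \<in> Gam"
  and Gam_uminus: "x \<in> Gam \<Longrightarrow> - x \<in> Gam"
  and Gam_I: "x \<in> Gam \<Longrightarrow> x \<in> I" and Gam_Lam: "x \<in> Gam \<Longrightarrow> x \<in> Lam"
  and Gam_conj: "x \<in> Gam \<Longrightarrow> r * x * cj r \<in> Gam"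
  using fi unfolding form_ideal_def two_sided_ideal_def add_subgroup_def by auto

lemma I_diff: "x \<in> I \<Longrightarrow> y \<in> I \<Longrightarrow> x - y \<in> I"
  using I_add[OF _ I_uminus, of x y] by simp

lemma Gam_diff: "x \<in> Gam \<Longrightarrow> y \<in> Gam \<Longrightarrow> x - y \<in> Gam"
  using Gam_add[OF _ Gam_uminus, of x y] by simp

lemma Gam_conj': "x \<in> Gam \<Longrightarrow> cj r * x * r \<in> Gam"
  using Gam_conj[of x "cj r"] by simp

lemma I_sum: "(\<And>i. i \<in> A \<Longrightarrow> g i \<in> I) \<Longrightarrow> sum g A \<in> I"
  by (induction A rule: infinite_finite_induct) (auto simp: I0 I_add)

lemma Gam_min_span:
  assumes "x \<in> I" "b \<in> add_span {z * al * cj z | z al. z \<in> I \<and> al \<in> Lam}"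
  shows "x - lam * cj x + b \<in> Gam"
proof -
  have "x - lam * cj x + b \<in> Gamma_min cj lam Lam I"
    using assms by (auto simp: Gamma_min_def)
  then show ?thesis using fi by (auto simp: form_ideal_def)
qed

lemma Gam_min: assumes "x \<in> I" shows "x - lam * cj x \<in> Gam"
  using Gam_min_span[OF assms, of 0] add_subgroup_add_span[of "{z * al * cj z | z al. z \<in> I \<and> al \<in> Lam}"]
  by (simp add: add_subgroup_def)

lemma Gam_min_conj: assumes "z \<in> I" "a \<in> Lam" shows "z * a * cj z \<in> Gam"
proof -
  have "z * a * cj z \<in> add_span {z * al * cj z | z al. z \<in> I \<and> al \<in> Lam}"
    by (rule subsetD[OF add_span_incl], intro CollectI exI[of _ z] exI[of _ a] conjI refl assms)
  then show ?thesis using Gam_min_span[OF I0] by fastforce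
qed

definition vI :: "'a vec \<Rightarrow> 'a vec \<Rightarrow> bool" where "vI u v \<longleftrightarrow> (\<forall>k\<in>Omega n. u k - v k \<in> I)"

lemma vI_sym: "vI u v \<Longrightarrow> vI v u"
  unfolding vI_def using I_uminus by (metis minus_diff_eq)

lemma vI_trans: "vI u v \<Longrightarrow> vI v w \<Longrightarrow> vI u w"
  unfolding vI_def using I_add by (metis diff_add_cancel add_diff_eq)

lemma vI_mvec: "vI u v \<Longrightarrow> vI (mvec n s u) (mvec n s v)"
  unfolding vI_def mvec_def by (auto simp: right_diff_distrib[symmetric] sum_subtractf[symmetric] intro!: I_sum I_left)

lemma vI_cong: "vI u v \<Longrightarrow> (\<And>i. i \<in> Omega n \<Longrightarrow> u i = u' i) \<Longrightarrow> (\<And>i. i \<in> Omega n \<Longrightarrow> v i = v' i) \<Longrightarrow> vI u' v'"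
  by (simp add: vI_def)

lemma f_I: "(\<And>k. k \<in> Omega n \<Longrightarrow> u k \<in> I) \<Longrightarrow> f u v \<in> I" "(\<And>k. k \<in> Omega n \<Longrightarrow> v k \<in> I) \<Longrightarrow> f u v \<in> I"
proof -
  have \<Omega>: "i \<in> Omega n" "- i \<in> Omega n" if "i \<in> {1..int n}" for i using that by (auto simp: Omega_def)
  show "(\<And>k. k \<in> Omega n \<Longrightarrow> u k \<in> I) \<Longrightarrow> f u v \<in> I" "(\<And>k. k \<in> Omega n \<Longrightarrow> v k \<in> I) \<Longrightarrow> f u v \<in> I"
    unfolding form_f_def using \<Omega> by (blast intro: I_sum I_right I_cj I_left)+
qed

text \<open>With \<open>?d = r - r'\<close>, the two terms linear in \<open>?d\<close> form a
  minimal element because \<open>lam * cj a = - a\<close>, and the term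
  \<open>?d * a * cj ?d\<close> is one of the generators in \<open>Gamma_min\<close>.\<close>

lemma Lam_cong: assumes a: "a \<in> Lam" and r: "r - r' \<in> I" shows "r * a * cj r - r' * a * cj r' \<in> Gam"
proof -
  let ?d = "r - r'"
  have "lam * (r' * (cj a * cj ?d)) = r' * ((lam * cj a) * cj ?d)"
    by (simp add: lam_left_commute[of r'] mult.assoc)
  also have "\<dots> = - (r' * (a * cj ?d))" using Lam_max[OF a] by simp
  finally have "r * a * cj r - r' * a * cj r' = (?d * a * cj r' - lam * cj (?d * a * cj r')) + ?d * a * cj ?d"
    by (simp add: cjs algebra_simps)
  also have "\<dots> \<in> Gam" using r a by (intro Gam_add Gam_min Gam_min_conj I_right)
  finally show ?thesis .
qed

text \<open>Since \<open>g\<close> preserves \<open>h\<close>, the failure of additivity is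
  \<open>x - lam * cj x\<close> for the element \<open>x\<close> of \<open>I\<close> in the
  assumption.\<close>

lemma Q_add:
  assumes g: "g \<in> UU" and I: "f (mvec n g v) (mvec n g v') - f v v' \<in> I"
  shows "Q g (v' + v) - (Q g v' + Q g v) \<in> Gam"
proof -
  have 1: "f v' v + f v v' = h v' v + (f v v' - lam * cj (f v v'))" for v v' by (simp add: h_f)
  have "Q g (v' + v) - (Q g v' + Q g v)
     = (f (mvec n g v') (mvec n g v) + f (mvec n g v) (mvec n g v')) - (f v' v + f v v')"
    by (simp add: Q_def mvec_add fs algebra_simps)
  also have "\<dots> = (f (mvec n g v) (mvec n g v') - f v v') - lam * cj (f (mvec n g v) (mvec n g v') - f v v')"
    unfolding 1 U_h[OF g] by (simp add: cjs algebra_simps)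
  also have "\<dots> \<in> Gam" by (rule Gam_min[OF I])
  finally show ?thesis .
qed

lemma Q_bvecs:
  assumes g: "g \<in> UU" and Qk: "\<And>k. k \<in> Omega n \<Longrightarrow> Q g (bvec k (v k)) \<in> Gam"
    and I: "\<And>k w. k \<in> Omega n \<Longrightarrow> f (mvec n g (bvec k (v k))) (mvec n g w) - f (bvec k (v k)) w \<in> I"
  shows "Q g v \<in> Gam"
proof -
  have *: "A \<subseteq> Omega n \<Longrightarrow> Q g (\<Sum>k\<in>A. bvec k (v k)) \<in> Gam" if "finite A" for A
    using that
  proof induction
    case empty
    have "mvec n g 0 = 0" by (rule ext) (simp add: mvec_def)
    then have "Q g 0 = 0" by (simp add: Q_def)
    then have "Q g 0 \<in> Gam" using Gam0 by simp
    then show ?case unfolding sum.empty .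
  next
    case (insert x A)
    let ?s = "\<Sum>k\<in>A. bvec k (v k)"
    have x: "x \<in> Omega n" using insert.prems by simp
    have "Q g (?s + bvec x (v x)) - (Q g ?s + Q g (bvec x (v x))) \<in> Gam"
      by (rule Q_add[OF g I[OF x]])
    then have "(Q g (?s + bvec x (v x)) - (Q g ?s + Q g (bvec x (v x)))) + (Q g ?s + Q g (bvec x (v x))) \<in> Gam"
      using insert Qk[OF x] by (intro Gam_add) auto
    then have "Q g (bvec x (v x) + ?s) \<in> Gam" by (simp add: add.commute)
    then show ?case unfolding sum.insert[OF insert.hyps] .
  qed
  show ?thesis using *[of "Omega n"] Q_cong[of "\<Sum>k\<in>Omega n. bvec k (v k)" v g] by (simp add: vec_decomp)
qed

lemma Q_I: assumes g: "g \<in> UU" and v: "\<And>k. k \<in> Omega n \<Longrightarrow> v k \<in> I" shows "Q g v \<in> Gam"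
proof (rule Q_bvecs[OF g])
  fix k assume k: "k \<in> Omega n"
  have "Q g (bvec k (v k)) = cj (v k) * Q g (bvec k 1) * v k"
    using Q_vscale[of g "bvec k 1" "v k"] by (simp add: vscale_bvec)
  then show "Q g (bvec k (v k)) \<in> Gam"
    using Gam_min_conj[OF I_cj[OF v[OF k]] U_Q[OF g]] by simp
  have "bvec k (v k) i \<in> I" for i using v[OF k] I0 by (simp add: bvec_apply)
  moreover have "mvec n g (bvec k (v k)) i \<in> I" for i
    using I_left[OF v[OF k]] k by (simp add: mvec_bvec)
  ultimately show "f (mvec n g (bvec k (v k))) (mvec n g w) - f (bvec k (v k)) w \<in> I" for w
    by (intro I_diff f_I)
qed

lemma Q_vI: assumes g: "g \<in> UU" and v: "vI v v'" shows "Q g v - Q g v' \<in> Gam"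
proof -
  let ?d = "v - v'"
  have d: "?d k \<in> I" if "k \<in> Omega n" for k using v that by (simp add: vI_def)
  have m: "mvec n g ?d i \<in> I" for i
    unfolding mvec_def using d by (intro I_sum I_left) auto
  have "Q g (v' + ?d) - (Q g v' + Q g ?d) \<in> Gam"
    using d m by (intro Q_add g I_diff f_I(1)) auto
  then have "(Q g (v' + ?d) - (Q g v' + Q g ?d)) + Q g ?d \<in> Gam"
    using Q_I[OF g, of ?d] d by (intro Gam_add) auto
  then show ?thesis by simp
qed

subsection \<open>The relative elementary subgroup\<close>

definition N :: "'a mat set" where "N = EU_rel cj lam Lam n (I, Gam)"

lemma rel_gens:
  "elem_gens cj lam n I Gam =
    {Eich (bvec i 1) (bvec k r) 0 | i k r. i \<in> Omega n \<and> k \<in> Omega n \<and> k \<noteq> i \<and> k \<noteq> - i \<and> r \<in> I}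
    \<union> {Eich (bvec i 1) 0 a | i a. i \<in> Omega n \<and> a \<in> Gam}"
  by (rule elem_gens_Eich) (auto intro: I_cj I_left Gam_uminus)

lemma rel_gens_EE: "elem_gens cj lam n I Gam \<subseteq> EE"
  unfolding rel_gens by (auto intro: EE_short EE_long Gam_Lam)

lemma subgroup_EE: "subgroup EE (GLgrp n)"
  unfolding EU_eq by (rule E.G_subgroup)

lemma N_eq: "N = generate (GLgrp n)
    {mmul n (mmul n g k) (ginv n g) | g k. g \<in> EE \<and> k \<in> generate (GLgrp n) (elem_gens cj lam n I Gam)}"
  by (simp add: N_def EU_rel_def)

lemma rel_conj_EE:
  "{mmul n (mmul n g k) (ginv n g) | g k. g \<in> EE \<and> k \<in> generate (GLgrp n) (elem_gens cj lam n I Gam)} \<subseteq> EE"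
  using group.generate_subgroup_incl[OF group_GLgrp rel_gens_EE subgroup_EE] EE_mult EE_inv by blast

lemma N_EE: "N \<subseteq> EE"
  unfolding N_eq by (rule group.generate_subgroup_incl[OF group_GLgrp rel_conj_EE subgroup_EE])

lemma N_GL: "x \<in> N \<Longrightarrow> x \<in> GL n" using N_EE EE_GL by blast

lemma subgroup_N: "subgroup N (GLgrp n)"
  unfolding N_eq using rel_conj_EE EE_GL by (intro group.generate_is_subgroup[OF group_GLgrp]) auto

lemma N_mult: "a \<in> N \<Longrightarrow> b \<in> N \<Longrightarrow> mmul n a b \<in> N" using subgroup.m_closed[OF subgroup_N] by simp
lemma N_inv: "a \<in> N \<Longrightarrow> ginv n a \<in> N" using subgroup.m_inv_closed[OF subgroup_N] by simp
lemma N_one: "emat n \<in> N" using subgroup.one_closed[OF subgroup_N] by simp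

lemma N_gens: "elem_gens cj lam n I Gam \<subseteq> N"
proof
  fix k assume k: "k \<in> elem_gens cj lam n I Gam"
  then have "mmul n (mmul n (emat n) k) (ginv n (emat n)) \<in> N"
    unfolding N_eq
    by (intro generate.incl CollectI exI[of _ "emat n"] exI[of _ k] conjI) (auto simp: EE_one k generate.incl)
  moreover have "k \<in> GL n" using k rel_gens_EE EE_GL by blast
  ultimately show "k \<in> N" by (simp add: ginv_emat gsimps)
qed

lemma N_short: "i \<in> Omega n \<Longrightarrow> k \<in> Omega n \<Longrightarrow> k \<noteq> i \<Longrightarrow> k \<noteq> - i \<Longrightarrow> r \<in> I \<Longrightarrow> Eich (bvec i 1) (bvec k r) 0 \<in> N"
  using N_gens unfolding rel_gens by blast

lemma N_long: "i \<in> Omega n \<Longrightarrow> a \<in> Gam \<Longrightarrow> Eich (bvec i 1) 0 a \<in> N"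
  using N_gens unfolding rel_gens by blast

lemma N_conj: assumes "g \<in> EE" "x \<in> N" shows "mmul n (mmul n g x) (ginv n g) \<in> N"
proof -
  have g: "g \<in> GL n" using assms EE_GL by blast
  let ?S = "{mmul n (mmul n g k) (ginv n g) | g k. g \<in> EE \<and> k \<in> generate (GLgrp n) (elem_gens cj lam n I Gam)}"
  have S: "?S \<subseteq> GL n" using rel_conj_EE EE_GL by blast
  have inv: "mmul n (mmul n g (ginv n y)) (ginv n g) = ginv n (mmul n (mmul n g y) (ginv n g))" if "y \<in> GL n" for y
    using g that by (simp add: gsimps)
  have inS: "mmul n (mmul n g y) (ginv n g) \<in> ?S" if y: "y \<in> ?S" for y
  proof -
    obtain g' k where "y = mmul n (mmul n g' k) (ginv n g')" "g' \<in> EE" "k \<in> generate (GLgrp n) (elem_gens cj lam n I Gam)"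
      using y by blast
    moreover have "k \<in> GL n"
      using calculation(3) group.generate_subgroup_incl[OF group_GLgrp rel_gens_EE subgroup_EE] EE_GL by blast
    ultimately have "mmul n (mmul n g y) (ginv n g) = mmul n (mmul n (mmul n g g') k) (ginv n (mmul n g g'))"
      using g EE_GL by (simp add: gsimps)
    then show ?thesis using assms EE_mult \<open>g' \<in> EE\<close> \<open>k \<in> generate _ _\<close> by blast
  qed
  show ?thesis
    using assms(2) unfolding N_eq
  proof (induction rule: generate.induct)
    case one
    then show ?case using g N_one by (simp add: gsimps N_eq)
  next
    case (incl y)
    show ?case by (rule generate.incl[OF inS[OF incl]])
  next
    case (inv y)
    then have "y \<in> GL n" using S by blast
    moreover have "ginv n (mmul n (mmul n g y) (ginv n g)) \<in> generate (GLgrp n) ?S"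
      using inS[OF inv] by (rule generate.inv)
    ultimately show ?case by (simp add: \<open>\<And>y. y \<in> GL n \<Longrightarrow> mmul n (mmul n g (ginv n y)) (ginv n g) = _\<close>)
  next
    case (eng y z)
    then have "y \<in> GL n" "z \<in> GL n" using N_GL unfolding N_eq by blast+
    then have "mmul n (mmul n g (mmul n y z)) (ginv n g) =
       mmul n (mmul n (mmul n g y) (ginv n g)) (mmul n (mmul n g z) (ginv n g))"
      using g by (simp add: gsimps)
    then show ?case using eng by (simp add: generate.eng[of _ "GLgrp n", simplified])
  qed
qed

definition cgN :: "'a mat \<Rightarrow> 'a mat \<Rightarrow> bool" where
  "cgN a b \<longleftrightarrow> a \<in> EE \<and> b \<in> EE \<and> mmul n a (ginv n b) \<in> N"

lemma cgN_mult: assumes "cgN a b" "cgN c d" shows "cgN (mmul n a c) (mmul n b d)"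
proof -
  have GL: "a \<in> GL n" "b \<in> GL n" "c \<in> GL n" "d \<in> GL n" using assms EE_GL by (auto simp: cgN_def)
  have "mmul n (mmul n a (mmul n c (ginv n d))) (ginv n a) \<in> N" "mmul n a (ginv n b) \<in> N"
    using assms by (auto simp: cgN_def intro: N_conj)
  note N_mult[OF this]
  then show ?thesis using assms GL by (simp add: cgN_def EE_mult gsimps)
qed

lemma cgN_inv: assumes "cgN a b" shows "cgN (ginv n a) (ginv n b)"
proof -
  have GL: "a \<in> GL n" "b \<in> GL n" using assms EE_GL by (auto simp: cgN_def)
  have "mmul n (mmul n (ginv n a) (ginv n (mmul n a (ginv n b)))) (ginv n (ginv n a)) \<in> N"
    using assms by (intro N_conj N_inv) (auto simp: cgN_def EE_inv)
  then show ?thesis using assms GL by (simp add: cgN_def EE_inv gsimps)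
qed

lemma cgN_trans: assumes "cgN a b" "cgN b c" shows "cgN a c"
proof -
  have GL: "a \<in> GL n" "b \<in> GL n" "c \<in> GL n" using assms EE_GL by (auto simp: cgN_def)
  have "mmul n (mmul n a (ginv n b)) (mmul n b (ginv n c)) \<in> N"
    by (rule N_mult) (use assms in \<open>auto simp: cgN_def\<close>)
  then show ?thesis using assms GL by (simp add: cgN_def gsimps)
qed

text \<open>The double of the form ring along \<open>(I, Gam)\<close>: pairs of ring elements that agree modulo \<open>I\<close>,
  encoded as functions on \<open>bool\<close>. Its elementary group consists of pairs congruent modulo \<open>N\<close>.\<close>

definition XX :: "(bool \<Rightarrow> 'a) set" where "XX = {r. r True - r False \<in> I}"
definition LL :: "(bool \<Rightarrow> 'a) set" where
  "LL = {r. r True \<in> Lam \<and> r False \<in> Lam \<and> r True - r False \<in> Gam}"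

lemma double: "form_subring (\<lambda>r b. cj (r b)) (\<lambda>b. lam) n XX LL"
proof
  show "is_involution (\<lambda>r b. cj (r b))"
    by (simp add: is_involution_def fun_eq_iff cjs)
  show "admissible_lambda (\<lambda>r b. cj (r b)) (\<lambda>b. lam)"
    by (simp add: admissible_lambda_def fun_eq_iff lam_commute)
  show "3 \<le> n" by (rule n3)
  show "1 \<in> XX" by (simp add: XX_def I0)
next
  fix x y assume xy: "x \<in> XX" "y \<in> XX"
  have "x True + y True - (x False + y False) = (x True - x False) + (y True - y False)" by simp
  then show "x + y \<in> XX" using xy I_add by (simp only: XX_def mem_Collect_eq plus_fun_apply)
  have "x True * y True - x False * y False = (x True - x False) * y True + x False * (y True - y False)"
    by (simp add: algebra_simps)
  then show "x * y \<in> XX" using xy I_add I_left I_right by (simp add: XX_def)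
next
  fix x assume x: "x \<in> XX"
  then show "- x \<in> XX" using I_uminus[of "x True - x False"] by (simp add: XX_def)
  show "(\<lambda>b. cj (x b)) \<in> XX" using x I_cj[of "x True - x False"] by (simp add: XX_def cj_diff)
  have "x True - lam * cj (x True) - (x False - lam * cj (x False))
    = (x True - x False) - lam * cj (x True - x False)" by (simp add: cjs algebra_simps)
  moreover have "x True - x False - lam * cj (x True - x False) \<in> Gam"
    using Gam_min x by (simp add: XX_def)
  ultimately have "x True - lam * cj (x True) - (x False - lam * cj (x False)) \<in> Gam" by (simp only:)
  then show "x - (\<lambda>b. lam) * (\<lambda>b. cj (x b)) \<in> LL" by (simp add: LL_def Lam_min)
next
  show "(\<lambda>b. lam) \<in> XX" by (simp add: XX_def I0)
  show "LL \<subseteq> XX" using Gam_I by (auto simp: LL_def XX_def)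
  show "0 \<in> LL" by (simp add: LL_def Lam0 Gam0)
next
  fix x y assume xy: "x \<in> LL" "y \<in> LL"
  have "x True + y True - (x False + y False) = (x True - x False) + (y True - y False)" by simp
  then show "x + y \<in> LL" using xy Gam_add Lam_add by (simp only: LL_def mem_Collect_eq plus_fun_apply)
next
  fix x assume x: "x \<in> LL"
  then show "- x \<in> LL" using Gam_uminus[of "x True - x False"] Lam_uminus by (simp add: LL_def)
  show "(\<lambda>b. lam) * (\<lambda>b. cj (x b)) = - x"
    using x by (auto simp: LL_def fun_eq_iff all_bool_eq Lam_max)
next
  fix r x assume rx: "r \<in> XX" "x \<in> LL"
  have "r True * x True * cj (r True) - r False * x False * cj (r False)
     = (r True * x True * cj (r True) - r False * x True * cj (r False)) + r False * (x True - x False) * cj (r False)"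
    by (simp add: algebra_simps)
  also have "\<dots> \<in> Gam" using rx by (intro Gam_add Lam_cong Gam_conj) (auto simp: LL_def XX_def)
  finally show "r * x * (\<lambda>b. cj (r b)) \<in> LL" using rx Lam_conj by (simp add: LL_def)
qed

interpretation D: form_subring "\<lambda>r b. cj (r b)" "\<lambda>b. lam" n XX LL by (rule double)

lemma D_XV: "D.XV w \<longleftrightarrow> (\<forall>k\<in>Omega n. w k True - w k False \<in> I)"
  unfolding D.XV_def by (simp add: XX_def)

definition pj :: "bool \<Rightarrow> (bool \<Rightarrow> 'a) mat \<Rightarrow> 'a mat" where "pj b A = (\<lambda>i j. A i j b)"

lemma pj_mmul: "pj b (mmul n A B) = mmul n (pj b A) (pj b B)"
  by (simp add: pj_def mmul_def sum_fun_apply)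

lemma pj_emat: "pj b (emat n) = emat n"
  by (auto simp: pj_def emat_def fun_eq_iff)

lemma pj_GL: "A \<in> GL n \<Longrightarrow> pj b A \<in> GL n"
proof -
  assume "A \<in> GL n"
  then obtain B where B: "is_mat n A" "is_mat n B" "mmul n A B = emat n" "mmul n B A = emat n"
    by (auto simp: GL_def)
  have "is_mat n (pj b A)" "is_mat n (pj b B)" using B by (auto simp: is_mat_def pj_def)
  moreover have "mmul n (pj b A) (pj b B) = emat n" "mmul n (pj b B) (pj b A) = emat n"
    using B by (simp_all add: pj_emat flip: pj_mmul)
  ultimately show ?thesis by (auto simp: GL_def)
qed

lemma pj_ginv: "A \<in> GL n \<Longrightarrow> pj b (ginv n A) = ginv n (pj b A)"
  by (rule ginv_unique[symmetric]) (simp_all add: pj_GL ginv_GL ginv_mmul pj_emat flip: pj_mmul)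

lemma D_h: "D.h u v b = h (\<lambda>k. u k b) (\<lambda>k. v k b)"
  by (simp add: form_h_def sum_fun_apply)

lemma D_f: "D.f u v b = f (\<lambda>k. u k b) (\<lambda>k. v k b)"
  by (simp add: form_f_def sum_fun_apply)

lemma D_Eich: "pj b (D.Eich u v q) = Eich (\<lambda>k. u k b) (\<lambda>k. v k b) (q b)"
proof -
  have "(\<lambda>k. bvec j (1 :: bool \<Rightarrow> 'a) k b) = bvec j 1" for j by (auto simp: bvec_apply)
  then show ?thesis
    by (simp add: pj_def D.Eich_def Eich_def D.Ev_def Ev_def D_h fun_eq_iff)
qed

text \<open>Generators suffice: the components of a root element over the double differ by a root
  element with parameter in \<open>I\<close> or \<open>Gam\<close>, and congruence modulo
  \<open>N\<close>, which \<open>EE\<close> normalizes, respects products and inverses.\<close>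

lemma D_G_cgN: assumes "A \<in> D.G" shows "cgN (pj True A) (pj False A)"
proof -
  have bv: "(\<lambda>k. bvec i (r :: bool \<Rightarrow> 'a) k b) = bvec i (r b)" for i r b by (auto simp: bvec_apply)
  have "D.G \<subseteq> {A \<in> GL n. cgN (pj True A) (pj False A)}"
    unfolding D.G_def
  proof (rule group.generate_subgroup_incl[OF group_GLgrp])
    show "elem_gens (\<lambda>r b. cj (r b)) (\<lambda>b. lam) n XX LL \<subseteq> {A \<in> GL n. cgN (pj True A) (pj False A)}"
    proof
      fix A assume A: "A \<in> elem_gens (\<lambda>r b. cj (r b)) (\<lambda>b. lam) n XX LL"
      have "cgN (pj True A) (pj False A)"
        using A unfolding D.G_gens
      proof (elim UnE CollectE exE conjE)
        fix i k r assume *: "A = D.Eich (bvec i 1) (bvec k r) 0" "i \<in> Omega n" "k \<in> Omega n" "k \<noteq> i" "k \<noteq> - i" "r \<in> XX"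
        have h: "h (bvec i 1) (bvec i 1) = 0" "h (bvec i 1) (bvec k s) = 0" "h (bvec k s) (bvec k t) = 0" for s t
          using * E.h_bvec_self by (auto simp: h_bvec_bvec)
        have "- bvec k (r False) = bvec k (- r False)" "bvec k (r True) + bvec k (- r False) = bvec k (r True - r False)"
          by (auto simp: bvec_apply)
        then have "mmul n (pj True A) (ginv n (pj False A)) = Eich (bvec i 1) (bvec k (r True - r False)) 0"
          using h by (simp add: *(1) D_Eich bv ginv_Eich Eich_mult)
        then show ?thesis using * by (auto simp: cgN_def D_Eich bv EE_short XX_def intro: N_short)
      next
        fix i a assume *: "A = D.Eich (bvec i 1) 0 a" "i \<in> Omega n" "a \<in> LL"
        have h: "h (bvec i 1) (bvec i 1) = 0" using * E.h_bvec_self by auto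
        then have "mmul n (pj True A) (ginv n (pj False A)) = Eich (bvec i 1) 0 (a True - a False)"
          by (simp add: *(1) D_Eich bv ginv_Eich Eich_mult flip: zero_fun_def)
        then show ?thesis
          using * by (auto simp: cgN_def D_Eich bv EE_long LL_def simp flip: zero_fun_def intro: N_long)
      qed
      then show "A \<in> {A \<in> GL n. cgN (pj True A) (pj False A)}" using A D.gens_GL by blast
    qed
    show "subgroup {A \<in> GL n. cgN (pj True A) (pj False A)} (GLgrp n)"
    proof (rule subgroup.intro)
      show "\<one>\<^bsub>GLgrp n\<^esub> \<in> {A \<in> GL n. cgN (pj True A) (pj False A)}"
        using group.is_monoid[OF group_GLgrp, of n]
        by (auto simp: pj_emat cgN_def EE_one ginv_emat N_one gsimps is_mat_emat monoid_def)
    qed (auto simp: gsimps pj_mmul pj_ginv intro: cgN_mult cgN_inv)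
  qed
  then show ?thesis using assms by blast
qed

lemma Eich_bvec_cgN:
  assumes p: "p \<in> Omega n" and v: "v (- p) = 0" "v' (- p) = 0" "vI v v'"
    and q: "q - f v v \<in> Lam" "q' - f v' v' \<in> Lam" "(q - f v v) - (q' - f v' v') \<in> Gam"
  shows "cgN (Eich (bvec p 1) v q) (Eich (bvec p 1) v' q')"
proof -
  let ?v = "\<lambda>k b. if k \<in> Omega n then if b then v k else v' k else 0" and ?q = "\<lambda>b. if b then q else q'"
  have vb: "f (\<lambda>k. ?v k True) (\<lambda>k. ?v k True) = f v v" "f (\<lambda>k. ?v k False) (\<lambda>k. ?v k False) = f v' v'"
    by (rule f_cong; simp)+
  have "D.Eich (bvec p 1) ?v ?q \<in> D.G"
    using p v q by (intro D.Eich_bvec_G) (auto simp: D_XV I0 LL_def vI_def D_f fun_eq_iff vb)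
  then have "cgN (pj True (D.Eich (bvec p 1) ?v ?q)) (pj False (D.Eich (bvec p 1) ?v ?q))"
    by (rule D_G_cgN)
  moreover have "(\<lambda>k. bvec p (1 :: bool \<Rightarrow> 'a) k b) = bvec p 1" for b by (auto simp: bvec_apply)
  moreover have "Eich (bvec p 1) (\<lambda>k. ?v k True) q = Eich (bvec p 1) v q"
    "Eich (bvec p 1) (\<lambda>k. ?v k False) q' = Eich (bvec p 1) v' q'" by (rule Eich_cong; simp)+
  ultimately show ?thesis by (simp add: D_Eich)
qed

text \<open>Both sides are components of one transvection over the double. The vectors
  \<open>u\<close> and \<open>u'\<close> share \<open>B\<close> and \<open>s\<close>, so that these
  become constant pairs, which are trivially congruent.\<close>

lemma Eich_scaled_cgN:
  assumes o': "o' \<in> Omega n" and u: "vI u u'" "h u u = 0" "h u' u' = 0" "f u u \<in> Lam" "f u' u' \<in> Lam"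
      "f u u - f u' u' \<in> Gam"
    and B: "u o' * B = s" "B * u o' = s" "u' o' * B = s" "B * u' o' = s" and s: "cj s = s" "s * B = B * s"
    and su: "\<And>k. k \<in> Omega n \<Longrightarrow> s * u k = u k * s" "\<And>k. k \<in> Omega n \<Longrightarrow> s * u' k = u' k * s"
    and v: "vI v v'" "h u v = 0" "h u' v' = 0" "q - f v v \<in> Lam" "q' - f v' v' \<in> Lam"
      "(q - f v v) - (q' - f v' v') \<in> Gam"
    and sv: "\<And>k. k \<in> Omega n \<Longrightarrow> s * v k = v k * s" "\<And>k. k \<in> Omega n \<Longrightarrow> s * v' k = v' k * s"
  shows "cgN (Eich u (vscale v (s ^ 6)) (s ^ 6 * q * s ^ 6)) (Eich u' (vscale v' (s ^ 6)) (s ^ 6 * q' * s ^ 6))"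
proof -
  let ?p = "\<lambda>(v :: 'a vec) (v' :: 'a vec) k b. if k \<in> Omega n then if b then v k else v' k else 0"
  let ?q = "\<lambda>b. if b then q else q'"
  have fp: "f (\<lambda>k. ?p v v' k True) (\<lambda>k. ?p w w' k True) = f v w" "f (\<lambda>k. ?p v v' k False) (\<lambda>k. ?p w w' k False) = f v' w'"
    for v v' w w' by (rule f_cong; simp)+
  have hp: "h (\<lambda>k. ?p v v' k True) (\<lambda>k. ?p w w' k True) = h v w" "h (\<lambda>k. ?p v v' k False) (\<lambda>k. ?p w w' k False) = h v' w'"
    for v v' w w' by (rule h_cong; simp)+
  have D0: "D.h (?p v v') (?p w w') = 0" if "h v w = 0" "h v' w' = 0" for v v' w w'
    using that by (auto simp: fun_eq_iff D_h all_bool_eq hp)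
  have XV: "D.XV (?p v v')" if "vI v v'" for v v' using that by (auto simp: D_XV vI_def I0)
  have "D.Eich (?p u u') (vscale (?p v v') ((\<lambda>_. s) ^ 6)) ((\<lambda>_. s) ^ 6 * ?q * (\<lambda>_. s) ^ 6) \<in> D.G"
  proof (rule D.Eich_scaled_G[where B = "\<lambda>_. B"])
    show "o' \<in> Omega n" "D.XV (?p u u')" "D.XV (?p v v')" "D.h (?p u u') (?p u u') = 0" "D.h (?p u u') (?p v v') = 0"
      using o' u v by (auto intro!: XV D0)
    show "D.f (?p u u') (?p u u') \<in> LL" "?q - D.f (?p v v') (?p v v') \<in> LL"
      using u v by (auto simp: LL_def D_f fp)
    show "(\<lambda>_. B) \<in> XX" by (simp add: XX_def I0)
  qed (use o' B s su sv in \<open>auto simp: fun_eq_iff\<close>)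
  from D_G_cgN[OF this] have "cgN (pj True (D.Eich (?p u u') (vscale (?p v v') ((\<lambda>_. s) ^ 6)) ((\<lambda>_. s) ^ 6 * ?q * (\<lambda>_. s) ^ 6)))
      (pj False (D.Eich (?p u u') (vscale (?p v v') ((\<lambda>_. s) ^ 6)) ((\<lambda>_. s) ^ 6 * ?q * (\<lambda>_. s) ^ 6)))" .
  moreover have "((\<lambda>_. s) ^ k) b = s ^ k" for k and b :: bool by (induction k) auto
  moreover have "Eich (\<lambda>k. ?p u u' k True) (\<lambda>k. ?p v v' k True * s ^ 6) r = Eich u (vscale v (s ^ 6)) r"
    "Eich (\<lambda>k. ?p u u' k False) (\<lambda>k. ?p v v' k False * s ^ 6) r = Eich u' (vscale v' (s ^ 6)) r" for r
    by (rule Eich_cong; simp)+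
  ultimately show ?thesis by (simp add: D_Eich)
qed

text \<open>A description of \<open>CU_rel\<close> by matrix entries: \<open>s\<close> is a scalar \<open>c\<close> modulo \<open>I\<close>, central modulo \<open>I\<close>
  (apply the first condition to \<open>bvec j x\<close>), and both \<open>s\<close> and \<open>c\<close> are compatible with \<open>Gam\<close>.\<close>

definition CUp :: "'a mat \<Rightarrow> bool" where
  "CUp s \<longleftrightarrow> s \<in> UU \<and> (\<exists>c. (\<forall>v. vI (mvec n s v) (vscale v c)) \<and> (\<forall>a\<in>Lam. a - cj c * a * c \<in> Gam))
     \<and> (\<forall>v. Q s v \<in> Gam)"

text \<open>The defect of the conjugate is that of \<open>s\<close> plus the difference of
  \<open>Q g\<close> at \<open>mvec n s ?w\<close> and at \<open>?w\<close>. Modulo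
  \<open>Gam\<close> the former is \<open>cj c * Q g ?w * c\<close>, and the condition on
  \<open>c\<close> and \<open>Lam\<close> finishes.\<close>

lemma CUp_conj:
  assumes s: "CUp s" and g: "g \<in> UU" shows "CUp (mmul n (mmul n g s) (ginv n g))"
proof -
  let ?s = "mmul n (mmul n g s) (ginv n g)"
  obtain c where c: "\<And>v. vI (mvec n s v) (vscale v c)" "\<And>a. a \<in> Lam \<Longrightarrow> a - cj c * a * c \<in> Gam"
    and Qs: "\<And>v. Q s v \<in> Gam" and sU: "s \<in> UU" using s by (auto simp: CUp_def)
  have GL: "g \<in> GL n" "s \<in> GL n" using g sU U_GL by auto
  have "vI (mvec n ?s v) (vscale v c)" for v
  proof (rule vI_cong[OF vI_mvec[OF c(1)]])
    show "mvec n g (mvec n s (mvec n (ginv n g) v)) i = mvec n ?s v i" for i by (simp add: mvec_mmul)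
    show "mvec n g (vscale (mvec n (ginv n g) v) c) i = vscale v c i" if "i \<in> Omega n" for i
      using that GL by (simp add: mvec_vscale mvec_ginv)
  qed
  moreover have "Q ?s v \<in> Gam" for v
  proof -
    let ?w = "mvec n (ginv n g) v"
    have "mmul n ?s g = mmul n g s" using GL by (simp add: gsimps)
    then have "Q ?s (mvec n g ?w) + Q g ?w = Q g (mvec n s ?w) + Q s ?w" by (metis Q_mult)
    moreover have "Q ?s (mvec n g ?w) = Q ?s v" using GL by (intro Q_cong) (simp add: mvec_ginv)
    ultimately have "Q ?s v = Q g (mvec n s ?w) + Q s ?w - Q g ?w"
      by (simp add: eq_diff_eq)
    also have "\<dots> = (Q g (mvec n s ?w) - Q g (vscale ?w c)) + Q s ?w - (Q g ?w - cj c * Q g ?w * c)"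
      by (simp add: Q_vscale)
    also have "\<dots> \<in> Gam" by (intro Gam_diff Gam_add Q_vI g c Qs U_Q)
    finally show ?thesis .
  qed
  ultimately show ?thesis using c(2) g sU by (auto simp: CUp_def U_mult U_inv)
qed

lemma f_vI: assumes "vI u u'" "vI v v'" shows "f u v - f u' v' \<in> I"
proof -
  have "f u v - f u' v' = f (u - u') v + f u' (v - v')" by (simp add: fs)
  also have "\<dots> \<in> I" using assms by (intro I_add f_I) (auto simp: vI_def)
  finally show ?thesis .
qed

lemma h_vI: assumes "vI u u'" "vI v v'" shows "h u v - h u' v' \<in> I"
proof -
  have "h u v - h u' v' = (f u v - f u' v') + lam * cj (f v u - f v' u')"
    by (simp add: h_f cjs algebra_simps)
  also have "\<dots> \<in> I" using assms by (intro I_add I_left I_cj f_vI)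
  finally show ?thesis .
qed

text \<open>Preservation of \<open>h\<close> on a hyperbolic pair into which \<open>y\<close> has
  been inserted as a scalar.\<close>

lemma scalar_unitary:
  assumes s: "s \<in> UU" and c: "\<And>v. vI (mvec n s v) (vscale v c)"
  shows "y - cj c * y * c \<in> I"
proof -
  have "(1::int) \<in> Omega n" using n3 by (auto simp: Omega_def)
  moreover have "h (mvec n s (bvec 1 (cj y))) (mvec n s (bvec (- 1) 1))
      - h (vscale (bvec 1 (cj y)) c) (vscale (bvec (- 1) 1) c) \<in> I"
    by (intro h_vI c)
  ultimately show ?thesis by (simp add: U_h[OF s] hs h_bvec_bvec eta_def)
qed

text \<open>The scalar of \<open>CUp\<close> may be taken to be a diagonal entry of
  \<open>s\<close>: such an entry commutes with the denominators used later, and it is the one whose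
  inverse \<open>B\<close> is available.\<close>

lemma CUp_diag:
  assumes s: "CUp s" and o': "o' \<in> Omega n"
  defines "a \<equiv> s o' o'"
  shows "\<And>v. vI (mvec n s v) (vscale v a)" "\<And>b. b \<in> Lam \<Longrightarrow> b - cj a * b * a \<in> Gam"
    and "a * cj a - 1 \<in> I"
proof -
  obtain c where c: "\<And>v. vI (mvec n s v) (vscale v c)" "\<And>a. a \<in> Lam \<Longrightarrow> a - cj c * a * c \<in> Gam"
    and sU: "s \<in> UU" using s by (auto simp: CUp_def)
  have ax: "a * x - x * c \<in> I" for x
    using c(1)[of "bvec o' x"] o' unfolding vI_def by (auto simp: a_def mvec_bvec bvec_apply)
  have ac: "a - c \<in> I" using ax[of 1] by simp
  show 1: "vI (mvec n s v) (vscale v a)" for v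
  proof (rule vI_trans[OF c(1)])
    show "vI (vscale v c) (vscale v a)"
      using I_uminus[OF ac] by (auto simp: vI_def right_diff_distrib[symmetric] intro!: I_left)
  qed
  show "b - cj a * b * a \<in> Gam" if b: "b \<in> Lam" for b
  proof -
    have "cj a - cj c \<in> I" using I_cj[OF ac] by (simp add: cj_diff)
    from Lam_cong[OF b this] have "cj a * b * a - cj c * b * c \<in> Gam" by simp
    from Gam_diff[OF c(2)[OF b] this] show ?thesis by (simp add: algebra_simps)
  qed
  have "1 - cj a * a \<in> I" using scalar_unitary[OF sU 1, of 1] by simp
  moreover have "a * cj a - cj a * a \<in> I"
  proof -
    have "(a * cj a - cj a * c) + cj a * (c - a) \<in> I"
      using ax I_left[OF I_uminus[OF ac], of "cj a"] by (intro I_add) auto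
    then show ?thesis by (simp add: algebra_simps)
  qed
  ultimately have "(a * cj a - cj a * a) - (1 - cj a * a) \<in> I" by (rule I_diff[rotated])
  then show "a * cj a - 1 \<in> I" by simp
qed

text \<open>The column of \<open>s\<close> with index \<open>o'\<close> is compared with its twin \<open>vscale (bvec o' 1) a\<close> in the doubled form ring.\<close>

lemma CUp_local:
  assumes s: "CUp s" and o': "o' \<in> Omega n" and B: "s o' o' * B = t" "B * s o' o' = t"
    and t: "cj t = t" "t * B = B * t" and ts: "\<And>k l. k \<in> Omega n \<Longrightarrow> l \<in> Omega n \<Longrightarrow> t * s k l = s k l * t"
    and v: "v (- o') = 0" "q - f v v \<in> Lam" and tv: "\<And>k. k \<in> Omega n \<Longrightarrow> t * v k = v k * t"
  defines "y \<equiv> Eich (bvec o' 1) (vscale v (t ^ 6)) (t ^ 6 * q * t ^ 6)"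
  shows "cgN (mmul n (mmul n s y) (ginv n s)) y"
proof -
  define a where "a = s o' o'"
  have sU: "s \<in> UU" and Qs: "Q s w \<in> Gam" for w using s by (auto simp: CUp_def)
  note diag = CUp_diag[OF s o', folded a_def]
  let ?e = "bvec o' 1" let ?u = "mvec n s ?e" let ?u' = "vscale ?e a" let ?v = "mvec n s v" let ?v' = "vscale v a"
  have ee: "h ?e ?e = 0" "f ?e ?e = 0" using o' by (simp_all add: E.h_bvec_self E.f_bvec_self)
  have ev: "h ?e v = 0" using o' v by (simp add: h_bvec_left)
  have ta: "t * a = a * t" using ts o' by (simp add: a_def)
  have tm: "t * (x * z) = (x * z) * t" if "t * x = x * t" "t * z = z * t" for x z
    using that by (metis mult.assoc)
  have tsum: "t * (\<Sum>i\<in>A. g i) = (\<Sum>i\<in>A. g i) * t" if "\<And>i. i \<in> A \<Longrightarrow> t * g i = g i * t" for A :: "int set" and g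
    using that by (simp add: sum_distrib_left sum_distrib_right)
  have fu: "f ?u ?u = Q s ?e" by (simp add: Q_def ee)
  have fv: "f ?v ?v = Q s v + f v v" by (simp add: Q_def)
  have cg: "cgN (Eich ?u (vscale ?v (t ^ 6)) (t ^ 6 * q * t ^ 6))
      (Eich ?u' (vscale ?v' (t ^ 6)) (t ^ 6 * (cj a * q * a) * t ^ 6))"
  proof (rule Eich_scaled_cgN[OF o', where B = B])
    show "h ?u ?u = 0" "h ?u ?v = 0" using U_h[OF sU] ee ev by simp_all
    show "h ?u' ?u' = 0" "h ?u' ?v' = 0" using ee ev by (simp_all add: hs)
    show "f ?u ?u \<in> Lam" unfolding fu by (rule U_Q[OF sU])
    show "f ?u' ?u' \<in> Lam" by (simp add: fs ee Lam0)
    show "f ?u ?u - f ?u' ?u' \<in> Gam" using Qs by (simp add: fu) (simp add: fs ee)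
    show "q - f ?v ?v \<in> Lam"
      using Lam_diff[OF v(2) U_Q[OF sU, of v]] by (simp add: fv algebra_simps)
    show "cj a * q * a - f ?v' ?v' \<in> Lam"
      using Lam_conj'[OF v(2), of a] by (simp add: fs algebra_simps)
    have "((q - f v v) - cj a * (q - f v v) * a) - Q s v \<in> Gam"
      by (intro Gam_diff diag v Qs)
    then show "q - f ?v ?v - (cj a * q * a - f ?v' ?v') \<in> Gam"
      by (simp add: fv) (simp add: fs algebra_simps)
    show "?u o' * B = t" "B * ?u o' = t" "?u' o' * B = t" "B * ?u' o' = t"
      using B o' by (simp_all add: mvec_bvec a_def bvec_apply)
    fix k assume k: "k \<in> Omega n"
    show "t * ?u k = ?u k * t" using ts k o' by (simp add: mvec_bvec)
    show "t * ?u' k = ?u' k * t" using ta by (simp add: bvec_apply)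
    show "t * ?v k = ?v k * t" unfolding mvec_def using ts tv k by (intro tsum tm) auto
    show "t * ?v' k = ?v' k * t" using tm[OF tv[OF k] ta] by simp
  qed (use t in \<open>auto intro: diag\<close>)
  \<comment> \<open>Moving \<open>a\<close> out of the direction \<open>?u'\<close> leaves
    \<open>bvec o' 1\<close> with the scaling factor \<open>r\<close>, which is congruent to
    \<open>t ^ 6\<close> because \<open>a * cj a\<close> is congruent to 1.\<close>
  define r where "r = a * t ^ 6 * cj a"
  have tpow: "t ^ k * x = x * t ^ k" if "t * x = x * t" for k x
    by (induction k) (auto simp: mult.assoc that simp flip: power_commutes, metis that mult.assoc)
  have ct: "cj (t ^ k) = t ^ k" for k by (induction k) (auto simp: cj_mult t power_commutes)
  have cr: "cj r = r" by (simp add: r_def cjs ct mult.assoc)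
  have rI: "r - t ^ 6 \<in> I"
  proof -
    have "r = t ^ 6 * (a * cj a)" using tpow[OF ta, of 6] by (simp add: r_def mult.assoc[symmetric])
    then show ?thesis using I_left[OF diag(3), of "t ^ 6"] by (simp add: algebra_simps)
  qed
  have "Eich ?u' (vscale ?v' (t ^ 6)) (t ^ 6 * (cj a * q * a) * t ^ 6) = Eich ?e (vscale v r) (r * q * r)"
    by (simp add: Eich_vscale_left vscale_vscale r_def mult.assoc)
  moreover have "cgN (Eich ?e (vscale v r) (r * q * r)) y"
    unfolding y_def
  proof (rule Eich_bvec_cgN[OF o'])
    show "vI (vscale v r) (vscale v (t ^ 6))"
      using rI by (auto simp: vI_def right_diff_distrib[symmetric] intro!: I_left)
    have 1: "r * q * r - f (vscale v r) (vscale v r) = r * (q - f v v) * cj r"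
      by (simp add: fs cr algebra_simps)
    have 2: "t ^ 6 * q * t ^ 6 - f (vscale v (t ^ 6)) (vscale v (t ^ 6)) = t ^ 6 * (q - f v v) * cj (t ^ 6)"
      by (simp add: fs ct algebra_simps)
    show "r * q * r - f (vscale v r) (vscale v r) \<in> Lam" unfolding 1 by (rule Lam_conj[OF v(2)])
    show "t ^ 6 * q * t ^ 6 - f (vscale v (t ^ 6)) (vscale v (t ^ 6)) \<in> Lam" unfolding 2 by (rule Lam_conj[OF v(2)])
    show "r * q * r - f (vscale v r) (vscale v r) - (t ^ 6 * q * t ^ 6 - f (vscale v (t ^ 6)) (vscale v (t ^ 6))) \<in> Gam"
      unfolding 1 2 by (rule Lam_cong[OF v(2) rI])
  qed (use v in auto)
  ultimately have "cgN (Eich ?u (vscale ?v (t ^ 6)) (t ^ 6 * q * t ^ 6)) y"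
    using cg cgN_trans by simp
  then show ?thesis by (simp add: y_def U_conj_Eich[OF sU] mvec_vscale)
qed

text \<open>Commuting with \<open>s\<close> modulo \<open>N\<close>; for fixed \<open>s\<close> such
  \<open>t\<close> form a subgroup, so that generators suffice.\<close>

definition Zr :: "'a mat \<Rightarrow> 'a mat \<Rightarrow> bool" where
  "Zr s t \<longleftrightarrow> cgN (mmul n (mmul n s t) (ginv n s)) t"

lemma Zr_EE: "Zr s t \<Longrightarrow> t \<in> EE" by (simp add: Zr_def cgN_def)

lemma Zr_mult: assumes "s \<in> GL n" "Zr s t" "Zr s t'" shows "Zr s (mmul n t t')"
  using cgN_mult[OF assms(2,3)[unfolded Zr_def]] assms(1) Zr_EE[OF assms(2)] Zr_EE[OF assms(3)] EE_GL
  by (simp add: Zr_def gsimps)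

lemma Zr_inv: assumes "s \<in> GL n" "Zr s t" shows "Zr s (ginv n t)"
  using cgN_inv[OF assms(2)[unfolded Zr_def]] assms(1) Zr_EE[OF assms(2)] EE_GL
  by (simp add: Zr_def gsimps)

lemma cgN_refl: "a \<in> EE \<Longrightarrow> cgN a a"
  using EE_GL by (simp add: cgN_def gsimps N_one)

lemma Zr_one: "s \<in> GL n \<Longrightarrow> Zr s (emat n)"
  using cgN_refl[OF EE_one] by (simp add: Zr_def gsimps is_mat_emat)

lemma Zr_conj:
  assumes s: "s \<in> GL n" and e: "e \<in> EE" and t: "t \<in> EE"
    and Z: "Zr (mmul n (mmul n e s) (ginv n e)) (mmul n (mmul n e t) (ginv n e))"
  shows "Zr s t"
proof -
  have GL: "e \<in> GL n" "t \<in> GL n" using e t EE_GL by auto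
  have "cgN (mmul n (ginv n e) (mmul n
      (mmul n (mmul n (mmul n (mmul n e s) (ginv n e)) (mmul n (mmul n e t) (ginv n e))) (ginv n (mmul n (mmul n e s) (ginv n e)))) e))
    (mmul n (ginv n e) (mmul n (mmul n (mmul n e t) (ginv n e)) e))"
    by (rule cgN_mult[OF cgN_refl[OF EE_inv[OF e]] cgN_mult[OF Z[unfolded Zr_def] cgN_refl[OF e]]])
  then show ?thesis using s GL by (simp add: Zr_def gsimps)
qed

text \<open>The denominators for which all scaled transvections along \<open>bvec o' 1\<close>
  commute with \<open>s\<close> form an ideal of \<open>K\<close>, so one outside each
  \<open>M\<close> is enough. There, conjugation by an \<open>e\<close> fixing
  \<open>bvec o' 1\<close> makes a diagonal entry of \<open>s\<close> invertible and keeps the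
  direction of the transvections, and \<open>CUp_local\<close> applies.\<close>

lemma Zr_Eich_bvec:
  assumes qf: "quasi_finite cj lam" and s: "CUp s" and o': "o' \<in> Omega n"
    and v: "v (- o') = 0" "q - f v v \<in> Lam"
  shows "Zr s (Eich (bvec o' 1) v q)"
proof -
  have sU: "s \<in> UU" using s by (auto simp: CUp_def)
  have sGL: "s \<in> GL n" using sU U_GL by blast
  let ?e = "bvec o' 1"
  let ?Y = "(\<lambda>(i, j). s i j) ` (Omega n \<times> Omega n) \<union> (\<lambda>(i, j). ginv n s i j) ` (Omega n \<times> Omega n)
     \<union> insert q (v ` Omega n)"
  have finY: "finite ?Y" by simp
  obtain S K g d where S: "finite_extension S K g d" "?Y \<subseteq> S" "lam \<in> S" "cj ` S \<subseteq> S" and Kcj: "\<And>k. k \<in> K \<Longrightarrow> cj k = k"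
    by (rule quasi_finite_finite_extension[OF inv qf finY]) (rule that)
  interpret S: finite_extension S K g d by fact
  have S0: "0 \<in> S" using S.S_add[OF S.S1 S.S_uminus[OF S.S1]] by simp
  have sum: "(\<And>i. i \<in> A \<Longrightarrow> u i \<in> S) \<Longrightarrow> sum u A \<in> S" for A :: "int set" and u
    by (induction A rule: infinite_finite_induct) (auto simp: S0 intro: S.S_add)
  have ent: "s i j \<in> S" "ginv n s i j \<in> S" if "i \<in> Omega n" "j \<in> Omega n" for i j
    using S(2) that by auto
  \<comment> \<open>All transvections with data in \<open>S\<close> are treated at once, because the
    closure properties below pass from one \<open>v\<close> and \<open>q\<close> to others.\<close>
  define adm where "adm = (\<lambda>v q. (\<forall>k\<in>Omega n. v k \<in> S) \<and> v (- o') = 0 \<and> q \<in> S \<and> q - f v v \<in> Lam)"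
  define A where "A = {t \<in> K. \<forall>v q. adm v q \<longrightarrow> Zr s (Eich ?e (vscale v t) (t * q * t))}"
  have AD: "Zr s (Eich ?e (vscale v t) (t * q * t))" if "t \<in> A" "adm v q" for t v q
    using that by (auto simp: A_def)
  have ee: "h ?e ?e = 0" using o' by (simp add: E.h_bvec_self)
  have ev: "h ?e v = 0" if "v (- o') = 0" for v using o' that by (simp add: h_bvec_left)
  have KK: "x * y = y * x" if "x \<in> K" "y \<in> K" for x y using that S.KS S.central by blast
  have "1 \<in> A"
  proof (rule S.local_global)
    show "A \<subseteq> K" by (auto simp: A_def)
    have "0 \<in> K" using S.K_add[OF S.K1 S.K_uminus[OF S.K1]] by simp
    then show "0 \<in> A" by (simp add: A_def Eich_0 Zr_one sGL)
  next
    fix x y assume xy: "x \<in> A" "y \<in> A"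
    have K: "x \<in> K" "y \<in> K" using xy by (auto simp: A_def)
    have "Zr s (Eich ?e (vscale v (x + y)) ((x + y) * q * (x + y)))" if vq: "adm v q" for v q
    proof -
      have c: "x * z = z * x" "y * z = z * y" if "z \<in> S" for z using K that S.central by auto
      have qS: "q \<in> S" and v0: "v (- o') = 0" and qv: "q - f v v \<in> Lam" using vq by (auto simp: adm_def)
      \<comment> \<open>The product of the transvections scaled by \<open>x\<close> and
        \<open>y\<close> has cross term \<open>x * y * (q + lam * cj q)\<close>, while
        \<open>(x + y) * q * (x + y)\<close> asks for \<open>2 * x * y * q\<close>. The difference
        \<open>x * y * (q - lam * cj q)\<close> comes, through \<open>Eich_self\<close>, from a
        vector part parallel to the axis.\<close>
      have "adm (bvec o' (y * q)) 0"
        using o' S0 S.S_mult[OF subsetD[OF S.KS K(2)] qS] by (auto simp: adm_def bvec_apply E.f_bvec_self Lam0)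
      then have "Zr s (Eich ?e (vscale (bvec o' (y * q)) x) (x * 0 * x))" by (rule AD[OF xy(1)])
      moreover have "vscale (bvec o' (y * q)) x = vscale ?e (y * q * x)" by (simp add: vscale_bvec)
      moreover have "lam * cj (y * q * x) = x * y * (lam * cj q)"
      proof -
        have "cj q \<in> S" using qS S(4) by auto
        then have "lam * cj q \<in> S" using S(3) S.S_mult by blast
        have "lam * cj (y * q * x) = lam * (x * (cj q * y))" using K by (simp add: cj_mult Kcj mult.assoc)
        also have "\<dots> = x * (lam * cj q * y)" by (simp add: lam_left_commute[of x] mult.assoc)
        also have "\<dots> = x * (y * (lam * cj q))" using c(2)[OF \<open>lam * cj q \<in> S\<close>] by simp
        finally show ?thesis by (simp add: mult.assoc)
      qed
      moreover have "y * q * x = x * y * q"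
      proof -
        have "y * q \<in> S" using K S.KS qS S.S_mult by blast
        then show ?thesis using c(1)[of "y * q"] by (simp add: mult.assoc)
      qed
      ultimately have Z3: "Zr s (Eich ?e 0 (x * y * q - x * y * (lam * cj q)))"
        by (simp add: Eich_self)
      have Z1: "Zr s (Eich ?e (vscale v x) (x * q * x))" "Zr s (Eich ?e (vscale v y) (y * q * y))"
        using xy vq by (auto simp: A_def)
      have hv: "h v v = q + lam * cj q" using E.h_self_of_L[OF qv] by simp
      have "Zr s (mmul n (mmul n (Eich ?e (vscale v x) (x * q * x)) (Eich ?e (vscale v y) (y * q * y)))
          (Eich ?e 0 (x * y * q - x * y * (lam * cj q))))"
        by (intro Zr_mult sGL Z1 Z3)
      moreover have "x * q * x + y * q * y + cj x * h v v * y + (x * y * q - x * y * (lam * cj q))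
          = (x + y) * q * (x + y)"
      proof -
        have "cj q \<in> S" using qS S(4) by auto
        then have l: "lam * cj q \<in> S" using S(3) S.S_mult by blast
        have "q * y = y * q" "q * x = x * q" "lam * cj q * y = y * (lam * cj q)" "y * x = x * y"
          using c[OF qS] c(2)[OF l] KK[OF K] by simp_all
        moreover have "x * (x * z) = x * (x * z)" "y * (x * z) = x * (y * z)" for z
          using KK[OF K] by (metis mult.assoc)+
        ultimately show ?thesis using K by (simp add: Kcj hv distrib_left distrib_right mult.assoc algebra_simps)
      qed
      ultimately show ?thesis using ee ev[of v, OF v0]
        by (simp add: Eich_mult hs flip: vscale_add)
          (simp add: vscale_def fun_eq_iff distrib_left plus_fun_def)
    qed
    then show "x + y \<in> A" using K S.K_add by (auto simp: A_def)
  next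
    fix k x assume k: "k \<in> K" and x: "x \<in> A"
    have xK: "x \<in> K" using x by (auto simp: A_def)
    have "Zr s (Eich ?e (vscale v (k * x)) ((k * x) * q * (k * x)))" if vq: "adm v q" for v q
    proof -
      have "k * (q - f v v) * cj k \<in> Lam" using vq by (intro Lam_conj) (auto simp: adm_def)
      then have "adm (vscale v k) (k * q * k)"
        using vq k S.KS by (auto simp: adm_def fs Kcj algebra_simps intro!: S.S_mult)
      then have "Zr s (Eich ?e (vscale (vscale v k) x) (x * (k * q * k) * x))" using x by (auto simp: A_def)
      moreover have "x * (k * q * k) * x = (k * x) * q * (k * x)" using KK[OF k xK] by (metis mult.assoc)
      ultimately show ?thesis by (simp add: vscale_vscale)
    qed
    then show "k * x \<in> A" using k xK S.K_mult by (auto simp: A_def)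
  next
    fix M assume M: "central_extension S K g d M"
    interpret M: central_extension S K g d M by fact
    obtain i where i: "i \<in> Omega n" "i \<noteq> o'" "i \<noteq> - o'" using exists_index[OF o' o'] by blast
    let ?u = "mvec n s ?e"
    have "\<exists>e. SG S o' e \<and> M.kunit (mvec n e ?u o')"
    proof (rule exists_kunit_entry[OF S(4,3) M o' i])
      show "?u k \<in> S" if "k \<in> Omega n" for k using that o' ent by (simp add: mvec_bvec)
      show "ginv n s o' k \<in> S" if "k \<in> Omega n" for k using that o' ent by simp
      have "mmul n (ginv n s) s o' o' = 1" using o' sGL by (simp add: ginv_mmul emat_def)
      then show "(\<Sum>k\<in>Omega n. ginv n s o' k * ?u k) = 1" using o' by (simp add: mmul_def mvec_bvec)
    qed blast
    then obtain e where e: "SG S o' e" and ku: "M.kunit (mvec n e ?u o')" by blast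
    have eE: "e \<in> EE" and eGL: "e \<in> GL n" and eU: "e \<in> UU" using e EE_GL EE_U by (auto simp: SG_def)
    obtain B t where B: "B \<in> S" "t \<in> K" "t \<notin> M" "mvec n e ?u o' * B = t" "B * mvec n e ?u o' = t"
      using ku unfolding M.kunit_def by blast
    let ?s = "mmul n (mmul n e s) (ginv n e)"
    have soo: "?s o' o' = mvec n e ?u o'" by (rule conj_column[OF eGL _ o']) (use e in \<open>auto simp: SG_def\<close>)
    have sent: "?s k l \<in> S" if "k \<in> Omega n" "l \<in> Omega n" for k l
      unfolding mmul_def using e ent that by (intro sum S.S_mult) (auto simp: SG_def)
    have tS: "t \<in> S" using B S.KS by blast
    have tc: "t * x = x * t" if "x \<in> S" for x using that B S.central by blast
    have tA: "Zr s (Eich ?e (vscale v (t ^ 6)) (t ^ 6 * q * t ^ 6))" if vq: "adm v q" for v q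
    proof -
      have v: "\<And>k. k \<in> Omega n \<Longrightarrow> v k \<in> S" "v (- o') = 0" "q \<in> S" "q - f v v \<in> Lam" using vq by (auto simp: adm_def)
      let ?v = "mvec n e v"
      let ?y = "Eich ?e (vscale ?v (t ^ 6)) (t ^ 6 * q * t ^ 6)"
      have vS: "?v k \<in> S" if "k \<in> Omega n" for k
        unfolding mvec_def using e v by (intro sum S.S_mult) (auto simp: SG_def)
      have "h ?e ?v = h (mvec n e ?e) ?v" using e by (intro h_cong) (auto simp: SG_def)
      also have "\<dots> = 0" using U_h[OF eU] ev[of v, OF v(2)] by simp
      finally have "eta o' * ?v (- o') = 0" using o' by (simp add: h_bvec_left)
      then have v0: "?v (- o') = 0" by (metis eta_cj_assoc(2) mult_zero_right)
      have qv: "q - f ?v ?v \<in> Lam"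
        using Lam_diff[OF v(4) U_Q[OF eU, of v]] by (simp add: Q_def algebra_simps)
      have "cgN (mmul n (mmul n ?s ?y) (ginv n ?s)) ?y"
        by (rule CUp_local[OF CUp_conj[OF s eU] o', where B = B])
          (use B soo v0 qv Kcj tc sent vS in auto)
      then have Z: "Zr ?s ?y" by (simp add: Zr_def)
      have "mmul n (mmul n e (Eich ?e (vscale v (t ^ 6)) (t ^ 6 * q * t ^ 6))) (ginv n e)
          = Eich (mvec n e ?e) (vscale ?v (t ^ 6)) (t ^ 6 * q * t ^ 6)"
        by (simp add: U_conj_Eich[OF eU] mvec_vscale)
      also have "\<dots> = ?y" using e by (intro Eich_cong) (auto simp: SG_def)
      finally have *: "mmul n (mmul n e (Eich ?e (vscale v (t ^ 6)) (t ^ 6 * q * t ^ 6))) (ginv n e) = ?y" .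
      have ct: "cj (t ^ k) = t ^ k" for k using B by (induction k) (auto simp: cj_mult Kcj power_commutes)
      have "t ^ 6 * q * t ^ 6 - f (vscale v (t ^ 6)) (vscale v (t ^ 6)) = t ^ 6 * (q - f v v) * cj (t ^ 6)"
        by (simp add: fs ct algebra_simps)
      then have "Eich ?e (vscale v (t ^ 6)) (t ^ 6 * q * t ^ 6) \<in> EE"
        using v(2,4) Lam_conj by (intro EE_bvec o') auto
      then show ?thesis using Z by (intro Zr_conj[OF sGL eE]) (simp_all add: *)
    qed
    have "t ^ k \<in> K \<and> t ^ k \<notin> M" for k
      using B S.K1 M.M1 by (induction k) (auto intro: S.K_mult dest: M.M_prime)
    then show "\<exists>s\<in>A. s \<notin> M" using tA unfolding A_def by blast
  qed
  moreover have "adm v q" using v S(2) by (auto simp: adm_def)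
  ultimately show ?thesis by (auto simp: A_def)
qed

theorem relative_commutator:
  assumes qf: "quasi_finite cj lam" and s: "CUp s" and t: "t \<in> EE"
  shows "gcomm n s t \<in> N"
proof -
  have sGL: "s \<in> GL n" using s U_GL by (auto simp: CUp_def)
  have "EE \<subseteq> {t. Zr s t}"
    unfolding EU_def
  proof (rule group.generate_subgroup_incl[OF group_GLgrp])
    show "elem_gens cj lam n UNIV Lam \<subseteq> {t. Zr s t}"
      unfolding E.G_gens by (auto intro!: Zr_Eich_bvec[OF qf s] simp: E.f_bvec_self Lam0 bvec_apply)
    show "subgroup {t. Zr s t} (GLgrp n)"
      by (rule subgroup.intro) (auto simp: Zr_mult Zr_inv Zr_one sGL dest: Zr_EE intro: EE_GL)
  qed
  then show ?thesis using t by (auto simp: Zr_def cgN_def gcomm_def)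
qed

end

section \<open>The level of an E-normal subgroup\<close>

locale normal_subgroup = hyperbolic cj lam n Lam for cj :: "'a::ring_1 \<Rightarrow> 'a" and lam n Lam +
  fixes H :: "'a mat set"
  assumes H_subgroup: "subgroup H (GLgrp n)" and H_U: "H \<subseteq> UU"
    and H_conj: "g \<in> EE \<Longrightarrow> s \<in> H \<Longrightarrow> mmul n (mmul n g s) (ginv n g) \<in> H"
begin

lemma H_mult: "a \<in> H \<Longrightarrow> b \<in> H \<Longrightarrow> mmul n a b \<in> H" using subgroup.m_closed[OF H_subgroup] by simp
lemma H_inv: "a \<in> H \<Longrightarrow> ginv n a \<in> H" using subgroup.m_inv_closed[OF H_subgroup] by simp
lemma H_one: "emat n \<in> H" using subgroup.one_closed[OF H_subgroup] by simp
lemma H_GL: "a \<in> H \<Longrightarrow> a \<in> GL n" using H_U U_GL by blast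

lemma H_conj': "g \<in> EE \<Longrightarrow> s \<in> H \<Longrightarrow> mmul n (mmul n (ginv n g) s) g \<in> H"
  using H_conj[OF EE_inv, of g s] EE_GL by (simp add: ginv_ginv)

lemma H_cancel_left: assumes "mmul n b a \<in> H" "b \<in> H" "is_mat n a" shows "a \<in> H"
  using H_mult[OF H_inv[OF assms(2)] assms(1)] assms H_GL by (simp add: gsimps)

lemma H_gcomm1: assumes "g \<in> EE" "s \<in> H" shows "gcomm n g s \<in> H"
  unfolding gcomm_def by (rule H_mult[OF H_conj[OF assms] H_inv[OF assms(2)]])

lemma H_gcomm2: assumes "g \<in> EE" "s \<in> H" shows "gcomm n s g \<in> H"
proof -
  have "mmul n s (mmul n (mmul n g (ginv n s)) (ginv n g)) \<in> H"
    by (rule H_mult[OF assms(2) H_conj[OF assms(1) H_inv[OF assms(2)]]])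
  then show ?thesis using assms EE_GL H_GL by (simp add: gcomm_def gsimps)
qed

lemma gcomm_Eich_eq:
  assumes y: "Eich i w r \<in> UU" "Ev i w r u = u" and u: "h u u = 0" "h u v = 0" "h u (Ev i w r v) = 0"
  shows "gcomm n (Eich i w r) (Eich u v q) = Eich u (Ev i w r v - v) (- h (Ev i w r v - v) v)"
  unfolding gcomm_def Eich_conj_Ev[OF y(1)] y(2) using u by (simp add: ginv_Eich Eich_mult hs)

text \<open>A commutator with an elementary matrix fixing \<open>u\<close> replaces the vector part
  by its displacement.\<close>

lemma H_step:
  assumes E: "Eich u v q \<in> H" and y: "Eich i w 0 \<in> EE" "Ev i w 0 u = u" and u: "h u u = 0" "h u v = 0"
    and uw: "h u (Ev i w 0 v) = 0"
  defines "v' \<equiv> Ev i w 0 v - v"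
  shows "Eich u v' (- h v' v) \<in> H"
proof -
  have "Eich i w 0 \<in> UU" using y EE_U by blast
  from gcomm_Eich_eq[OF this y(2) u uw] show ?thesis
    using H_gcomm1[OF y(1) E] by (simp add: v'_def)
qed

section \<open>The root elements contained in \<open>H\<close>\<close>

definition I :: "'a set" where
  "I = {x. \<forall>i\<in>Omega n. \<forall>k\<in>Omega n. k \<noteq> i \<longrightarrow> k \<noteq> - i \<longrightarrow> Eich (bvec i 1) (bvec k x) 0 \<in> H}"

definition Gam :: "'a set" where
  "Gam = {a \<in> Lam. \<forall>p\<in>Omega n. Eich (bvec p 1) 0 a \<in> H}"

lemma Ev_bvec_bvec:
  assumes "i \<in> Omega n" "k \<in> Omega n"
  shows "Ev (bvec i 1) (bvec k r) 0 v = v + bvec i (cj r * eta k * v (- k)) - bvec k (r * (cj (eta (- i)) * v (- i)))"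
proof -
  have "cj (h v (bvec i 1)) = cj (eta (- i)) * v (- i)"
    using assms by (simp add: h_bvec_right cjs) (simp add: eta_def flip: cj_lam_commute)
  then show ?thesis using assms by (simp add: Ev_def h_bvec_left vscale_bvec)
qed

context
  fixes i k x
  assumes ik: "i \<in> Omega n" "k \<in> Omega n" "k \<noteq> i" "k \<noteq> - i" and H: "Eich (bvec i 1) (bvec k x) 0 \<in> H"
begin

lemma h_ik: "h (bvec i 1) (bvec i 1) = 0" "h (bvec i 1) (bvec k x) = 0"
  using ik E.h_bvec_self by (auto simp: h_bvec_bvec)

lemma level_left:
  assumes j: "j \<in> Omega n" "j \<noteq> i" "j \<noteq> - i" "j \<noteq> k" "j \<noteq> - k"
  shows "Eich (bvec i 1) (bvec j (r * x)) 0 \<in> H"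
proof -
  let ?r = "cj (r * cj (eta (- k)))"
  have neq: "- k \<noteq> j" "k \<noteq> - j" "- k \<noteq> - j" "j \<noteq> - j" using j Omega_neq_uminus by auto
  have 1: "Ev (bvec j 1) (bvec (- k) ?r) 0 (bvec i 1) = bvec i 1"
    using ik j neq by (auto simp: Ev_bvec_bvec bvec_apply)
  have 2: "Ev (bvec j 1) (bvec (- k) ?r) 0 (bvec k x) = bvec k x + bvec j (r * x)"
    using ik j neq by (auto simp: Ev_bvec_bvec bvec_apply mult.assoc)
  have "Eich (bvec i 1) (bvec j (r * x)) (- h (bvec j (r * x)) (bvec k x)) \<in> H"
    using H_step[OF H EE_short[of j "- k" ?r] 1 h_ik] ik j neq unfolding 2
    by (auto simp: hs h_bvec_bvec)
  then show ?thesis using ik j neq by (simp add: h_bvec_bvec)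
qed

lemma level_self: "Eich (bvec i 1) 0 (x - lam * cj x) \<in> H"
proof -
  let ?r = "cj (cj (eta (- k)))"
  have neq: "- k \<noteq> i" "k \<noteq> - i" "- k \<noteq> - i" "i \<noteq> - i" "k \<noteq> - k" using ik Omega_neq_uminus by auto
  have 1: "Ev (bvec i 1) (bvec (- k) ?r) 0 (bvec i 1) = bvec i 1"
    using ik neq by (auto simp: Ev_bvec_bvec bvec_apply)
  have 2: "Ev (bvec i 1) (bvec (- k) ?r) 0 (bvec k x) = bvec k x + bvec i x"
    using ik neq by (auto simp: Ev_bvec_bvec bvec_apply mult.assoc)
  have "Eich (bvec i 1) (bvec i x) (- h (bvec i x) (bvec k x)) \<in> H"
    using H_step[OF H EE_short[of i "- k" ?r] 1 h_ik] ik neq unfolding 2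
    by (auto simp: hs h_bvec_bvec)
  moreover have "h (bvec i x) (bvec k x) = 0" using ik by (simp add: h_bvec_bvec)
  ultimately show ?thesis using Eich_self[of "bvec i 1" x] by (simp add: vscale_bvec)
qed

lemma level_swap: "Eich (bvec k 1) (bvec i (- (lam * cj x))) 0 \<in> H"
  using H Eich_swap[of "bvec i 1" "bvec k 1" x] by (simp add: vscale_bvec)

end

lemma level_other:
  assumes "i \<in> Omega n" "k \<in> Omega n" "k \<noteq> i" "k \<noteq> - i" "Eich (bvec i 1) (bvec k x) 0 \<in> H"
    and k': "k' \<in> Omega n" "k' \<noteq> i" "k' \<noteq> - i"
  shows "Eich (bvec i 1) (bvec k' x) 0 \<in> H"
proof (cases "k' = k \<or> k' = - k")
  case True
  obtain j where j: "j \<in> Omega n" "j \<noteq> i" "j \<noteq> - i" "j \<noteq> k" "j \<noteq> - k"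
    using exists_index[OF assms(1,2)] by blast
  have "Eich (bvec i 1) (bvec j (1 * x)) 0 \<in> H" by (rule level_left[OF assms(1-5) j])
  then have "Eich (bvec i 1) (bvec j x) 0 \<in> H" by simp
  from level_left[OF assms(1) j(1-3) this k', of 1] show ?thesis using True j by auto
next
  case False
  then show ?thesis using level_left[OF assms(1-5) k', of 1] by simp
qed

text \<open>One root position yields all: \<open>level_other\<close> changes the second index,
  \<open>level_swap\<close> exchanges the two, and an auxiliary index avoids coincidences.\<close>

lemma level_all:
  assumes "i \<in> Omega n" "k \<in> Omega n" "k \<noteq> i" "k \<noteq> - i" "Eich (bvec i 1) (bvec k x) 0 \<in> H"
  shows "x \<in> I"
proof -
  have *: "Eich (bvec p 1) (bvec q x) 0 \<in> H"
    if pq: "p \<in> Omega n" "q \<in> Omega n" "q \<noteq> p" "q \<noteq> - p" and q: "q \<noteq> i" "q \<noteq> - i" for p q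
  proof -
    have n: "i \<noteq> q" "i \<noteq> - q" "p \<noteq> q" "p \<noteq> - q" using pq q by auto
    have "Eich (bvec i 1) (bvec q x) 0 \<in> H" by (rule level_other[OF assms pq(2) q])
    from level_swap[OF assms(1) pq(2) q this]
    have "Eich (bvec q 1) (bvec i (- (lam * cj x))) 0 \<in> H" .
    from level_other[OF pq(2) assms(1) n(1,2) this pq(1) n(3,4)]
    have "Eich (bvec q 1) (bvec p (- (lam * cj x))) 0 \<in> H" .
    from level_swap[OF pq(2,1) n(3,4) this] show ?thesis by (simp add: cjs flip: cj_lam_commute)
  qed
  have "Eich (bvec p 1) (bvec q x) 0 \<in> H"
    if pq: "p \<in> Omega n" "q \<in> Omega n" "q \<noteq> p" "q \<noteq> - p" for p q
  proof (cases "q = i \<or> q = - i")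
    case True
    obtain q' where q': "q' \<in> Omega n" "q' \<noteq> p" "q' \<noteq> - p" "q' \<noteq> i" "q' \<noteq> - i"
      using exists_index[OF pq(1) assms(1)] by blast
    show ?thesis by (rule level_other[OF pq(1) q'(1-3) *[OF pq(1) q'] pq(2-4)])
  qed (use * pq in auto)
  then show ?thesis by (auto simp: I_def)
qed

lemma I_Eich: "x \<in> I \<Longrightarrow> i \<in> Omega n \<Longrightarrow> k \<in> Omega n \<Longrightarrow> k \<noteq> i \<Longrightarrow> k \<noteq> - i \<Longrightarrow> Eich (bvec i 1) (bvec k x) 0 \<in> H"
  by (auto simp: I_def)

lemma three_indices:
  obtains i k j where "i \<in> Omega n" "k \<in> Omega n" "k \<noteq> i" "k \<noteq> - i" "j \<in> Omega n" "j \<noteq> i" "j \<noteq> - i" "j \<noteq> k" "j \<noteq> - k"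
proof -
  have "(1::int) \<in> Omega n" "2 \<in> Omega n" "3 \<in> Omega n" using n3 by (auto simp: Omega_def)
  then show ?thesis using that[of 1 2 3] by auto
qed

lemma level_I_left: assumes "x \<in> I" shows "r * x \<in> I"
proof -
  obtain i k j where *: "i \<in> Omega n" "k \<in> Omega n" "k \<noteq> i" "k \<noteq> - i" "j \<in> Omega n" "j \<noteq> i" "j \<noteq> - i" "j \<noteq> k" "j \<noteq> - k"
    by (rule three_indices)
  show ?thesis
    by (rule level_all[OF *(1,5-7) level_left[OF *(1-4) I_Eich[OF assms *(1-4)] *(5-9)]])
qed

lemma level_I_cj: assumes "x \<in> I" shows "cj x \<in> I"
proof -
  obtain i k j where *: "i \<in> Omega n" "k \<in> Omega n" "k \<noteq> i" "k \<noteq> - i" "j \<in> Omega n" "j \<noteq> i" "j \<noteq> - i" "j \<noteq> k" "j \<noteq> - k"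
    by (rule three_indices)
  have "- (lam * cj x) \<in> I"
    using * by (intro level_all[OF _ _ _ _ level_swap[OF *(1-4) I_Eich[OF assms *(1-4)]]]) auto
  then have "(- cj lam) * (- (lam * cj x)) \<in> I" by (rule level_I_left)
  then show ?thesis by simp
qed

lemma level_I_right: "x \<in> I \<Longrightarrow> x * r \<in> I"
  using level_I_cj[OF level_I_left[OF level_I_cj, of x "cj r"]] by (simp add: cj_mult)

lemma level_I_add: assumes "x \<in> I" "y \<in> I" shows "x + y \<in> I"
proof -
  obtain i k j where *: "i \<in> Omega n" "k \<in> Omega n" "k \<noteq> i" "k \<noteq> - i" "j \<in> Omega n" "j \<noteq> i" "j \<noteq> - i" "j \<noteq> k" "j \<noteq> - k"
    by (rule three_indices)
  have "mmul n (Eich (bvec i 1) (bvec k x) 0) (Eich (bvec i 1) (bvec k y) 0) \<in> H"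
    by (intro H_mult I_Eich assms *)
  moreover have "bvec k x + bvec k y = bvec k (x + y)" by (auto simp: bvec_apply)
  moreover have "h (bvec i 1) (bvec i 1) = 0" "h (bvec k x) (bvec k y) = 0" using * E.h_bvec_self by auto
  ultimately have "Eich (bvec i 1) (bvec k (x + y)) 0 \<in> H"
    using * by (simp add: Eich_mult h_bvec_bvec)
  then show ?thesis by (rule level_all[OF *(1-4)])
qed

lemma level_I_0: "0 \<in> I"
  by (simp add: I_def Eich_0 H_one)

lemma level_I_uminus: "x \<in> I \<Longrightarrow> - x \<in> I"
  using level_I_left[of x "- 1"] by simp

text \<open>Three commutators with elementary matrices fixing \<open>bvec l 1\<close> isolate a single entry of \<open>v\<close>.\<close>

lemma level_entries:
  assumes l: "l \<in> Omega n" and H: "Eich (bvec l 1) v q \<in> H" and v: "v (- l) = 0"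
    and i: "i \<in> Omega n" "i \<noteq> l" "i \<noteq> - l"
  shows "v i \<in> I"
proof -
  let ?e = "bvec l 1"
  obtain j where j: "j \<in> Omega n" "j \<noteq> l" "j \<noteq> - l" "j \<noteq> i" "j \<noteq> - i"
    using exists_index[OF l i(1)] by blast
  have neq: "l \<noteq> - l" "i \<noteq> - i" "j \<noteq> - j" using l i j Omega_neq_uminus by auto
  have n2: "- i \<noteq> l" "i \<noteq> - j" "l \<noteq> - j" "l \<noteq> - i" "- j \<noteq> i" "l \<noteq> j" "l \<noteq> i" "i \<noteq> j" using i j by auto
  have ee: "h ?e ?e = 0" using l by (simp add: E.h_bvec_self)
  have he: "h ?e w = 0" if "w (- l) = 0" for w using l that by (simp add: h_bvec_left)
  have fixl: "Ev (bvec a 1) (bvec b 1) 0 ?e = ?e" if "a \<in> Omega n" "b \<in> Omega n" "a \<noteq> - l" "b \<noteq> - l" for a b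
    using that by (auto simp: Ev_bvec_bvec bvec_apply)
  define v1 where "v1 = bvec (- i) (eta j * v (- j)) - bvec j (cj (eta i) * v i)"
  have s1: "Ev (bvec (- i) 1) (bvec j 1) 0 v - v = v1"
    using i j by (simp add: Ev_bvec_bvec v1_def)
  have H1: "Eich ?e v1 (- h v1 v) \<in> H"
  proof -
    have "h ?e (Ev (bvec (- i) 1) (bvec j 1) 0 v) = 0"
      using i j v n2 by (intro he) (auto simp: Ev_bvec_bvec bvec_apply)
    from H_step[OF H EE_short fixl ee he[of v, OF v] this] show ?thesis
      unfolding s1 using i j n2 by auto
  qed
  have v1l: "v1 (- l) = 0" using n2 i j by (auto simp: v1_def bvec_apply)
  define v2 where "v2 = bvec (- i) (- (eta (- j) * (cj (eta i) * v i)))"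
  have s2: "Ev (bvec (- i) 1) (bvec (- j) 1) 0 v1 - v1 = v2"
    using i j n2 neq by (auto simp: Ev_bvec_bvec v1_def v2_def bvec_apply fun_eq_iff)
  have H2: "Eich ?e v2 (- h v2 v1) \<in> H"
  proof -
    have "h ?e (Ev (bvec (- i) 1) (bvec (- j) 1) 0 v1) = 0"
      using i j v1l n2 by (intro he) (auto simp: Ev_bvec_bvec bvec_apply)
    from H_step[OF H1 EE_short fixl ee he[of v1, OF v1l] this] show ?thesis
      unfolding s2 using i j n2 by auto
  qed
  have v2l: "v2 (- l) = 0" using n2 i j by (auto simp: v2_def bvec_apply)
  define v3 where "v3 = bvec j (- (eta (- j) * v i))"
  have s3: "Ev (bvec j 1) (bvec i 1) 0 v2 - v2 = v3"
  proof -
    have "eta i * (eta (- j) * (cj (eta i) * v i)) = eta (- j) * v i"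
      by (metis eta_cj_assoc(1) eta_left_commute)
    then show ?thesis
      using i j n2 neq by (auto simp: Ev_bvec_bvec v3_def v2_def bvec_apply fun_eq_iff)
  qed
  have H3: "Eich ?e v3 (- h v3 v2) \<in> H"
  proof -
    have "h ?e (Ev (bvec j 1) (bvec i 1) 0 v2) = 0"
      using i j v2l n2 by (intro he) (auto simp: Ev_bvec_bvec bvec_apply)
    from H_step[OF H2 EE_short fixl ee he[of v2, OF v2l] this] show ?thesis
      unfolding s3 using i j n2 by auto
  qed
  have "h v3 v2 = 0" using j n2 by (auto simp: v3_def v2_def h_bvec_bvec)
  then have "- (eta (- j) * v i) \<in> I"
    using H3 l j by (intro level_all[of l j]) (auto simp: v3_def)
  then have "(- cj (eta (- j))) * (- (eta (- j) * v i)) \<in> I" by (rule level_I_left)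
  then show ?thesis by simp
qed

lemma Ev_move:
  assumes "j \<in> Omega n" "p \<in> Omega n" "j \<noteq> p" "j \<noteq> - p"
  shows "Ev (bvec j 1) (bvec (- p) (cj (z * cj (eta (- p))))) 0 (bvec p 1) = bvec p 1 + vscale (bvec j 1) z"
  using assms by (auto simp: Ev_bvec_bvec bvec_apply mult.assoc fun_eq_iff)

text \<open>Conjugation by the short root element shifts the direction \<open>bvec p 1\<close> by a
  multiple of \<open>bvec j 1\<close>. \<open>Eich_add_left\<close> splits the result, and the
  commutator is the part along \<open>bvec j 1\<close>, carrying a short and a long parameter at
  once.\<close>

lemma Eich_move:
  fixes z :: "'a"
  assumes jp: "j \<in> Omega n" "p \<in> Omega n" "j \<noteq> p" "j \<noteq> - p" and a: "a \<in> Lam"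
  defines "y \<equiv> Eich (bvec j 1) (bvec (- p) (cj (z * cj (eta (- p))))) 0"
  shows "gcomm n y (Eich (bvec p 1) 0 a) = Eich (bvec j 1) (bvec p (a * cj z)) (z * a * cj z)"
proof -
  have y: "y \<in> UU" unfolding y_def using jp EE_U by (intro subsetD[OF EE_U] EE_short) auto
  have hh: "h (bvec p 1) (bvec p 1) = 0" "h (bvec p 1) (vscale (bvec j 1) z) = 0" "h (vscale (bvec j 1) z) (vscale (bvec j 1) z) = 0"
    using jp E.h_bvec_self by (auto simp: hs h_bvec_bvec)
  have "mmul n (mmul n y (Eich (bvec p 1) 0 a)) (ginv n y) = Eich (bvec p 1 + vscale (bvec j 1) z) 0 a"
    using y unfolding y_def by (simp add: Eich_conj_Ev Ev_move[OF jp] Ev_zero)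
  also have "\<dots> = mmul n (Eich (vscale (bvec j 1) z) (0 + vscale (bvec p 1) a) a) (Eich (bvec p 1) 0 a)"
    using hh Lam_max[OF a] by (intro Eich_add_left) auto
  also have "Eich (vscale (bvec j 1) z) (0 + vscale (bvec p 1) a) a = Eich (bvec j 1) (bvec p (a * cj z)) (z * a * cj z)"
    using Eich_vscale_left[of "bvec j 1" z "bvec p a" a] by (simp add: vscale_bvec)
  finally have eq: "mmul n (mmul n y (Eich (bvec p 1) 0 a)) (ginv n y)
      = mmul n (Eich (bvec j 1) (bvec p (a * cj z)) (z * a * cj z)) (Eich (bvec p 1) 0 a)" .
  have X: "Eich (bvec p 1) 0 a \<in> GL n" using hh by (intro Eich_GL) auto
  show ?thesis
    unfolding gcomm_def eq unfolding mmul_assoc mmul_ginv[OF X] by (rule mmul_emat_right[OF is_mat_Eich])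
qed

lemma strip_short:
  assumes jp: "j \<in> Omega n" "p \<in> Omega n" "p \<noteq> j" "p \<noteq> - j" and x: "x \<in> I" and H: "Eich (bvec j 1) (bvec p x) q \<in> H"
  shows "Eich (bvec j 1) 0 q \<in> H"
proof -
  have "mmul n (Eich (bvec j 1) (bvec p x) 0) (Eich (bvec j 1) 0 q) = Eich (bvec j 1) (bvec p x) q"
    using jp E.h_bvec_self by (subst Eich_mult) (auto simp: h_bvec_bvec)
  then show ?thesis using H I_Eich[OF x jp] by (metis H_cancel_left is_mat_Eich)
qed

text \<open>A commutator with a short root element displays \<open>a\<close> as a coordinate, where
  \<open>level_entries\<close> can read it.\<close>

lemma long_I:
  assumes p: "p \<in> Omega n" and a: "a \<in> Lam" and H: "Eich (bvec p 1) 0 a \<in> H"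
  shows "a \<in> I"
proof -
  obtain j where j: "j \<in> Omega n" "j \<noteq> p" "j \<noteq> - p" using exists_index[OF p p] by blast
  have "Eich (bvec j 1) (bvec p (a * cj 1)) (1 * a * cj 1) \<in> H"
    using p j unfolding Eich_move[OF j(1) p j(2,3) a, symmetric] by (intro H_gcomm1 H EE_short) auto
  from level_entries[OF j(1) this _ p] show ?thesis using j by (auto simp: bvec_apply)
qed

lemma long_move:
  assumes p: "p \<in> Omega n" and a: "a \<in> Lam" and H: "Eich (bvec p 1) 0 a \<in> H"
    and j: "j \<in> Omega n" "j \<noteq> p" "j \<noteq> - p"
  shows "Eich (bvec j 1) 0 (z * a * cj z) \<in> H"
proof (rule strip_short[OF j(1) p])
  show "Eich (bvec j 1) (bvec p (a * cj z)) (z * a * cj z) \<in> H"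
    using p j unfolding Eich_move[OF j(1) p j(2,3) a, symmetric] by (intro H_gcomm1 H EE_short) auto
  show "a * cj z \<in> I" by (intro level_I_right long_I[OF p a H])
qed (use j in auto)

text \<open>Two moves through an auxiliary index, since \<open>long_move\<close> cannot end at
  \<open>p\<close> or \<open>- p\<close>.\<close>

lemma long_all:
  assumes p: "p \<in> Omega n" and a: "a \<in> Lam" and H: "Eich (bvec p 1) 0 a \<in> H"
  shows "z * a * cj z \<in> Gam"
proof -
  have "Eich (bvec k 1) 0 (z * a * cj z) \<in> H" if k: "k \<in> Omega n" for k
  proof -
    obtain j where j: "j \<in> Omega n" "j \<noteq> p" "j \<noteq> - p" "j \<noteq> k" "j \<noteq> - k" using exists_index[OF p k] by blast
    have "Eich (bvec j 1) 0 (1 * a * cj 1) \<in> H" by (rule long_move[OF p a H j(1-3)])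
    then show ?thesis using j k a by (intro long_move[of j]) auto
  qed
  then show ?thesis using Lam_conj[OF a] by (auto simp: Gam_def)
qed

lemma long_Gam: "p \<in> Omega n \<Longrightarrow> a \<in> Lam \<Longrightarrow> Eich (bvec p 1) 0 a \<in> H \<Longrightarrow> a \<in> Gam"
  using long_all[of p a 1] by simp

lemma level_Gam_min: assumes x: "x \<in> I" shows "x - lam * cj x \<in> Gam"
proof -
  obtain i k j where *: "i \<in> Omega n" "k \<in> Omega n" "k \<noteq> i" "k \<noteq> - i" "j \<in> Omega n" "j \<noteq> i" "j \<noteq> - i" "j \<noteq> k" "j \<noteq> - k"
    by (rule three_indices)
  show ?thesis by (rule long_Gam[OF *(1) Lam_min level_self[OF *(1-4) I_Eich[OF x *(1-4)]]])
qed

text \<open>The commutator of \<open>Eich_move\<close> again, now with the short factor in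
  \<open>H\<close> instead of the long one.\<close>

lemma level_Gam_min_conj: assumes z: "z \<in> I" and a: "a \<in> Lam" shows "z * a * cj z \<in> Gam"
proof -
  obtain p j k where *: "p \<in> Omega n" "j \<in> Omega n" "j \<noteq> p" "j \<noteq> - p" "k \<in> Omega n" "k \<noteq> p" "k \<noteq> - p" "k \<noteq> j" "k \<noteq> - j"
    by (rule three_indices)
  have "cj (z * cj (eta (- p))) \<in> I" using z by (intro level_I_cj level_I_right)
  then have "Eich (bvec j 1) (bvec p (a * cj z)) (z * a * cj z) \<in> H"
    unfolding Eich_move[OF *(2,1,3,4) a, symmetric] using * a by (intro H_gcomm2 I_Eich EE_long) auto
  moreover have "a * cj z \<in> I" using z by (intro level_I_left level_I_cj)
  ultimately have "Eich (bvec j 1) 0 (z * a * cj z) \<in> H" using * by (intro strip_short[OF *(2,1)]) auto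
  then show ?thesis using * Lam_conj[OF a] by (intro long_Gam[of j]) auto
qed

lemma Gam_group: "0 \<in> Gam" "x \<in> Gam \<Longrightarrow> y \<in> Gam \<Longrightarrow> x + y \<in> Gam" "x \<in> Gam \<Longrightarrow> - x \<in> Gam"
proof -
  have e: "h (bvec p 1) (bvec p 1) = 0" if "p \<in> Omega n" for p using that by (simp add: E.h_bvec_self)
  show "0 \<in> Gam" by (simp add: Gam_def Lam0 Eich_0 H_one)
  show "x + y \<in> Gam" if "x \<in> Gam" "y \<in> Gam"
    unfolding Gam_def
  proof (intro CollectI conjI ballI)
    show "x + y \<in> Lam" using that Lam_add by (auto simp: Gam_def)
    fix p assume p: "p \<in> Omega n"
    have "mmul n (Eich (bvec p 1) 0 x) (Eich (bvec p 1) 0 y) \<in> H"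
      using that p by (intro H_mult) (auto simp: Gam_def)
    then show "Eich (bvec p 1) 0 (x + y) \<in> H" using e[OF p] by (simp add: Eich_mult)
  qed
  show "- x \<in> Gam" if "x \<in> Gam"
    unfolding Gam_def
  proof (intro CollectI conjI ballI)
    show "- x \<in> Lam" using that Lam_uminus by (auto simp: Gam_def)
    fix p assume p: "p \<in> Omega n"
    have "ginv n (Eich (bvec p 1) 0 x) \<in> H" using that p by (intro H_inv) (auto simp: Gam_def)
    then show "Eich (bvec p 1) 0 (- x) \<in> H" using e[OF p] by (simp add: ginv_Eich)
  qed
qed

theorem level_form_ideal: "form_ideal cj lam Lam (I, Gam)"
proof -
  have GI: "Gam \<subseteq> I"
  proof
    fix a assume "a \<in> Gam"
    then have "a \<in> Lam" "Eich (bvec 1 1) 0 a \<in> H" "1 \<in> Omega n" using n3 by (auto simp: Gam_def Omega_def)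
    then show "a \<in> I" using long_I by blast
  qed
  have "Gamma_min cj lam Lam I \<subseteq> Gam"
  proof
    fix x assume "x \<in> Gamma_min cj lam Lam I"
    then obtain a b where ab: "x = a + b" "a \<in> {x - lam * cj x | x. x \<in> I}"
        "b \<in> add_span {z * al * cj z | z al. z \<in> I \<and> al \<in> Lam}" by (auto simp: Gamma_min_def)
    have "b \<in> Gam"
      by (rule add_span_induct[OF ab(3)]) (auto simp: add_subgroup_def Gam_group level_Gam_min_conj)
    moreover have "a \<in> Gam" using ab(2) level_Gam_min by auto
    ultimately show "x \<in> Gam" using ab(1) Gam_group by simp
  qed
  moreover have "cj ` I = I"
  proof
    show "cj ` I \<subseteq> I" using level_I_cj by auto
    show "I \<subseteq> cj ` I" using level_I_cj by (metis cj_cj imageI subsetI)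
  qed
  moreover have "al * x * cj al \<in> Gam" if "x \<in> Gam" for x al
  proof -
    have "x \<in> Lam" "Eich (bvec 1 1) 0 x \<in> H" "1 \<in> Omega n" using n3 that by (auto simp: Gam_def Omega_def)
    then show ?thesis using long_all by blast
  qed
  moreover have "Gam \<subseteq> Lam" by (auto simp: Gam_def)
  ultimately show ?thesis using GI
    by (auto simp: form_ideal_def two_sided_ideal_def add_subgroup_def level_I_0 level_I_add level_I_uminus
        level_I_left level_I_right Gam_group)
qed

sublocale R: relative cj lam n Lam I Gam
  by unfold_locales (rule level_form_ideal)

lemma N_H: "R.N \<subseteq> H"
proof -
  have "elem_gens cj lam n I Gam \<subseteq> H"
    unfolding R.rel_gens by (auto intro: I_Eich simp: Gam_def)
  then have "generate (GLgrp n) (elem_gens cj lam n I Gam) \<subseteq> H"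
    by (rule group.generate_subgroup_incl[OF group_GLgrp _ H_subgroup])
  then show ?thesis
    unfolding R.N_eq by (intro group.generate_subgroup_incl[OF group_GLgrp _ H_subgroup]) (auto intro: H_conj)
qed

text \<open>The factor \<open>Z\<close> cancels from the commutator with \<open>y\<close>, so
  \<open>A\<close> can be studied although only the product with \<open>Z\<close> is known to lie in
  \<open>H\<close>.\<close>

lemma gcomm_commuting:
  assumes AZ: "mmul n A Z \<in> H" and A: "A \<in> GL n" and Z: "Z \<in> GL n" and y: "y \<in> EE"
    and yZ: "mmul n (mmul n y Z) (ginv n y) = Z"
  shows "gcomm n y A \<in> H"
proof -
  have yG: "y \<in> GL n" using y EE_GL by blast
  have "gcomm n y (mmul n A Z) = mmul n (mmul n (mmul n y A) (ginv n y)) (mmul n (mmul n (mmul n (mmul n y Z) (ginv n y)) (ginv n Z)) (ginv n A))"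
    using A Z yG by (simp add: gcomm_def gsimps)
  also have "\<dots> = gcomm n y A" unfolding yZ using A Z yG by (simp add: gcomm_def gsimps)
  finally show ?thesis using H_gcomm1[OF y AZ] by simp
qed

text \<open>The second factor is an unwanted long element along \<open>bvec o' 1\<close>. It
  commutes with every elementary matrix fixing that vector, so commutators with two such matrices
  see only the first factor; they put first \<open>b\<close>, then \<open>a\<close> into
  \<open>I\<close>.\<close>

lemma level_two_long:
  assumes o': "o' \<in> Omega n" and k: "k \<in> Omega n" "k \<noteq> o'" "k \<noteq> - o'"
    and j: "j \<in> Omega n" "j \<noteq> o'" "j \<noteq> - o'" "j \<noteq> k" "j \<noteq> - k"
    and q: "q + lam * cj q = 0"
    and H: "mmul n (Eich (bvec k 1) (bvec o' a - bvec j b) q) (Eich (bvec o' 1) 0 c) \<in> H"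
  shows "a \<in> I"
proof -
  let ?o = "bvec o' 1" and ?k = "bvec k 1" and ?v = "bvec o' a - bvec j b"
  let ?Z = "Eich ?o 0 c"
  have neq: "- o' \<noteq> k" "- k \<noteq> o'" "o' \<noteq> k" "o' \<noteq> - k" "- j \<noteq> o'" "- o' \<noteq> j" "- j \<noteq> k" "- k \<noteq> j" "o' \<noteq> j" "o' \<noteq> - j" "k \<noteq> j"
      "k \<noteq> - j" "o' \<noteq> - o'" "k \<noteq> - k" "j \<noteq> - j"
    using k j o' Omega_neq_uminus by auto
  have hh: "h ?o ?o = 0" "h ?k ?k = 0" using o' k by (simp_all add: E.h_bvec_self)
  have hk: "h ?k w = 0" if "w (- k) = 0" for w using k that by (simp add: h_bvec_left)
  have Z: "?Z \<in> GL n" using hh by (intro Eich_GL) auto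
  have AG: "Eich ?k w r \<in> GL n" if "w (- k) = 0" for w r using hh hk[of w, OF that] by (intro Eich_GL)
  have fixZ: "mmul n (mmul n y ?Z) (ginv n y) = ?Z" if "y = Eich x w 0" "y \<in> EE" "Ev x w 0 ?o = ?o" for y x w
  proof -
    have "y \<in> UU" using that EE_U by blast
    then show ?thesis using Eich_conj_Ev[of x w 0 ?o 0 c] that by (simp add: Ev_zero)
  qed
  have vk: "?v (- k) = 0" using neq by (auto simp: bvec_apply)
  let ?y = "Eich ?o (bvec (- j) 1) 0"
  have y: "?y \<in> EE" using o' j neq by (intro EE_short) auto
  have yo: "Ev ?o (bvec (- j) 1) 0 ?o = ?o" "Ev ?o (bvec (- j) 1) 0 ?k = ?k"
    using o' j neq by (auto simp: Ev_bvec_bvec bvec_apply)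
  have yv: "Ev ?o (bvec (- j) 1) 0 ?v - ?v = bvec o' (- (eta (- j) * b))"
    using o' j neq by (auto simp: Ev_bvec_bvec bvec_apply fun_eq_iff)
  have "h ?k (Ev ?o (bvec (- j) 1) 0 ?v) = 0"
    using o' j neq by (intro hk) (auto simp: Ev_bvec_bvec bvec_apply)
  with gcomm_commuting[OF H AG[of ?v, OF vk] Z y fixZ[OF refl y yo(1)]]
  have "Eich ?k (bvec o' (- (eta (- j) * b))) (- h (bvec o' (- (eta (- j) * b))) ?v) \<in> H"
    using y EE_U yo hh hk[of ?v, OF vk] by (subst (asm) gcomm_Eich_eq) (auto simp: yv)
  from level_entries[OF k(1) this _ o' neq(3,4)] have "- (eta (- j) * b) \<in> I"
    using neq by (auto simp: bvec_apply)
  then have "(- cj (eta (- j))) * (- (eta (- j) * b)) \<in> I" by (rule level_I_left)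
  then have b: "b \<in> I" by simp
  let ?A = "Eich ?k (bvec o' a) q"
  have B: "Eich ?k (bvec j (- b)) 0 \<in> H"
    using k j level_I_uminus[OF b] by (intro I_Eich)
  have "mmul n (Eich ?k (bvec j (- b)) 0) ?A = Eich ?k (bvec j (- b) + bvec o' a) q"
    using hh hk[of "bvec j (- b)"] hk[of "bvec o' a"] neq j
    by (subst Eich_mult) (auto simp: bvec_apply h_bvec_bvec)
  moreover have "bvec j (- b) + bvec o' a = ?v" by (auto simp: bvec_apply)
  ultimately have "mmul n (Eich ?k (bvec j (- b)) 0) ?A = Eich ?k ?v q" by (simp only:)
  then have "mmul n (Eich ?k (bvec j (- b)) 0) (mmul n ?A ?Z) \<in> H"
    using H by (simp add: mmul_assoc[symmetric])
  then have AZ: "mmul n ?A ?Z \<in> H"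
    using B by (rule H_cancel_left) (simp add: is_mat_mmul is_mat_Eich)
  let ?r = "cj (1 * cj (eta (- k)))"
  let ?y = "Eich (bvec j 1) (bvec (- k) ?r) 0"
  have y: "?y \<in> EE" using j k neq by (intro EE_short) auto
  have yo: "Ev (bvec j 1) (bvec (- k) ?r) 0 ?o = ?o" "Ev (bvec j 1) (bvec (- k) ?r) 0 (bvec o' a) = bvec o' a"
    using o' j k neq by (auto simp: Ev_bvec_bvec bvec_apply)
  have yk: "Ev (bvec j 1) (bvec (- k) ?r) 0 ?k = ?k + bvec j 1"
    using Ev_move[OF j(1) k(1) j(4,5), of 1] by (simp only: vscale_one)
  have ak: "bvec o' a (- k) = 0" using neq by (simp add: bvec_apply)
  have "gcomm n ?y ?A \<in> H"
    using gcomm_commuting[OF AZ AG[of "bvec o' a", OF ak] Z y fixZ[OF refl y yo(1)]] .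
  moreover have "gcomm n ?y ?A = Eich (bvec j 1) (bvec o' a + vscale ?k q) q"
  proof -
    have "mmul n (mmul n ?y ?A) (ginv n ?y) = Eich (?k + bvec j 1) (bvec o' a) q"
      using Eich_conj_Ev[of "bvec j 1" "bvec (- k) ?r" 0 ?k "bvec o' a" q] y EE_U by (auto simp only: yk yo)
    also have "\<dots> = mmul n (Eich (bvec j 1) (bvec o' a + vscale ?k q) q) ?A"
      using k j o' neq q hh hk[of "bvec o' a", OF ak] E.h_bvec_self[of j 1 1] E.h_bvec_self[of o' a a]
      by (intro Eich_add_left) (auto simp: h_bvec_bvec)
    finally have eq: "mmul n (mmul n ?y ?A) (ginv n ?y) = mmul n (Eich (bvec j 1) (bvec o' a + vscale ?k q) q) ?A" .
    show ?thesis
      unfolding gcomm_def eq unfolding mmul_assoc mmul_ginv[OF AG[of "bvec o' a", OF ak]]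
      by (rule mmul_emat_right[OF is_mat_Eich])
  qed
  ultimately have "Eich (bvec j 1) (bvec o' a + vscale ?k q) q \<in> H" by simp
  from level_entries[OF j(1) this _ o' neq(9,10)] show ?thesis using neq by (auto simp: bvec_apply)
qed

text \<open>The matrix \<open>Eich (W k) (W l) 0\<close> below is elementary and fixes the column \<open>u\<close> of \<open>s\<close>, so its conjugate
  by \<open>ginv n s\<close> fixes \<open>bvec o' 1\<close>. Modulo \<open>H\<close> the two are equal; comparing their actions on the unipotent radical
  of the stabilizer of \<open>bvec o' 1\<close> reveals the entries of \<open>u\<close>.\<close>

lemma extract_column:
  assumes s: "s \<in> H" and o': "o' \<in> Omega n" and B: "s o' o' * B = t" "B * s o' o' = t"
    and t: "cj t = t" "t * B = B * t" and ts: "\<And>k. k \<in> Omega n \<Longrightarrow> t * s k o' = s k o' * t"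
    and m: "m \<in> Omega n" "m \<noteq> o'" "m \<noteq> - o'"
  shows "t * t * s m o' \<in> I"
proof -
  let ?o = "bvec o' 1" let ?u = "mvec n s ?o"
  \<comment> \<open>With this sign the pairing of \<open>?u\<close> with \<open>bvec k 1\<close>
    reads the entry of \<open>?u\<close> at \<open>m\<close>, which thereby enters the coordinate
    \<open>x l\<close>.\<close>
  define k where "k = - m"
  have k: "k \<in> Omega n" "k \<noteq> o'" "k \<noteq> - o'" using m by (auto simp: k_def)
  obtain l where l: "l \<in> Omega n" "l \<noteq> o'" "l \<noteq> - o'" "l \<noteq> k" "l \<noteq> - k"
    using exists_index[OF o' k(1)] by blast
  have neq: "k \<noteq> l" "k \<noteq> - l" "- k \<noteq> l" "- o' \<noteq> k" "- o' \<noteq> l" "o' \<noteq> - o'" "k \<noteq> - k" "l \<noteq> - l" "- k \<noteq> o'" "- l \<noteq> o'" "o' \<noteq> k" "o' \<noteq> l" "- l \<noteq> k"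
    using k l o' Omega_neq_uminus by auto
  have sU: "s \<in> UU" and sG: "s \<in> GL n" using s H_U H_GL by auto
  have ui: "?u i = s i o'" for i using o' by (simp add: mvec_bvec)
  have oo: "h ?o ?o = 0" "f ?o ?o = 0" using o' by (simp_all add: E.h_bvec_self E.f_bvec_self)
  have u: "E.XV ?u" "h ?u ?u = 0" "f ?u ?u \<in> Lam"
    using U_h[OF sU] U_Q[OF sU, of ?o] oo by (auto simp: E.XV_def Q_def)
  have tu: "\<And>k. k \<in> Omega n \<Longrightarrow> t * ?u k = ?u k * t" using ts by (simp add: ui)
  define W where "W = E.dv ?u o' B t"
  have uo: "?u o' * B = t" "B * ?u o' = t" using B ui by simp_all
  note dvH = o' u UNIV_I uo t(1) tu t(2)
  have Wd: "W k = bvec k t - bvec (- o') (cj (eta o') * cj B * h ?u (bvec k 1))" for k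
    unfolding W_def by (rule E.dv_def[OF dvH])
  have fW: "f (W i) (W i) = 0" if "i \<in> Omega n" "i \<noteq> o'" "i \<noteq> - o'" for i
    unfolding W_def by (rule E.f_dv[OF dvH that])
  have hW0: "h (W i) (W i) = 0" if "i \<in> Omega n" "i \<noteq> o'" "i \<noteq> - o'" for i
    using fW[OF that] by (simp add: h_f)
  have hW: "h ?u (W i) = 0" if "i \<in> Omega n" for i
    unfolding W_def by (rule E.h_u_dv[OF dvH that])
  have hWW: "h (W k) (W l) = 0" using k l neq o' by (auto simp: Wd hs h_bvec_bvec)
  let ?E = "Eich (W k) (W l) 0"
  have E: "?E \<in> EE"
    unfolding EU_eq W_def
    by (rule E.Eich_dv_G[OF dvH k]) (use hWW fW[OF l(1-3)] in \<open>auto simp: E.XV_def Lam0 W_def\<close>)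
  have EU: "?E \<in> UU" and EG: "?E \<in> GL n" using E EE_U EE_GL by auto
  have Eu: "Ev (W k) (W l) 0 ?u = ?u"
    using hW k l h_eq_0_sym[OF hW] by (simp add: Ev_def)
  have Wlk: "W l (- k) = 0" "W k (- k) = 0" "W k l = 0" "W l l = t"
    using neq l k by (auto simp: Wd bvec_apply)
  have Ek: "Ev (W k) (W l) 0 (bvec k 1) = bvec k 1"
    using k Wlk by (simp add: Ev_def h_bvec_right h_bvec_left)
  define x where "x = Ev (W k) (W l) 0 ?o"
  have x: "h x x = 0" "h x (bvec k 1) = 0"
  proof -
    have E0: "h (Ev (W k) (W l) 0 a) (Ev (W k) (W l) 0 b) = h a b" for a b
      using hW0 k l hWW by (intro Ev_preserves_h) auto
    show "h x x = 0" unfolding x_def E0 by (rule oo)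
    have "h x (Ev (W k) (W l) 0 (bvec k 1)) = h ?o (bvec k 1)" unfolding x_def E0 ..
    then show "h x (bvec k 1) = 0" using o' k neq by (simp add: Ek h_bvec_bvec)
  qed
  have xl: "x l = t * (s m o' * cj (eta (- k)) * B)"
  proof -
    have "h ?o (W k) = - (cj B * h ?u (bvec k 1))"
      using o' neq by (simp add: h_bvec_left Wd bvec_apply mult.assoc)
    then have "cj (h ?o (W k)) = - (s m o' * cj (eta (- k)) * B)"
      using k by (simp add: h_bvec_right cjs ui k_def)
    then show ?thesis using neq l Wlk by (simp add: x_def Ev_def bvec_apply)
  qed
  define v1 where "v1 = vscale x (- lam)"
  let ?T = "Eich ?o (bvec k 1) 0"
  have T: "?T \<in> EE" "?T \<in> GL n" using o' k EE_GL by (auto intro!: EE_short)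
  let ?T' = "Eich (bvec k 1) v1 0"
  have T': "mmul n (mmul n ?E ?T) (ginv n ?E) = ?T'"
    unfolding Eich_conj_Ev[OF EU] Ek x_def[symmetric] v1_def by (rule E.Eich_swap1)
  have T'E: "?T' \<in> EE" unfolding T'[symmetric] by (intro EE_mult EE_inv E T)
  have T'G: "?T' \<in> GL n" using T'E EE_GL by blast
  \<comment> \<open>\<open>?T'\<close> is the conjugate of \<open>?T\<close> by \<open>?E\<close>,
    and \<open>p\<close> its conjugate by \<open>ginv n s\<close>, \<open>?E\<close>,
    \<open>s\<close> multiplied in this order. They agree modulo \<open>H\<close>, because
    \<open>s\<close> lies in \<open>H\<close> and \<open>?E\<close>, \<open>?T\<close>,
    \<open>?T'\<close> normalize \<open>H\<close>.\<close>
  define p where "p = mmul n (mmul n (mmul n (ginv n s) (mmul n ?E s)) ?T) (ginv n (mmul n (ginv n s) (mmul n ?E s)))"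
  have pT: "mmul n p (ginv n ?T') \<in> H"
  proof -
    have "mmul n (mmul n (ginv n s) (mmul n (mmul n (mmul n ?E (gcomm n s ?T)) (ginv n ?E)) s)) (gcomm n (ginv n s) ?T') \<in> H"
      by (intro H_mult H_conj H_inv H_gcomm2 s E T T'E)
    moreover have "mmul n (mmul n (ginv n s) (mmul n (mmul n (mmul n ?E (gcomm n s ?T)) (ginv n ?E)) s)) (gcomm n (ginv n s) ?T')
       = mmul n p (ginv n ?T')"
      unfolding p_def gcomm_def T'[symmetric] using sG EG T by (simp add: gsimps)
    ultimately show ?thesis by simp
  qed
  define g where "g = mmul n (ginv n s) (mmul n ?E s)"
  define v2 where "v2 = mvec n g (bvec k 1)"
  have gU: "g \<in> UU" unfolding g_def by (intro U_mult U_inv sU EU)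
  have go: "mvec n g ?o i = ?o i" if "i \<in> Omega n" for i
  proof -
    have "mvec n g ?o i = mvec n (ginv n s) (mvec n ?E ?u) i" by (simp add: g_def mvec_mmul)
    also have "mvec n (ginv n s) (mvec n ?E ?u) = mvec n (ginv n s) ?u"
      by (rule mvec_cong) (simp add: mvec_Eich Eu)
    finally show ?thesis using that sG by (simp add: ginv_mvec)
  qed
  have p: "p = Eich ?o v2 0"
  proof -
    have "p = Eich (mvec n g ?o) v2 0"
      unfolding p_def g_def[symmetric] v2_def by (rule U_conj_Eich[OF gU])
    also have "\<dots> = Eich ?o v2 0" by (rule Eich_cong) (simp_all add: go)
    finally show ?thesis .
  qed
  have ov2: "h ?o v2 = 0"
  proof -
    have "h ?o v2 = h (mvec n g ?o) (mvec n g (bvec k 1))" unfolding v2_def by (rule h_cong) (simp_all add: go)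
    then show ?thesis using U_h[OF gU] o' k neq by (simp add: h_bvec_bvec)
  qed
  have v2o: "h v2 ?o = 0" by (rule h_eq_0_sym[OF ov2])
  have pG: "p \<in> GL n" unfolding p by (rule Eich_GL[OF oo(1) ov2])
  have v1: "h v1 v1 = 0" "h (bvec k 1) v1 = 0" "h v1 (bvec k 1) = 0"
    using x h_eq_0_sym[OF x(2)] by (simp_all add: v1_def hs)
  have kk: "h (bvec k 1) (bvec k 1) = 0" using k by (simp add: E.h_bvec_self)
  \<comment> \<open>Both \<open>p\<close> and \<open>?y\<close> are transvections along
    \<open>?o\<close>, so their commutator is only a long element, while the commutator of
    \<open>?y\<close> with \<open>?T'\<close> displays the coordinate \<open>v1 l\<close>, which
    carries the sought entry.\<close>
  let ?w = "bvec (- l) 1" let ?y = "Eich ?o ?w 0"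
  have yE: "?y \<in> EE" using o' l neq by (intro EE_short) auto
  have yU: "?y \<in> UU" and yG: "?y \<in> GL n" using yE EE_U EE_GL by auto
  have Evy: "Ev ?o ?w 0 z = z + bvec o' (eta (- l) * z l) - bvec (- l) (cj (eta (- o')) * z (- o'))" for z
    using o' l by (simp add: Ev_bvec_bvec)
  have yk: "Ev ?o ?w 0 (bvec k 1) = bvec k 1" "Ev ?o ?w 0 ?o = ?o"
    using o' l neq by (simp_all add: Evy bvec_apply)
  define a where "a = eta (- l) * v1 l"
  define b where "b = cj (eta (- o')) * v1 (- o')"
  have yv1: "Ev ?o ?w 0 v1 - v1 = bvec o' a - bvec (- l) b" by (simp add: Evy a_def b_def)
  define q where "q = - h v1 (bvec o' a - bvec (- l) b)"
  have yT': "mmul n (ginv n ?T') (mmul n (mmul n ?y ?T') (ginv n ?y)) = Eich (bvec k 1) (bvec o' a - bvec (- l) b) q"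
  proof -
    have "Ev ?o ?w 0 v1 = v1 + (bvec o' a - bvec (- l) b)" by (simp add: yv1[symmetric])
    moreover have "h (bvec k 1) (bvec o' a - bvec (- l) b) = 0" using o' l k neq by (auto simp: hs h_bvec_bvec)
    ultimately show ?thesis
      unfolding Eich_conj_Ev[OF yU] yk using kk v1 by (simp add: ginv_Eich Eich_mult hs q_def)
  qed
  have q0: "q + lam * cj q = 0"
  proof -
    let ?d = "bvec o' a - bvec (- l) b"
    have "h (Ev ?o ?w 0 v1) (Ev ?o ?w 0 v1) = h v1 v1"
      using o' l neq E.h_bvec_self[of o' 1 1] E.h_bvec_self[of "- l" 1 1] by (intro Ev_preserves_h) (auto simp: h_bvec_bvec)
    moreover have "Ev ?o ?w 0 v1 = v1 + ?d" by (simp add: yv1[symmetric])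
    moreover have "h ?d ?d = 0" using o' l neq E.h_bvec_self[of o' a a] E.h_bvec_self[of "- l" b b]
      by (auto simp: hs h_bvec_bvec)
    ultimately have "h v1 ?d + h ?d v1 = 0" using v1 by (simp add: h_add add.commute)
    then show ?thesis using h_conj[of ?d v1] by (simp add: q_def cjs add_eq_0_iff)
  qed
  define z where "z = - (eta (- l) * v2 l)"
  have pinv: "ginv n p = Eich ?o (- v2) (h v2 v2)"
    unfolding p using ginv_Eich[OF oo(1) ov2, of 0] by simp
  have v2mo: "v2 (- o') = 0"
  proof -
    have "eta o' * v2 (- o') = 0" using ov2 o' by (simp add: h_bvec_left)
    then show ?thesis by (metis eta_cj_assoc(2) mult_zero_right)
  qed
  have yp: "mmul n (mmul n (mmul n ?y (ginv n p)) (ginv n ?y)) p = Eich ?o 0 (z - lam * cj z)"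
  proof -
    have "Ev ?o ?w 0 (- v2) = - v2 + vscale ?o z" by (simp add: Evy v2mo z_def vscale_bvec)
    then have "mmul n (mmul n ?y (ginv n p)) (ginv n ?y) = Eich ?o (- v2 + vscale ?o z) (h v2 v2)"
      unfolding pinv Eich_conj_Ev[OF yU] yk by simp
    then have "mmul n (mmul n (mmul n ?y (ginv n p)) (ginv n ?y)) p
        = mmul n (Eich ?o (- v2 + vscale ?o z) (h v2 v2)) (Eich ?o v2 0)" by (simp only: p)
    also have "\<dots> = Eich ?o (vscale ?o z) 0" using oo ov2 by (simp add: Eich_mult hs)
    finally show ?thesis by (simp only: Eich_self)
  qed
  have v2f: "0 - f v2 v2 \<in> Lam"
  proof -
    have "f v2 v2 = Q g (bvec k 1)" using k by (simp add: Q_def v2_def E.f_bvec_self)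
    then show ?thesis using Lam_uminus[OF U_Q[OF gU, of "bvec k 1"]] by simp
  qed
  have pE: "p \<in> EE" unfolding p by (rule EE_bvec[OF o' v2mo v2f])
  let ?z = "mmul n p (ginv n ?T')"
  have "mmul n (mmul n (ginv n p) (mmul n ?z (mmul n (mmul n ?y (ginv n ?z)) (ginv n ?y)))) p \<in> H"
    by (intro H_conj' H_mult H_conj H_inv pT pE yE)
  moreover have "mmul n (mmul n (ginv n p) (mmul n ?z (mmul n (mmul n ?y (ginv n ?z)) (ginv n ?y)))) p
      = mmul n (mmul n (ginv n ?T') (mmul n (mmul n ?y ?T') (ginv n ?y)))
          (mmul n (mmul n (mmul n ?y (ginv n p)) (ginv n ?y)) p)"
    using pG T'G yG by (simp add: gsimps)
  ultimately have "mmul n (Eich (bvec k 1) (bvec o' a - bvec (- l) b) q) (Eich ?o 0 (z - lam * cj z)) \<in> H"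
    unfolding yT' yp by simp
  from level_two_long[OF o' k _ _ _ _ _ q0 this] have "a \<in> I" using l neq by auto
  then have "cj (eta (- l)) * a * (- cj lam) \<in> I" by (intro level_I_left level_I_right)
  then have "x l \<in> I" by (simp add: a_def v1_def mult.assoc)
  \<comment> \<open>This multiplication turns \<open>B\<close> into \<open>t\<close> and removes the
    weight from \<open>xl\<close>; together with the factor \<open>t\<close> already there it
    explains \<open>t * t\<close>.\<close>
  then have "x l * (s o' o' * eta (- k)) \<in> I" by (rule level_I_right)
  moreover have "x l * (s o' o' * eta (- k)) = t * (s m o' * (cj (eta (- k)) * ((B * s o' o') * eta (- k))))"
    by (simp add: xl mult.assoc)
  moreover have "\<dots> = t * (s m o' * t)" unfolding B(2) eta_commute[of _ t, symmetric] by simp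
  moreover have "\<dots> = t * t * s m o'" by (simp add: ts[OF m(1)] mult.assoc)
  ultimately show ?thesis by simp
qed

text \<open>\<open>extract_column\<close> treats all rows but \<open>- o'\<close>. Conjugating once
  more, by \<open>?E\<close>, adds that entry up to a weight to the one in row \<open>- i\<close>;
  both conjugates are in \<open>H\<close>, and comparing their columns yields the missing
  entry.\<close>

lemma level_column:
  assumes qf: "quasi_finite cj lam" and s: "s \<in> H" and o': "o' \<in> Omega n" and k: "k \<in> Omega n" "k \<noteq> o'"
  shows "s k o' \<in> I"
proof -
  have sGL: "s \<in> GL n" using s H_GL by blast
  let ?e = "bvec o' 1" let ?x = "mvec n s ?e"
  let ?Y = "(\<lambda>(i, j). s i j) ` (Omega n \<times> Omega n) \<union> (\<lambda>(i, j). ginv n s i j) ` (Omega n \<times> Omega n)"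
  have finY: "finite ?Y" by simp
  obtain S K g d where S: "finite_extension S K g d" "?Y \<subseteq> S" "lam \<in> S" "cj ` S \<subseteq> S" and Kcj: "\<And>k. k \<in> K \<Longrightarrow> cj k = k"
    by (rule quasi_finite_finite_extension[OF inv qf finY]) (rule that)
  interpret S: finite_extension S K g d by fact
  have S0: "0 \<in> S" using S.S_add[OF S.S1 S.S_uminus[OF S.S1]] by simp
  have sum: "(\<And>i. i \<in> A \<Longrightarrow> u i \<in> S) \<Longrightarrow> sum u A \<in> S" for A :: "int set" and u
    by (induction A rule: infinite_finite_induct) (auto simp: S0 intro: S.S_add)
  have ent: "s i j \<in> S" "ginv n s i j \<in> S" if "i \<in> Omega n" "j \<in> Omega n" for i j
    using S(2) that by auto
  have xS: "?x k \<in> S" if "k \<in> Omega n" for k using that o' ent by (simp add: mvec_bvec)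
  define A where "A = {t \<in> K. \<forall>k\<in>Omega n. k \<noteq> o' \<longrightarrow> t * s k o' \<in> I}"
  have "1 \<in> A"
  proof (rule S.local_global)
    show "A \<subseteq> K" by (auto simp: A_def)
    have "0 \<in> K" using S.K_add[OF S.K1 S.K_uminus[OF S.K1]] by simp
    then show "0 \<in> A" by (simp add: A_def level_I_0)
    show "x + y \<in> A" if "x \<in> A" "y \<in> A" for x y
      using that by (auto simp: A_def distrib_right S.K_add level_I_add)
    show "k * x \<in> A" if "k \<in> K" "x \<in> A" for k x
      using that by (auto simp: A_def mult.assoc S.K_mult level_I_left)
  next
    fix M assume M: "central_extension S K g d M"
    interpret M: central_extension S K g d M by fact
    obtain i where i: "i \<in> Omega n" "i \<noteq> o'" "i \<noteq> - o'" using exists_index[OF o' o'] by blast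
    have "\<exists>e. SG S o' e \<and> M.kunit (mvec n e ?x o') \<and> M.kunit (mvec n e ?x o' - cj (eta i) * mvec n e ?x i)"
    proof (rule exists_kunit_entry[OF S(4,3) M o' i])
      show "?x k \<in> S" if "k \<in> Omega n" for k by (rule xS[OF that])
      show "ginv n s o' k \<in> S" if "k \<in> Omega n" for k using that o' ent by simp
      have "mmul n (ginv n s) s o' o' = 1" using o' sGL by (simp add: ginv_mmul emat_def)
      then show "(\<Sum>k\<in>Omega n. ginv n s o' k * ?x k) = 1" using o' by (simp add: mmul_def mvec_bvec)
    qed blast
    then obtain e where e: "SG S o' e" and ku: "M.kunit (mvec n e ?x o')"
      "M.kunit (mvec n e ?x o' - cj (eta i) * mvec n e ?x i)" by blast
    have eE: "e \<in> EE" and eGL: "e \<in> GL n" and eo: "\<And>i. i \<in> Omega n \<Longrightarrow> mvec n e ?e i = ?e i"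
      using e EE_GL by (auto simp: SG_def)
    let ?u = "mvec n e ?x"
    let ?E = "Eich (bvec (- i) 1) (bvec o' 1) 0"
    have neq: "- i \<noteq> o'" "o' \<noteq> - i" "- o' \<noteq> i" "i \<noteq> - o'" "i \<noteq> - i" "o' \<noteq> - o'" using i o' Omega_neq_uminus by auto
    have E: "?E \<in> EE" using i o' neq by (intro EE_short) auto
    note E = E EE_GL[OF E]
    have Eo: "mvec n ?E ?e j = ?e j" if "j \<in> Omega n" for j
      using that i o' neq by (auto simp: mvec_Eich_short bvec_apply)
    let ?v = "mvec n ?E ?u"
    have v: "?v o' = ?u o' - cj (eta i) * ?u i" "?v (- i) = ?u (- i) + eta o' * ?u (- o')"
      using i o' neq by (auto simp: mvec_Eich_short)
    have uS: "?u k \<in> S" if "k \<in> Omega n" for k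
      unfolding mvec_def[of n e] using e xS that by (intro sum S.S_mult) (auto simp: SG_def)
    have vS: "?v k \<in> S" if "k \<in> Omega n" for k
    proof -
      have "eta o' \<in> S" "cj (eta i) \<in> S" using S(3,4) S.S1 by (auto simp: eta_def)
      then show ?thesis using that i o' neq uS
        by (auto simp: mvec_Eich_short intro!: S.S_add S.S_mult M.S_diff)
    qed
    have kill: "\<exists>t\<in>K. t \<notin> M \<and> (\<forall>m\<in>Omega n. m \<noteq> o' \<longrightarrow> m \<noteq> - o' \<longrightarrow> t * w m \<in> I)"
      if y: "y \<in> H" and col: "\<And>k. y k o' = w k" and wS: "\<And>k. k \<in> Omega n \<Longrightarrow> w k \<in> S" and wu: "M.kunit (w o')" for y w
    proof -
      obtain B t where B: "B \<in> S" "t \<in> K" "t \<notin> M" "w o' * B = t" "B * w o' = t"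
        using wu unfolding M.kunit_def by blast
      have "t * t * w m \<in> I" if m: "m \<in> Omega n" "m \<noteq> o'" "m \<noteq> - o'" for m
        using extract_column[OF y o' _ _ _ _ _ m, of B t] B wS Kcj S.central by (auto simp: col)
      moreover have "t * t \<in> K" "t * t \<notin> M" using B S.K_mult M.M_prime by blast+
      ultimately show ?thesis by blast
    qed
    obtain t1 where t1: "t1 \<in> K" "t1 \<notin> M" "\<And>m. m \<in> Omega n \<Longrightarrow> m \<noteq> o' \<Longrightarrow> m \<noteq> - o' \<Longrightarrow> t1 * ?u m \<in> I"
      using kill[OF H_conj[OF eE s] conj_column[OF eGL eo o'] uS ku(1)] by blast
    obtain t2 where t2: "t2 \<in> K" "t2 \<notin> M" "\<And>m. m \<in> Omega n \<Longrightarrow> m \<noteq> o' \<Longrightarrow> m \<noteq> - o' \<Longrightarrow> t2 * ?v m \<in> I"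
    proof -
      have "mmul n (mmul n ?E (mmul n (mmul n e s) (ginv n e))) (ginv n ?E) k o' = ?v k" for k
      proof -
        have "mvec n ?E (mvec n (mmul n (mmul n e s) (ginv n e)) ?e) = mvec n ?E ?u"
          using conj_column[OF eGL eo o'] o' by (intro mvec_cong) (simp add: mvec_bvec)
        then show ?thesis using conj_column[OF E(2) Eo o'] by simp
      qed
      from kill[OF H_conj[OF E(1) H_conj[OF eE s]] this vS] ku(2) show ?thesis
        using that unfolding v(1) by blast
    qed
    let ?t = "t2 * t1"
    have t: "?t \<in> K" "?t \<notin> M" "?t = t1 * t2" using t1 t2 S.K_mult M.M_prime S.central S.KS by blast+
    have tu: "?t * ?u m \<in> I" if m: "m \<in> Omega n" "m \<noteq> o'" for m
    proof (cases "m = - o'")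
      case False
      then show ?thesis using level_I_left[OF t1(3)[OF m False], of t2] by (simp add: mult.assoc)
    next
      case True
      have "?t * ?v (- i) \<in> I" unfolding t(3) using level_I_left[OF t2(3)[of "- i"], of t1] i neq by (simp add: mult.assoc)
      moreover have "?t * ?u (- i) \<in> I" using level_I_left[OF t1(3)[of "- i"], of t2] i neq by (simp add: mult.assoc)
      ultimately have "?t * ?v (- i) - ?t * ?u (- i) \<in> I" using R.I_diff by blast
      then have "eta o' * (?t * ?u m) \<in> I" by (simp add: v(2) True distrib_left eta_left_commute)
      then show ?thesis using level_I_left[of _ "cj (eta o')"] by force
    qed
    have "?t * s k o' \<in> I" if k: "k \<in> Omega n" "k \<noteq> o'" for k
    proof -
      have "s k o' = mvec n (ginv n e) ?u k" using k o' eGL by (simp add: ginv_mvec mvec_bvec)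
      then have 1: "s k o' = (\<Sum>j\<in>Omega n. ginv n e k j * ?u j)" by (simp only: mvec_def[of n "ginv n e"])
      have 2: "?t * (ginv n e k j * z) = ginv n e k j * (?t * z)" for j z
      proof -
        have "?t * ginv n e k j = ginv n e k j * ?t" using S.central[OF t(1)] e by (auto simp: SG_def)
        from arg_cong[OF this, of "\<lambda>y. y * z"] show ?thesis by (simp only: mult.assoc)
      qed
      have "?t * s k o' = (\<Sum>j\<in>Omega n. ginv n e k j * (?t * ?u j))"
        unfolding 1 sum_distrib_left 2 ..
      \<comment> \<open>The entry \<open>?u o'\<close> is not known to be in \<open>I\<close>; it
        drops out because \<open>ginv n e\<close> fixes \<open>bvec o' 1\<close>.\<close>
      moreover have "ginv n e k o' = 0"
        using ginv_fixes[OF eGL eo k(1)] o' k by (simp add: mvec_bvec bvec_apply)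
      then have "ginv n e k j * (?t * ?u j) \<in> I" if "j \<in> Omega n" for j
        using that tu[of j] level_I_left level_I_0 by (cases "j = o'") auto
      ultimately show ?thesis by (simp add: R.I_sum)
    qed
    then show "\<exists>s\<in>A. s \<notin> M" using t unfolding A_def by blast
  qed
  then show ?thesis using k by (auto simp: A_def)
qed

end

section \<open>The sandwich classification\<close>

context hyperbolic
begin

lemma Q_long:
  assumes p: "p \<in> Omega n" "p > 0" and a: "a \<in> Lam"
  shows "Q (Eich (bvec p 1) 0 a) w = cj (w (- p)) * a * w (- p)"
proof -
  define z where "z = a * (w (- p) * cj lam)"
  have "cj (h w (bvec p 1)) = w (- p) * cj lam" using p by (simp add: h_bvec_right eta_def cj_mult)
  then have T: "mvec n (Eich (bvec p 1) 0 a) w i = (w - bvec p z) i" if "i \<in> Omega n" for i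
    using that by (simp add: mvec_Eich Ev_def z_def bvec_apply)
  have "f w (bvec p z) = 0"
    unfolding form_f_def by (rule sum.neutral) (use p in \<open>auto simp: bvec_apply\<close>)
  moreover have "f (bvec p z) w = cj z * w (- p)"
  proof -
    have "f (bvec p z) w = (\<Sum>i\<in>{1..int n}. if i = p then cj z * w (- p) else 0)"
      unfolding form_f_def by (rule sum.cong) (auto simp: bvec_apply)
    then show ?thesis using p by (auto simp: Omega_def)
  qed
  moreover have "Q (Eich (bvec p 1) 0 a) w = f (w - bvec p z) (w - bvec p z) - f w w"
    unfolding Q_def by (intro arg_cong2[of _ _ _ _ minus] f_cong T refl)
  ultimately have "Q (Eich (bvec p 1) 0 a) w = - (cj z * w (- p))"
    using p by (simp add: fs E.f_bvec_self)
  moreover have "cj z = - (cj (w (- p)) * a)"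
    using Lam_max[OF a] lam_left_commute[of "cj (w (- p))" "cj a"] by (simp add: z_def cj_mult mult.assoc)
  ultimately show ?thesis by simp
qed

lemma Q_short:
  assumes "i \<in> Omega n" "k \<in> Omega n" "k \<noteq> i" "k \<noteq> - i" "b \<in> Omega n"
  shows "Q (Eich (bvec i 1) (bvec k r) 0) (bvec b 1) = 0"
proof -
  let ?v = "if b = - k then bvec b 1 + bvec i (cj r * eta k) else if b = - i then bvec b 1 - bvec k (r * cj (eta (- i))) else bvec b 1"
  have T: "mvec n (Eich (bvec i 1) (bvec k r) 0) (bvec b 1) j = ?v j" if "j \<in> Omega n" for j
    using that assms by (auto simp: mvec_Eich_short bvec_apply)
  have "Q (Eich (bvec i 1) (bvec k r) 0) (bvec b 1) = f ?v ?v - f (bvec b 1) (bvec b 1)"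
    unfolding Q_def by (intro arg_cong2[of _ _ _ _ minus] f_cong T refl)
  also have "\<dots> = 0" using assms by (auto simp: fs f_bvec Omega_def)
  finally show ?thesis .
qed

end

context relative
begin

text \<open>If all elementary conjugates of \<open>s\<close> are diagonal modulo \<open>I\<close>,
  then \<open>s\<close> is scalar there: for a short root element \<open>T\<close> with parameter
  \<open>x\<close>, row \<open>i\<close> of the relation between \<open>s\<close> and its conjugate
  makes \<open>s i i * x\<close> congruent to \<open>x * s b b\<close>. For \<open>x = 1\<close> the
  diagonal entries agree, and general \<open>x\<close> makes them central modulo
  \<open>I\<close>.\<close>

lemma scalar_mod:
  assumes s: "s \<in> GL n"
    and off: "\<And>T k j. T \<in> EE \<Longrightarrow> k \<in> Omega n \<Longrightarrow> j \<in> Omega n \<Longrightarrow> k \<noteq> j \<Longrightarrow> mmul n (mmul n T s) (ginv n T) k j \<in> I"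
  obtains c where "\<And>v. vI (mvec n s v) (vscale v c)"
proof -
  have s_off: "s k j \<in> I" if "k \<in> Omega n" "j \<in> Omega n" "k \<noteq> j" for k j
    using off[OF EE_one that] s by (simp add: ginv_emat gsimps)
  have diag: "mvec n t v k - t k k * v k \<in> I"
    if "k \<in> Omega n" "\<And>j. j \<in> Omega n \<Longrightarrow> k \<noteq> j \<Longrightarrow> t k j \<in> I" for t v k
  proof -
    have "mvec n t v k = t k k * v k + (\<Sum>j\<in>Omega n - {k}. t k j * v j)"
      unfolding mvec_def using that(1) by (intro sum.remove) auto
    then show ?thesis using that by (auto intro!: I_sum I_right)
  qed
  have key: "s i i * x - x * s b b \<in> I" if ib: "i \<in> Omega n" "b \<in> Omega n" "b \<noteq> i" "b \<noteq> - i" for i b x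
  proof -
    define T where "T = Eich (bvec i 1) (bvec (- b) (cj (x * cj (eta (- b))))) 0"
    define t where "t = mmul n (mmul n T s) (ginv n T)"
    have T: "T \<in> EE" unfolding T_def using ib by (intro EE_short) auto
    have t_off: "t i j \<in> I" if "j \<in> Omega n" "i \<noteq> j" for j
      unfolding t_def by (rule off[OF T ib(1) that])
    have Ti: "mvec n T u i = u i + x * u b" for u
      unfolding T_def using ib by (auto simp: mvec_Eich_short mult.assoc)
    have "mmul n t T = mmul n T s" using s T EE_GL by (simp add: t_def gsimps)
    then have eq: "mvec n t (mvec n T u) i = mvec n s u i + x * mvec n s u b" for u
      using Ti[of "mvec n s u"] by (simp flip: mvec_mmul)
    have 1: "s i b + x * s b b - t i i * x \<in> I"
      using diag[of i t, OF ib(1) t_off, of "mvec n T (bvec b 1)"] ib by (simp add: eq Ti mvec_bvec bvec_apply)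
    have 2: "s i i + x * s b i - t i i \<in> I"
      using diag[of i t, OF ib(1) t_off, of "mvec n T (bvec i 1)"] ib by (simp add: eq Ti mvec_bvec bvec_apply)
    have "(s i i + x * s b i - t i i) * x - (s i b + x * s b b - t i i * x) - x * s b i * x + s i b \<in> I"
      by (intro I_add[OF I_diff[OF I_diff[OF I_right[OF 2] 1] I_right[OF I_left]]] s_off) (use ib in auto)
    then show ?thesis by (simp add: algebra_simps)
  qed
  have "(1::int) \<in> Omega n" "2 \<in> Omega n" using n3 by (auto simp: Omega_def)
  \<comment> \<open>\<open>key\<close> compares different hyperbolic planes only, so the indices 1
    and - 1 are compared with 1 by way of 2.\<close>
  have scal: "s k k * x - x * s 1 1 \<in> I" if k: "k \<in> Omega n" for k x
  proof (cases "k = 1 \<or> k = - 1")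
    case False
    then show ?thesis using k \<open>1 \<in> Omega n\<close> by (intro key) auto
  next
    case True
    then have "s k k * x - x * s 2 2 \<in> I" using k \<open>2 \<in> Omega n\<close> by (intro key) auto
    moreover have "s 2 2 * 1 - 1 * s 1 1 \<in> I" using \<open>1 \<in> Omega n\<close> \<open>2 \<in> Omega n\<close> by (intro key) auto
    ultimately have "(s k k * x - x * s 2 2) + x * (s 2 2 * 1 - 1 * s 1 1) \<in> I" by (intro I_add I_left)
    then show ?thesis by (simp add: algebra_simps)
  qed
  have "vI (mvec n s v) (vscale v (s 1 1))" for v
    unfolding vI_def vscale_apply
  proof
    fix k assume k: "k \<in> Omega n"
    have "(mvec n s v k - s k k * v k) + (s k k * v k - v k * s 1 1) \<in> I"
      by (intro I_add diag scal s_off k) auto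
    then show "mvec n s v k - v k * s 1 1 \<in> I" by simp
  qed
  then show thesis by (rule that)
qed

text \<open>The crossed homomorphism \<open>Q\<close> is evaluated on the relation that
  \<open>gcomm n s t\<close> times \<open>t\<close> times \<open>s\<close> is \<open>s\<close> times
  \<open>t\<close>, so that no inverse occurs.\<close>

lemma Q_gcomm:
  assumes "s \<in> GL n" "t \<in> GL n"
  shows "Q (gcomm n s t) (mvec n t (mvec n s v)) + Q t (mvec n s v) + Q s v = Q s (mvec n t v) + Q t v"
proof -
  have "mmul n (mmul n (gcomm n s t) t) s = mmul n s t"
    using assms by (simp add: gcomm_def gsimps)
  then have "Q (mmul n (mmul n (gcomm n s t) t) s) v = Q (mmul n s t) v" by simp
  then show ?thesis by (simp add: Q_mult mvec_mmul)
qed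

text \<open>Insert elementary \<open>g\<close> of known defect into the commutator identity. Short
  root elements have defect 0 on basis vectors and move \<open>bvec b 1\<close> to
  \<open>bvec b 1 + bvec i x\<close>, which puts the value of \<open>Q s\<close> at
  \<open>bvec i x\<close> into \<open>Gam\<close>. Once \<open>Q s\<close> is known everywhere, a
  long root element, with an arbitrary element of \<open>Lam\<close> as defect, yields the condition
  on \<open>c\<close>.\<close>

lemma CUp_I:
  assumes s: "s \<in> UU" and c: "\<And>v. vI (mvec n s v) (vscale v c)"
    and comm: "\<And>t v. t \<in> EE \<Longrightarrow> Q (gcomm n s t) v \<in> Gam"
  shows "CUp s"
proof -
  have sGL: "s \<in> GL n" using s U_GL by blast
  have *: "Q s (mvec n g v) - Q s v + (Q g v - cj c * Q g v * c) \<in> Gam" if g: "g \<in> EE" for g v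
  proof -
    have gGL: "g \<in> GL n" "g \<in> UU" using g EE_GL EE_U by auto
    have "Q s (mvec n g v) - Q s v + (Q g v - cj c * Q g v * c)
        = Q (gcomm n s g) (mvec n g (mvec n s v)) + (Q g (mvec n s v) - Q g (vscale v c))"
      using Q_gcomm[OF sGL gGL(1), of v] by (simp add: Q_vscale algebra_simps)
    also have "\<dots> \<in> Gam" by (intro Gam_add comm g Q_vI gGL c)
    finally show ?thesis .
  qed
  have add: "f (mvec n s x) (mvec n s y) - f x y \<in> I" for x y
  proof -
    have "f (mvec n s x) (mvec n s y) - f (vscale x c) (vscale y c) \<in> I" by (intro f_vI c)
    then have "(f (mvec n s x) (mvec n s y) - f (vscale x c) (vscale y c)) - (f x y - cj c * f x y * c) \<in> I"
      by (rule I_diff[OF _ scalar_unitary[OF s c]])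
    then show ?thesis by (simp add: f_vscale algebra_simps)
  qed
  have Qi: "Q s (bvec i x) \<in> Gam" if i: "i \<in> Omega n" for i x
  proof -
    obtain b where b: "b \<in> Omega n" "b \<noteq> i" "b \<noteq> - i" using exists_index[OF i i] by blast
    define T where "T = Eich (bvec i 1) (bvec (- b) (cj (x * cj (eta (- b))))) 0"
    have T: "T \<in> EE" unfolding T_def using i b by (intro EE_short) auto
    have "Q T (bvec b 1) = 0" unfolding T_def using i b by (intro Q_short) auto
    moreover have "Q s (mvec n T (bvec b 1)) = Q s (bvec b 1 + bvec i x)"
      unfolding T_def using i b Omega_neq_uminus[OF b(1)]
      by (intro Q_cong) (auto simp: mvec_Eich_short bvec_apply mult.assoc)
    ultimately have 1: "Q s (bvec b 1 + bvec i x) - Q s (bvec b 1) \<in> Gam" using *[OF T, of "bvec b 1"] by simp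
    have "Q s (bvec b 1 + bvec i x) - (Q s (bvec b 1) + Q s (bvec i x)) \<in> Gam"
      by (rule Q_add[OF s add])
    from Gam_diff[OF 1 this] show ?thesis by simp
  qed
  have Qs: "Q s v \<in> Gam" for v by (rule Q_bvecs[OF s Qi add])
  have "a - cj c * a * c \<in> Gam" if a: "a \<in> Lam" for a
  proof -
    have 1: "(1::int) \<in> Omega n" using n3 by (auto simp: Omega_def)
    let ?T = "Eich (bvec 1 1) 0 a" let ?e = "bvec (- 1) 1"
    have "Q s (mvec n ?T ?e) - Q s ?e + (Q ?T ?e - cj c * Q ?T ?e * c) \<in> Gam" by (rule *[OF EE_long[OF 1 a]])
    then have "(Q s (mvec n ?T ?e) - Q s ?e + (Q ?T ?e - cj c * Q ?T ?e * c)) - (Q s (mvec n ?T ?e) - Q s ?e) \<in> Gam"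
      by (intro Gam_diff Qs)
    then show ?thesis using 1 a by (simp add: Q_long bvec_apply)
  qed
  then show ?thesis using s c Qs unfolding CUp_def by blast
qed

section \<open>Commutators and the description of \<open>CU_rel\<close>\<close>

definition cong1 :: "'a mat \<Rightarrow> bool" where "cong1 s \<longleftrightarrow> (\<forall>v. vI (mvec n s v) v)"

lemma cong1_mult: "cong1 s \<Longrightarrow> cong1 t \<Longrightarrow> cong1 (mmul n s t)"
  unfolding cong1_def mvec_mmul by (blast intro: vI_trans)

lemma cong1_inv: assumes "s \<in> GL n" "cong1 s" shows "cong1 (ginv n s)"
  unfolding cong1_def
proof
  fix v
  have "vI (mvec n s (mvec n (ginv n s) v)) (mvec n (ginv n s) v)" using assms(2) by (simp add: cong1_def)
  then have "vI v (mvec n (ginv n s) v)" by (rule vI_cong) (simp_all add: mvec_ginv assms(1))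
  then show "vI (mvec n (ginv n s) v) v" by (rule vI_sym)
qed

lemma cong1_iff: assumes "s \<in> GL n" shows "cong1 s \<longleftrightarrow> (\<forall>i\<in>Omega n. \<forall>j\<in>Omega n. s i j - emat n i j \<in> I)"
proof
  assume *: "cong1 s"
  have "s i j - emat n i j \<in> I" if "i \<in> Omega n" "j \<in> Omega n" for i j
  proof -
    have "vI (mvec n s (bvec j 1)) (bvec j 1)" using * by (simp add: cong1_def)
    then show ?thesis using that by (auto simp: vI_def mvec_bvec emat_def bvec_apply)
  qed
  then show "\<forall>i\<in>Omega n. \<forall>j\<in>Omega n. s i j - emat n i j \<in> I" by blast
next
  assume *: "\<forall>i\<in>Omega n. \<forall>j\<in>Omega n. s i j - emat n i j \<in> I"
  have "mvec n s v k - v k \<in> I" if "k \<in> Omega n" for v k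
  proof -
    have "mvec n s v k - v k = mvec n s v k - mvec n (emat n) v k" using that by (simp add: mvec_emat)
    also have "\<dots> = (\<Sum>j\<in>Omega n. (s k j - emat n k j) * v j)"
      by (simp add: mvec_def left_diff_distrib sum_subtractf)
    also have "\<dots> \<in> I" using * that by (intro I_sum I_right) auto
    finally show ?thesis .
  qed
  then show "cong1 s" by (auto simp: cong1_def vI_def)
qed

lemma cong1_gcomm:
  assumes s: "s \<in> GL n" "\<And>v. vI (mvec n s v) (vscale v c)" and t: "t \<in> GL n"
  shows "cong1 (gcomm n s t)"
  unfolding cong1_def
proof
  fix v
  define y where "y = mvec n (ginv n t) v"
  define z where "z = mvec n (ginv n s) y"
  have sz: "mvec n s z i = y i" if "i \<in> Omega n" for i using that s by (simp add: z_def mvec_ginv)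
  have "vI (mvec n s (mvec n t z)) (mvec n t (vscale z c))" using s(2)[of "mvec n t z"] by (simp add: mvec_vscale)
  moreover have "vI (mvec n t (vscale z c)) (mvec n t (mvec n s z))" by (intro vI_mvec vI_sym[OF s(2)])
  ultimately have "vI (mvec n s (mvec n t z)) (mvec n t (mvec n s z))" by (rule vI_trans)
  moreover have "mvec n t (mvec n s z) i = v i" if "i \<in> Omega n" for i
    using mvec_cong[of n "mvec n s z" y t] sz that t by (simp add: y_def mvec_ginv)
  moreover have "mvec n (gcomm n s t) v = mvec n s (mvec n t z)" by (simp add: gcomm_def mvec_mmul z_def y_def)
  ultimately show "vI (mvec n (gcomm n s t) v) v" using vI_cong by simp
qed

lemma U_rel_iff: "s \<in> U_rel cj lam Lam n (I, Gam) \<longleftrightarrow> s \<in> UU \<and> cong1 s \<and> (\<forall>v. Q s v \<in> Gam)"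
  using cong1_iff[OF U_GL] by (auto simp: U_rel_def Q_def)

text \<open>If \<open>CUp s\<close>, the commutator identity expresses the defect of
  \<open>gcomm n s t\<close> through that of \<open>s\<close> and terms controlled by the scalar.
  Conversely, commutators with short root elements give the off-diagonal entries of
  \<open>s\<close>, further elementary commutators those of its conjugates, and then
  \<open>scalar_mod\<close> and \<open>CUp_I\<close> take over.\<close>

lemma CU_rel_iff: "s \<in> CU_rel cj lam Lam n (I, Gam) \<longleftrightarrow> CUp s"
proof
  assume s: "CUp s"
  then obtain c where c: "\<And>v. vI (mvec n s v) (vscale v c)" "\<And>a. a \<in> Lam \<Longrightarrow> a - cj c * a * c \<in> Gam"
    and Qs: "\<And>v. Q s v \<in> Gam" and sU: "s \<in> UU" by (auto simp: CUp_def)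
  have sGL: "s \<in> GL n" using sU U_GL by blast
  have "gcomm n s t \<in> U_rel cj lam Lam n (I, Gam)" if t: "t \<in> UU" for t
    unfolding U_rel_iff
  proof (intro conjI allI)
    have tGL: "t \<in> GL n" using t U_GL by blast
    show "gcomm n s t \<in> UU" unfolding gcomm_def by (intro U_mult U_inv sU t)
    show "cong1 (gcomm n s t)" by (rule cong1_gcomm[OF sGL c(1) tGL])
    fix w
    define v where "v = mvec n (ginv n s) (mvec n (ginv n t) w)"
    have sv: "mvec n s v i = mvec n (ginv n t) w i" if "i \<in> Omega n" for i
      using that sGL by (simp add: v_def mvec_ginv)
    have "mvec n t (mvec n s v) i = w i" if "i \<in> Omega n" for i
      using mvec_cong[of n "mvec n s v" "mvec n (ginv n t) w" t] sv that tGL by (simp add: mvec_ginv)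
    then have "Q (gcomm n s t) w = Q (gcomm n s t) (mvec n t (mvec n s v))" by (intro Q_cong) simp
    also have "\<dots> = Q s (mvec n t v) - Q s v + (Q t v - cj c * Q t v * c) - (Q t (mvec n s v) - Q t (vscale v c))"
      using Q_gcomm[OF sGL tGL, of v] by (simp add: Q_vscale algebra_simps)
    also have "\<dots> \<in> Gam" by (intro Gam_diff Gam_add Qs c U_Q t Q_vI)
    finally show "Q (gcomm n s t) w \<in> Gam" .
  qed
  then show "s \<in> CU_rel cj lam Lam n (I, Gam)" using sU by (simp add: CU_rel_def gcomm_def)
next
  assume s: "s \<in> CU_rel cj lam Lam n (I, Gam)"
  then have sU: "s \<in> UU" by (simp add: CU_rel_def)
  have sGL: "s \<in> GL n" using sU U_GL by blast
  have comm: "cong1 (gcomm n s t)" "Q (gcomm n s t) v \<in> Gam" if "t \<in> UU" for t v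
  proof -
    have "gcomm n s t \<in> U_rel cj lam Lam n (I, Gam)" using s that by (simp add: CU_rel_def gcomm_def)
    then show "cong1 (gcomm n s t)" "Q (gcomm n s t) v \<in> Gam" by (auto simp: U_rel_iff)
  qed
  have s_off: "s k j \<in> I" if kj: "k \<in> Omega n" "j \<in> Omega n" "k \<noteq> j" for k j
  proof -
    obtain b where b: "b \<in> Omega n" "b \<noteq> j" "b \<noteq> - j" "b \<noteq> k" "b \<noteq> - k" using exists_index[OF kj(2,1)] by blast
    \<comment> \<open>\<open>T\<close> sends \<open>bvec b 1\<close> to
      \<open>bvec b 1 + bvec j 1\<close> and leaves row \<open>k\<close> alone, so the comparison
      isolates \<open>s k j\<close>.\<close>
    define T where "T = Eich (bvec j 1) (bvec (- b) (cj (1 * cj (eta (- b))))) 0"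
    have T: "T \<in> EE" unfolding T_def using kj b by (intro EE_short) auto
    note T' = subsetD[OF EE_U T] EE_GL[OF T]
    have Tb: "mvec n T (bvec b 1) i = (bvec b 1 + bvec j 1) i" if "i \<in> Omega n" for i
      unfolding T_def using that kj b Omega_neq_uminus[OF b(1)] by (auto simp: mvec_Eich_short bvec_apply mult.assoc)
    have Tk: "mvec n T u k = u k" for u
      unfolding T_def using kj b by (auto simp: mvec_Eich_short)
    have "mmul n (gcomm n s T) (mmul n T s) = mmul n s T" using sGL T' by (simp add: gcomm_def gsimps)
    then have "mvec n (gcomm n s T) (mvec n (mmul n T s) (bvec b 1)) = mvec n s (mvec n T (bvec b 1))"
      by (simp flip: mvec_mmul)
    also have "\<dots> = mvec n s (bvec b 1 + bvec j 1)" by (rule mvec_cong[OF Tb])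
    finally have "vI (mvec n s (bvec b 1 + bvec j 1)) (mvec n T (mvec n s (bvec b 1)))"
      using comm(1)[OF T'(1)] unfolding cong1_def by (metis mvec_mmul)
    then show ?thesis using kj b unfolding vI_def by (force simp: mvec_add mvec_bvec Tk)
  qed
  obtain c where c: "\<And>v. vI (mvec n s v) (vscale v c)"
  proof (rule scalar_mod[OF sGL])
    fix T k j assume T: "T \<in> EE" and kj: "k \<in> Omega n" "j \<in> Omega n" "k \<noteq> j"
    note T' = subsetD[OF EE_U T] EE_GL[OF T]
    let ?t = "mmul n (mmul n T s) (ginv n T)"
    have "gcomm n s T \<in> GL n" using sGL T' by (simp add: gcomm_def gsimps)
    then have "cong1 (ginv n (gcomm n s T))" by (intro cong1_inv comm T')
    then have "vI (mvec n (ginv n (gcomm n s T)) (mvec n s (bvec j 1))) (mvec n s (bvec j 1))" by (simp add: cong1_def)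
    moreover have "mmul n (ginv n (gcomm n s T)) s = ?t" using sGL T' by (simp add: gcomm_def gsimps)
    ultimately have "?t k j - s k j \<in> I" using kj by (simp add: vI_def mvec_bvec flip: mvec_mmul)
    from I_add[OF this s_off[OF kj]] show "?t k j \<in> I" by simp
  qed blast
  show "CUp s" by (rule CUp_I[OF sU c]) (use comm EE_U in blast)
qed

end

section \<open>Defects of the elements of \<open>H\<close>, and uniqueness of the level\<close>

context normal_subgroup
begin

text \<open>As \<open>s\<close> is trivial modulo \<open>I\<close>, the commutator with
  \<open>ginv n T\<close> acts on its defect as a difference operator modulo
  \<open>Gam\<close>.\<close>

lemma comm_step:
  assumes s: "s \<in> H" "R.cong1 s" and T: "T \<in> EE"
  obtains t where "t \<in> H" "R.cong1 t" "\<And>w. Q t w - (Q s w - Q s (mvec n T w)) \<in> Gam"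
proof
  define g where "g = ginv n T"
  have g: "g \<in> EE" "g \<in> UU" "g \<in> GL n" and sU: "s \<in> UU" "s \<in> GL n"
    using EE_inv[OF T] EE_U EE_GL s H_U H_GL by (auto simp: g_def)
  let ?t = "gcomm n s g"
  show tH: "?t \<in> H" using s g by (intro H_gcomm2)
  show "R.cong1 ?t" using R.cong1_gcomm[of s 1 g] s sU g by (simp add: R.cong1_def)
  fix w
  define v where "v = mvec n T w"
  have sv: "R.vI (mvec n s v) v" using s by (simp add: R.cong1_def)
  have gv: "mvec n g v i = w i" if "i \<in> Omega n" for i using that T EE_GL by (simp add: g_def v_def ginv_mvec)
  have w: "Q ?t w = Q ?t (mvec n g v)" "Q s w = Q s (mvec n g v)" using gv by (intro Q_cong; simp)+
  have "Q ?t w - (Q s w - Q s v) = - (Q ?t (mvec n g (mvec n s v)) - Q ?t (mvec n g v)) - (Q g (mvec n s v) - Q g v)"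
    using R.Q_gcomm[OF sU(2) g(3), of v] unfolding w by (simp add: algebra_simps)
  also have "\<dots> \<in> Gam" using tH H_U by (intro R.Gam_diff R.Gam_uminus R.Q_vI R.vI_mvec sv g) auto
  finally show "Q ?t w - (Q s w - Q s (mvec n T w)) \<in> Gam" unfolding v_def .
qed

lemma cong1_f: "R.cong1 s \<Longrightarrow> f (mvec n s x) (mvec n s y) - f x y \<in> I"
  by (intro R.f_vI) (auto simp: R.cong1_def)

text \<open>A short root element moves only two basis vectors. The differences therefore carry the
  defect at \<open>i\<close> to \<open>- k\<close> and that at \<open>k\<close> to
  \<open>- i\<close>, with a sign, and vanish elsewhere.\<close>

lemma comm_step_short:
  assumes s: "s \<in> H" "R.cong1 s" and ik: "i \<in> Omega n" "k \<in> Omega n" "k \<noteq> i" "k \<noteq> - i"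
  obtains t where "t \<in> H" "R.cong1 t" "Q t (bvec (- k) 1) + Q s (bvec i 1) \<in> Gam"
    "Q t (bvec (- i) 1) + Q s (bvec k 1) \<in> Gam"
    "\<And>b. b \<in> Omega n \<Longrightarrow> b \<noteq> - k \<Longrightarrow> b \<noteq> - i \<Longrightarrow> Q t (bvec b 1) \<in> Gam"
proof -
  have sU: "s \<in> UU" using s H_U by blast
  let ?T = "Eich (bvec i 1) (bvec k 1) 0"
  obtain t where t: "t \<in> H" "R.cong1 t" "\<And>w. Q t w - (Q s w - Q s (mvec n ?T w)) \<in> Gam"
    by (rule comm_step[OF s EE_short[OF ik]]) (rule that)
  have neq: "- k \<noteq> i" "i \<noteq> - i" "k \<noteq> - k" using ik Omega_neq_uminus by auto
  have tb: "Q t (bvec b 1) + Q s x \<in> Gam"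
    if "b \<in> Omega n" "\<And>j. j \<in> Omega n \<Longrightarrow> mvec n ?T (bvec b 1) j = (bvec b 1 + x) j" for b x
  proof -
    have "Q s (bvec b 1 + x) - (Q s (bvec b 1) + Q s x) \<in> Gam" by (rule R.Q_add[OF sU cong1_f[OF s(2)]])
    moreover have "Q s (mvec n ?T (bvec b 1)) = Q s (bvec b 1 + x)" by (rule Q_cong[OF that(2)])
    ultimately have "(Q t (bvec b 1) - (Q s (bvec b 1) - Q s (mvec n ?T (bvec b 1))))
        - (Q s (mvec n ?T (bvec b 1)) - (Q s (bvec b 1) + Q s x)) \<in> Gam"
      by (intro R.Gam_diff[OF t(3)]) simp
    then show ?thesis by (simp add: algebra_simps)
  qed
  have Qe: "Q s (bvec j z) = cj z * Q s (bvec j 1) * z" for j z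
    using Q_vscale[of s "bvec j 1" z] by (simp add: vscale_bvec)
  have eta_conj: "cj (eta j) * y * eta j = y" "eta j * y * cj (eta j) = y" for j y
    by (simp add: mult.assoc flip: eta_commute[of j y]) (simp add: mult.assoc eta_commute[of j y])
  show thesis
  proof (rule that[OF t(1,2)])
    have "Q t (bvec (- k) 1) + Q s (bvec i (eta k)) \<in> Gam"
      using ik neq by (intro tb) (auto simp: mvec_Eich_short bvec_apply)
    then show "Q t (bvec (- k) 1) + Q s (bvec i 1) \<in> Gam" by (simp add: Qe[of i "eta k"] eta_conj)
    have "Q t (bvec (- i) 1) + Q s (bvec k (- cj (eta (- i)))) \<in> Gam"
      using ik neq by (intro tb) (auto simp: mvec_Eich_short bvec_apply)
    then show "Q t (bvec (- i) 1) + Q s (bvec k 1) \<in> Gam" by (simp add: Qe[of k "- _"] cjs eta_conj)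
    show "Q t (bvec b 1) \<in> Gam" if "b \<in> Omega n" "b \<noteq> - k" "b \<noteq> - i" for b
    proof -
      have "Q t (bvec b 1) + Q s 0 \<in> Gam" using that ik neq by (intro tb) (auto simp: mvec_Eich_short bvec_apply)
      moreover have "Q s 0 = 0" using Qe[of 0 0] by simp
      ultimately show ?thesis by simp
    qed
  qed
qed

text \<open>Two commutators reduce to the case that \<open>Q\<close> is supported on one basis vector. Then \<open>s\<close> is a long
  root element up to a factor in \<open>CU_rel\<close>, and the relative commutator formula removes that factor.\<close>

lemma Q_cong1_Gam:
  assumes qf: "quasi_finite cj lam" and s: "s \<in> H" "R.cong1 s"
  shows "Q s v \<in> Gam"
proof -
  have sU: "s \<in> UU" using s H_U by blast
  have basis: "Q s (bvec j 1) \<in> Gam" if j: "j \<in> Omega n" for j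
  proof -
    define a where "a = Q s (bvec j 1)"
    have aL: "a \<in> Lam" unfolding a_def by (rule U_Q[OF sU])
    have aI: "a \<in> I" unfolding a_def Q_def by (rule cong1_f[OF s(2)])
    obtain k where k: "k \<in> Omega n" "k \<noteq> j" "k \<noteq> - j" using exists_index[OF j j] by blast
    obtain l where l: "l \<in> Omega n" "l > 0" "l \<noteq> j" "l \<noteq> - j" "l \<noteq> k" "l \<noteq> - k" using exists_index[OF j k(1)] by blast
    \<comment> \<open>\<open>t1\<close> carries the defect \<open>- a\<close> at \<open>- k\<close>
      and an unknown one at \<open>- j\<close>. The next commutator, for the indices
      \<open>- k\<close> and \<open>l\<close>, passes the former on to \<open>- l\<close> and drops
      the unknown one.\<close>
    obtain t1 where t1: "t1 \<in> H" "R.cong1 t1" "Q t1 (bvec (- k) 1) + a \<in> Gam"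
      "\<And>b. b \<in> Omega n \<Longrightarrow> b \<noteq> - k \<Longrightarrow> b \<noteq> - j \<Longrightarrow> Q t1 (bvec b 1) \<in> Gam"
      using comm_step_short[OF s j k] unfolding a_def by blast
    obtain t where t: "t \<in> H" "R.cong1 t" "Q t (bvec (- l) 1) + Q t1 (bvec (- k) 1) \<in> Gam"
      "Q t (bvec k 1) + Q t1 (bvec l 1) \<in> Gam"
      "\<And>b. b \<in> Omega n \<Longrightarrow> b \<noteq> - l \<Longrightarrow> b \<noteq> k \<Longrightarrow> Q t (bvec b 1) \<in> Gam"
      using comm_step_short[OF t1(1,2), of "- k" l] k l by auto
    have Qt: "Q t (bvec b 1) - (if b = - l then a else 0) \<in> Gam" if b: "b \<in> Omega n" for b
    proof -
      have "Q t (bvec (- l) 1) - a \<in> Gam" using R.Gam_diff[OF t(3) t1(3)] by simp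
      moreover have "Q t (bvec k 1) \<in> Gam" using R.Gam_diff[OF t(4) t1(4)[OF l(1)]] l by force
      ultimately show ?thesis using t(5)[OF b] by auto
    qed
    let ?L = "Eich (bvec l 1) 0 a"
    have L: "?L \<in> EE" by (rule EE_long[OF l(1) aL])
    have LU: "?L \<in> UU" "?L \<in> GL n" using L EE_U EE_GL by auto
    have L1: "R.cong1 ?L"
      unfolding R.cong1_def R.vI_def
      using l aI by (auto simp: mvec_Eich Ev_def bvec_apply level_I_0 intro!: level_I_uminus level_I_right)
    have tU: "t \<in> UU" "t \<in> GL n" using t H_U H_GL by auto
    define x where "x = mmul n t (ginv n ?L)"
    have xU: "x \<in> UU" unfolding x_def by (intro U_mult U_inv tU LU)
    have x1: "R.cong1 x" unfolding x_def by (intro R.cong1_mult R.cong1_inv t L1 LU)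
    have Qx: "Q x (bvec b 1) \<in> Gam" if b: "b \<in> Omega n" for b
    proof -
      have "mmul n x ?L = t" using tU LU by (simp add: x_def gsimps)
      then have "Q x (mvec n ?L (bvec b 1)) + Q ?L (bvec b 1) = Q t (bvec b 1)" by (metis Q_mult)
      then have "Q x (bvec b 1) = (Q t (bvec b 1) - (if b = - l then a else 0))
          - (Q x (mvec n ?L (bvec b 1)) - Q x (bvec b 1))"
        using Q_long[OF l(1,2) aL, of "bvec b 1"] by (auto simp: bvec_apply algebra_simps)
      also have "\<dots> \<in> Gam" using L1 by (intro R.Gam_diff Qt b R.Q_vI xU) (simp add: R.cong1_def)
      finally show ?thesis .
    qed
    have "Q x v \<in> Gam" for v
    proof (rule R.Q_bvecs[OF xU])
      show "Q x (bvec k (v k)) \<in> Gam" if "k \<in> Omega n" for k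
        using R.Gam_conj'[OF Qx[OF that]] Q_vscale[of x "bvec k 1" "v k"] by (simp add: vscale_bvec)
    qed (rule cong1_f[OF x1])
    then have "R.CUp x" using xU x1 unfolding R.CUp_def R.cong1_def by (auto intro!: exI[of _ 1] simp: R.Gam0)
    let ?T = "Eich (bvec j 1) (bvec (- l) (cj (1 * cj (eta (- l))))) 0"
    have jl: "j \<noteq> l" "j \<noteq> - l" using l by auto
    have T: "?T \<in> EE" using j l by (intro EE_short) auto
    note TG = EE_GL[OF T]
    have "gcomm n x ?T \<in> H" using R.relative_commutator[OF qf \<open>R.CUp x\<close> T] N_H by blast
    \<comment> \<open>Since \<open>t\<close> is \<open>x\<close> times \<open>?L\<close> and
      \<open>x\<close> commutes with \<open>?T\<close> modulo \<open>H\<close>, the commutator of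
      \<open>?T\<close> with \<open>?L\<close> is a conjugate of a product of elements of
      \<open>H\<close>.\<close>
    then have "mmul n (mmul n ?L (mmul n (mmul n (ginv n t) (gcomm n x ?T)) (mmul n (mmul n ?T t) (ginv n ?T)))) (ginv n ?L) \<in> H"
      by (intro H_conj H_mult H_inv L T t)
    moreover have "mmul n (mmul n ?L (mmul n (mmul n (ginv n t) (gcomm n x ?T)) (mmul n (mmul n ?T t) (ginv n ?T)))) (ginv n ?L)
       = gcomm n ?T ?L" using LU TG tU by (simp add: gcomm_def x_def gsimps)
    ultimately have "Eich (bvec j 1) (bvec l (a * cj 1)) (1 * a * cj 1) \<in> H" by (simp only: Eich_move[OF j l(1) jl aL])
    then have "Eich (bvec j 1) 0 a \<in> H" using aI l by (intro strip_short[OF j l(1), of a]) auto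
    then show ?thesis using long_Gam[OF j aL] by (simp add: a_def)
  qed
  show ?thesis
  proof (rule R.Q_bvecs[OF sU])
    show "Q s (bvec k (v k)) \<in> Gam" if "k \<in> Omega n" for k
      using R.Gam_conj'[OF basis[OF that]] Q_vscale[of s "bvec k 1" "v k"] by (simp add: vscale_bvec)
  qed (rule cong1_f[OF s(2)])
qed

theorem H_CUp: assumes qf: "quasi_finite cj lam" and s: "s \<in> H" shows "R.CUp s"
proof -
  have sU: "s \<in> UU" "s \<in> GL n" using s H_U H_GL by auto
  obtain c where c: "\<And>v. R.vI (mvec n s v) (vscale v c)"
    by (rule R.scalar_mod[OF sU(2) level_column[OF qf H_conj[OF _ s]]]) (use that in auto)
  show ?thesis
  proof (rule R.CUp_I[OF sU(1) c])
    fix t v assume t: "t \<in> EE"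
    show "Q (gcomm n s t) v \<in> Gam"
      by (intro Q_cong1_Gam qf H_gcomm2 R.cong1_gcomm[OF sU(2) c] EE_GL t s)
  qed
qed

text \<open>Root elements reveal their parameters to \<open>CUp\<close>: an off-diagonal entry must
  lie in \<open>I'\<close>, and the defect of a long element at the opposite basis vector is its
  parameter. The other inclusions hold since \<open>H\<close> contains the generators of
  \<open>R'.N\<close>.\<close>

lemma level_unique:
  assumes "form_ideal cj lam Lam (I', Gam')" "EU_rel cj lam Lam n (I', Gam') \<subseteq> H"
    "H \<subseteq> CU_rel cj lam Lam n (I', Gam')"
  shows "I' = I \<and> Gam' = Gam"
proof -
  interpret R': relative cj lam n Lam I' Gam' by unfold_locales fact
  have 1: "(1::int) \<in> Omega n" "2 \<in> Omega n" using n3 by (auto simp: Omega_def)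
  have N: "R'.N \<subseteq> H" using assms(2) by (simp add: R'.N_def)
  have CU: "R'.CUp s" if "s \<in> H" for s using that assms(3) R'.CU_rel_iff by blast
  have "x \<in> I'" if "x \<in> I" for x
  proof -
    let ?s = "Eich (bvec 1 1) (bvec 2 x) 0"
    have "R'.CUp ?s" using that 1 by (intro CU I_Eich) auto
    then obtain c where "R'.vI (mvec n ?s (bvec (- 1) 1)) (vscale (bvec (- 1) 1) c)" unfolding R'.CUp_def by blast
    then have "- (x * cj lam) \<in> I'"
      using 1 by (auto simp: R'.vI_def mvec_Eich_short bvec_apply eta_def dest!: bspec[of _ _ 2])
    then have "- (x * cj lam) * (- lam) \<in> I'" by (rule R'.I_right)
    then show ?thesis by (simp add: mult.assoc)
  qed
  moreover have "a \<in> Gam'" if "a \<in> Gam" for a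
  proof -
    have a: "a \<in> Lam" "Eich (bvec 1 1) 0 a \<in> H" using that 1 by (auto simp: Gam_def)
    then have "Q (Eich (bvec 1 1) 0 a) (bvec (- 1) 1) \<in> Gam'" using CU by (simp add: R'.CUp_def)
    then show ?thesis using 1 a by (simp add: Q_long bvec_apply)
  qed
  moreover have "I' \<subseteq> I" "Gam' \<subseteq> Gam"
    using N R'.N_short R'.N_long R'.Gam_Lam by (auto simp: I_def Gam_def)
  ultimately show ?thesis by blast
qed

end

text \<open>The conjugate of \<open>s\<close> by \<open>g\<close> is the inverse of
  \<open>gcomm n s g\<close> times \<open>s\<close>, and the commutator formula puts the first
  factor into \<open>N\<close>.\<close>

lemma (in relative) sandwich_normal:
  assumes qf: "quasi_finite cj lam" and H: "subgroup H (GLgrp n)" "N \<subseteq> H" "H \<subseteq> CU_rel cj lam Lam n (I, Gam)"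
    and g: "g \<in> EE" and s: "s \<in> H"
  shows "mmul n (mmul n g s) (ginv n g) \<in> H"
proof -
  have "CUp s" using s H CU_rel_iff by blast
  then have "gcomm n s g \<in> H" using relative_commutator[OF qf _ g] H by blast
  then have "mmul n (ginv n (gcomm n s g)) s \<in> H"
    using subgroup.m_closed[OF H(1) subgroup.m_inv_closed[OF H(1)]] s by simp
  moreover have "s \<in> GL n" using \<open>CUp s\<close> U_GL by (simp add: CUp_def)
  ultimately show ?thesis using EE_GL[OF g] by (simp add: gcomm_def gsimps)
qed

theorem theorem4p14:
  fixes cj :: "'a::ring_1 \<Rightarrow> 'a" and lam :: 'a and Lam :: "'a set" and n :: nat
    and H :: "'a mat set"
  assumes "(1::'a) \<noteq> 0"
    and "form_ring cj lam Lam"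
    and "quasi_finite cj lam"
    and "n \<ge> 3"
    and "subgroup H (GLgrp n)"
    and "H \<subseteq> U cj lam Lam n"
  shows "normalized_by n H (EU cj lam Lam n) \<longleftrightarrow>
         (\<exists>!IG. form_ideal cj lam Lam IG
                \<and> EU_rel cj lam Lam n IG \<subseteq> H \<and> H \<subseteq> CU_rel cj lam Lam n IG)"
proof
  interpret hyperbolic cj lam n Lam
    by unfold_locales (use assms in \<open>auto simp: form_ring_def\<close>)
  assume norm: "normalized_by n H EE"
  interpret normal_subgroup cj lam n Lam H
  proof (intro normal_subgroup.intro normal_subgroup_axioms.intro hyperbolic_axioms assms)
    show "mmul n (mmul n g s) (ginv n g) \<in> H" if "g \<in> EE" "s \<in> H" for g s
      using norm that by (auto simp: normalized_by_def)
  qed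
  have "H \<subseteq> CU_rel cj lam Lam n (I, Gam)"
    using H_CUp[OF assms(3)] R.CU_rel_iff by blast
  then show "\<exists>!IG. form_ideal cj lam Lam IG \<and> EU_rel cj lam Lam n IG \<subseteq> H \<and> H \<subseteq> CU_rel cj lam Lam n IG"
  proof (intro ex1I[of _ "(I, Gam)"] conjI level_form_ideal N_H[unfolded R.N_def])
    fix IG assume "form_ideal cj lam Lam IG \<and> EU_rel cj lam Lam n IG \<subseteq> H \<and> H \<subseteq> CU_rel cj lam Lam n IG"
    then show "IG = (I, Gam)" using level_unique by (cases IG) blast
  qed
next
  interpret hyperbolic cj lam n Lam
    by unfold_locales (use assms in \<open>auto simp: form_ring_def\<close>)
  assume "\<exists>!IG. form_ideal cj lam Lam IG \<and> EU_rel cj lam Lam n IG \<subseteq> H \<and> H \<subseteq> CU_rel cj lam Lam n IG"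
  then obtain I Gam where IG: "form_ideal cj lam Lam (I, Gam)" "EU_rel cj lam Lam n (I, Gam) \<subseteq> H"
      "H \<subseteq> CU_rel cj lam Lam n (I, Gam)" by (metis surj_pair)
  interpret relative cj lam n Lam I Gam by unfold_locales (rule IG)
  show "normalized_by n H EE"
    using sandwich_normal[OF assms(3,5)] IG by (auto simp: normalized_by_def N_def)
qed

end
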